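(* Assume that the positive integers $d,n\in\mathbb{N}$ satisfy $n>2^d(d-1)$ and let $F\in\mathbb{Z}[x_1,\ldots,x_n]$ be a smooth form of degree $d$. Let $\mathcal{B}\subset[-1,1]^n$ be a box (as in the context) and let $b=2\max\{|F(\mathbf{t})|:\mathbf{t}\in\mathcal{B}\}$. Assume that $\mathcal{A}\subset\mathbb{Z}_{\geq 0}$ is a non-empty set for which there exist a $\mathcal{C}^1$ function $\omega:[1,\infty)\to(0,\infty)$ and, for all $q\in\mathbb{N}$ and $r\in\mathbb{Z}/q\mathbb{Z}$, a real number $\rho(r,q)\geq 0$ such that for every $q\in\mathbb{N}$ we have $$\lim_{x\to\infty}\ \sup_{y\in\mathbb{R}\cap[1,x]}\ \max_{r\in\mathbb{Z}/q\mathbb{Z}}\left|\frac{\#\{a\in\mathcal{A}:a\leq y,\ a\equiv r\ (\mathrm{mod}\ q)\}}{\int_1^y\omega(t)\,\mathrm{d}t}-\rho(r,q)\right|=0.$$ Assume, in addition, that $$\liminf_{P\to\infty}P^d\Bigg|\int_{\mathbf{t}\in\mathcal{B}:\,F(\mathbf{t})>P^{-d}}\omega(P^dF(\mathbf{t}))\,\mathrm{d}\mathbf{t}\Bigg|\cdot\Bigg|\int_1^{bP^d}\omega(t)\,\mathrm{d}t\Bigg|^{-1}\neq 0.$$ Define for any $z>1$ the integer $T_z=\prod_{p\leq z}p^{t_p(z)}$ (product over primes $p$), where $t_p(z)$ are arbitrary positive integers such that for each fixed prime $p$ one has $\lim_{z\to\infty}t_p(z)=\infty$. Then the limit $$\sigma(F):=\lim_{z\to\infty}T_z^{-n+1}\sum_{\mathbf{t}\in(\mathbb{Z}/T_z\mathbb{Z})^n}\rho(F(\mathbf{t}),T_z)$$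 exists and is independent of the choice of $t_p(z)$. Furthermore, $$\lim_{P\to\infty}\frac{\#\{\mathbf{x}\in\mathbb{Z}^n\cap P\mathcal{B}:F(\mathbf{x})\in\mathcal{A}\}}{P^n\int_{\mathbf{t}\in\mathcal{B}:\,F(\mathbf{t})>P^{-d}}\omega(P^dF(\mathbf{t}))\,\mathrm{d}\mathbf{t}}=\sigma(F).$$
   Context: A form $F\in\mathbb{Z}[x_1,\ldots,x_n]$ of degree $d$ (homogeneous polynomial) is smooth if the projective hypersurface $F=0$ is smooth, i.e. the partial derivatives of $F$ have no common zero in $\mathbb{C}^n\setminus\{0\}$. A box is a set $\mathcal{B}\subset[-1,1]^n$ of the form $\mathcal{B}=\prod_{j=1}^n[a_j,a'_j]$ with real $a_j,a_j'$ satisfying $\max_j|a'_j-a_j|\leq 1$; $P\mathcal{B}=\{P\mathbf{t}:\mathbf{t}\in\mathcal{B}\}$.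
   Formalization: The density hypothesis as printed is unsatisfiable for non-empty A (the sup over y in [1,x] is nondecreasing in x); it is replaced by: sup over y in [1,x] of max over r of |#{a≤y, a≡r mod q} − ρ(r,q)∫_1^y ω| / ∫_1^x ω tends to 0. *)

theory Defs
  imports
    "HOL-Analysis.Analysis"
    "HOL-Library.Poly_Mapping"
    "HOL-Number_Theory.Cong"
    "HOL-Computational_Algebra.Primes"
begin

text \<open>Integer polynomials in variables indexed by a finite type \<open>'n\<close>: finitely supported maps
  from exponent vectors to coefficients.\<close>

type_synonym 'n int_mpoly = "('n \<Rightarrow>\<^sub>0 nat) \<Rightarrow>\<^sub>0 int"

definition mpoly_eval :: "'n::finite int_mpoly \<Rightarrow> 'a::comm_ring_1 ^ 'n \<Rightarrow> 'a" where
  "mpoly_eval F x =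
     (\<Sum>m\<in>Poly_Mapping.keys F.
        of_int (Poly_Mapping.lookup F m) * (\<Prod>i\<in>UNIV. (x $ i) ^ Poly_Mapping.lookup m i))"

definition mpoly_pderiv :: "'n::finite \<Rightarrow> 'n int_mpoly \<Rightarrow> 'n int_mpoly" where
  "mpoly_pderiv i F =
     (\<Sum>m\<in>Poly_Mapping.keys F.
        Poly_Mapping.single (m - Poly_Mapping.single i 1)
          (Poly_Mapping.lookup F m * int (Poly_Mapping.lookup m i)))"

definition is_form :: "nat \<Rightarrow> 'n::finite int_mpoly \<Rightarrow> bool" where
  "is_form d F \<longleftrightarrow> (\<forall>m\<in>Poly_Mapping.keys F. (\<Sum>i\<in>UNIV. Poly_Mapping.lookup m i) = d)"

text \<open>The zero polynomial satisfies \<^const>\<open>is_form\<close> for every degree, but is not smooth.\<close>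

definition smooth_form :: "'n::finite int_mpoly \<Rightarrow> bool" where
  "smooth_form F \<longleftrightarrow>
     \<not> (\<exists>z :: complex ^ 'n. z \<noteq> 0 \<and> (\<forall>i. mpoly_eval (mpoly_pderiv i F) z = 0))"

definition is_box :: "(real ^ 'n::finite) set \<Rightarrow> bool" where
  "is_box B \<longleftrightarrow>
     (\<exists>a a'. B = {t. \<forall>j. t $ j \<in> {a $ j..a' $ j}} \<and> (\<forall>j. \<bar>a' $ j - a $ j\<bar> \<le> 1)) \<and>
     B \<subseteq> {t. \<forall>j. t $ j \<in> {-1..1}}"

text \<open>The derivative at a boundary point of \<open>S\<close> is one-sided, so only the values of \<open>f\<close> on \<open>S\<close>
  matter (unlike for \<^const>\<open>C1_differentiable_on\<close>).\<close>

definition C1_on :: "real set \<Rightarrow> (real \<Rightarrow> real) \<Rightarrow> bool" where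
  "C1_on S f \<longleftrightarrow>
     (\<exists>f'. (\<forall>t\<in>S. (f has_real_derivative f' t) (at t within S)) \<and> continuous_on S f')"

text \<open>A function on pairs \<open>(r, q)\<close> with \<open>q \<ge> 1\<close> and \<open>r\<close> a residue class modulo \<open>q\<close> is represented by
  \<open>\<rho> :: int \<Rightarrow> nat \<Rightarrow> real\<close>, of which only the values \<open>\<rho> r q\<close> with \<open>0 \<le> r < q\<close> are used.

  The discrepancy between counting function and main term, taken uniformly over \<open>1 \<le> y \<le> x\<close>, is
  required to be small relative to the total mass \<open>\<integral>\<^sub>1\<^sup>x \<omega>\<close>. Dividing by \<open>\<integral>\<^sub>1\<^sup>y \<omega>\<close> inside the supremum
  instead would make the condition unsatisfiable, see \<open>not_uniform_relative_density\<close> below.\<close>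

definition ap_count :: "int set \<Rightarrow> int \<Rightarrow> nat \<Rightarrow> real \<Rightarrow> nat" where
  "ap_count A r q y = card {a \<in> A. real_of_int a \<le> y \<and> [a = r] (mod int q)}"

definition equidistributed_in_aps ::
    "int set \<Rightarrow> (real \<Rightarrow> real) \<Rightarrow> (int \<Rightarrow> nat \<Rightarrow> real) \<Rightarrow> bool" where
  "equidistributed_in_aps A \<omega> \<rho> \<longleftrightarrow>
     (\<forall>q\<ge>1.
       ((\<lambda>x. SUP y\<in>{1..x}. MAX r\<in>{0..<int q}.
           \<bar>real (ap_count A r q y) - \<rho> r q * (LINT t:{1..y}|lborel. \<omega> t)\<bar> /
           (LINT t:{1..x}|lborel. \<omega> t)) \<longlongrightarrow> 0) at_top)"

lemma not_uniform_relative_density: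
  assumes A: "A \<subseteq> {0..}" "A \<noteq> {}"
    and \<omega>: "continuous_on {1..} \<omega>" "\<And>t. t \<ge> 1 \<Longrightarrow> \<omega> t > 0"
  shows "\<not> ((\<lambda>x. SUP y\<in>{1<..x}.
              ereal \<bar>real (ap_count A r 1 y) / (LINT t:{1..y}|lborel. \<omega> t) - c\<bar>) \<longlongrightarrow> 0) at_top"
proof
  define I where "I y = (LINT t:{1..y}|lborel. \<omega> t)" for y
  define N where "N y = ap_count A r 1 y" for y
  define f where "f y = ereal \<bar>real (N y) / I y - c\<bar>" for y
  assume "((\<lambda>x. SUP y\<in>{1<..x}.
      ereal \<bar>real (ap_count A r 1 y) / (LINT t:{1..y}|lborel. \<omega> t) - c\<bar>) \<longlongrightarrow> 0) at_top"
  then have lim: "((\<lambda>x. SUP y\<in>{1<..x}. f y) \<longlongrightarrow> 0) at_top"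
    by (simp add: f_def N_def I_def)
  have eq: "real (N y) / I y = c" if "y > 1" for y
  proof -
    have "\<forall>\<^sub>F x in at_top. f y \<le> (SUP y\<in>{1<..x}. f y)"
      using eventually_ge_at_top[of y] by eventually_elim (rule SUP_upper, use that in auto)
    then have "f y \<le> 0"
      using lim by (intro tendsto_lowerbound[OF lim]) auto
    then show ?thesis by (simp add: f_def)
  qed
  have HK: "\<omega> integrable_on {a..b} \<and> (LINT t:{a..b}|lborel. \<omega> t) = integral {a..b} \<omega>"
    if "1 \<le> a" for a b
  proof -
    have "continuous_on {a..b} \<omega>" by (rule continuous_on_subset[OF \<omega>(1)]) (use that in auto)
    then have "set_integrable lborel {a..b} \<omega>"
      by (rule borel_integrable_atLeastAtMost')
    then show ?thesis using set_borel_integral_eq_integral by blast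
  qed
  have pos: "integral {a..b} \<omega> > 0" if ab: "1 \<le> a" "a < b" for a b
  proof -
    have c: "continuous_on {a..b} \<omega>" by (rule continuous_on_subset[OF \<omega>(1)]) (use ab in auto)
    obtain m where m: "m \<in> {a..b}" "\<And>t. t \<in> {a..b} \<Longrightarrow> \<omega> m \<le> \<omega> t"
      using continuous_attains_inf[OF compact_Icc _ c] ab by auto
    have "integral {a..b} (\<lambda>_. \<omega> m) \<le> integral {a..b} \<omega>"
      by (rule integral_le) (use m HK[OF ab(1)] in auto)
    moreover have "(b - a) * \<omega> m > 0" using \<omega>(2)[of m] m ab by simp
    ultimately show ?thesis using ab by simp
  qed
  have Ieq: "I y = integral {1..y} \<omega>" for y using HK by (simp add: I_def)
  have Ipos: "I y > 0" if "y > 1" for y using pos[of 1 y] that by (simp add: Ieq)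
  have "integral {1..2} \<omega> + integral {2..5/2} \<omega> = integral {1..5/2::real} \<omega>"
    by (rule Henstock_Kurzweil_Integration.integral_combine) (use HK in auto)
  then have I2: "I (5/2) > I 2" using pos[of 2 "5/2"] by (simp add: Ieq)
  have "real_of_int a \<le> 5/2 \<longleftrightarrow> real_of_int a \<le> 2" for a by (cases "a \<le> 2") auto
  then have "N (5/2) = N 2" by (simp add: N_def ap_count_def)
  then have "c * I 2 = c * I (5/2)"
    using eq[of 2] eq[of "5/2"] Ipos[of 2] Ipos[of "5/2"] by (simp add: field_simps)
  then have "c = 0" using I2 by auto
  obtain a where a: "a \<in> A" using A by blast
  define y where "y = real_of_int (a + 2)"
  have y: "y > 1" using a A by (auto simp: y_def)
  then have "N y = 0" using eq[OF y] Ipos[OF y] \<open>c = 0\<close> by simp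
  moreover have "finite {a \<in> A. real_of_int a \<le> y \<and> [a = r] (mod int 1)}"
    by (rule finite_subset[of _ "{0..a+2}"]) (use A in \<open>auto simp: y_def\<close>)
  ultimately have "{a \<in> A. real_of_int a \<le> y \<and> [a = r] (mod int 1)} = {}"
    by (simp add: N_def ap_count_def)
  then show False using a by (auto simp: y_def)
qed

definition T_mod :: "(nat \<Rightarrow> real \<Rightarrow> nat) \<Rightarrow> real \<Rightarrow> nat" where
  "T_mod t z = (\<Prod>p | prime p \<and> real p \<le> z. p ^ t p z)"

definition admissible_exponents :: "(nat \<Rightarrow> real \<Rightarrow> nat) \<Rightarrow> bool" where
  "admissible_exponents t \<longleftrightarrow>
     (\<forall>z>1. \<forall>p. prime p \<and> real p \<le> z \<longrightarrow> t p z > 0) \<and>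
     (\<forall>p. prime p \<longrightarrow> filterlim (t p) at_top at_top)"

definition sigma_mod :: "'n::finite int_mpoly \<Rightarrow> (int \<Rightarrow> nat \<Rightarrow> real) \<Rightarrow> nat \<Rightarrow> real" where
  "sigma_mod F \<rho> T =
     real T powi (1 - int CARD('n)) *
     (\<Sum>t | \<forall>i. (t :: int ^ 'n) $ i \<in> {0..<int T}. \<rho> (mpoly_eval F t mod int T) T)"

definition weighted_volume ::
    "'n::finite int_mpoly \<Rightarrow> nat \<Rightarrow> (real ^ 'n) set \<Rightarrow> (real \<Rightarrow> real) \<Rightarrow> real \<Rightarrow> real" where
  "weighted_volume F d B \<omega> P =
     (LINT t:{t\<in>B. mpoly_eval F t > P powi (- int d)}|lborel. \<omega> (P ^ d * mpoly_eval F t))"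

definition lattice_count ::
    "'n::finite int_mpoly \<Rightarrow> (real ^ 'n) set \<Rightarrow> int set \<Rightarrow> real \<Rightarrow> nat" where
  "lattice_count F B A P =
     card {x :: int ^ 'n. (\<chi> j. real_of_int (x $ j)) \<in> (\<lambda>t. P *\<^sub>R t) ` B \<and> mpoly_eval F x \<in> A}"

end

theory Submission
 imports Defs "HOL-Library.Function_Algebras" "HOL-Computational_Algebra.Fundamental_Theorem_Algebra"
begin

text \<open>
  Let \<open>r(m)\<close> be the number of lattice points \<open>x\<close> of \<open>P B\<close> with \<open>F(x) = m\<close>. On average \<open>r(m)\<close> is of order
  \<open>X = P^n / P^d\<close>. The heart of the proof is a regularity statement (\<open>regular_counts\<close>): \<open>r(m) \<le> C X\<close> for
  all \<open>m\<close>, and for every \<open>\<epsilon> > 0\<close> there are a modulus \<open>T\<close> and finitely many cut points such that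
  \<open>\<bar>r(m) - r(m')\<bar> \<le> \<epsilon> X\<close> whenever \<open>m\<close> and \<open>m'\<close> are congruent modulo \<open>T\<close> and lie in the same interval
  between neighbouring cut points, scaled by \<open>P^d\<close>. No asymptotic formula for \<open>r(m)\<close> is needed.

  For \<open>d \<ge> 2\<close> regularity comes from the circle method (\<open>spline_bounds\<close>). The indicator of a box is
  replaced by a \<open>(d+1)\<close>-fold convolution of indicators, counted by \<open>reps\<close>; this makes the Weyl inequality
  free of logarithms, so that the condition \<open>n > 2^d (d - 1)\<close> leaves a geometric series over dyadic
  levels of approximation. Weyl differencing leads to counting lattice points at which
  multilinear forms are small. \<open>LP_shrink\<close>, Davenport's shrinking lemma, reduces this to counting exact zeros, and
  \<open>birch_count\<close> bounds those by means of a Nullstellensatz and the smoothness of \<open>F\<close>.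
  For \<open>d = 1\<close> regularity is elementary.

  Averaging \<open>r\<close> over a residue class in a short interval and comparing with a Riemann sum turns
  regularity into a local density: \<open>r(m)\<close> is within \<open>2\<epsilon>X\<close> of \<open>\<nu>(m) \<lambda> X\<close>, where \<open>\<nu>(m)\<close> is the density
  of solutions of \<open>F(t) = m\<close> modulo \<open>T\<close> and \<open>\<lambda>\<close> the density of the values of \<open>F\<close> on \<open>B\<close> in that interval
  (\<open>rep_count_local\<close>, \<open>level_vol_local\<close>). Summing over \<open>A\<close> and using equidistribution,
  the quotient in question is within a fixed multiple of \<open>\<epsilon> (1 + \<sigma>(T))\<close> of \<open>\<sigma>(T)\<close>, the average of \<open>\<rho>\<close> over values of \<open>F\<close>
  modulo \<open>T\<close>, for every multiple \<open>T\<close> of some \<open>T0\<close> depending on \<open>\<epsilon>\<close>. Since the quotient does not depend on \<open>T\<close>, both it and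
  \<open>\<sigma>(T)\<close> along multiples must converge, to the same limit (\<open>limit_of_approximations\<close>).
\<close>

abbreviation "lookup \<equiv> Poly_Mapping.lookup"
abbreviation "keys \<equiv> Poly_Mapping.keys"

section \<open>Dirichlet kernels\<close>

text \<open>The Dirichlet kernel \<open>\<Sum>k<L. e(k y)\<close> with \<open>e(t) = exp(2 \<pi> i t)\<close>.\<close>
definition dir :: "nat => real => complex" where
 "dir L y = (\<Sum>k\<in>{0..<int L}. cis (2 * pi * of_int k * y))"

lemma norm_dir_le: "cmod (dir L y) \<le> real L"
proof -
 have "cmod (dir L y) \<le> (\<Sum>k\<in>{0..<int L}. cmod (cis (2 * pi * of_int k * y)))"
  unfolding dir_def by (rule norm_sum)
 thus ?thesis by simp
qed

lemma dir_geom: "dir L y * (cis (2 * pi * y) - 1) = cis (2 * pi * real L * y) - 1"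
proof (induction L)
 case 0 thus ?case by (simp add: dir_def)
next
 case (Suc L)
 have "{0..<int (Suc L)} = insert (int L) {0..<int L}" by auto
 hence "dir (Suc L) y = cis (2 * pi * real L * y) + dir L y"
  by (simp add: dir_def)
 moreover have "cis (2 * pi * real (Suc L) * y) = cis (2 * pi * real L * y) * cis (2 * pi * y)"
  by (simp add: cis_mult ring_distribs add.commute)
 ultimately show ?case using Suc by (simp add: algebra_simps)
qed

lemma cmod_cis_minus_1: "cmod (cis (2 * t) - 1) = 2 * \<bar>sin t\<bar>"
proof -
 have "cis (2 * t) - 1 = cis t * (cis t - cis (- t))"
  by (simp add: right_diff_distrib cis_mult)
 also have "cis t - cis (- t) = Complex 0 (2 * sin t)" by (simp add: complex_eq_iff)
 finally have "cis (2 * t) - 1 = cis t * Complex 0 (2 * sin t)" .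
 hence "cmod (cis (2 * t) - 1) = cmod (Complex 0 (2 * sin t))" by (simp add: norm_mult)
 also have "... = 2 * \<bar>sin t\<bar>" by (simp add: cmod_def real_sqrt_mult)
 finally show ?thesis .
qed

lemma norm_dir_sin_le: "cmod (dir L y) * \<bar>sin (pi * y)\<bar> \<le> 1"
proof -
 have "cmod (dir L y) * cmod (cis (2 * (pi * y)) - 1) = cmod (cis (2 * (pi * real L * y)) - 1)"
  using dir_geom[of L y] by (metis mult.assoc norm_mult)
 thus ?thesis unfolding cmod_cis_minus_1
  using abs_sin_le_one[of "pi * real L * y"] by simp
qed

lemma sin_ge_half:
 assumes "0 \<le> x" "x \<le> pi / 2" shows "sin x \<ge> x / (2::real)"
proof -
 have "\<bar>sin x - (\<Sum>m<3. sin_coeff m * x ^ m)\<bar> \<le> inverse (fact 3) * \<bar>x\<bar> ^ 3"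
  by (rule Maclaurin_sin_bound)
 moreover have "(\<Sum>m<3. sin_coeff m * x ^ m) = x"
  by (simp add: numeral_3_eq_3 sin_coeff_def)
 ultimately have 1: "\<bar>sin x - x\<bar> \<le> x * (x * x) / 6"
  using assms by (simp add: fact_numeral power3_eq_cube)
 have "x * x \<le> (8/5) * (8/5)" using assms pi_approx assms by (intro mult_mono) auto
 hence "x * (x * x) \<le> x * 3" using assms by (intro mult_left_mono) auto
 thus ?thesis using 1 by linarith
qed

lemma dir_frac: "dir L (frac y) = dir L y"
proof -
 have "cis (2 * pi * of_int k * y) = cis (2 * pi * of_int k * frac y)" for k
 proof -
  have "2 * pi * of_int k * y = 2 * pi * of_int k * frac y + 2 * pi * of_int (k * \<lfloor>y\<rfloor>)"
   by (simp add: frac_def algebra_simps)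
  thus ?thesis by (simp add: cis_mult[symmetric] cis_multiple_2pi)
 qed
 thus ?thesis by (simp add: dir_def)
qed

lemma norm_dir_le_inverse:
 assumes "0 \<le> f" "f \<le> 1/2" shows "cmod (dir L f) * f \<le> 1" "cmod (dir L (1 - f)) * f \<le> 1"
proof -
 have "sin (pi * f) \<ge> (pi * f) / 2" using assms by (intro sin_ge_half) auto
 moreover have "pi * f \<ge> 2 * f" using assms pi_ge_two by (intro mult_right_mono) auto
 ultimately have s: "\<bar>sin (pi * f)\<bar> \<ge> f" by linarith
 show "cmod (dir L f) * f \<le> 1"
  using norm_dir_sin_le[of L f] mult_left_mono[OF s, of "cmod (dir L f)"] by simp
 have "\<bar>sin (pi * (1 - f))\<bar> = \<bar>sin (pi * f)\<bar>" by (simp add: right_diff_distrib sin_diff)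
 thus "cmod (dir L (1 - f)) * f \<le> 1"
  using norm_dir_sin_le[of L "1 - f"] mult_left_mono[OF s, of "cmod (dir L (1 - f))"] by simp
qed

text \<open>Bounds \<open>\<bar>dir L y\<bar>\<^sup>2\<close> for \<open>y\<close> in the \<open>s\<close>-th cell of
  length \<open>1/c\<close> next to an integer.\<close>
definition cell_bound :: "nat => nat => nat => real" where
 "cell_bound L c s = (if s * L \<le> c then (real L)\<^sup>2 else (real c / real s)\<^sup>2)"

lemma sum_cell_bound:
 assumes L: "1 \<le> L" "L \<le> c" shows "(\<Sum>s<m. cell_bound L c s) \<le> 6 * real c * real L"
proof -
 define G where "G s = 6 * real c * real L * (real c / (real c + real s * real L))" for s :: nat
 have Lc: "real L \<ge> 1" "real L \<le> real c" "real c \<ge> 1" using L by auto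
 have "cell_bound L c s \<le> G s - G (Suc s)" for s
 proof -
  let ?x = "real c + real s * real L"
  have x: "?x > 0" using Lc by (simp add: add_pos_nonneg)
  have "G s - G (Suc s) = 6 * real c * real L * real c * (1 / ?x - 1 / (?x + real L))"
   by (simp add: G_def algebra_simps)
  also have "1 / ?x - 1 / (?x + real L) = real L / (?x * (?x + real L))"
   using x Lc by (simp add: divide_simps)
  finally have eq: "G s - G (Suc s) = 6 * (real c)\<^sup>2 * (real L)\<^sup>2 / (?x * (?x + real L))"
   by (simp add: power2_eq_square algebra_simps)
  show ?thesis
  proof (cases "s * L \<le> c")
   case True
   hence "real s * real L \<le> real c" by (metis of_nat_le_iff of_nat_mult)
   hence "?x * (?x + real L) \<le> (2 * real c) * (3 * real c)" using Lc x by (intro mult_mono) auto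
   hence "(real L)\<^sup>2 * (?x * (?x + real L)) \<le> (real L)\<^sup>2 * (6 * (real c)\<^sup>2)"
    by (intro mult_left_mono) (auto simp: power2_eq_square)
   thus ?thesis using True x Lc unfolding eq cell_bound_def
    by (simp add: pos_le_divide_eq mult_ac)
  next
   case False
   hence s: "real c \<le> real s * real L" by (metis nle_le of_nat_le_iff of_nat_mult)
   have s1: "real s \<ge> 1" using False by (cases s) auto
   have s2: "real L \<le> real s * real L" using s1 Lc by simp
   hence "?x * (?x + real L) \<le> (2 * (real s * real L)) * (3 * (real s * real L))"
    using s s2 Lc x by (intro mult_mono) linarith+
   hence "?x * (?x + real L) * (real c)\<^sup>2 \<le> 6 * (real s)\<^sup>2 * (real L)\<^sup>2 * (real c)\<^sup>2"
    by (intro mult_right_mono) (auto simp: power2_eq_square mult_ac)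
   thus ?thesis using False x Lc s1 unfolding eq cell_bound_def
    by (simp add: divide_simps mult_ac)
  qed
 qed
 hence "(\<Sum>s<m. cell_bound L c s) \<le> (\<Sum>s<m. G s - G (Suc s))" by (intro sum_mono) auto
 also have "... = G 0 - G m" by (rule sum_lessThan_telescope')
 also have "... \<le> G 0" using Lc by (simp add: G_def)
 also have "... = 6 * real c * real L" using Lc by (simp add: G_def)
 finally show ?thesis .
qed

lemma cell_bound_nonneg: "cell_bound L c s \<ge> 0" by (simp add: cell_bound_def)

text \<open>The fractional part of \<open>y\<close> may be close to 0 or close to 1; the two summands cover these
  cases.\<close>
lemma norm_dir_cell:
 assumes c: "c \<ge> 1" and r: "\<lfloor>real c * frac y\<rfloor> = int r"
 shows "(cmod (dir L y))\<^sup>2 \<le> cell_bound L c r + cell_bound L c (c - 1 - r)"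
proof -
 define f where "f = frac y"
 have f: "0 \<le> f" "f < 1" by (auto simp: f_def frac_lt_1)
 have rf: "real r \<le> real c * f" "real c * f < real r + 1" using r unfolding f_def[symmetric] by linarith+
 have rc: "r < c"
 proof -
  have "real c * f < real c * 1" using f c by (intro mult_strict_left_mono) auto
  thus ?thesis using rf by simp
 qed
 have key: "(cmod (dir L y))\<^sup>2 \<le> cell_bound L c s" if "cmod (dir L y) * g \<le> 1" "real s \<le> real c * g" for s g
 proof (cases "s * L \<le> c")
  case True
  thus ?thesis using norm_dir_le[of L y] by (simp add: cell_bound_def power_mono)
 next
  case False
  hence s: "real s > 0" by (cases s) auto
  have "cmod (dir L y) * real s \<le> cmod (dir L y) * (real c * g)" using that by (intro mult_left_mono) auto
  also have "... = real c * (cmod (dir L y) * g)" by simp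
  also have "... \<le> real c * 1" using that by (intro mult_left_mono) auto
  finally have "cmod (dir L y) \<le> real c / real s" using s by (simp add: pos_le_divide_eq)
  thus ?thesis using False by (simp add: cell_bound_def power_mono)
 qed
 show ?thesis
 proof (cases "f \<le> 1/2")
  case True
  have "cmod (dir L y) * f \<le> 1" using norm_dir_le_inverse(1)[OF f(1) True, of L] by (simp add: f_def dir_frac)
  from key[OF this rf(1)] show ?thesis using cell_bound_nonneg[of L c "c-1-r"] by linarith
 next
  case False
  have 1: "cmod (dir L y) * (1 - f) \<le> 1"
   using norm_dir_le_inverse(2)[of "1 - f" L] False f by (simp add: f_def dir_frac)
  have "real (c - 1 - r) = real c - 1 - real r" using rc by linarith
  hence "real (c - 1 - r) \<le> real c * (1 - f)" using rf by (simp add: algebra_simps)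
  from key[OF 1 this] show ?thesis using cell_bound_nonneg[of L c r] by linarith
 qed
qed

section \<open>Lattice points near linear forms and the shrinking lemma\<close>

text \<open>Integer boxes: \<open>ibox L\<close> is one-sided with side lengths \<open>L i\<close>, \<open>sbox
  a\<close> is the symmetric open cube.\<close>
definition ibox :: "('n::finite => nat) => (int ^ 'n) set" where
 "ibox L = {x. \<forall>i. 0 \<le> x $ i \<and> x $ i < int (L i)}"

definition sbox :: "nat => (int ^ 'n::finite) set" where
 "sbox a = {x. \<forall>i. \<bar>x $ i\<bar> < int a}"

lemma bij_betw_vec_PiE: "bij_betw (\<lambda>g. \<chi> i. g i) (PiE UNIV B) {x::'a^'n::finite. \<forall>i. x $ i \<in> B i}"
 by (rule bij_betwI[where g = "\<lambda>x i. x $ i"]) (auto simp: PiE_def)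

lemma sum_vec_prod:
 fixes f :: "'n::finite => 'a => 'b::comm_semiring_1"
 assumes "\<And>i. finite (B i)"
 shows "(\<Sum>x\<in>{x::'a^'n. \<forall>i. x $ i \<in> B i}. \<Prod>i\<in>UNIV. f i (x $ i)) = (\<Prod>i\<in>UNIV. \<Sum>y\<in>B i. f i y)"
proof -
 have "(\<Prod>i\<in>UNIV. \<Sum>y\<in>B i. f i y) = (\<Sum>g\<in>PiE UNIV B. \<Prod>i\<in>UNIV. f i (g i))"
  by (rule prod_sum_PiE) (use assms in auto)
 also have "... = (\<Sum>x\<in>{x::'a^'n. \<forall>i. x $ i \<in> B i}. \<Prod>i\<in>UNIV. f i (x $ i))"
  using sum.reindex_bij_betw[OF bij_betw_vec_PiE[where B=B], of "\<lambda>x. \<Prod>i\<in>UNIV. f i (x $ i)"] by simp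
 finally show ?thesis by simp
qed

lemma finite_vec_box: "(\<And>i. finite (B i)) ==> finite {x::'a^'n::finite. \<forall>i. x $ i \<in> B i}"
 using bij_betw_finite[OF bij_betw_vec_PiE[where B=B]] by (simp add: finite_PiE)

lemma card_vec_box: "(\<And>i. finite (B i)) ==> card {x::'a^'n::finite. \<forall>i. x $ i \<in> B i} = (\<Prod>i\<in>UNIV. card (B i))"
 using bij_betw_same_card[OF bij_betw_vec_PiE[where B=B]] by (simp add: card_PiE)

lemma ibox_eq: "ibox L = {x. \<forall>i. x $ i \<in> {0..<int (L i)}}" by (auto simp: ibox_def)
lemma sbox_eq: "sbox a = {x. \<forall>i. x $ i \<in> {- int a<..<int a}}" proof -
 have "\<bar>k\<bar> < int a \<longleftrightarrow> k \<in> {- int a<..<int a}" for k by auto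
 thus ?thesis by (simp add: sbox_def)
qed

lemma finite_ibox [simp]: "finite (ibox L)" unfolding ibox_eq by (rule finite_vec_box) simp
lemma finite_sbox [simp]: "finite (sbox a)" unfolding sbox_eq by (rule finite_vec_box) simp
lemma card_ibox: "card (ibox L) = (\<Prod>i\<in>UNIV. L i)" unfolding ibox_eq by (subst card_vec_box) auto
lemma card_sbox_le: "card (sbox a :: (int^'n::finite) set) \<le> (2 * a) ^ CARD('n)"
proof -
 have "card (sbox a :: (int^'n) set) = (2 * a - 1) ^ CARD('n)"
  unfolding sbox_eq by (subst card_vec_box) (auto intro!: arg_cong2[where f="(^)"])
 also have "... \<le> (2 * a) ^ CARD('n)" by (rule power_mono) auto
 finally show ?thesis .
qed

text \<open>A tuple \<open>lam\<close> of additive real-valued functions; \<open>LP lam a c\<close> is the set of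
  \<open>(u, v)\<close> with \<open>u\<close> in the cube of radius \<open>a\<close> and \<open>v i\<close>
  within \<open>1/c\<close> of \<open>lam i u\<close>.\<close>
definition additive_forms :: "('n::finite => int ^ 'n => real) => bool" where
 "additive_forms lam \<longleftrightarrow> (\<forall>i u v. lam i (u + v) = lam i u + lam i v)"

definition LP :: "('n::finite => int ^ 'n => real) => nat => nat => ((int ^ 'n) \<times> (int ^ 'n)) set" where
 "LP lam a c = {(u, v). \<forall>i. \<bar>u $ i\<bar> < int a \<and> \<bar>lam i u - of_int (v $ i)\<bar> < 1 / real c}"

lemma additive_forms_add: "additive_forms lam ==> lam i (u + v) = lam i u + lam i v"
 by (simp add: additive_forms_def)

lemma additive_forms_diff: "additive_forms lam ==> lam i (u - v) = lam i u - lam i v"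
 using additive_forms_add[of lam i "u - v" v] by simp

lemma additive_forms_zero: "additive_forms lam ==> lam i 0 = 0"
 using additive_forms_add[of lam i 0 0] by simp

lemma additive_forms_scale:
 assumes "additive_forms lam" shows "lam i (\<chi> j. int t * u $ j) = real t * lam i u"
proof (induction t)
 case 0
 have "(\<chi> j. int 0 * u $ j) = 0" by (simp add: vec_eq_iff)
 thus ?case using additive_forms_zero[OF assms] by simp
next
 case (Suc t)
 have "(\<chi> j. int (Suc t) * u $ j) = u + (\<chi> j. int t * u $ j)" by (simp add: vec_eq_iff algebra_simps)
 thus ?case using Suc additive_forms_add[OF assms] by (simp add: algebra_simps)
qed

lemma finite_LP:
 fixes lam :: "'n::finite => int ^ 'n => real"
 assumes "c \<ge> 1" shows "finite (LP lam a c)"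
proof (rule finite_subset)
 show "LP lam a c \<subseteq> (SIGMA u:sbox a. {v. \<forall>i. v $ i \<in> {\<lfloor>lam i u\<rfloor> - 1..\<lceil>lam i u\<rceil> + 1}})"
 proof
  fix p assume p: "p \<in> LP lam a c"
  obtain u v where uv: "p = (u, v)" by (cases p)
  have "\<lfloor>lam i u\<rfloor> - 1 \<le> v $ i \<and> v $ i \<le> \<lceil>lam i u\<rceil> + 1" for i
  proof -
   have "\<bar>lam i u - of_int (v $ i)\<bar> < 1 / real c" using p by (simp add: uv LP_def)
   moreover have "1 / real c \<le> 1" using assms by simp
   ultimately have "\<bar>lam i u - of_int (v $ i)\<bar> < 1" by linarith
   thus ?thesis by linarith
  qed
  thus "p \<in> (SIGMA u:sbox a. {v. \<forall>i. v $ i \<in> {\<lfloor>lam i u\<rfloor> - 1..\<lceil>lam i u\<rceil> + 1}})"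
   using p by (simp add: uv LP_def sbox_def)
 qed
 show "finite (SIGMA u:sbox a. {v. \<forall>i. v $ i \<in> {\<lfloor>lam i u\<rfloor> - 1..\<lceil>lam i u\<rceil> + 1}})"
  by (intro finite_SigmaI finite_sbox finite_vec_box) simp
qed

lemma card_LP_mono:
 assumes "a \<le> a'" "c' \<le> c" "c' \<ge> 1" shows "card (LP lam a c) \<le> card (LP lam a' c')"
proof (rule card_mono[OF finite_LP[OF assms(3)]])
 have "1 / real c \<le> 1 / real c'" using assms by (intro divide_left_mono) auto
 thus "LP lam a c \<subseteq> LP lam a' c'" 
  using assms(1) by (force simp: LP_def intro: less_le_trans)
qed

lemma cis_sum: "finite A ==> cis (\<Sum>i\<in>A. f i) = (\<Prod>i\<in>A. cis (f i))"
 by (induction A rule: finite_induct) (auto simp: cis_mult[symmetric])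

lemma sum_ibox_cis:
 fixes L :: "'n::finite => nat"
 shows "(\<Sum>w\<in>ibox L. cis (2 * pi * (\<Sum>i\<in>UNIV. of_int (w $ i) * \<gamma> i))) = (\<Prod>i\<in>UNIV. dir (L i) (\<gamma> i))"
proof -
 have "cis (2 * pi * (\<Sum>i\<in>UNIV. of_int (w $ i) * \<gamma> i)) = (\<Prod>i\<in>UNIV. cis (2 * pi * of_int (w $ i) * \<gamma> i))"
  for w :: "int^'n" by (simp add: sum_distrib_left cis_sum mult.assoc)
 hence "(\<Sum>w\<in>ibox L. cis (2 * pi * (\<Sum>i\<in>UNIV. of_int (w $ i) * \<gamma> i))) =
  (\<Sum>w\<in>{x. \<forall>i. x $ i \<in> {0..<int (L i)}}. \<Prod>i\<in>UNIV. (\<lambda>i k. cis (2 * pi * of_int k * \<gamma> i)) i (w $ i))"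
  by (simp add: ibox_eq)
 also have "... = (\<Prod>i\<in>UNIV. dir (L i) (\<gamma> i))"
  unfolding dir_def by (rule sum_vec_prod) simp
 finally show ?thesis .
qed

lemma sum_ibox_diff_cis:
 fixes L :: "'n::finite => nat"
 shows "(\<Sum>w\<in>ibox L. \<Sum>w'\<in>ibox L. cis (2 * pi * (\<Sum>i\<in>UNIV. of_int ((w - w') $ i) * \<gamma> i)))
  = of_real (\<Prod>i\<in>UNIV. (cmod (dir (L i) (\<gamma> i)))\<^sup>2)"
proof -
 let ?e = "\<lambda>w::int^'n. cis (2 * pi * (\<Sum>i\<in>UNIV. of_int (w $ i) * \<gamma> i))"
 have "?e (w - w') = ?e w * cnj (?e w')" for w w'
  by (simp add: cis_cnj cis_mult algebra_simps sum_subtractf)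
 hence "(\<Sum>w\<in>ibox L. \<Sum>w'\<in>ibox L. ?e (w - w')) = (\<Sum>w\<in>ibox L. ?e w) * cnj (\<Sum>w\<in>ibox L. ?e w)"
  by (simp add: sum_product)
 also have "... = of_real ((cmod (\<Prod>i\<in>UNIV. dir (L i) (\<gamma> i)))\<^sup>2)"
  unfolding sum_ibox_cis by (simp only: complex_norm_square)
 also have "... = of_real (\<Prod>i\<in>UNIV. (cmod (dir (L i) (\<gamma> i)))\<^sup>2)"
  by (simp add: prod_norm[symmetric] prod_power_distrib)
 finally show ?thesis .
qed

lemma sum_cells_le:
 assumes L: "1 \<le> L" "L \<le> c"
 shows "(\<Sum>r\<in>{0..<int c}. cell_bound L c (nat r) + cell_bound L c (c - 1 - nat r)) \<le> 12 * real c * real L"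
proof -
 have "(\<Sum>r\<in>{0..<int c}. cell_bound L c (nat r) + cell_bound L c (c - 1 - nat r))
   = (\<Sum>s<c. cell_bound L c s + cell_bound L c (c - 1 - s))"
  by (rule sum.reindex_bij_witness[where i = int and j = nat]) auto
 also have "... = (\<Sum>s<c. cell_bound L c s) + (\<Sum>s<c. cell_bound L c (c - Suc s))"
  by (simp add: sum.distrib)
 also have "(\<Sum>s<c. cell_bound L c (c - Suc s)) = (\<Sum>s<c. cell_bound L c s)"
  by (rule sum.nat_diff_reindex)
 finally show ?thesis using sum_cell_bound[OF L, of c] by linarith
qed

text \<open>Two points \<open>w\<close>, \<open>w'\<close> for which every \<open>lam i w + off i\<close> lies in the
  same cell modulo 1 differ by an element counted by \<open>LP lam a c\<close>. So each product of cells
  contains at most \<open>card (LP lam a c)\<close> points, and summing \<open>cell_bound\<close> over all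
  cells costs no logarithm.\<close>
lemma sum_dir_le:
 fixes lam :: "'n::finite => int ^ 'n => real"
 assumes add: "additive_forms lam" and W: "finite W"
  and diff: "\<And>w w' i. w \<in> W ==> w' \<in> W ==> \<bar>w $ i - w' $ i\<bar> < int a"
  and c: "c \<ge> 1" and L: "\<And>i. 1 \<le> L i" "\<And>i. L i \<le> c"
 shows "(\<Sum>w\<in>W. \<Prod>i\<in>UNIV. (cmod (dir (L i) (lam i w + off i)))\<^sup>2)
  \<le> real (card (LP lam a c)) * (\<Prod>i\<in>UNIV. 12 * real c * real (L i))"
proof -
 define R where "R w = (\<chi> i. \<lfloor>real c * frac (lam i w + off i)\<rfloor>)" for w
 define h where "h i r = cell_bound (L i) c (nat r) + cell_bound (L i) c (c - 1 - nat r)" for i r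
 have h0: "h i r \<ge> 0" for i r by (simp add: h_def cell_bound_nonneg)
 have R0: "0 \<le> R w $ i" for w i by (simp add: R_def frac_ge_0)
 have Rc: "R w $ i < int c" for w i
 proof -
  have "real c * frac (lam i w + off i) < real c * 1"
   using c by (intro mult_strict_left_mono frac_lt_1) auto
  thus ?thesis by (simp add: R_def floor_less_iff)
 qed
 have "(cmod (dir (L i) (lam i w + off i)))\<^sup>2 \<le> h i (R w $ i)" for w i
  unfolding h_def using R0[of w i] by (intro norm_dir_cell c) (simp add: R_def)
 hence "(\<Sum>w\<in>W. \<Prod>i\<in>UNIV. (cmod (dir (L i) (lam i w + off i)))\<^sup>2) \<le> (\<Sum>w\<in>W. \<Prod>i\<in>UNIV. h i (R w $ i))"
  by (intro sum_mono prod_mono) auto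
 also have "... = (\<Sum>r\<in>R ` W. \<Sum>w\<in>{w\<in>W. R w = r}. \<Prod>i\<in>UNIV. h i (R w $ i))"
  by (rule sum.image_gen[OF W])
 also have "... = (\<Sum>r\<in>R ` W. real (card {w\<in>W. R w = r}) * (\<Prod>i\<in>UNIV. h i (r $ i)))"
  by (intro sum.cong refl) simp
 also have "... \<le> (\<Sum>r\<in>R ` W. real (card (LP lam a c)) * (\<Prod>i\<in>UNIV. h i (r $ i)))"
 proof (intro sum_mono mult_right_mono prod_nonneg)
  fix r assume "r \<in> R ` W"
  then obtain w0 where w0: "w0 \<in> W" "r = R w0" by auto
  let ?g = "\<lambda>w. (w - w0, \<chi> i. \<lfloor>lam i w + off i\<rfloor> - \<lfloor>lam i w0 + off i\<rfloor>)"
  have "card {w\<in>W. R w = r} \<le> card (LP lam a c)"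
  proof (rule card_inj_on_le[where f = ?g])
   show "inj_on ?g {w\<in>W. R w = r}" by (rule inj_onI) auto
   show "?g ` {w\<in>W. R w = r} \<subseteq> LP lam a c"
   proof clarify
    fix w assume w: "w \<in> W" "r = R w"
    have "\<bar>lam i (w - w0) - of_int (\<lfloor>lam i w + off i\<rfloor> - \<lfloor>lam i w0 + off i\<rfloor>)\<bar> < 1 / real c" for i
    proof -
     let ?f = "frac (lam i w + off i)" and ?g = "frac (lam i w0 + off i)"
     have "\<lfloor>real c * ?f\<rfloor> = \<lfloor>real c * ?g\<rfloor>" using w w0 by (simp add: R_def vec_eq_iff)
     hence "\<bar>real c * ?f - real c * ?g\<bar> < 1" by linarith
     hence "real c * \<bar>?f - ?g\<bar> < 1" by (simp add: right_diff_distrib[symmetric] abs_mult)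
     hence "\<bar>?f - ?g\<bar> < 1 / real c" using c by (simp add: pos_less_divide_eq mult.commute)
     moreover have "lam i (w - w0) - of_int (\<lfloor>lam i w + off i\<rfloor> - \<lfloor>lam i w0 + off i\<rfloor>) = ?f - ?g"
      unfolding additive_forms_diff[OF add] frac_def of_int_diff by (simp only: algebra_simps)
     ultimately show ?thesis by simp
    qed
    thus "?g w \<in> LP lam a c" using diff[OF w(1) w0(1)] by (simp add: LP_def)
   qed
   show "finite (LP lam a c)" by (rule finite_LP[OF c])
  qed
  thus "real (card {w\<in>W. R w = r}) \<le> real (card (LP lam a c))" by simp
 qed (use h0 in auto)
 also have "... \<le> (\<Sum>r\<in>ibox (\<lambda>_. c). real (card (LP lam a c)) * (\<Prod>i\<in>UNIV. h i (r $ i)))"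
  by (rule sum_mono2, simp) (auto simp: ibox_def R0 Rc intro!: mult_nonneg_nonneg prod_nonneg h0)
 also have "... = real (card (LP lam a c)) * (\<Sum>r\<in>ibox (\<lambda>_. c). \<Prod>i\<in>UNIV. h i (r $ i))"
  by (simp add: sum_distrib_left)
 also have "(\<Sum>r\<in>ibox (\<lambda>_. c). \<Prod>i\<in>UNIV. h i (r $ i)) = (\<Prod>i\<in>UNIV. \<Sum>r\<in>{0..<int c}. h i r)"
  unfolding ibox_eq by (rule sum_vec_prod) simp
 also have "... \<le> (\<Prod>i\<in>UNIV. 12 * real c * real (L i))"
  unfolding h_def by (intro prod_mono conjI sum_nonneg sum_cells_le L) (auto simp: cell_bound_nonneg)
 finally show ?thesis by (simp add: mult_left_mono)
qed

lemma norm_dir_ge: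
 assumes b: "b \<ge> 1" and y: "\<bar>y - of_int v\<bar> < 1 / real (8 * b)" shows "cmod (dir b y) \<ge> real b / 2"
proof -
 define x where "x = y - of_int v"
 have e: "cis (2 * pi * of_int k * y) = cis (2 * pi * of_int k * x)" for k
 proof -
  have "2 * pi * of_int k * y = 2 * pi * of_int k * x + 2 * pi * of_int (k * v)"
   by (simp add: x_def algebra_simps)
  thus ?thesis by (simp only: cis_mult[symmetric]) (simp add: cis_multiple_2pi)
 qed
 have "1 / 2 \<le> cos (2 * pi * of_int k * x)" if "k \<in> {0..<int b}" for k
 proof -
  have "real_of_int k * \<bar>x\<bar> \<le> real b * (1 / real (8 * b))"
   using that y by (intro mult_mono) (auto simp: x_def)
  hence "2 * pi * (real_of_int k * \<bar>x\<bar>) \<le> 2 * pi * (1 / 6)" using b by (intro mult_left_mono) auto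
  hence "cos (pi / 3) \<le> cos (2 * pi * (real_of_int k * \<bar>x\<bar>))"
   using that by (intro cos_monotone_0_pi_le) auto
  also have "cos (2 * pi * (real_of_int k * \<bar>x\<bar>)) = cos \<bar>2 * pi * of_int k * x\<bar>"
   using that by (simp add: abs_mult mult.assoc)
  finally show ?thesis by (simp add: cos_60)
 qed
 hence "(\<Sum>k\<in>{0..<int b}. 1 / 2) \<le> (\<Sum>k\<in>{0..<int b}. cos (2 * pi * of_int k * x))"
  by (intro sum_mono) auto
 also have "... = Re (dir b y)" by (simp add: dir_def e)
 also have "... \<le> cmod (dir b y)" by (rule complex_Re_le_cmod)
 finally show ?thesis by simp
qed

lemma sum_diff_ge:
 fixes f :: "int ^ 'n::finite => real"
 assumes "\<And>u. f u \<ge> 0"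
 shows "real H ^ CARD('n) * (\<Sum>u\<in>sbox H. f u) \<le> (\<Sum>z\<in>ibox (\<lambda>_. 3 * H). \<Sum>z'\<in>ibox (\<lambda>_. 3 * H). f (z - z'))"
proof -
 let ?c = "\<chi> i. int H :: int ^ 'n"
 let ?g = "\<lambda>(s, u). (s + ?c + u, s + ?c)"
 have inj: "inj_on ?g (ibox (\<lambda>_. H) \<times> sbox H)" by (rule inj_onI) auto
 have "real H ^ CARD('n) * (\<Sum>u\<in>sbox H. f u) = (\<Sum>s\<in>(ibox (\<lambda>_. H) :: (int^'n) set). \<Sum>u\<in>sbox H. f u)"
  by (simp add: card_ibox)
 also have "... = (\<Sum>p\<in>(ibox (\<lambda>_. H) :: (int^'n) set) \<times> sbox H. f (snd p))"
  unfolding sum.cartesian_product by (simp add: case_prod_unfold)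
 also have "... = (\<Sum>q\<in>?g ` (ibox (\<lambda>_. H) \<times> sbox H). f (fst q - snd q))"
  by (subst sum.reindex[OF inj]) (auto intro!: sum.cong)
 also have "... \<le> (\<Sum>q\<in>ibox (\<lambda>_. 3 * H) \<times> ibox (\<lambda>_. 3 * H). f (fst q - snd q))"
 proof (rule sum_mono2)
  show "?g ` (ibox (\<lambda>_. H) \<times> sbox H) \<subseteq> ibox (\<lambda>_. 3 * H) \<times> ibox (\<lambda>_. 3 * H)"
  proof clarsimp
   fix s u :: "int^'n" assume s: "s \<in> ibox (\<lambda>_. H)" and u: "u \<in> sbox H"
   have "0 \<le> s $ i \<and> s $ i < int H \<and> - int H < u $ i \<and> u $ i < int H" for i
   proof -
    have "\<bar>u $ i\<bar> < int H" "0 \<le> s $ i" "s $ i < int H" using s u by (auto simp: ibox_def sbox_def)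
    thus ?thesis by linarith
   qed
   thus "s + ?c + u \<in> ibox (\<lambda>_. 3 * H) \<and> s + ?c \<in> ibox (\<lambda>_. 3 * H)"
    unfolding ibox_def by (auto; smt (verit))
  qed
 qed (use assms in auto)
 also have "... = (\<Sum>z\<in>ibox (\<lambda>_. 3 * H). \<Sum>z'\<in>ibox (\<lambda>_. 3 * H). f (z - z'))"
  by (simp add: sum.cartesian_product case_prod_unfold)
 finally show ?thesis .
qed

lemma sum_swap4:
 "(\<Sum>z\<in>A. \<Sum>z'\<in>A'. \<Sum>w\<in>B. \<Sum>w'\<in>B'. g z z' w w') = (\<Sum>w\<in>B. \<Sum>w'\<in>B'. \<Sum>z\<in>A. \<Sum>z'\<in>A'. g z z' w w')"
proof -
 have "(\<Sum>z\<in>A. \<Sum>z'\<in>A'. \<Sum>w\<in>B. \<Sum>w'\<in>B'. g z z' w w') = (\<Sum>z\<in>A. \<Sum>w\<in>B. \<Sum>z'\<in>A'. \<Sum>w'\<in>B'. g z z' w w')"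
  by (intro sum.cong refl sum.swap)
 also have "... = (\<Sum>w\<in>B. \<Sum>z\<in>A. \<Sum>z'\<in>A'. \<Sum>w'\<in>B'. g z z' w w')" by (rule sum.swap)
 also have "... = (\<Sum>w\<in>B. \<Sum>z\<in>A. \<Sum>w'\<in>B'. \<Sum>z'\<in>A'. g z z' w w')"
  by (intro sum.cong refl sum.swap)
 also have "... = (\<Sum>w\<in>B. \<Sum>w'\<in>B'. \<Sum>z\<in>A. \<Sum>z'\<in>A'. g z z' w w')"
  by (intro sum.cong refl sum.swap)
 finally show ?thesis .
qed

text \<open>A transference inequality for symmetric systems: the roles of the bound on \<open>u\<close> and of the
  bound on the distance to integers are exchanged. The double sum \<open>Q\<close> is evaluated in two
  ways, swapping variables by the symmetry of \<open>lam\<close>. This replaces successive minima.\<close>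
lemma LP_dual:
 fixes lam :: "'n::finite => int ^ 'n => real"
 assumes add: "additive_forms lam"
  and sym: "\<And>u w. (\<Sum>i\<in>UNIV. of_int (w $ i) * lam i u) = (\<Sum>i\<in>UNIV. of_int (u $ i) * lam i w)"
  and H: "H \<ge> 1" and b: "b \<ge> 1"
 shows "card (LP lam H (8 * b)) * b ^ CARD('n) \<le> (432 * H) ^ CARD('n) * card (LP lam b (3 * H))"
proof -
 let ?n = "CARD('n)"
 define f where "f u = (\<Prod>i\<in>UNIV. (cmod (dir b (lam i u)))\<^sup>2)" for u :: "int^'n"
 define Q where "Q = (\<Sum>z\<in>ibox (\<lambda>_. 3 * H). \<Sum>z'\<in>ibox (\<lambda>_. 3 * H). f (z - z'))"
 have f0: "f u \<ge> 0" for u by (simp add: f_def prod_nonneg)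
 have inj: "inj_on fst (LP lam H (8 * b))"
 proof (rule inj_onI, clarify)
  fix u v u' v' assume "(u, v) \<in> LP lam H (8 * b)" "(u', v') \<in> LP lam H (8 * b)" "fst (u, v) = fst (u', v')"
  hence "\<bar>lam i u - of_int (v $ i)\<bar> < 1 / real (8 * b) \<and> \<bar>lam i u - of_int (v' $ i)\<bar> < 1 / real (8 * b)" for i
   by (auto simp: LP_def)
  moreover have "1 / real (8 * b) \<le> 1 / 2" using b by (intro divide_left_mono) auto
  ultimately have "v $ i = v' $ i" for i by (smt (verit) of_int_diff of_int_less_1_iff field_sum_of_halves)
  thus "u = u' \<and> v = v'" using \<open>fst (u, v) = fst (u', v')\<close> by (simp add: vec_eq_iff)
 qed
 have "real (card (LP lam H (8 * b))) * ((real b / 2)\<^sup>2) ^ ?n = (\<Sum>p\<in>LP lam H (8 * b). \<Prod>i\<in>(UNIV::'n set). (real b / 2)\<^sup>2)"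
  by simp
 also have "... \<le> (\<Sum>p\<in>LP lam H (8 * b). f (fst p))"
  unfolding f_def
 proof (intro sum_mono prod_mono conjI power_mono)
  fix p and i :: 'n assume "p \<in> LP lam H (8 * b)"
  hence "\<bar>lam i (fst p) - of_int (snd p $ i)\<bar> < 1 / real (8 * b)" by (auto simp: LP_def)
  thus "real b / 2 \<le> cmod (dir b (lam i (fst p)))" by (rule norm_dir_ge[OF b])
 qed auto
 also have "... = (\<Sum>u\<in>fst ` LP lam H (8 * b). f u)" by (simp add: sum.reindex[OF inj])
 also have "... \<le> (\<Sum>u\<in>sbox H. f u)" by (rule sum_mono2) (auto simp: LP_def f0, auto simp: sbox_def)
 finally have 1: "real H ^ ?n * (real (card (LP lam H (8 * b))) * ((real b / 2)\<^sup>2) ^ ?n) \<le> Q"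
  unfolding Q_def using sum_diff_ge[of f H, OF f0]
  by (meson mult_left_mono of_nat_0_le_iff order_trans zero_le_power)
 let ?E = "\<lambda>w u. cis (2 * pi * (\<Sum>i\<in>UNIV. of_int (w $ i) * lam i u))"
 have "complex_of_real Q = (\<Sum>z\<in>ibox (\<lambda>_. 3 * H). \<Sum>z'\<in>ibox (\<lambda>_. 3 * H). \<Sum>w\<in>ibox (\<lambda>_. b). \<Sum>w'\<in>ibox (\<lambda>_. b). ?E (w - w') (z - z'))"
  unfolding Q_def f_def sum_ibox_diff_cis by simp
 also have "... = (\<Sum>w\<in>ibox (\<lambda>_. b). \<Sum>w'\<in>ibox (\<lambda>_. b). \<Sum>z\<in>ibox (\<lambda>_. 3 * H). \<Sum>z'\<in>ibox (\<lambda>_. 3 * H). ?E (w - w') (z - z'))"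
  by (rule sum_swap4)
 also have "... = (\<Sum>w\<in>ibox (\<lambda>_. b). \<Sum>w'\<in>ibox (\<lambda>_. b). \<Sum>z\<in>ibox (\<lambda>_. 3 * H). \<Sum>z'\<in>ibox (\<lambda>_. 3 * H). ?E (z - z') (w - w'))"
  by (intro sum.cong refl arg_cong[where f = "\<lambda>r. cis (2 * pi * r)"] sym)
 also have "... = of_real (\<Sum>w\<in>ibox (\<lambda>_. b). \<Sum>w'\<in>ibox (\<lambda>_. b). \<Prod>i\<in>UNIV. (cmod (dir (3 * H) (lam i (w - w'))))\<^sup>2)"
  unfolding sum_ibox_diff_cis by simp
 finally have "Q = (\<Sum>w\<in>ibox (\<lambda>_. b). \<Sum>w'\<in>ibox (\<lambda>_. b). \<Prod>i\<in>UNIV. (cmod (dir (3 * H) (lam i (w - w'))))\<^sup>2)"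
  by (simp only: of_real_eq_iff)
 also have "... = (\<Sum>w'\<in>ibox (\<lambda>_. b). \<Sum>w\<in>ibox (\<lambda>_. b). \<Prod>i\<in>UNIV. (cmod (dir (3 * H) (lam i w + - lam i w')))\<^sup>2)"
  by (subst sum.swap) (simp add: additive_forms_diff[OF add])
 also have "... \<le> (\<Sum>w'\<in>(ibox (\<lambda>_. b) :: (int^'n) set). real (card (LP lam b (3 * H))) * (\<Prod>i\<in>(UNIV::'n set). 12 * real (3 * H) * real (3 * H)))"
 proof (intro sum_mono sum_dir_le add)
  fix w w' :: "int^'n" and i assume "w \<in> ibox (\<lambda>_. b)" "w' \<in> ibox (\<lambda>_. b)"
  hence "0 \<le> w $ i \<and> w $ i < int b" "0 \<le> w' $ i \<and> w' $ i < int b" by (auto simp: ibox_def)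
  thus "\<bar>w $ i - w' $ i\<bar> < int b" by linarith
 qed (use H in auto)
 also have "... = real b ^ ?n * (real (card (LP lam b (3 * H))) * (108 * real H * real H) ^ ?n)"
  by (simp add: card_ibox mult.assoc)
 finally have 2: "Q \<le> real b ^ ?n * (real (card (LP lam b (3 * H))) * (108 * real H * real H) ^ ?n)" .
 have bH: "real b ^ ?n > 0" "real H ^ ?n > 0" using b H by auto
 have "(real H ^ ?n * real b ^ ?n) * (real (card (LP lam H (8 * b))) * real b ^ ?n) =
   4 ^ ?n * (real H ^ ?n * (real (card (LP lam H (8 * b))) * ((real b / 2)\<^sup>2) ^ ?n))"
  by (simp add: power2_eq_square power_divide power_mult_distrib)
 also have "... \<le> 4 ^ ?n * (real b ^ ?n * (real (card (LP lam b (3 * H))) * (108 * real H * real H) ^ ?n))"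
  using order_trans[OF 1 2] by (intro mult_left_mono) auto
 also have "... = (real H ^ ?n * real b ^ ?n) * ((432 * real H) ^ ?n * real (card (LP lam b (3 * H))))"
 proof -
  have "(4::real) ^ ?n * 108 ^ ?n = 432 ^ ?n" by (simp add: power_mult_distrib[symmetric])
  thus ?thesis by (simp add: power_mult_distrib algebra_simps)
 qed
 finally have "real (card (LP lam H (8 * b))) * real b ^ ?n \<le> (432 * real H) ^ ?n * real (card (LP lam b (3 * H)))"
  using bH by (simp add: mult_le_cancel_left_pos)
 hence "real (card (LP lam H (8 * b)) * b ^ ?n) \<le> real ((432 * H) ^ ?n * card (LP lam b (3 * H)))" by simp
 thus ?thesis by (simp only: of_nat_le_iff)
qed

lemma maximal_separated_subset:
 fixes A :: "'a::ab_group_add set"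
 assumes "finite A" "0 \<in> B" "\<And>x. x \<in> B ==> - x \<in> B"
 shows "\<exists>S\<subseteq>A. (\<forall>p\<in>S. \<forall>q\<in>S. p \<noteq> q --> p - q \<notin> B) \<and> (\<forall>a\<in>A. \<exists>s\<in>S. a - s \<in> B)"
 using assms(1)
proof (induction A rule: finite_induct)
 case empty thus ?case by auto
next
 case (insert a A)
 then obtain S where S: "S \<subseteq> A" "\<forall>p\<in>S. \<forall>q\<in>S. p \<noteq> q --> p - q \<notin> B" "\<forall>a\<in>A. \<exists>s\<in>S. a - s \<in> B" by auto
 show ?case
 proof (cases "\<exists>s\<in>S. a - s \<in> B")
  case True thus ?thesis using S by (intro exI[of _ S]) auto
 next
  case False
  have "s - a \<notin> B" if "s \<in> S" for s using False assms(3)[of "s - a"] that by auto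
  thus ?thesis using S False assms(2) by (intro exI[of _ "insert a S"]) auto
 qed
qed

text \<open>Davenport's shrinking lemma. A maximal \<open>B\<close>-separated subset \<open>S\<close> of
  \<open>A\<close> gives \<open>\<bar>A\<bar> \<le> \<bar>S\<bar> \<bar>B\<bar>\<close>; the translates of
  \<open>W\<close> by \<open>t S\<close> are disjoint and contained in \<open>G\<close>, so
  \<open>\<bar>S\<bar> \<bar>W\<bar> \<le> \<bar>G\<bar>\<close>. By \<open>LP_dual\<close>,
  \<open>\<bar>G\<bar>\<close> is bounded in terms of \<open>\<bar>A\<bar>\<close> and
  \<open>\<bar>A\<bar>\<close> in terms of \<open>\<bar>W\<bar>\<close>.\<close>
lemma LP_shrink:
 fixes lam :: "'n::finite => int ^ 'n => real"
 assumes add: "additive_forms lam"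
  and sym: "\<And>u w. (\<Sum>i\<in>UNIV. of_int (w $ i) * lam i u) = (\<Sum>i\<in>UNIV. of_int (u $ i) * lam i w)"
  and x: "x \<ge> 1" and M: "M \<ge> 1" and m: "m \<ge> 1" and X: "X = 16 * x" and P: "P = X * M"
 shows "card (LP lam P (P * m)) \<le> (13824 * M) ^ CARD('n) * card (LP lam X (P * m * M))"
proof -
 let ?n = "CARD('n)"
 \<comment> \<open>The dilation \<open>t\<close> is chosen so that a difference of two elements of \<open>W\<close>, divided by \<open>t\<close>, lies in \<open>B\<close>.\<close>
 define t where "t = M * m"
 have t: "t \<ge> 1" using M m by (simp add: t_def)
 have P1: "P \<ge> 1" using x M by (simp add: P X)
 define A where "A = LP lam P (P * m)"
 define B where "B = LP lam X (P * m * M)"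
 define W where "W = LP lam (8 * x * t) (2 * P)"
 define G where "G = LP lam (2 * t * P) (8 * x)"
 have fin: "finite A" "finite B" "finite W" "finite G"
  unfolding A_def B_def W_def G_def using P1 m M x by (auto intro!: finite_LP)
 have B0: "0 \<in> B" using P1 m M x by (simp add: B_def LP_def zero_prod_def additive_forms_zero[OF add] X)
 have Bm: "- p \<in> B" if "p \<in> B" for p
 proof -
  have "lam i (- u) = - lam i u" for i u
   using additive_forms_diff[OF add, of i 0 u] by (simp add: additive_forms_zero[OF add])
  thus ?thesis using that by (cases p) (simp add: B_def LP_def uminus_prod_def abs_minus_commute)
 qed
 obtain S where S: "S \<subseteq> A" "\<forall>p\<in>S. \<forall>q\<in>S. p \<noteq> q --> p - q \<notin> B" "\<forall>a\<in>A. \<exists>s\<in>S. a - s \<in> B"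
  using maximal_separated_subset[OF fin(1) B0 Bm] by blast
 have finS: "finite S" using S(1) fin(1) finite_subset by blast
 have "card A \<le> card ((\<lambda>(s, b). s + b) ` (S \<times> B))"
 proof (rule card_mono)
  show "A \<subseteq> (\<lambda>(s, b). s + b) ` (S \<times> B)"
  proof
   fix a assume "a \<in> A"
   then obtain s where "s \<in> S" "a - s \<in> B" using S(3) by (meson bspec)
   thus "a \<in> (\<lambda>(s, b). s + b) ` (S \<times> B)" by (intro image_eqI[of _ _ "(s, a - s)"]) auto
  qed
 qed (use finS fin in auto)
 also have "... \<le> card (S \<times> B)" by (rule card_image_le) (use finS fin in auto)
 finally have 1: "card A \<le> card S * card B" by (simp add: card_cartesian_product)
 define sc where "sc p = ((\<chi> j. int t * fst p $ j) :: int^'n, (\<chi> j. int t * snd p $ j) :: int^'n)" for p :: "(int^'n) \<times> (int^'n)"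
 have lsc: "lam i (fst (sc p)) = real t * lam i (fst p)" for i p
  unfolding sc_def fst_conv by (rule additive_forms_scale[OF add])
 let ?g = "\<lambda>(s, w). sc s + w"
 have "card (S \<times> W) \<le> card G"
 proof (rule card_inj_on_le[where f = ?g])
  show "finite G" by fact
  show "?g ` (S \<times> W) \<subseteq> G"
  proof (rule image_subsetI)
   fix a assume a: "a \<in> S \<times> W"
   obtain u v u' v' where a': "a = ((u, v), (u', v'))" by (metis prod.collapse)
   have s: "(u, v) \<in> S" and w: "(u', v') \<in> W" using a by (auto simp: a')
   have s': "\<bar>u $ i\<bar> < int P" "\<bar>lam i u - of_int (v $ i)\<bar> < 1 / real (P * m)" for i
    using s S(1) by (auto simp: A_def LP_def)
   have w': "\<bar>u' $ i\<bar> < int (8 * x * t)" "\<bar>lam i u' - of_int (v' $ i)\<bar> < 1 / real (2 * P)" for i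
    using w by (auto simp: W_def LP_def)
   have "\<bar>int t * u $ i + u' $ i\<bar> < int (2 * t * P)" for i
   proof -
    have "\<bar>int t * u $ i\<bar> \<le> int t * int P" unfolding abs_mult using s'(1)[of i] by (intro mult_mono) auto
    moreover have "8 * x * t \<le> t * P" using x M by (simp add: P X)
    hence "int (8 * x * t) \<le> int t * int P" by (metis of_nat_le_iff of_nat_mult)
    ultimately show ?thesis using w'(1)[of i] by simp
   qed
   moreover have "\<bar>lam i (fst (sc (u, v)) + u') - of_int (int t * v $ i + v' $ i)\<bar> < 1 / real (8 * x)" for i
   proof -
    have "lam i (fst (sc (u, v)) + u') - of_int (int t * v $ i + v' $ i)
      = real t * (lam i u - of_int (v $ i)) + (lam i u' - of_int (v' $ i))"
     by (simp add: additive_forms_add[OF add] lsc algebra_simps)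
    moreover have "\<bar>real t * (lam i u - of_int (v $ i))\<bar> \<le> real t * (1 / real (P * m))"
     unfolding abs_mult using s'(2)[of i] by (intro mult_mono) auto
    moreover have "real t * (1 / real (P * m)) = 1 / real (16 * x)"
     using M m x by (simp add: t_def P X field_simps)
    moreover have "1 / real (2 * P) \<le> 1 / real (16 * x)"
     using x M by (intro divide_left_mono) (auto simp: P X)
    moreover have "1 / real (8 * x) = 1 / real (16 * x) + 1 / real (16 * x)" using x by (simp add: field_simps)
    ultimately show ?thesis using w'(2)[of i] by linarith
   qed
   ultimately show "?g a \<in> G" by (simp add: a' G_def LP_def sc_def)
  qed
  show "inj_on ?g (S \<times> W)"
  proof (rule inj_onI)
   fix a b assume a: "a \<in> S \<times> W" and b: "b \<in> S \<times> W" and ab: "?g a = ?g b"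
   obtain u v u' v' where a': "a = ((u, v), (u', v'))" by (metis prod.collapse)
   obtain p q p' q' where b': "b = ((p, q), (p', q'))" by (metis prod.collapse)
   have s: "(u, v) \<in> S" "(p, q) \<in> S" and w: "(u', v') \<in> W" "(p', q') \<in> W"
    and eq: "sc (u, v) + (u', v') = sc (p, q) + (p', q')"
    using a b ab by (auto simp: a' b')
   have e1: "int t * (u $ i - p $ i) = p' $ i - u' $ i" for i
    using eq by (simp add: sc_def vec_eq_iff algebra_simps; smt (verit))
   have e2: "int t * (v $ i - q $ i) = q' $ i - v' $ i" for i
    using eq by (simp add: sc_def vec_eq_iff algebra_simps; smt (verit))
   have w': "\<bar>u' $ i\<bar> < int (8 * x * t)" "\<bar>lam i u' - of_int (v' $ i)\<bar> < 1 / real (2 * P)"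
    "\<bar>p' $ i\<bar> < int (8 * x * t)" "\<bar>lam i p' - of_int (q' $ i)\<bar> < 1 / real (2 * P)" for i
    using w by (auto simp: W_def LP_def)
   have "(u, v) - (p, q) \<in> B"
   proof -
    have "\<bar>u $ i - p $ i\<bar> < int X" for i
    proof -
     have "int t * \<bar>u $ i - p $ i\<bar> = \<bar>p' $ i - u' $ i\<bar>" using e1[of i] by (metis abs_mult abs_of_nat)
     also have "... < int t * int X" using w'(1,3)[of i] by (simp add: X mult_ac)
     finally show ?thesis using t by simp
    qed
    moreover have "\<bar>lam i (u - p) - of_int (v $ i - q $ i)\<bar> < 1 / real (P * m * M)" for i
    proof -
     have "lam i (fst (sc (u, v))) + lam i u' = lam i (fst (sc (p, q))) + lam i p'"
      using eq additive_forms_add[OF add] by (metis fst_add fst_conv)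
     hence l: "real t * (lam i u - lam i p) = lam i p' - lam i u'" by (simp add: lsc algebra_simps)
     have v: "real t * (real_of_int (v $ i) - real_of_int (q $ i)) = real_of_int (q' $ i) - real_of_int (v' $ i)"
      using e2[of i] by (metis of_int_diff of_int_mult of_int_of_nat_eq)
     have "real t * (lam i (u - p) - of_int (v $ i - q $ i)) = (lam i p' - of_int (q' $ i)) - (lam i u' - of_int (v' $ i))"
      using l v by (simp add: additive_forms_diff[OF add] algebra_simps)
     hence "real t * \<bar>lam i (u - p) - of_int (v $ i - q $ i)\<bar> = \<bar>(lam i p' - of_int (q' $ i)) - (lam i u' - of_int (v' $ i))\<bar>"
      by (metis abs_mult abs_of_nat)
     also have "... < 1 / real (2 * P) + 1 / real (2 * P)" using w'(2,4)[of i] by linarith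
     also have "... = real t * (1 / real (P * m * M))" using P1 M m by (simp add: t_def field_simps)
     finally show ?thesis using t by (subst (asm) mult_less_cancel_left_pos; simp)
    qed
    ultimately show ?thesis by (simp add: B_def LP_def)
   qed
   hence "(u, v) = (p, q)" using S(2) s by blast
   thus "a = b" using eq by (auto simp: a' b')
  qed
 qed
 hence 2: "card S * card W \<le> card G" by (simp add: card_cartesian_product)
 have tn: "0 < x ^ ?n" "0 < (x * t) ^ ?n" "0 < m ^ ?n" using x t m by auto
 have "card G * x ^ ?n \<le> (432 * (2 * t * P)) ^ ?n * card (LP lam x (3 * (2 * t * P)))"
  unfolding G_def using t P1 x by (intro LP_dual[OF add sym]) auto
 also have "... \<le> (432 * (2 * t * P)) ^ ?n * card B"
  unfolding B_def using P1 m M by (intro mult_left_mono card_LP_mono) (auto simp: X t_def)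
 also have "... = x ^ ?n * ((13824 * (t * M)) ^ ?n * card B)"
  by (simp add: P X power_mult_distrib[symmetric] mult_ac)
 finally have 3: "card G \<le> (13824 * (t * M)) ^ ?n * card B" using tn by (simp add: mult.commute)
 have "card A \<le> card (LP lam (2 * P) (8 * (x * t)))"
  unfolding A_def using x t by (intro card_LP_mono) (auto simp: P X t_def)
 hence "card A * (x * t) ^ ?n \<le> card (LP lam (2 * P) (8 * (x * t))) * (x * t) ^ ?n" by simp
 also have "... \<le> (432 * (2 * P)) ^ ?n * card (LP lam (x * t) (3 * (2 * P)))"
  using P1 x t by (intro LP_dual[OF add sym]) auto
 also have "... \<le> (432 * (2 * P)) ^ ?n * card W"
  unfolding W_def using P1 by (intro mult_left_mono card_LP_mono) auto
 finally have "(x * M) ^ ?n * (card A * m ^ ?n) \<le> (x * M) ^ ?n * (13824 ^ ?n * card W)"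
  by (simp add: P X t_def power_mult_distrib[symmetric] mult_ac)
 hence 4: "card A * m ^ ?n \<le> 13824 ^ ?n * card W" using x M by simp
 have "m ^ ?n * (card A)\<^sup>2 = (card A * m ^ ?n) * card A" by (simp add: power2_eq_square)
 also have "... \<le> (13824 ^ ?n * card W) * (card S * card B)" by (rule mult_le_mono[OF 4 1])
 also have "... = 13824 ^ ?n * card B * (card S * card W)" by simp
 also have "... \<le> 13824 ^ ?n * card B * ((13824 * (t * M)) ^ ?n * card B)"
  by (rule mult_le_mono[OF order_refl order_trans[OF 2 3]])
 also have "... = m ^ ?n * ((13824 * M) ^ ?n * card B)\<^sup>2"
  by (simp add: t_def power_mult_distrib power2_eq_square mult_ac)
 finally have "(card A)\<^sup>2 \<le> ((13824 * M) ^ ?n * card B)\<^sup>2" using tn by simp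
 thus ?thesis unfolding A_def B_def by (rule power2_le_imp_le) simp
qed

section \<open>Differences and polarization\<close>

text \<open>Forward differences, and iterated differences along a list of directions.\<close>
definition Dif :: "'a => ('a::ab_group_add => 'b::ab_group_add) => 'a => 'b" where
 "Dif h f = (\<lambda>x. f (x + h) - f x)"

definition Difs :: "'a list => ('a::ab_group_add => 'b::ab_group_add) => 'a => 'b" where
 "Difs hs f = fold Dif hs f"

lemma Difs_Nil [simp]: "Difs [] f = f" by (simp add: Difs_def)
lemma Difs_Cons [simp]: "Difs (h # hs) f = Difs hs (Dif h f)" by (simp add: Difs_def)
lemma Difs_append: "Difs (hs @ ks) f = Difs ks (Difs hs f)" by (simp add: Difs_def)

lemma Dif_commute: "Dif h (Dif k f) = Dif k (Dif h f)"
 by (simp add: Dif_def fun_eq_iff algebra_simps)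

lemma Difs_perm: "mset hs = mset ks ==> Difs hs f = Difs ks f"
 unfolding Difs_def by (rule fun_cong[OF fold_multiset_equiv]) (auto simp: fun_eq_iff Dif_commute)

text \<open>\<open>dlt k f\<close>: all \<open>k\<close>-fold differences of \<open>f\<close> vanish, that is,
  \<open>f\<close> is a polynomial of degree less than \<open>k\<close>.\<close>
fun dlt :: "nat => ('a::ab_group_add => 'b::ab_group_add) => bool" where
 "dlt 0 f \<longleftrightarrow> (\<forall>x. f x = 0)"
| "dlt (Suc k) f \<longleftrightarrow> (\<forall>h. dlt k (Dif h f))"

lemma Dif_add: "Dif h (\<lambda>x. f x + g x) = (\<lambda>x. Dif h f x + Dif h g x)"
 by (simp add: Dif_def fun_eq_iff algebra_simps)
lemma Dif_shift: "Dif h (\<lambda>x. f (x + a)) = (\<lambda>x. Dif h f (x + a))"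
 by (simp add: Dif_def fun_eq_iff algebra_simps)
lemma Dif_cmult: "Dif h (\<lambda>x. c * f x) = (\<lambda>x. (c::'b::comm_ring_1) * Dif h f x)"
 by (simp add: Dif_def fun_eq_iff algebra_simps)

lemma dlt_add: "dlt k f ==> dlt k g ==> dlt k (\<lambda>x. f x + g x)"
 by (induction k arbitrary: f g) (auto simp: Dif_add)
lemma dlt_shift: "dlt k f ==> dlt k (\<lambda>x. f (x + a))"
 by (induction k arbitrary: f) (auto simp: Dif_shift)
lemma dlt_cmult: "dlt k f ==> dlt k (\<lambda>x. (c::'b::comm_ring_1) * f x)"
 by (induction k arbitrary: f) (auto simp: Dif_cmult)
lemma dlt_zero: "dlt k (\<lambda>_. 0)"
 by (induction k) (auto simp: Dif_def)
lemma dlt_sum: "(\<And>i. i \<in> A ==> dlt k (f i)) ==> dlt k (\<lambda>x. \<Sum>i\<in>A. f i x)"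
 by (induction A rule: infinite_finite_induct) (auto simp: dlt_zero dlt_add)
lemma dlt_Suc: "dlt k f ==> dlt (Suc k) f"
proof (induction k arbitrary: f)
 case 0 thus ?case by (simp add: Dif_def)
qed auto
lemma dlt_Difs: "dlt k f ==> dlt (k - length hs) (Difs hs f)"
proof (induction hs arbitrary: k f)
 case (Cons h hs)
 show ?case
 proof (cases k)
  case 0
  hence "dlt 0 (Dif h f)" using Cons.prems by (simp add: Dif_def)
  from Cons.IH[OF this] show ?thesis using 0 by simp
 next
  case (Suc k') thus ?thesis using Cons by auto
 qed
qed simp

lemma dlt_var_mult:
 fixes f :: "int ^ 'n::finite => int"
 shows "dlt k f ==> dlt (Suc k) (\<lambda>x. x $ i * f x)"
proof (induction k arbitrary: f)
 case 0 thus ?case by (simp add: Dif_def)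
next
 case (Suc k)
 have "dlt (Suc k) (Dif h (\<lambda>x. x $ i * f x))" for h
 proof -
  have "Dif h (\<lambda>x. x $ i * f x) = (\<lambda>x. x $ i * Dif h f x + h $ i * f (x + h))"
   by (simp add: Dif_def fun_eq_iff algebra_simps)
  moreover have "dlt (Suc k) (\<lambda>x. x $ i * Dif h f x)" using Suc by simp
  moreover have "dlt (Suc k) (\<lambda>x. h $ i * f (x + h))" using Suc.prems by (intro dlt_cmult dlt_shift)
  ultimately show ?thesis by (simp only: dlt_add)
 qed
 thus ?case by (subst dlt.simps) simp
qed

lemma dlt_var_power_mult:
 fixes f :: "int ^ 'n::finite => int"
 assumes "dlt k f" shows "dlt (k + e) (\<lambda>x. (x $ i) ^ e * f x)"
proof (induction e)
 case 0 thus ?case using assms by simp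
next
 case (Suc e)
 hence "dlt (Suc (k + e)) (\<lambda>x. x $ i * ((x $ i) ^ e * f x))" by (rule dlt_var_mult)
 thus ?case by (simp add: mult.assoc)
qed

lemma dlt_monomial:
 fixes m :: "'n::finite => nat"
 shows "finite I ==> dlt (Suc (\<Sum>i\<in>I. m i)) (\<lambda>x::int^'n. \<Prod>i\<in>I. (x $ i) ^ m i)"
proof (induction I rule: finite_induct)
 case empty thus ?case by (simp add: Dif_def)
next
 case (insert i I)
 from dlt_var_power_mult[OF insert.IH, of "m i" i] insert.hyps show ?case by (simp add: add_ac)
qed

lemma dlt_mpoly:
 assumes "is_form d F" shows "dlt (Suc d) (mpoly_eval F :: int ^ 'n::finite => int)"
proof -
 have "dlt (Suc d) (\<lambda>x::int^'n. of_int (lookup F m) * (\<Prod>i\<in>UNIV. (x $ i) ^ lookup m i))"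
  if "m \<in> keys F" for m
  using dlt_monomial[of UNIV "lookup m"] that assms by (intro dlt_cmult) (simp add: is_form_def)
 hence "dlt (Suc d) (\<lambda>x::int^'n. \<Sum>m\<in>keys F. of_int (lookup F m) * (\<Prod>i\<in>UNIV. (x $ i) ^ lookup m i))"
  by (rule dlt_sum)
 thus ?thesis by (simp add: mpoly_eval_def[abs_def])
qed

text \<open>If \<open>dlt (Suc d) f\<close> and \<open>hs\<close> has length \<open>d\<close>, this is the symmetric
  multilinear form with \<open>polar f [x, ..., x] = d! f x\<close> for \<open>f\<close> homogeneous of
  degree \<open>d\<close>.\<close>
definition polar :: "('a::ab_group_add => 'b::ab_group_add) => 'a list => 'b" where
 "polar f hs = Difs hs f 0"

lemma dlt_1_const: assumes "dlt (Suc 0) f" shows "f x = f 0"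
proof -
 have "Dif x f 0 = 0" using assms by simp
 thus ?thesis by (simp add: Dif_def)
qed

lemma Difs_const:
 assumes "dlt (Suc d) f" "length hs = d" shows "Difs hs f x = polar f hs"
 using dlt_Difs[OF assms(1), of hs] assms(2) dlt_1_const[of "Difs hs f" x] by (simp add: polar_def)

lemma polar_perm: "mset hs = mset ks ==> polar f hs = polar f ks"
 using Difs_perm[of hs ks f] by (simp add: polar_def)

lemma polar_add_Cons:
 assumes f: "dlt (Suc d) f" "Suc (length hs) = d"
 shows "polar f ((h + k) # hs) = polar f (h # hs) + polar f (k # hs)"
proof -
 define g where "g = Difs hs f"
 have swap: "polar f (u # hs) = g (x + u) - g x" for u x
 proof -
  have "Difs (u # hs) f x = polar f (u # hs)" by (rule Difs_const[OF f(1)]) (use f(2) in simp)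
  moreover have "Difs (u # hs) f = Difs (hs @ [u]) f" by (rule Difs_perm) simp
  ultimately show ?thesis by (simp add: Difs_append Dif_def g_def)
 qed
 show ?thesis using swap[of h 0] swap[of k h] swap[of "h + k" 0] by (simp add: add_ac)
qed

lemma polar_add:
 assumes f: "dlt (Suc d) f" "Suc (length us + length vs) = d"
 shows "polar f (us @ (h + k) # vs) = polar f (us @ h # vs) + polar f (us @ k # vs)"
proof -
 have "polar f (us @ w # vs) = polar f (w # us @ vs)" for w by (rule polar_perm) simp
 thus ?thesis using polar_add_Cons[OF f(1), of "us @ vs" h k] f(2) by simp
qed

lemma polar_sum:
 assumes f: "dlt (Suc d) f" "Suc (length us + length vs) = d"
 shows "polar f (us @ (\<Sum>i\<in>I. h i) # vs) = (\<Sum>i\<in>I. polar f (us @ h i # vs))"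
proof -
 have 0: "polar f (us @ 0 # vs) = 0" using polar_add[OF f, of 0 0] by simp
 show ?thesis by (induction I rule: infinite_finite_induct) (auto simp: 0 polar_add[OF f])
qed

lemma polar_diff:
 assumes f: "dlt (Suc d) f" "Suc (length us + length vs) = d"
 shows "polar f (us @ (h - k) # vs) = polar f (us @ h # vs) - polar f (us @ k # vs)"
 using polar_add[OF f, of "h - k" k] by simp

text \<open>Integer multiples of integer vectors.\<close>
definition smul :: "int => int ^ 'n::finite => int ^ 'n" where "smul t x = (\<chi> i. t * x $ i)"

lemma smul_nth [simp]: "smul t x $ i = t * x $ i" by (simp add: smul_def)

lemma polar_smul:
 fixes f :: "int ^ 'n::finite => int"
 assumes f: "dlt (Suc d) f" "Suc (length us + length vs) = d"
 shows "polar f (us @ smul t h # vs) = t * polar f (us @ h # vs)"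
proof -
 have n: "polar f (us @ smul (int k) h # vs) = int k * polar f (us @ h # vs)" for k
 proof (induction k)
  case 0
  have "smul 0 h = 0" by (simp add: vec_eq_iff)
  thus ?case using polar_sum[OF f, of _ "{}"] by simp
 next
  case (Suc k)
  have "smul (int (Suc k)) h = h + smul (int k) h" by (simp add: vec_eq_iff algebra_simps)
  thus ?case using polar_add[OF f] Suc by (simp add: algebra_simps)
 qed
 show ?thesis
 proof (cases "t \<ge> 0")
  case True thus ?thesis using n[of "nat t"] by simp
 next
  case False
  have "smul t h = 0 - smul (int (nat (- t))) h" using False by (simp add: vec_eq_iff)
  thus ?thesis using polar_diff[OF f, of 0 "smul (int (nat (- t))) h"] n[of "nat (- t)"] False polar_sum[OF f, of _ "{}"] by simp
 qed
qed

lemma vec_sum_axis: "(\<Sum>j\<in>UNIV. smul (x $ j) (axis j 1)) = x" for x :: "int ^ 'n::finite"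
proof -
 have "(\<Sum>j\<in>UNIV. x $ j * (if i = j then 1 else 0)) = x $ i" for i
  using sum.delta[of UNIV i "\<lambda>j. x $ j"] by (simp add: mult_delta_right)
 thus ?thesis by (simp add: vec_eq_iff axis_def)
qed

lemma polar_expand:
 fixes f :: "int ^ 'n::finite => int"
 assumes f: "dlt (Suc d) f" "Suc (length us + length vs) = d"
 shows "polar f (us @ h # vs) = (\<Sum>j\<in>UNIV. h $ j * polar f (us @ axis j 1 # vs))"
proof -
 have "polar f (us @ h # vs) = polar f (us @ (\<Sum>j\<in>UNIV. smul (h $ j) (axis j 1)) # vs)"
  unfolding vec_sum_axis ..
 also have "... = (\<Sum>j\<in>UNIV. polar f (us @ smul (h $ j) (axis j 1) # vs))"
  by (rule polar_sum[OF f])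
 also have "... = (\<Sum>j\<in>UNIV. h $ j * polar f (us @ axis j 1 # vs))"
  by (rule sum.cong[OF refl polar_smul[OF f]])
 finally show ?thesis .
qed

lemma dlt_int_var_mult:
 fixes f :: "int => int"
 shows "dlt k f ==> dlt (Suc k) (\<lambda>x. x * f x)"
 proof (induction k arbitrary: f)
  case 0 thus ?case by (simp add: Dif_def)
 next
  case (Suc k)
  have "dlt (Suc k) (Dif h (\<lambda>x. x * f x))" for h
  proof -
   have "Dif h (\<lambda>x. x * f x) = (\<lambda>x. x * Dif h f x + h * f (x + h))"
    by (simp add: Dif_def fun_eq_iff algebra_simps)
   moreover have "dlt (Suc k) (\<lambda>x. x * Dif h f x)" using Suc by simp
   moreover have "dlt (Suc k) (\<lambda>x. h * f (x + h))" using Suc.prems by (intro dlt_cmult dlt_shift)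
   ultimately show ?thesis by (simp only: dlt_add)
  qed
  thus ?case by (subst dlt.simps) simp
 qed

lemma dlt_power_int: "dlt (Suc k) (\<lambda>t::int. t ^ k)"
proof (induction k)
 case 0 thus ?case by (simp add: Dif_def)
next
 case (Suc k) from dlt_int_var_mult[OF Suc] show ?case by simp
qed

lemma Difs_add: "Difs hs (\<lambda>x. f x + g x) = (\<lambda>x. Difs hs f x + Difs hs g x)"
 by (induction hs arbitrary: f g) (auto simp: Dif_add)
lemma Difs_cmult: "Difs hs (\<lambda>x. c * f x) = (\<lambda>x. (c::'b::comm_ring_1) * Difs hs f x)"
 by (induction hs arbitrary: f) (auto simp: Dif_cmult)

lemma Difs_power: "Difs (replicate k 1) (\<lambda>t::int. t ^ k) x = fact k"
proof (induction k arbitrary: x)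
 case 0 thus ?case by simp
next
 case (Suc k)
 have rest: "\<exists>g. (\<forall>t::int. (t + 1) ^ Suc k - t ^ Suc k = int (Suc k) * t ^ k + g t) \<and> dlt k g" for k
 proof (induction k)
  case 0 thus ?case by (intro exI[of _ "\<lambda>_. 0"]) simp
 next
  case (Suc k)
  then obtain g where g: "\<forall>t::int. (t + 1) ^ Suc k - t ^ Suc k = int (Suc k) * t ^ k + g t" "dlt k g"
   by (elim exE conjE) (rule that)
  let ?h = "\<lambda>t. int (Suc k) * t ^ k + ((t + 0) * g t + g t)"
  have "(t + 1) ^ Suc (Suc k) - t ^ Suc (Suc k) = int (Suc (Suc k)) * t ^ Suc k + ?h t" for t
  proof -
   have "(t + 1) * (t + 1) ^ Suc k = (t + 1) * (t ^ Suc k + int (Suc k) * t ^ k + g t)" using g(1)[rule_format, of t] by simp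
   thus ?thesis by (simp add: algebra_simps)
  qed
  moreover have "dlt (Suc k) ?h"
  proof (intro dlt_add dlt_cmult dlt_power_int dlt_Suc[OF g(2)])
   show "dlt (Suc k) (\<lambda>t. (t + 0) * g t)" using dlt_int_var_mult[OF g(2)] by simp
  qed
  ultimately show ?case by (intro exI[of _ ?h] conjI allI)
 qed
 from rest[of k] obtain g where g: "\<forall>t::int. (t + 1) ^ Suc k - t ^ Suc k = int (Suc k) * t ^ k + g t" "dlt k g"
  by (elim exE conjE) (rule that)
 have "Difs (replicate (Suc k) 1) (\<lambda>t::int. t ^ Suc k) x = Difs (replicate k 1) (\<lambda>t. int (Suc k) * t ^ k + g t) x"
  using g(1) by (simp add: Dif_def del: power_Suc)
 also have "... = int (Suc k) * Difs (replicate k 1) (\<lambda>t. t ^ k) x + Difs (replicate k 1) g x"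
  by (simp add: Difs_add Difs_cmult)
 also have "Difs (replicate k 1) g x = 0" using dlt_Difs[OF g(2), of "replicate k 1"] by simp
 finally show ?case using Suc by (simp add: algebra_simps)
qed

lemma polar_diagonal:
 fixes f :: "int ^ 'n::finite => int"
 assumes hom: "\<And>t x. f (smul t x) = t ^ d * f x"
 shows "polar f (replicate d x) = fact d * f x"
proof -
 have "Difs (replicate k x) g (smul t x) = Difs (replicate k 1) (\<lambda>t. g (smul t x)) t" for k t and g :: "int^'n => int"
 proof (induction k arbitrary: g)
  case (Suc k)
  have "Dif x g (smul s x) = Dif 1 (\<lambda>t. g (smul t x)) s" for s
  proof -
   have "smul s x + x = smul (s + 1) x" by (simp add: vec_eq_iff algebra_simps)
   thus ?thesis by (simp add: Dif_def)
  qed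
  thus ?case using Suc[of "Dif x g"] by simp
 qed simp
 note this[of d f 0]
 moreover have "smul 0 x = 0" by (simp add: vec_eq_iff)
 moreover have "(\<lambda>t. f (smul t x)) = (\<lambda>t. f x * t ^ d)" by (simp add: hom mult.commute)
 ultimately show ?thesis by (simp add: polar_def Difs_cmult Difs_power)
qed

section \<open>Polynomial functions and the Nullstellensatz\<close>

text \<open>Complex-valued functions as a vector space, for spans and linear dependence.\<close>
definition fsc :: "complex => ('a => complex) => 'a => complex" where "fsc c f = (\<lambda>x. c * f x)"

global_interpretation fs: vector_space "fsc :: complex => ('a => complex) => 'a => complex"
 by unfold_locales (auto simp: fsc_def fun_eq_iff algebra_simps)

lemma fsc_apply [simp]: "fsc c f x = c * f x" by (simp add: fsc_def)

lemma span_times: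
 assumes "f \<in> fs.span A" "g \<in> fs.span B" "\<And>a b. a \<in> A ==> b \<in> B ==> a * b \<in> fs.span C"
 shows "f * g \<in> fs.span C"
proof -
 have 1: "a * g \<in> fs.span C" if "a \<in> A" for a
  using assms(2)
 proof (induction rule: fs.span_induct_alt)
  case base
  show ?case by (simp only: mult_zero_left mult_zero_right fs.span_zero)
 next
  case (step c x y)
  have "a * (fsc c x + y) = fsc c (a * x) + a * y" by (simp add: fun_eq_iff algebra_simps)
  thus ?case using step assms(3)[OF that] by (simp only: fs.span_add fs.span_scale)
 qed
 show ?thesis using assms(1)
 proof (induction rule: fs.span_induct_alt)
  case base
  show ?case by (simp only: mult_zero_left mult_zero_right fs.span_zero)
 next
  case (step c x y)
  have "(fsc c x + y) * g = fsc c (x * g) + y * g" by (simp add: fun_eq_iff algebra_simps)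
  thus ?case using step 1 by (simp only: fs.span_add fs.span_scale)
 qed
qed

text \<open>Monomial functions.\<close>
definition monf :: "('n::finite => nat) => complex ^ 'n => complex" where
 "monf m x = (\<Prod>i\<in>UNIV. (x $ i) ^ m i)"

lemma monf_mult: "monf m * monf m' = monf (\<lambda>i. m i + m' i)"
 by (simp add: monf_def fun_eq_iff power_add prod.distrib)

lemma monf_single: "monf (\<lambda>i. if i = j then e else 0) x = (x $ j) ^ e"
proof -
 have "monf (\<lambda>i. if i = j then e else 0) x = (\<Prod>i\<in>UNIV. if i = j then (x $ i) ^ e else 1)"
  unfolding monf_def by (rule prod.cong) auto
 also have "... = (x $ j) ^ e" by (subst prod.delta) auto
 finally show ?thesis .
qed

text \<open>\<open>PD P\<close>: the span of the monomial functions whose degree satisfies \<open>P\<close>;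
  \<open>PF\<close>: all polynomial functions. Polynomials over an infinite field may be identified with
  functions.\<close>
definition PD :: "(nat => bool) => (complex ^ 'n::finite => complex) set" where
 "PD P = fs.span {monf m | m. P (sum m UNIV)}"

abbreviation "PDeq k \<equiv> PD (\<lambda>l. l = k)"
abbreviation "PDle k \<equiv> PD (\<lambda>l. l \<le> k)"

lemma monf_PD: "P (sum m UNIV) ==> monf m \<in> PD P"
 unfolding PD_def by (rule fs.span_base) auto

lemma PD_mono: "(\<And>k. P k ==> Q k) ==> PD P \<subseteq> PD Q"
 unfolding PD_def by (rule fs.span_mono) auto

lemma PD_add: "f \<in> PD P ==> g \<in> PD P ==> f + g \<in> PD P" unfolding PD_def by (rule fs.span_add)
lemma PD_scale: "f \<in> PD P ==> fsc c f \<in> PD P" unfolding PD_def by (rule fs.span_scale)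
lemma PD_zero: "0 \<in> PD P" unfolding PD_def by (rule fs.span_zero)
lemma PD_sum: "(\<And>i. i \<in> I ==> f i \<in> PD P) ==> sum f I \<in> PD P" unfolding PD_def by (rule fs.span_sum)

lemma PD_mult:
 assumes "f \<in> PD P" "g \<in> PD Q" "\<And>k l. P k ==> Q l ==> R (k + l)"
 shows "f * g \<in> PD R"
 using assms(1,2) unfolding PD_def
proof (rule span_times)
 fix a b :: "complex ^ 'n => complex"
 assume "a \<in> {monf m |m. P (sum m UNIV)}" "b \<in> {monf m |m. Q (sum m UNIV)}"
 then obtain m m' where mm: "a = monf m" "P (sum m UNIV)" "b = monf m'" "Q (sum m' UNIV)" by auto
 show "a * b \<in> fs.span {monf m |m. R (sum m UNIV)}"
  using mm assms(3) by (intro fs.span_base) (auto simp: monf_mult sum.distrib intro!: exI[of _ "\<lambda>i. m i + m' i"])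
qed

inductive_set PF :: "(complex ^ 'n::finite => complex) set" where
 PF_const: "(\<lambda>_. c) \<in> PF"
| PF_var: "(\<lambda>x. x $ i) \<in> PF"
| PF_add: "f \<in> PF ==> g \<in> PF ==> f + g \<in> PF"
| PF_mult: "f \<in> PF ==> g \<in> PF ==> f * g \<in> PF"

lemma PF_in_PD:
 fixes f :: "complex ^ 'n::finite => complex"
 shows "f \<in> PF ==> \<exists>k. f \<in> PDle k"
proof (induction rule: PF.induct)
 case (PF_const c)
 have "monf (\<lambda>_::'n. 0) \<in> PDle 0" by (rule monf_PD) simp
 from PD_scale[OF this, of c] have "fsc c (monf (\<lambda>_::'n. 0)) \<in> PDle 0" .
 moreover have "fsc c (monf (\<lambda>_::'n. 0)) = (\<lambda>_. c)" by (simp add: fun_eq_iff monf_def)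
 ultimately show ?case by (intro exI[of _ 0]) (simp only:)
next
 case (PF_var i)
 have "monf (\<lambda>k::'n. if k = i then 1 else 0) \<in> PDle 1" by (rule monf_PD) simp
 moreover have "monf (\<lambda>k::'n. if k = i then 1 else 0) = (\<lambda>x. x $ i)" by (simp add: fun_eq_iff monf_single)
 ultimately show ?case by (intro exI[of _ 1]) (simp only:)
next
 case (PF_add f g)
 then obtain k l where k: "f \<in> PDle k" and l: "g \<in> PD (\<lambda>u. u \<le> l)" by auto
 have "f \<in> PD (\<lambda>u. u \<le> k + l)" by (rule subsetD[OF PD_mono k]) simp
 moreover have "g \<in> PD (\<lambda>u. u \<le> k + l)" by (rule subsetD[OF PD_mono l]) simp
 ultimately show ?case using PD_add by blast
next
 case (PF_mult f g)
 then obtain k l where k: "f \<in> PDle k" and l: "g \<in> PD (\<lambda>u. u \<le> l)" by auto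
 have "f * g \<in> PD (\<lambda>u. u \<le> k + l)" by (rule PD_mult[OF k l]) simp
 thus ?case by blast
qed

lemma PF_minus: "f \<in> PF ==> g \<in> PF ==> f - g \<in> PF"
proof -
 assume "f \<in> PF" "g \<in> PF"
 hence "f + (\<lambda>_. -1) * g \<in> PF" by (intro PF_add PF_mult PF_const)
 moreover have "f + (\<lambda>_. -1) * g = f - g" by (simp add: fun_eq_iff)
 ultimately show ?thesis by (simp only:)
qed

lemma PF_power: "f \<in> PF ==> (\<lambda>x. f x ^ k) \<in> PF"
proof (induction k)
 case 0 thus ?case using PF_const[of 1] by simp
next
 case (Suc k)
 hence "f * (\<lambda>x. f x ^ k) \<in> PF" by (intro PF_mult) auto
 thus ?case by (simp add: times_fun_def)
qed

lemma PF_sum: "(\<And>i. i \<in> I ==> f i \<in> PF) ==> (\<lambda>x. \<Sum>i\<in>I. f i x) \<in> PF"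
proof (induction I rule: infinite_finite_induct)
 case (insert i I)
 hence "f i + (\<lambda>x. \<Sum>i\<in>I. f i x) \<in> PF" by (intro PF_add) auto
 thus ?case using insert.hyps by (simp add: plus_fun_def)
qed (use PF_const[of 0] in auto)

lemma PF_prod: "(\<And>i. i \<in> I ==> f i \<in> PF) ==> (\<lambda>x. \<Prod>i\<in>I. f i x) \<in> PF"
proof (induction I rule: infinite_finite_induct)
 case (insert i I)
 hence "f i * (\<lambda>x. \<Prod>i\<in>I. f i x) \<in> PF" by (intro PF_mult) auto
 thus ?case using insert.hyps by (simp add: times_fun_def)
qed (use PF_const[of 1] in auto)

lemma PF_poly: "(\<lambda>x. poly Q (x $ j)) \<in> PF"
proof (induction Q)
 case 0 thus ?case using PF_const[of 0] by simp
next
 case (pCons a Q)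
 have "(\<lambda>_. a) + (\<lambda>x. x $ j) * (\<lambda>x. poly Q (x $ j)) \<in> PF" by (intro PF_add PF_mult PF_const PF_var pCons.IH)
 thus ?case by (simp add: plus_fun_def times_fun_def)
qed

text \<open>Ideals of the ring \<open>PF\<close>.\<close>
definition PF_ideal :: "(complex ^ 'n::finite => complex) set => bool" where
 "PF_ideal I \<longleftrightarrow> 0 \<in> I \<and> I \<subseteq> PF \<and> (\<forall>a\<in>I. \<forall>b\<in>I. a + b \<in> I) \<and> (\<forall>a\<in>PF. \<forall>b\<in>I. a * b \<in> I)"

lemma finite_bounded_exponents: "finite {m :: 'n::finite => nat. sum m UNIV \<le> k}"
proof (rule finite_subset)
 show "{m :: 'n => nat. sum m UNIV \<le> k} \<subseteq> PiE UNIV (\<lambda>_. {..k})"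
 proof
  fix m :: "'n => nat" assume "m \<in> {m. sum m UNIV \<le> k}"
  hence "m i \<le> k" for i using member_le_sum[of i UNIV m] by simp
  thus "m \<in> PiE UNIV (\<lambda>_. {..k})" by auto
 qed
qed (simp add: finite_PiE)

text \<open>Were no \<open>x $ j - c\<close> in \<open>M\<close>, each would have an inverse \<open>u c\<close>
  modulo \<open>M\<close>. Uncountably many \<open>c\<close> and countably many degree bounds leave
  infinitely many \<open>u c\<close> in one finite-dimensional space. A linear relation between them,
  multiplied by the product of the \<open>x $ j - c\<close>, yields a nonzero polynomial in \<open>x $
  j\<close> in \<open>M\<close>, impossible as it splits into linear factors.\<close>
lemma maximal_PF_ideal_root:
 fixes M :: "(complex ^ 'n::finite => complex) set"
 assumes id: "PF_ideal M" and one: "1 \<notin> M"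
  and mx: "\<And>f. f \<in> PF ==> f \<notin> M ==> \<exists>u\<in>PF. u * f - 1 \<in> M"
 shows "\<exists>c. (\<lambda>x. x $ j - c) \<in> M"
proof (rule ccontr)
 assume no: "\<not> ?thesis"
 have Madd: "a \<in> M ==> b \<in> M ==> a + b \<in> M" and Mmult: "a \<in> PF ==> b \<in> M ==> a * b \<in> M"
  and M0: "0 \<in> M" and MPF: "M \<subseteq> PF" for a b
  using id by (auto simp: PF_ideal_def)
 have Mmin: "a - b \<in> M" if "a \<in> M" "b \<in> M" for a b
 proof -
  have "a + (\<lambda>_. -1) * b \<in> M" using that by (intro Madd Mmult PF_const)
  moreover have "a + (\<lambda>_. -1) * b = a - b" by (simp add: fun_eq_iff)
  ultimately show ?thesis by (simp only:)
 qed
 have Msum: "(\<And>i. i \<in> I ==> f i \<in> M) ==> sum f I \<in> M" for f :: "complex => _" and I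
  by (induction I rule: infinite_finite_induct) (auto simp: M0 Madd)
 have const: "c = 0" if "(\<lambda>_. c) \<in> M" for c
 proof (rule ccontr)
  assume "c \<noteq> 0"
  hence "(\<lambda>_. inverse c) * (\<lambda>_. c) = (1 :: complex ^ 'n => complex)" by (simp add: fun_eq_iff)
  moreover have "(\<lambda>_. inverse c) * (\<lambda>_. c) \<in> M" by (intro Mmult PF_const that)
  ultimately show False using one by simp
 qed
 have prime: "b \<in> M" if ab: "a * b \<in> M" "a \<in> PF" "b \<in> PF" "a \<notin> M" for a b
 proof -
  obtain u where u: "u \<in> PF" "u * a - 1 \<in> M" using mx[OF ab(2,4)] by blast
  have "u * (a * b) - b * (u * a - 1) \<in> M" by (intro Mmin Mmult u ab)
  moreover have "u * (a * b) - b * (u * a - 1) = b" by (simp add: fun_eq_iff algebra_simps)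
  ultimately show ?thesis by (simp only:)
 qed
 have npoly: "Q = 0" if "(\<lambda>x. poly Q (x $ j)) \<in> M" for Q
  using that
 proof (induction "degree Q" arbitrary: Q rule: less_induct)
  case less
  show ?case
  proof (cases "degree Q = 0")
   case True
   then obtain a where a: "Q = [:a:]" by (metis degree_eq_zeroE)
   thus ?thesis using const[of a] less.prems by simp
  next
   case False
   hence "\<not> constant (poly Q)" by (simp add: constant_degree)
   then obtain z where "poly Q z = 0" using fundamental_theorem_of_algebra by blast
   then obtain R where R: "Q = [:-z, 1:] * R" by (metis dvdE poly_eq_0_iff_dvd)
   have R0: "R \<noteq> 0" using R False by auto
   have "degree Q = Suc (degree R)" unfolding R using R0 by (subst degree_mult_eq) auto
   hence dR: "degree R < degree Q" by simp
   have "(\<lambda>x. poly Q (x $ j)) = (\<lambda>x. x $ j - z) * (\<lambda>x. poly R (x $ j))"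
    by (simp add: R fun_eq_iff algebra_simps)
   moreover have "(\<lambda>x. x $ j - z) \<in> PF" using PF_minus[OF PF_var PF_const] by (simp add: fun_diff_def)
   moreover have "(\<lambda>x. x $ j - z) \<notin> M" using no by blast
   ultimately have "(\<lambda>x. poly R (x $ j)) \<in> M" using less.prems by (intro prime[OF _ _ PF_poly]) simp_all
   thus ?thesis using less.hyps[OF dR] R0 by simp
  qed
 qed
 have "\<exists>u\<in>PF. u * (\<lambda>x. x $ j - c) - 1 \<in> M" for c
 proof (rule mx)
  show "(\<lambda>x. x $ j - c) \<in> PF" using PF_minus[OF PF_var PF_const] by (simp add: fun_diff_def)
 qed (use no in blast)
 hence ex: "\<exists>v. v \<in> PF \<and> v * (\<lambda>x. x $ j - c) - 1 \<in> M" for c by blast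
 define u where "u c = (SOME v. v \<in> PF \<and> v * (\<lambda>x. x $ j - c) - 1 \<in> M)" for c
 have u12: "u c \<in> PF \<and> u c * (\<lambda>x. x $ j - c) - 1 \<in> M" for c
  unfolding u_def by (rule someI_ex[OF ex])
 note u = conjunct1[OF u12] conjunct2[OF u12]
 have "\<exists>k. infinite {c. u c \<in> PDle k}"
 proof (rule ccontr)
  assume "\<not> ?thesis"
  hence "countable (\<Union>k. {c. u c \<in> PDle k})" by (intro countable_UN) (auto intro: countable_finite)
  moreover have "(\<Union>k. {c. u c \<in> PDle k}) = UNIV" using PF_in_PD[OF u(1)] by auto
  ultimately show False using uncountable_UNIV_complex by simp
 qed
 then obtain k where k: "infinite {c. u c \<in> PDle k}" by blast
 define Bk where "Bk = {monf m | m :: 'n => nat. sum m UNIV \<le> k}"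
 have finB: "finite Bk"
 proof -
  have "Bk = monf ` {m. sum m UNIV \<le> k}" by (auto simp: Bk_def)
  thus ?thesis by (simp add: finite_bounded_exponents)
 qed
 from infinite_arbitrarily_large[OF k, of "Suc (card Bk)"]
 obtain C where C': "finite C" "card C = Suc (card Bk)" "C \<subseteq> {c. u c \<in> PDle k}"
  by (elim exE conjE) (rule that)
 note C = C'(3,1,2)
 have injU: "inj_on u C"
 proof (rule inj_onI, rule ccontr)
  fix c c' assume cc: "u c = u c'" "c \<noteq> c'"
  have "(u c * (\<lambda>x. x $ j - c) - 1) - (u c' * (\<lambda>x. x $ j - c') - 1) \<in> M" by (intro Mmin u)
  hence "(\<lambda>x. inverse (c' - c) * (x $ j - c)) * ((u c * (\<lambda>x. x $ j - c) - 1) - (u c' * (\<lambda>x. x $ j - c') - 1)) \<in> M"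
  proof (rule Mmult[rotated])
   show "(\<lambda>x. inverse (c' - c) * (x $ j - c)) \<in> PF"
    using PF_mult[OF PF_const PF_minus[OF PF_var PF_const]] by (simp add: fun_diff_def times_fun_def)
  qed
  moreover have "(\<lambda>x. inverse (c' - c) * (x $ j - c)) * ((u c * (\<lambda>x. x $ j - c) - 1) - (u c' * (\<lambda>x. x $ j - c') - 1))
    = u c * (\<lambda>x. x $ j - c)"
  proof
   fix x :: "complex ^ 'n"
   have "(u c x * (x $ j - c) - 1) - (u c' x * (x $ j - c') - 1) = u c x * (c' - c)"
    using cc(1) by (simp add: algebra_simps)
   thus "((\<lambda>x. inverse (c' - c) * (x $ j - c)) * ((u c * (\<lambda>x. x $ j - c) - 1) - (u c' * (\<lambda>x. x $ j - c') - 1))) x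
    = (u c * (\<lambda>x. x $ j - c)) x" using cc(2) by simp
  qed
  ultimately have m: "u c * (\<lambda>x. x $ j - c) \<in> M" by (simp only:)
  have "u c * (\<lambda>x. x $ j - c) - (u c * (\<lambda>x. x $ j - c) - 1) \<in> M" by (rule Mmin[OF m u(2)])
  thus False using one by (simp add: algebra_simps)
 qed
 have "fs.dependent (u ` C)"
 proof (rule ccontr)
  assume "fs.independent (u ` C)"
  moreover have "u ` C \<subseteq> fs.span Bk" using C(1) by (auto simp: PD_def Bk_def)
  ultimately have "card (u ` C) \<le> card Bk" by (rule conjunct2[OF fs.independent_span_bound[OF finB]])
  thus False using C(3) card_image[OF injU] by simp
 qed
 from this[unfolded fs.dependent_finite[OF finite_imageI[OF C(2)]]]
 obtain co v where co: "v \<in> u ` C" "co v \<noteq> 0" "(\<Sum>v\<in>u ` C. fsc (co v) v) = 0"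
  by (elim exE conjE bexE) (rule that)
 define la where "la c = co (u c)" for c
 obtain c0 where c0: "c0 \<in> C" "la c0 \<noteq> 0" using co by (auto simp: la_def)
 have lin: "(\<Sum>c\<in>C. fsc (la c) (u c)) = 0" using co(3) by (simp add: sum.reindex[OF injU] la_def)
 define Q where "Q = (\<Sum>c\<in>C. smult (la c) (\<Prod>l\<in>C - {c}. [:- l, 1:]))"
 let ?Pi = "\<lambda>S x. \<Prod>l\<in>S. (x $ j - l)"
 have PiPF: "?Pi S \<in> PF" for S
 proof (rule PF_prod)
  fix l show "(\<lambda>x. x $ j - l) \<in> PF" using PF_minus[OF PF_var PF_const] by (simp add: fun_diff_def)
 qed
 have "(\<lambda>x. la c) * (?Pi (C - {c}) * (u c * (\<lambda>x. x $ j - c) - 1)) \<in> M" for c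
  by (intro Mmult PF_const PiPF u)
 hence "(\<Sum>c\<in>C. (\<lambda>x. la c) * (?Pi (C - {c}) * (u c * (\<lambda>x. x $ j - c) - 1))) \<in> M" by (intro Msum)
 moreover have "(\<Sum>c\<in>C. (\<lambda>x. la c) * (?Pi (C - {c}) * (u c * (\<lambda>x. x $ j - c) - 1))) = (\<lambda>x. - 1) * (\<lambda>x. poly Q (x $ j))"
 proof
  fix x :: "complex ^ 'n"
  have e: "la c * (?Pi (C - {c}) x * (u c x * (x $ j - c) - 1)) = ?Pi C x * (la c * u c x) - la c * ?Pi (C - {c}) x" if "c \<in> C" for c
   unfolding prod.remove[OF C(2) that, of "\<lambda>l. x $ j - l"] by (simp add: algebra_simps)
  have sf: "(\<Sum>c\<in>C. g c) x = (\<Sum>c\<in>C. g c x)" for g :: "complex => complex ^ 'n => complex"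
   using C(2) by (induction C rule: finite_induct) auto
  have l0: "(\<Sum>c\<in>C. la c * u c x) = 0" using fun_cong[OF lin, of x] by (simp add: sf)
  have "(\<Sum>c\<in>C. (\<lambda>x. la c) * (?Pi (C - {c}) * (u c * (\<lambda>x. x $ j - c) - 1))) x
    = (\<Sum>c\<in>C. la c * (?Pi (C - {c}) x * (u c x * (x $ j - c) - 1)))" by (simp add: sf)
  also have "... = (\<Sum>c\<in>C. ?Pi C x * (la c * u c x) - la c * ?Pi (C - {c}) x)"
   by (rule sum.cong[OF refl e])
  also have "... = ?Pi C x * (\<Sum>c\<in>C. la c * u c x) - (\<Sum>c\<in>C. la c * ?Pi (C - {c}) x)"
   by (simp add: sum_subtractf sum_distrib_left)
  also have "(\<Sum>c\<in>C. la c * ?Pi (C - {c}) x) = poly Q (x $ j)"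
   by (simp add: Q_def poly_sum poly_prod algebra_simps)
  also have "?Pi C x * (\<Sum>c\<in>C. la c * u c x) - poly Q (x $ j) = ((\<lambda>x. - 1) * (\<lambda>x. poly Q (x $ j))) x"
   using l0 by simp
  finally show "(\<Sum>c\<in>C. (\<lambda>x. la c) * (?Pi (C - {c}) * (u c * (\<lambda>x. x $ j - c) - 1))) x = ((\<lambda>x. - 1) * (\<lambda>x. poly Q (x $ j))) x" .
 qed
 ultimately have "(\<lambda>x. - 1) * (\<lambda>x. poly Q (x $ j)) \<in> M" by (simp only:)
 hence "(\<lambda>x. - 1) * ((\<lambda>x. - 1) * (\<lambda>x. poly Q (x $ j))) \<in> M" by (rule Mmult[OF PF_const])
 moreover have "(\<lambda>x. - 1) * ((\<lambda>x. - 1) * (\<lambda>x. poly Q (x $ j))) = (\<lambda>x. poly Q (x $ j))" by (simp add: fun_eq_iff)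
 ultimately have "(\<lambda>x. poly Q (x $ j)) \<in> M" by (simp only:)
 hence Q0: "Q = 0" by (rule npoly)
 have "poly Q c0 = (\<Sum>c\<in>C. la c * (\<Prod>l\<in>C - {c}. c0 - l))"
  by (simp add: Q_def poly_sum poly_prod)
 also have "... = (\<Sum>c\<in>{c0}. la c * (\<Prod>l\<in>C - {c}. c0 - l))"
  using C(2) c0(1) by (intro sum.mono_neutral_right) auto
 also have "... \<noteq> 0" using c0 C(2) by simp
 finally show False using Q0 by simp
qed

lemma weak_nullstellensatz:
 fixes J :: "(complex ^ 'n::finite => complex) set"
 assumes J: "PF_ideal J" "1 \<notin> J" shows "\<exists>z. \<forall>f\<in>J. f z = 0"
proof -
 let ?A = "{I. J \<subseteq> I \<and> PF_ideal I \<and> 1 \<notin> I}"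
 have "\<exists>M\<in>?A. \<forall>X\<in>?A. M \<subseteq> X --> X = M"
 proof (rule subset_Zorn_nonempty)
  show "?A \<noteq> {}" using J by auto
  fix C assume C: "C \<noteq> {}" "subset.chain ?A C"
  hence Cs: "\<And>I. I \<in> C ==> J \<subseteq> I \<and> PF_ideal I \<and> 1 \<notin> I" by (auto simp: subset_chain_def)
  have ch: "\<And>X Y. X \<in> C ==> Y \<in> C ==> X \<subseteq> Y \<or> Y \<subseteq> X" using C by (auto simp: subset_chain_def)
  obtain I0 where I0: "I0 \<in> C" using C by blast
  have "PF_ideal (\<Union>C)" unfolding PF_ideal_def
  proof (intro conjI ballI)
   show "0 \<in> \<Union>C" using I0 Cs[OF I0] by (auto simp: PF_ideal_def)
   show "\<Union>C \<subseteq> PF" using Cs by (force simp: PF_ideal_def)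
  next
   fix a b assume "a \<in> \<Union>C" "b \<in> \<Union>C"
   then obtain X Y where XY: "X \<in> C" "a \<in> X" "Y \<in> C" "b \<in> Y" by auto
   then obtain Z where "Z \<in> C" "a \<in> Z" "b \<in> Z" using ch[of X Y] by blast
   hence "a + b \<in> Z" using Cs[of Z] by (auto simp: PF_ideal_def)
   thus "a + b \<in> \<Union>C" using \<open>Z \<in> C\<close> by blast
  next
   fix a b :: "complex ^ 'n => complex" assume "a \<in> PF" "b \<in> \<Union>C"
   then obtain X where "X \<in> C" "b \<in> X" by blast
   hence "a * b \<in> X" using Cs[of X] \<open>a \<in> PF\<close> by (auto simp: PF_ideal_def)
   thus "a * b \<in> \<Union>C" using \<open>X \<in> C\<close> by blast
  qed
  thus "\<Union>C \<in> ?A" using Cs I0 by auto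
 qed
 then obtain M where M: "J \<subseteq> M" "PF_ideal M" "1 \<notin> M"
  and mx: "\<And>X. J \<subseteq> X ==> PF_ideal X ==> 1 \<notin> X ==> M \<subseteq> X ==> X = M" by auto
 have Madd: "a \<in> M ==> b \<in> M ==> a + b \<in> M" and Mmult: "a \<in> PF ==> b \<in> M ==> a * b \<in> M"
  and M0: "0 \<in> M" and MPF: "M \<subseteq> PF" for a b
  using M(2) by (auto simp: PF_ideal_def)
 have inv: "\<exists>u\<in>PF. u * f - 1 \<in> M" if f: "f \<in> PF" "f \<notin> M" for f
 proof -
  let ?X = "{m + u * f | m u. m \<in> M \<and> u \<in> PF}"
  have sub: "M \<subseteq> ?X"
  proof
   fix m assume "m \<in> M"
   thus "m \<in> ?X" using PF_const[of 0] by (intro CollectI exI[of _ m] exI[of _ "\<lambda>_. 0"]) (auto simp: fun_eq_iff)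
  qed
  have fX: "f \<in> ?X" using M0 PF_const[of 1] by (intro CollectI exI[of _ 0] exI[of _ "\<lambda>_. 1"]) (auto simp: fun_eq_iff)
  have "PF_ideal ?X" unfolding PF_ideal_def
  proof (intro conjI ballI)
   show "0 \<in> ?X" using sub M0 by blast
   show "?X \<subseteq> PF" using MPF f(1) by (auto intro!: PF_add PF_mult)
   fix a b assume "a \<in> ?X" "b \<in> ?X"
   then obtain m u m' u' where "a = m + u * f" "m \<in> M" "u \<in> PF" "b = m' + u' * f" "m' \<in> M" "u' \<in> PF" by auto
   thus "a + b \<in> ?X" by (intro CollectI exI[of _ "m + m'"] exI[of _ "u + u'"]) (auto simp: algebra_simps Madd PF_add)
  next
   fix a b :: "complex ^ 'n => complex" assume a: "a \<in> PF" and "b \<in> ?X"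
   then obtain m u where "b = m + u * f" "m \<in> M" "u \<in> PF" by auto
   thus "a * b \<in> ?X" using a by (intro CollectI exI[of _ "a * m"] exI[of _ "a * u"]) (auto simp: algebra_simps Mmult PF_mult)
  qed
  moreover have "?X \<noteq> M" using fX f(2) by blast
  ultimately have "1 \<in> ?X" using mx[of ?X] sub M(1) by blast
  then obtain m u where m: "1 = m + u * f" "m \<in> M" "u \<in> PF" by auto
  have "u * f - 1 = (\<lambda>_. -1) * m"
  proof
   fix x
   show "(u * f - 1) x = ((\<lambda>_. -1) * m) x" using fun_cong[OF m(1), of x] by (simp add: algebra_simps)
  qed
  thus ?thesis using Mmult[OF PF_const m(2), of "-1"] m(3) by (intro bexI[of _ u]) simp_all
 qed
 have "\<exists>c. (\<lambda>x. x $ j - c) \<in> M" for j by (rule maximal_PF_ideal_root[OF M(2,3) inv])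
 then obtain c where "\<forall>j. (\<lambda>x. x $ j - c j) \<in> M" using choice[of "\<lambda>j c. (\<lambda>x. x $ j - c) \<in> M"] by blast
 hence c: "\<And>j. (\<lambda>x. x $ j - c j) \<in> M" by blast
 define z where "z = (\<chi> j. c j)"
 have ev: "f - (\<lambda>_. f z) \<in> M" if "f \<in> PF" for f
  using that
 proof (induction rule: PF.induct)
  case (PF_const c) show ?case using M0 by (simp add: fun_diff_def zero_fun_def)
 next
  case (PF_var i) show ?case using c[of i] by (simp add: fun_diff_def z_def)
 next
  case (PF_add f g)
  have "(f + g) - (\<lambda>_. (f + g) z) = (f - (\<lambda>_. f z)) + (g - (\<lambda>_. g z))" by (simp add: fun_eq_iff)
  thus ?case using Madd[OF PF_add.IH] by (simp only:)
 next
  case (PF_mult f g)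
  have "(f * g) - (\<lambda>_. (f * g) z) = f * (g - (\<lambda>_. g z)) + (\<lambda>_. g z) * (f - (\<lambda>_. f z))" by (simp add: fun_eq_iff algebra_simps)
  moreover have "f * (g - (\<lambda>_. g z)) + (\<lambda>_. g z) * (f - (\<lambda>_. f z)) \<in> M"
   by (intro Madd Mmult PF_mult PF_const)
  ultimately show ?case by (simp only:)
 qed
 have "f z = 0" if "f \<in> J" for f
 proof (rule ccontr)
  assume nz: "f z \<noteq> 0"
  have fM: "f \<in> M" using that M(1) by blast
  hence "f - (\<lambda>_. f z) \<in> M" using ev MPF by blast
  hence "(\<lambda>_. inverse (f z)) * (f + (\<lambda>_. -1) * (f - (\<lambda>_. f z))) \<in> M" by (intro Madd Mmult fM PF_const)
  moreover have "(\<lambda>_. inverse (f z)) * (f + (\<lambda>_. -1) * (f - (\<lambda>_. f z))) = 1" using nz by (simp add: fun_eq_iff)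
  ultimately show False using M(3) by (simp only:)
 qed
 thus ?thesis by blast
qed

lemma homogenize:
 fixes f :: "complex ^ 'n::finite => complex"
 assumes "f \<in> PDle k"
 shows "\<exists>h\<in>PDeq k. \<forall>x. x $ j \<noteq> 0 --> h x = (x $ j) ^ k * f (\<chi> i. x $ i / x $ j)"
 using assms unfolding PD_def[of "\<lambda>l. l \<le> k"]
proof (induction rule: fs.span_induct_alt)
 case base
 show ?case by (rule bexI[of _ 0]) (auto simp: PD_zero)
next
 case (step c y f)
 then obtain m where m: "y = monf m" "sum m UNIV \<le> k" by auto
 obtain h where h: "h \<in> PDeq k" "\<And>x. x $ j \<noteq> 0 ==> h x = (x $ j) ^ k * f (\<chi> i. x $ i / x $ j)"
  using step.IH by blast
 let ?m' = "\<lambda>i. m i + (if i = j then k - sum m UNIV else 0)"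
 have s: "sum ?m' UNIV = k" using m(2) by (simp add: sum.distrib)
 have e: "monf ?m' x = (x $ j) ^ k * y (\<chi> i. x $ i / x $ j)" if x: "x $ j \<noteq> 0" for x
 proof -
  have 1: "monf ?m' x = monf m x * (x $ j) ^ (k - sum m UNIV)"
   using fun_cong[OF monf_mult[of m "\<lambda>i. if i = j then k - sum m UNIV else 0"], of x] monf_single[of j "k - sum m UNIV" x] by simp
  have "y (\<chi> i. x $ i / x $ j) = monf m x / (x $ j) ^ sum m UNIV"
   by (simp add: m monf_def power_divide prod_dividef power_sum)
  hence "(x $ j) ^ k * y (\<chi> i. x $ i / x $ j) = monf m x * ((x $ j) ^ k / (x $ j) ^ sum m UNIV)" by simp
  also have "(x $ j) ^ k / (x $ j) ^ sum m UNIV = (x $ j) ^ (k - sum m UNIV)"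
   using m(2) x by (simp add: power_diff)
  finally show ?thesis using 1 by simp
 qed
 have "fsc c (monf ?m') + h \<in> PDeq k"
  using monf_PD[of "\<lambda>l. l = k" ?m'] s h(1) by (intro PD_add PD_scale) auto
 moreover have "(fsc c (monf ?m') + h) x = (x $ j) ^ k * (fsc c y + f) (\<chi> i. x $ i / x $ j)" if "x $ j \<noteq> 0" for x
  using e[OF that] h(2)[OF that] by (simp add: algebra_simps)
 ultimately show ?case by (intro bexI[of _ "fsc c (monf ?m') + h"]) auto
qed

text \<open>The polynomials \<open>g i\<close> and \<open>x $ j - 1\<close> have no common zero; homogenizing a
  representation of 1 gives the identity.\<close>
lemma homogeneous_nullstellensatz:
 fixes g :: "'i::finite => complex ^ 'n::finite => complex"
 assumes g: "\<And>i. g i \<in> PF"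
  and hom: "\<And>i c x. g i (\<chi> l. c * x $ l) = c ^ D * g i x"
  and zero: "\<And>z. (\<And>i. g i z = 0) ==> z = 0"
 shows "\<exists>N A. (\<forall>i. A i \<in> PDeq N) \<and> (\<forall>x. (x $ j) ^ (N + D) = (\<Sum>i\<in>UNIV. A i x * g i x))"
proof -
 define J where "J = {f. \<exists>a b. (\<forall>i. a i \<in> PF) \<and> b \<in> PF \<and> f = (\<lambda>x. (\<Sum>i\<in>UNIV. a i x * g i x) + b x * (x $ j - 1))}"
 have xPF: "(\<lambda>x. x $ j - 1) \<in> PF" using PF_minus[OF PF_var PF_const] by (simp add: fun_diff_def)
 have id: "PF_ideal J" unfolding PF_ideal_def
 proof (intro conjI ballI)
  show "0 \<in> J" unfolding J_def using PF_const[of 0]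
   by (intro CollectI exI[of _ "\<lambda>_ _. 0"] exI[of _ "\<lambda>_. 0"]) (auto simp: fun_eq_iff)
  show "J \<subseteq> PF"
  proof
   fix f assume "f \<in> J"
   then obtain a b where ab: "\<And>i. a i \<in> PF" "b \<in> PF" "f = (\<lambda>x. (\<Sum>i\<in>UNIV. a i x * g i x) + b x * (x $ j - 1))"
    unfolding J_def by blast
   have 1: "(\<lambda>x. a i x * g i x) \<in> PF" for i using PF_mult[OF ab(1) g] by (simp add: times_fun_def)
   have 2: "(\<lambda>x. b x * (x $ j - 1)) \<in> PF" using PF_mult[OF ab(2) xPF] by (simp add: times_fun_def)
   show "f \<in> PF" using PF_add[OF PF_sum[of UNIV, OF 1] 2] by (simp add: ab(3) plus_fun_def)
  qed
 next
  fix f f' assume "f \<in> J" "f' \<in> J"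
  then obtain a b a' b' where ab: "\<And>i. a i \<in> PF" "b \<in> PF" "f = (\<lambda>x. (\<Sum>i\<in>UNIV. a i x * g i x) + b x * (x $ j - 1))"
   "\<And>i. a' i \<in> PF" "b' \<in> PF" "f' = (\<lambda>x. (\<Sum>i\<in>UNIV. a' i x * g i x) + b' x * (x $ j - 1))"
   unfolding J_def by blast
  show "f + f' \<in> J" unfolding J_def
   by (intro CollectI exI[of _ "\<lambda>i. a i + a' i"] exI[of _ "b + b'"])
     (auto simp: ab PF_add fun_eq_iff algebra_simps sum.distrib)
 next
  fix u f :: "complex ^ 'n => complex" assume u: "u \<in> PF" and "f \<in> J"
  then obtain a b where ab: "\<And>i. a i \<in> PF" "b \<in> PF" "f = (\<lambda>x. (\<Sum>i\<in>UNIV. a i x * g i x) + b x * (x $ j - 1))"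
   unfolding J_def by blast
  show "u * f \<in> J" unfolding J_def
   by (intro CollectI exI[of _ "\<lambda>i. u * a i"] exI[of _ "u * b"])
     (auto simp: ab u PF_mult fun_eq_iff algebra_simps sum_distrib_left)
 qed
 have "1 \<in> J"
 proof (rule ccontr)
  assume "1 \<notin> J"
  from weak_nullstellensatz[OF id this] obtain z where z: "\<And>f. f \<in> J ==> f z = 0" by blast
  have "g k z = 0" for k
  proof -
   have "g k \<in> J" unfolding J_def
   proof (intro CollectI exI[of _ "\<lambda>i _. if i = k then 1 else 0"] exI[of _ "\<lambda>_. 0"] conjI allI PF_const)
    show "g k = (\<lambda>x. (\<Sum>i\<in>UNIV. (if i = k then 1 else 0) * g i x) + 0 * (x $ j - 1))"
     by (simp add: mult_delta_left)
   qed
   thus ?thesis by (rule z)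
  qed
  hence "z = 0" by (rule zero)
  moreover have "(\<lambda>x. x $ j - 1) \<in> J" unfolding J_def using PF_const[of 0] PF_const[of 1]
   by (intro CollectI exI[of _ "\<lambda>_ _. 0"] exI[of _ "\<lambda>_. 1"]) auto
  ultimately show False using z[of "\<lambda>x. x $ j - 1"] by simp
 qed
 then obtain a b where ab: "\<And>i. a i \<in> PF" "b \<in> PF" "1 = (\<lambda>x. (\<Sum>i\<in>UNIV. a i x * g i x) + b x * (x $ j - 1))"
  unfolding J_def by blast
 have "\<forall>i. \<exists>k. a i \<in> PDle k" using PF_in_PD ab(1) by blast
 then obtain kk where kk: "\<And>i. a i \<in> PDle (kk i)" by metis
 define k where "k = sum kk UNIV"
 have "a i \<in> PDle k" for i
  by (rule subsetD[OF PD_mono kk]) (use member_le_sum[of i UNIV kk] in \<open>simp add: k_def\<close>)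
 hence "\<forall>i. \<exists>h. h \<in> PDeq k \<and> (\<forall>x. x $ j \<noteq> 0 --> h x = (x $ j) ^ k * a i (\<chi> i. x $ i / x $ j))"
  using homogenize by blast
 then obtain h where h: "\<And>i. h i \<in> PDeq k"
  "\<And>i x. x $ j \<noteq> 0 ==> h i x = (x $ j) ^ k * a i (\<chi> i. x $ i / x $ j)" by metis
 let ?A = "\<lambda>i x. x $ j * h i x"
 have A: "?A i \<in> PDeq (Suc k)" for i
 proof -
  have "monf (\<lambda>i. if i = j then 1 else 0) * h i \<in> PDeq (Suc k)"
   by (rule PD_mult[OF monf_PD[of "\<lambda>l. l = 1"] h(1)]) auto
  thus ?thesis by (simp add: times_fun_def monf_single)
 qed
 have "(x $ j) ^ (Suc k + D) = (\<Sum>i\<in>UNIV. ?A i x * g i x)" for x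
 proof (cases "x $ j = 0")
  case False
  let ?y = "\<chi> i. x $ i / x $ j"
  have "x = (\<chi> l. x $ j * ?y $ l)" using False by (simp add: vec_eq_iff)
  hence gx: "g i x = (x $ j) ^ D * g i ?y" for i using hom[of i "x $ j" ?y] by simp
  have "1 = (\<Sum>i\<in>UNIV. a i ?y * g i ?y)" using fun_cong[OF ab(3), of ?y] False by simp
  hence "(x $ j) ^ (Suc k + D) = (x $ j) ^ (Suc k + D) * (\<Sum>i\<in>UNIV. a i ?y * g i ?y)" by simp
  also have "... = (\<Sum>i\<in>UNIV. ?A i x * g i x)"
   unfolding gx h(2)[OF False] sum_distrib_left by (intro sum.cong refl) (simp add: power_add mult_ac)
  finally show ?thesis .
 qed simp
 thus ?thesis using A by (intro exI[of _ "Suc k"] exI[of _ ?A] conjI allI)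
qed

text \<open>The embedding of integer vectors into complex vectors.\<close>
definition cvec :: "int ^ 'n::finite => complex ^ 'n" where "cvec z = (\<chi> i. of_int (z $ i))"

lemma cvec_nth [simp]: "cvec z $ i = of_int (z $ i)" by (simp add: cvec_def)

text \<open>A uniform Bezout-type bound. On \<open>Z\<close> the identity \<open>id\<close> rewrites \<open>(x $
  j)^(N+D)\<close> as a polynomial of smaller degree, so functions on \<open>Z\<close> are spanned by
  monomials of degree at most \<open>n (N + D)\<close>, while the point indicators are linearly
  independent. The bound does not depend on the lower-order terms \<open>low\<close>.\<close>
lemma card_zeros_le:
 fixes g :: "'n::finite => complex ^ 'n => complex"
 assumes A: "\<And>i j. A i j \<in> PDeq N"
  and id: "\<And>j x. (x $ j) ^ (N + D) = (\<Sum>i\<in>UNIV. A i j x * g i x)"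
  and low: "\<And>i. low i \<in> PD (\<lambda>l. l < D)"
  and Z: "finite Z" "\<And>z i. z \<in> Z ==> c * g i (cvec z) = low i (cvec z)"
  and c: "c \<noteq> 0" and ND: "N + D \<ge> 1"
 shows "card Z \<le> card {m :: 'n => nat. sum m UNIV \<le> CARD('n) * (N + D)}"
proof -
 define K where "K = CARD('n) * (N + D)"
 define res where "res f = (\<lambda>z. if z \<in> Z then f (cvec z) else 0)" for f :: "complex ^ 'n => complex"
 define Bs where "Bs = {res (monf m) | m :: 'n => nat. sum m UNIV \<le> K}"
 define T where "T = fs.span Bs"
 have res_lin: "res (fsc a f + h) = fsc a (res f) + res h" for a f h
  by (simp add: res_def fun_eq_iff)
 have res0: "res 0 = 0" by (simp add: res_def fun_eq_iff)
 have res_PD: "res f \<in> T" if f: "f \<in> PD P" and m: "\<And>m. P (sum m UNIV) ==> res (monf m) \<in> T" for f P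
  using f unfolding PD_def
 proof (induction rule: fs.span_induct_alt)
  case base show ?case unfolding res0 T_def by (rule fs.span_zero)
 next
  case (step a y h)
  then obtain m' where "y = monf m'" "P (sum m' UNIV)" by auto
  hence "res y \<in> T" using m by simp
  thus ?case unfolding res_lin using step.IH unfolding T_def by (intro fs.span_add fs.span_scale)
 qed
 have mon: "res (monf m) \<in> T" for m :: "'n => nat"
 proof (induction "sum m UNIV" arbitrary: m rule: less_induct)
  case less
  show ?case
  proof (cases "sum m UNIV \<le> K")
   case True
   thus ?thesis unfolding T_def Bs_def by (intro fs.span_base) auto
  next
   case False
   have "\<exists>j. m j \<ge> N + D"
   proof (rule ccontr)
    assume "\<not> ?thesis"
    hence "sum m UNIV \<le> (\<Sum>j\<in>(UNIV::'n set). N + D)" by (intro sum_mono) (simp add: not_le less_imp_le)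
    thus False using False by (simp add: K_def)
   qed
   then obtain j where j: "m j \<ge> N + D" by blast
   define m' where "m' = (\<lambda>i. m i - (if i = j then N + D else 0))"
   have m_eq: "m = (\<lambda>i. m' i + (if i = j then N + D else 0))" using j by (auto simp: m'_def fun_eq_iff)
   have sm: "sum m UNIV = sum m' UNIV + (N + D)" by (subst m_eq) (simp add: sum.distrib)
   let ?f = "\<Sum>i\<in>UNIV. fsc (inverse c) (A i j * low i * monf m')"
   have "?f \<in> PD (\<lambda>l. l < sum m UNIV)"
   proof (intro PD_sum PD_scale)
    fix i
    have "A i j * low i \<in> PD (\<lambda>l. l < N + D)" by (rule PD_mult[OF A low]) simp
    thus "A i j * low i * monf m' \<in> PD (\<lambda>l. l < sum m UNIV)"
     by (rule PD_mult[OF _ monf_PD[of "\<lambda>l. l = sum m' UNIV"]]) (simp_all add: sm)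
   qed
   hence "res ?f \<in> T" by (rule res_PD) (rule less.hyps)
   moreover have "res ?f = res (monf m)"
   proof
    fix z
    have sf: "(\<Sum>i\<in>I. F i) x = (\<Sum>i\<in>I. F i x)" if "finite I" for F :: "'n => complex ^ 'n => complex" and x I
     using that by (induction I rule: finite_induct) auto
    show "res ?f z = res (monf m) z"
    proof (cases "z \<in> Z")
     case True
     have eq1: "monf m (cvec z) = monf m' (cvec z) * (cvec z $ j) ^ (N + D)"
      using fun_cong[OF monf_mult[of m' "\<lambda>i. if i = j then N + D else 0"], of "cvec z"] monf_single[of j "N + D" "cvec z"]
      by (simp only: m_eq[symmetric] times_fun_apply)
     have gi: "g i (cvec z) = inverse c * low i (cvec z)" for i
      using Z(2)[OF True, of i] c by (simp add: field_simps)
     have "monf m' (cvec z) * (cvec z $ j) ^ (N + D) = monf m' (cvec z) * (\<Sum>i\<in>UNIV. A i j (cvec z) * (inverse c * low i (cvec z)))"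
      unfolding id gi ..
     also have "... = ?f (cvec z)" by (simp add: sf sum_distrib_left mult_ac)
     finally show ?thesis using True eq1 by (simp add: res_def)
    qed (simp add: res_def)
   qed
   ultimately show ?thesis by (simp only:)
  qed
 qed
 have PFT: "res f \<in> T" if "f \<in> PF" for f using PF_in_PD[OF that] res_PD mon by blast
 define dl where "dl z = (\<lambda>y. if y = z then 1 else 0 :: complex)" for z :: "int ^ 'n"
 have dlT: "dl z \<in> T" if z: "z \<in> Z" for z
 proof -
  have "\<forall>y. \<exists>j. y \<noteq> z --> z $ j \<noteq> y $ j" by (metis vec_eq_iff)
  then obtain jj where jj: "\<And>y. y \<noteq> z ==> z $ jj y \<noteq> y $ jj y" by metis
  \<comment> \<open>an interpolation polynomial that is 1 at \<open>z\<close> and 0 at the other points of \<open>Z\<close>\<close>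
  define f where "f = (\<lambda>x. \<Prod>y\<in>Z - {z}. (inverse (cvec z $ jj y - cvec y $ jj y)) * (x $ jj y - cvec y $ jj y))"
  have "f \<in> PF" unfolding f_def
  proof (rule PF_prod)
   fix y show "(\<lambda>x. inverse (cvec z $ jj y - cvec y $ jj y) * (x $ jj y - cvec y $ jj y)) \<in> PF"
    using PF_mult[OF PF_const PF_minus[OF PF_var PF_const]] by (simp add: fun_diff_def times_fun_def)
  qed
  hence "res f \<in> T" by (rule PFT)
  moreover have "res f = dl z"
  proof
   fix y show "res f y = dl z y"
   proof (cases "y \<in> Z \<and> y \<noteq> z")
    case True
    hence "f (cvec y) = 0" using Z(1) unfolding f_def by (subst prod_zero_iff) auto
    thus ?thesis using True by (simp add: res_def dl_def)
   next
    case False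
    have "f (cvec z) = 1" unfolding f_def
    proof (rule prod.neutral, rule ballI)
     fix y assume "y \<in> Z - {z}"
     thus "inverse (cvec z $ jj y - cvec y $ jj y) * (cvec z $ jj y - cvec y $ jj y) = 1" using jj[of y] by simp
    qed
    thus ?thesis using False z by (cases "y = z") (simp_all add: res_def dl_def)
   qed
  qed
  ultimately show ?thesis by (simp only:)
 qed
 have inj: "inj_on dl Z"
 proof (rule inj_onI)
  fix x y assume "dl x = dl y"
  from fun_cong[OF this, of x] show "x = y" by (simp add: dl_def split: if_splits)
 qed
 have ind: "fs.independent (dl ` Z)"
 proof
  assume "fs.dependent (dl ` Z)"
  from this[unfolded fs.dependent_finite[OF finite_imageI[OF Z(1)]]]
  obtain co v where co: "v \<in> dl ` Z" "co v \<noteq> 0" "(\<Sum>v\<in>dl ` Z. fsc (co v) v) = 0"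
   by (elim exE conjE bexE) (rule that)
  then obtain z where z: "z \<in> Z" "v = dl z" by auto
  have sf: "(\<Sum>i\<in>I. F i) x = (\<Sum>i\<in>I. F i x)" if "finite I" for F :: "int ^ 'n => int ^ 'n => complex" and x I
   using that by (induction I rule: finite_induct) auto
  have "0 = (\<Sum>y\<in>Z. fsc (co (dl y)) (dl y)) z" using co(3) by (simp add: sum.reindex[OF inj])
  also have "... = (\<Sum>y\<in>Z. if z = y then co (dl y) else 0)" unfolding sf[OF Z(1)]
   by (intro sum.cong refl) (simp add: dl_def)
  also have "... = co (dl z)" using z Z(1) by (subst sum.delta') auto
  finally show False using co z by simp
 qed
 have Bs_eq: "Bs = (\<lambda>m. res (monf m)) ` {m. sum m UNIV \<le> K}" by (auto simp: Bs_def)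
 have finB: "finite Bs" unfolding Bs_eq by (simp add: finite_bounded_exponents)
 have "card (dl ` Z) \<le> card Bs"
  using dlT by (intro conjunct2[OF fs.independent_span_bound[OF finB ind]] image_subsetI) (simp add: T_def)
 also have "... \<le> card {m :: 'n => nat. sum m UNIV \<le> K}"
  unfolding Bs_eq by (rule card_image_le) (rule finite_bounded_exponents)
 finally show ?thesis by (simp add: card_image[OF inj] K_def)
qed

section \<open>Partial derivatives and polar forms\<close>

lemma mpoly_eval_superset:
 assumes "finite S" "keys F \<subseteq> S"
 shows "mpoly_eval F x = (\<Sum>m\<in>S. of_int (lookup F m) * (\<Prod>i\<in>UNIV. (x $ i) ^ lookup m i))"
 unfolding mpoly_eval_def
 by (rule sum.mono_neutral_left[OF assms]) (auto simp: in_keys_iff)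

lemma mpoly_eval_add: "mpoly_eval (F + G) x = mpoly_eval F x + mpoly_eval G x"
proof -
 let ?S = "keys F \<union> keys G"
 have S: "finite ?S" "keys F \<subseteq> ?S" "keys G \<subseteq> ?S" "keys (F + G) \<subseteq> ?S"
  using Poly_Mapping.keys_add[of F G] by auto
 show ?thesis
  unfolding mpoly_eval_superset[OF S(1,2)] mpoly_eval_superset[OF S(1,3)] mpoly_eval_superset[OF S(1,4)]
  by (simp add: lookup_add ring_distribs sum.distrib)
qed

lemma mpoly_eval_sum: "mpoly_eval (\<Sum>k\<in>K. G k) x = (\<Sum>k\<in>K. mpoly_eval (G k) x)"
proof (induction K rule: infinite_finite_induct)
 case (insert k K)
 thus ?case by (simp add: mpoly_eval_add)
qed (simp_all add: mpoly_eval_def)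

lemma mpoly_eval_single:
 "mpoly_eval (Poly_Mapping.single m c) x = of_int c * (\<Prod>i\<in>UNIV. (x $ i) ^ lookup m i)"
 by (subst mpoly_eval_superset[of "{m}"]) auto

lemma mpoly_eval_pderiv:
 "mpoly_eval (mpoly_pderiv i F) x = (\<Sum>m\<in>keys F. of_int (lookup F m * int (lookup m i)) *
   (\<Prod>j\<in>UNIV. (x $ j) ^ lookup (m - Poly_Mapping.single i 1) j))"
 unfolding mpoly_pderiv_def mpoly_eval_sum mpoly_eval_single ..

lemma mpoly_eval_cvec: "mpoly_eval G (cvec z) = of_int (mpoly_eval G z)"
 by (simp add: mpoly_eval_def)

lemma mpoly_eval_PF: "(\<lambda>x :: complex ^ 'n::finite. mpoly_eval G x) \<in> PF"
 unfolding mpoly_eval_def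
proof (rule PF_sum)
 fix m :: "'n \<Rightarrow>\<^sub>0 nat"
 have "(\<lambda>x :: complex ^ 'n. \<Prod>i\<in>UNIV. (x $ i) ^ lookup m i) \<in> PF"
  by (intro PF_prod PF_power PF_var)
 from PF_mult[OF PF_const this, of "of_int (lookup G m)"]
 show "(\<lambda>x :: complex ^ 'n. of_int (lookup G m) * (\<Prod>i\<in>UNIV. (x $ i) ^ lookup m i)) \<in> PF"
  by (simp add: times_fun_def)
qed

lemma monomial_scale:
 fixes x :: "'a::comm_ring_1 ^ 'n::finite"
 shows "(\<Prod>i\<in>UNIV. (c * x $ i) ^ m i) = c ^ (\<Sum>i\<in>UNIV. m i) * (\<Prod>i\<in>UNIV. (x $ i) ^ m i)"
 by (simp add: power_mult_distrib prod.distrib power_sum)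

lemma form_scale:
 assumes "is_form d F" shows "mpoly_eval F (\<chi> l. c * x $ l) = c ^ d * mpoly_eval F x"
 unfolding mpoly_eval_def sum_distrib_left
 using assms by (intro sum.cong refl) (simp add: monomial_scale is_form_def)

lemma form_smul:
 assumes "is_form d F" shows "mpoly_eval F (smul t x) = t ^ d * mpoly_eval F x"
 unfolding smul_def by (rule form_scale[OF assms])

lemma pderiv_scale:
 assumes "is_form d F"
 shows "mpoly_eval (mpoly_pderiv i F) (\<chi> l. c * x $ l) = c ^ (d - 1) * mpoly_eval (mpoly_pderiv i F) x"
 unfolding mpoly_eval_pderiv sum_distrib_left
proof (rule sum.cong[OF refl])
 fix m assume m: "m \<in> keys F"
 let ?m' = "lookup (m - Poly_Mapping.single i 1)"
 let ?a = "of_int (lookup F m * int (lookup m i)) :: 'b"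
 show "?a * (\<Prod>j\<in>UNIV. ((\<chi> l. c * x $ l) $ j) ^ ?m' j) = c ^ (d - 1) * (?a * (\<Prod>j\<in>UNIV. (x $ j) ^ ?m' j))"
 proof (cases "lookup m i = 0")
  case False
  have "(\<Sum>j\<in>UNIV. ?m' j) = (\<Sum>j\<in>UNIV. lookup m j) - (\<Sum>j\<in>UNIV. lookup (Poly_Mapping.single i 1) j)"
   unfolding lookup_minus using False
   by (subst sum_subtractf_nat) (auto simp: lookup_single when_def)
  also have "... = d - 1" using m assms by (simp add: is_form_def lookup_single when_def)
  finally show ?thesis by (simp add: monomial_scale)
 qed simp
qed

lemma power_add_mod_square: "\<exists>z. (x + t) ^ k = x ^ k + t * (of_nat k * x ^ (k - 1)) + t\<^sup>2 * (z::int)"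
proof (induction k)
 case (Suc k)
 then obtain z where z: "(x + t) ^ k = x ^ k + t * (of_nat k * x ^ (k - 1)) + t\<^sup>2 * z" by blast
 have k: "of_nat k * x ^ (k - 1) * x = of_nat k * x ^ k" by (cases k) auto
 have "(x + t) ^ Suc k = (x + t) * (x ^ k + t * (of_nat k * x ^ (k - 1)) + t\<^sup>2 * z)" by (simp add: z)
 also have "... = x ^ Suc k + t * (of_nat k * x ^ (k - 1) * x + x ^ k) + t\<^sup>2 * (of_nat k * x ^ (k - 1) + z * (x + t))"
  by (simp add: algebra_simps power2_eq_square)
 also have "of_nat k * x ^ (k - 1) * x + x ^ k = of_nat (Suc k) * x ^ (Suc k - 1)" unfolding k by (simp add: algebra_simps)
 finally show ?case by blast
qed auto

lemma mpoly_eval_shift: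
 fixes x :: "int ^ 'n::finite"
 shows "\<exists>z. mpoly_eval F (x + smul t (axis i 1)) = mpoly_eval F x + t * mpoly_eval (mpoly_pderiv i F) x + t\<^sup>2 * z"
proof -
 let ?y = "x + smul t (axis i 1)"
 have yi: "?y $ i = x $ i + t" by (simp add: axis_def)
 have yj: "?y $ j = x $ j" if "j \<noteq> i" for j using that by (simp add: axis_def)
 have "\<exists>z. (\<Prod>j\<in>UNIV. (?y $ j) ^ lookup m j) = (\<Prod>j\<in>UNIV. (x $ j) ^ lookup m j)
   + t * (int (lookup m i) * (\<Prod>j\<in>UNIV. (x $ j) ^ lookup (m - Poly_Mapping.single i 1) j)) + t\<^sup>2 * z" for m
 proof -
  let ?R = "\<Prod>j\<in>UNIV - {i}. (x $ j) ^ lookup m j"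
  obtain z where z: "(x $ i + t) ^ lookup m i = (x $ i) ^ lookup m i
    + t * (of_nat (lookup m i) * (x $ i) ^ (lookup m i - 1)) + t\<^sup>2 * z"
   using power_add_mod_square by blast
  have 1: "(\<Prod>j\<in>UNIV. (?y $ j) ^ lookup m j) = (x $ i + t) ^ lookup m i * ?R"
  proof -
   have "(\<Prod>j\<in>UNIV - {i}. (?y $ j) ^ lookup m j) = ?R" by (rule prod.cong[OF refl]) (simp only: yj Diff_iff singleton_iff not_False_eq_True)
   thus ?thesis by (subst prod.remove[of _ i]) (simp_all only: yi finite_UNIV UNIV_I finite)
  qed
  have 2: "(\<Prod>j\<in>UNIV. (x $ j) ^ lookup m j) = (x $ i) ^ lookup m i * ?R"
   by (rule prod.remove) auto
  have 3: "(\<Prod>j\<in>UNIV. (x $ j) ^ lookup (m - Poly_Mapping.single i 1) j) = (x $ i) ^ (lookup m i - 1) * ?R"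
  proof -
   have "(\<Prod>j\<in>UNIV - {i}. (x $ j) ^ lookup (m - Poly_Mapping.single i 1) j) = ?R"
    by (rule prod.cong[OF refl]) (auto simp: lookup_minus lookup_single when_def)
   thus ?thesis by (subst prod.remove[of _ i]) (simp_all add: lookup_minus)
  qed
  show ?thesis unfolding 1 2 3 z by (intro exI[of _ "z * ?R"]) (simp add: algebra_simps)
 qed
 hence "\<exists>z. \<forall>m. (\<Prod>j\<in>UNIV. (?y $ j) ^ lookup m j) = (\<Prod>j\<in>UNIV. (x $ j) ^ lookup m j)
   + t * (int (lookup m i) * (\<Prod>j\<in>UNIV. (x $ j) ^ lookup (m - Poly_Mapping.single i 1) j)) + t\<^sup>2 * z m"
  by (intro choice allI)
 then obtain z where z: "\<forall>m. (\<Prod>j\<in>UNIV. (?y $ j) ^ lookup m j) = (\<Prod>j\<in>UNIV. (x $ j) ^ lookup m j)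
   + t * (int (lookup m i) * (\<Prod>j\<in>UNIV. (x $ j) ^ lookup (m - Poly_Mapping.single i 1) j)) + t\<^sup>2 * z m"
  by (elim exE) (rule that)
 have "mpoly_eval F ?y = mpoly_eval F x + t * mpoly_eval (mpoly_pderiv i F) x + t\<^sup>2 * (\<Sum>m\<in>keys F. lookup F m * z m)"
  unfolding mpoly_eval_pderiv unfolding mpoly_eval_def z[THEN spec] sum_distrib_left sum.distrib[symmetric]
  by (rule sum.cong[OF refl]) (simp add: algebra_simps)
 thus ?thesis by blast
qed

lemma polar_replicate_shift:
 fixes f :: "int ^ 'n::finite => int"
 assumes f: "dlt (Suc d) f"
 shows "j + length ts = d ==> \<exists>z. polar f (replicate j (x + smul t e) @ ts) =
   polar f (replicate j x @ ts) + t * (int j * polar f (replicate (j - 1) x @ (if j = 0 then [] else [e]) @ ts)) + t\<^sup>2 * z"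
proof (induction j arbitrary: ts)
 case (Suc j)
 let ?y = "x + smul t e"
 have mv: "polar f (replicate j w @ u # vs) = polar f (u # replicate j w @ vs)" for u w vs by (rule polar_perm) simp
 have len: "Suc (length [] + length (replicate j w @ ts)) = d" for w :: "int ^ 'n" using Suc.prems by simp
 have "polar f (replicate (Suc j) ?y @ ts) = polar f (x # replicate j ?y @ ts) + t * polar f (e # replicate j ?y @ ts)"
  using polar_add[OF f len, of x "smul t e" ?y] polar_smul[OF f len, of t e ?y] by simp
 moreover obtain z1 where "polar f (replicate j ?y @ x # ts) = polar f (replicate j x @ x # ts) +
   t * (int j * polar f (replicate (j - 1) x @ (if j = 0 then [] else [e]) @ x # ts)) + t\<^sup>2 * z1"
  using Suc.IH[of "x # ts"] Suc.prems by auto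
 moreover obtain z2 where "polar f (replicate j ?y @ e # ts) = polar f (replicate j x @ e # ts) +
   t * (int j * polar f (replicate (j - 1) x @ (if j = 0 then [] else [e]) @ e # ts)) + t\<^sup>2 * z2"
  using Suc.IH[of "e # ts"] Suc.prems by auto
 moreover have "int j * polar f (replicate (j - 1) x @ (if j = 0 then [] else [e]) @ x # ts) = int j * polar f (replicate j x @ e # ts)"
 proof (cases j)
  case (Suc k)
  have "polar f (replicate k x @ [e] @ x # ts) = polar f (replicate (Suc k) x @ e # ts)" by (rule polar_perm) simp
  thus ?thesis using Suc by simp
 qed simp
 moreover define q where "q = int j * polar f (replicate (j - 1) x @ (if j = 0 then [] else [e]) @ e # ts)"
 ultimately have "polar f (replicate (Suc j) ?y @ ts) = polar f (replicate (Suc j) x @ ts) + t * (int (Suc j) * polar f (replicate j x @ e # ts))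
   + t\<^sup>2 * (z1 + q + t * z2)"
  unfolding mv by (simp add: algebra_simps power2_eq_square)
 thus ?case by auto
qed simp

lemma int_eq_if_all_dvd:
 assumes "\<And>t::int. t \<noteq> 0 ==> t dvd a" shows "a = 0"
proof (rule ccontr)
 assume "a \<noteq> 0"
 have "(\<bar>a\<bar> + 1) dvd a" by (rule assms) auto
 hence "\<bar>a\<bar> + 1 \<le> \<bar>a\<bar>" using \<open>a \<noteq> 0\<close> by (metis abs_of_nonneg abs_ge_zero add_nonneg_nonneg dvd_imp_le_int zero_le_one)
 thus False by simp
qed

text \<open>Both sides arise from comparing the terms of order \<open>t\<close> in \<open>F(x + t e_i)\<close>.\<close>
lemma polar_pderiv:
 fixes x :: "int ^ 'n::finite"
 assumes F: "is_form d F" and d: "d \<ge> 1"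
 shows "fact d * mpoly_eval (mpoly_pderiv i F) x = int d * polar (mpoly_eval F) (replicate (d - 1) x @ [axis i 1])"
proof -
 let ?f = "mpoly_eval F :: int ^ 'n => int"
 have hom: "?f (smul t x) = t ^ d * ?f x" for t x by (rule form_smul[OF F])
 let ?D = "mpoly_eval (mpoly_pderiv i F) x" and ?Q = "polar ?f (replicate (d - 1) x @ [axis i 1])"
 have "fact d * ?D - int d * ?Q = 0"
 proof (rule int_eq_if_all_dvd)
  fix t :: int assume t: "t \<noteq> 0"
  let ?y = "x + smul t (axis i 1)"
  obtain z where z: "?f ?y = ?f x + t * ?D + t\<^sup>2 * z" using mpoly_eval_shift by blast
  obtain z' where z': "polar ?f (replicate d ?y) = polar ?f (replicate d x) + t * (int d * ?Q) + t\<^sup>2 * z'"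
   using polar_replicate_shift[OF dlt_mpoly[OF F], of d "[]" x t "axis i 1"] d by auto
  have "fact d * ?f ?y = fact d * ?f x + t * (int d * ?Q) + t\<^sup>2 * z'"
   using z' unfolding polar_diagonal[of ?f, OF hom] .
  hence "t * (fact d * ?D - int d * ?Q) = t * (t * (z' - fact d * z))"
   unfolding z by (simp add: algebra_simps power2_eq_square)
  thus "t dvd fact d * ?D - int d * ?Q" using t by simp
 qed
 thus ?thesis by simp
qed

lemma polar_PD:
 fixes f :: "int ^ 'n::finite => int"
 assumes f: "dlt (Suc d) f"
 shows "k + length ts = d ==> \<exists>q\<in>PDeq k. \<forall>x. of_int (polar f (replicate k x @ ts)) = q (cvec x)"
proof (induction k arbitrary: ts)
 case 0
 have "fsc (of_int (polar f ts)) (monf (\<lambda>_::'n. 0)) \<in> PDeq 0" by (intro PD_scale monf_PD) simp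
 thus ?case by (rule bexI[rotated]) (simp add: monf_def)
next
 case (Suc k)
 have "\<exists>q. q \<in> PDeq k \<and> (\<forall>x. of_int (polar f (replicate k x @ axis j 1 # ts)) = q (cvec x))" for j
  using Suc.IH[of "axis j 1 # ts"] Suc.prems by auto
 then obtain q where q: "\<And>j. q j \<in> PDeq k" "\<And>j x. of_int (polar f (replicate k x @ axis j 1 # ts)) = q j (cvec x)" by metis
 let ?q = "\<Sum>j\<in>UNIV. monf (\<lambda>i. if i = j then 1 else 0) * q j"
 have "?q \<in> PDeq (Suc k)"
  by (intro PD_sum PD_mult[OF monf_PD[of "\<lambda>l. l = 1"] q(1)]) auto
 moreover have "of_int (polar f (replicate (Suc k) x @ ts)) = ?q (cvec x)" for x
 proof -
  have sf: "(\<Sum>i\<in>I. F i) y = (\<Sum>i\<in>I. F i y)" if "finite I" for F :: "'n => complex ^ 'n => complex" and y I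
   using that by (induction I rule: finite_induct) auto
  have len: "Suc (length [] + length (replicate k x @ ts)) = d" using Suc.prems by simp
  have mv: "polar f (axis j 1 # replicate k x @ ts) = polar f (replicate k x @ axis j 1 # ts)" for j by (rule polar_perm) simp
  have "polar f (replicate (Suc k) x @ ts) = (\<Sum>j\<in>UNIV. x $ j * polar f (replicate k x @ axis j 1 # ts))"
   using polar_expand[OF f len, of x] by (simp add: mv)
  thus ?thesis by (simp add: sf q(2)[symmetric] monf_single)
 qed
 ultimately show ?case by blast
qed

lemma polar_shift_PD:
 fixes f :: "int ^ 'n::finite => int"
 assumes f: "dlt (Suc d) f"
 shows "length us + e + length ts = d ==> \<exists>p\<in>PD (\<lambda>l. l < length us + e). \<forall>x.
   of_int (polar f (map (\<lambda>u. u + x) us @ replicate e x @ ts)) = of_int (polar f (replicate (length us + e) x @ ts)) + p (cvec x)"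
proof (induction us arbitrary: e ts)
 case Nil
 show ?case by (rule bexI[OF _ PD_zero]) simp
next
 case (Cons u us)
 obtain p1 where p1: "p1 \<in> PD (\<lambda>l. l < length us + e)" "\<And>x. of_int (polar f (map (\<lambda>u. u + x) us @ replicate e x @ u # ts))
   = of_int (polar f (replicate (length us + e) x @ u # ts)) + p1 (cvec x)"
  using Cons.IH[of e "u # ts"] Cons.prems by auto
 obtain p2 where p2: "p2 \<in> PD (\<lambda>l. l < length us + Suc e)" "\<And>x. of_int (polar f (map (\<lambda>u. u + x) us @ replicate (Suc e) x @ ts))
   = of_int (polar f (replicate (length us + Suc e) x @ ts)) + p2 (cvec x)"
  using Cons.IH[of "Suc e" ts] Cons.prems by auto
 obtain q where q: "q \<in> PDeq (length us + e)" "\<And>x. of_int (polar f (replicate (length us + e) x @ u # ts)) = q (cvec x)"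
  using polar_PD[OF f, of "length us + e" "u # ts"] Cons.prems by auto
 let ?p = "(q + p1) + p2"
 have "?p \<in> PD (\<lambda>l. l < length (u # us) + e)"
 proof (intro PD_add)
  show "q \<in> PD (\<lambda>l. l < length (u # us) + e)" by (rule subsetD[OF PD_mono q(1)]) simp
  show "p1 \<in> PD (\<lambda>l. l < length (u # us) + e)" by (rule subsetD[OF PD_mono p1(1)]) simp
  show "p2 \<in> PD (\<lambda>l. l < length (u # us) + e)" by (rule subsetD[OF PD_mono p2(1)]) simp
 qed
 moreover have "of_int (polar f (map (\<lambda>u. u + x) (u # us) @ replicate e x @ ts)) = of_int (polar f (replicate (length (u # us) + e) x @ ts)) + ?p (cvec x)" for x
 proof -
  let ?R = "map (\<lambda>u. u + x) us @ replicate e x @ ts"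
  have len: "Suc (length [] + length ?R) = d" using Cons.prems by simp
  have "polar f ((u + x) # ?R) = polar f (u # ?R) + polar f (x # ?R)" using polar_add[OF f len, of u x] by simp
  moreover have "polar f (u # ?R) = polar f (map (\<lambda>u. u + x) us @ replicate e x @ u # ts)" by (rule polar_perm) simp
  moreover have "polar f (x # ?R) = polar f (map (\<lambda>u. u + x) us @ replicate (Suc e) x @ ts)" by (rule polar_perm) simp
  ultimately show ?thesis using p1(2)[of x] p2(2)[of x] q(2)[of x] by simp
 qed
 ultimately show ?case by blast
qed

text \<open>The terms of degree \<open>d - 1\<close> in \<open>x\<close> of these polynomials are multiples of the
  partial derivatives of \<open>F\<close>, whose only common zero is the origin; the remaining terms have
  lower degree.\<close>
lemma birch_fibre_bound:
 fixes F :: "'n::finite int_mpoly"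
 assumes F: "is_form d F" and sm: "smooth_form F" and d: "d \<ge> 2"
 shows "\<exists>E. \<forall>us Z. length us = d - 2 --> finite Z -->
  (\<forall>x\<in>Z. \<forall>i. polar (mpoly_eval F) (map (\<lambda>u. u + x) us @ [x, axis i 1]) = 0) --> card (Z :: (int ^ 'n) set) \<le> E"
proof -
 let ?f = "mpoly_eval F :: int ^ 'n => int"
 let ?g = "\<lambda>i x. mpoly_eval (mpoly_pderiv i F) x :: complex"
 have "\<exists>N A. (\<forall>i. A i \<in> PDeq N) \<and> (\<forall>x. (x $ j) ^ (N + (d - 1)) = (\<Sum>i\<in>UNIV. A i x * ?g i x))" for j
 proof (rule homogeneous_nullstellensatz)
  show "?g i \<in> PF" for i by (rule mpoly_eval_PF)
  show "?g i (\<chi> l. c * x $ l) = c ^ (d - 1) * ?g i x" for i c x by (rule pderiv_scale[OF F])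
  show "z = 0" if "\<And>i. ?g i z = 0" for z using sm that by (auto simp: smooth_form_def)
 qed
 hence "\<exists>N. \<forall>j. \<exists>A. (\<forall>i. A i \<in> PDeq (N j)) \<and> (\<forall>x. (x $ j) ^ (N j + (d - 1)) = (\<Sum>i\<in>UNIV. A i x * ?g i x))"
  by (intro choice allI)
 then obtain N where "\<forall>j. \<exists>A. (\<forall>i. A i \<in> PDeq (N j)) \<and> (\<forall>x. (x $ j) ^ (N j + (d - 1)) = (\<Sum>i\<in>UNIV. A i x * ?g i x))"
  by (elim exE) (rule that)
 hence "\<exists>A. \<forall>j. (\<forall>i. A j i \<in> PDeq (N j)) \<and> (\<forall>x. (x $ j) ^ (N j + (d - 1)) = (\<Sum>i\<in>UNIV. A j i x * ?g i x))"
  by (rule choice)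
 then obtain A where A12: "\<forall>j. (\<forall>i. A j i \<in> PDeq (N j)) \<and> (\<forall>x. (x $ j) ^ (N j + (d - 1)) = (\<Sum>i\<in>UNIV. A j i x * ?g i x))"
  by (elim exE) (rule that)
 have A: "A j i \<in> PDeq (N j)" "(x $ j) ^ (N j + (d - 1)) = (\<Sum>i\<in>UNIV. A j i x * ?g i x)" for i j x
  by (rule A12[THEN spec, THEN conjunct1, THEN spec], rule A12[THEN spec, THEN conjunct2, THEN spec])
 define N' where "N' = sum N UNIV"
 define A' where "A' i j = monf (\<lambda>k. if k = j then N' - N j else 0) * A j i" for i j
 have Nj: "N j \<le> N'" for j unfolding N'_def by (rule member_le_sum) auto
 have A'1: "A' i j \<in> PDeq N'" for i j
  unfolding A'_def by (rule PD_mult[OF monf_PD[of "\<lambda>l. l = N' - N j"] A(1)]) (use Nj[of j] in auto)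
 have A'2: "(x $ j) ^ (N' + (d - 1)) = (\<Sum>i\<in>UNIV. A' i j x * ?g i x)" for j x
 proof -
  have "(x $ j) ^ (N' + (d - 1)) = (x $ j) ^ (N' - N j) * (x $ j) ^ (N j + (d - 1))"
   using Nj[of j] by (simp add: power_add[symmetric])
  also have "... = (\<Sum>i\<in>UNIV. A' i j x * ?g i x)"
   unfolding A(2) A'_def sum_distrib_left by (simp add: monf_single mult.assoc)
  finally show ?thesis .
 qed
 show ?thesis
 proof (intro exI allI impI)
  fix us :: "(int ^ 'n) list" and Z :: "(int ^ 'n) set"
  assume us: "length us = d - 2" and Z: "finite Z"
   and zero: "\<forall>x\<in>Z. \<forall>i. polar ?f (map (\<lambda>u. u + x) us @ [x, axis i 1]) = 0"
  have "\<exists>p. p \<in> PD (\<lambda>l. l < d - 1) \<and> (\<forall>x. of_int (polar ?f (map (\<lambda>u. u + x) us @ [x, axis i 1])) =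
    of_int (polar ?f (replicate (d - 1) x @ [axis i 1])) + p (cvec x))" for i
  proof -
   have "length us + 1 = d - 1" "length us + 1 + length [axis i (1::int)] = d" using us d by auto
   thus ?thesis using polar_shift_PD[OF dlt_mpoly[OF F], of us 1 "[axis i 1]"] by auto
  qed
  hence "\<exists>p. \<forall>i. p i \<in> PD (\<lambda>l. l < d - 1) \<and> (\<forall>x. of_int (polar ?f (map (\<lambda>u. u + x) us @ [x, axis i 1])) =
    of_int (polar ?f (replicate (d - 1) x @ [axis i 1])) + p i (cvec x))" by (intro choice allI)
  then obtain p where p12: "\<forall>i. p i \<in> PD (\<lambda>l. l < d - 1) \<and> (\<forall>x. of_int (polar ?f (map (\<lambda>u. u + x) us @ [x, axis i 1])) =
    of_int (polar ?f (replicate (d - 1) x @ [axis i 1])) + p i (cvec x))" by (elim exE) (rule that)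
  have p: "p i \<in> PD (\<lambda>l. l < d - 1)" "of_int (polar ?f (map (\<lambda>u. u + x) us @ [x, axis i 1])) =
    of_int (polar ?f (replicate (d - 1) x @ [axis i 1])) + p i (cvec x)" for i x
   by (rule p12[THEN spec, THEN conjunct1], rule p12[THEN spec, THEN conjunct2, THEN spec])
  show "card Z \<le> card {m :: 'n => nat. sum m UNIV \<le> CARD('n) * (N' + (d - 1))}"
  proof (rule card_zeros_le[OF A'1 A'2 _ Z])
   show "fsc (- of_nat d) (p i) \<in> PD (\<lambda>l. l < d - 1)" for i by (rule PD_scale[OF p(1)])
   fix z i assume z: "z \<in> Z"
   have "of_int (polar ?f (replicate (d - 1) z @ [axis i 1])) = - p i (cvec z)"
    using p(2)[of z i] zero z by (simp add: eq_neg_iff_add_eq_0)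
   moreover have "complex_of_int (fact d * mpoly_eval (mpoly_pderiv i F) z) = of_int (int d * polar ?f (replicate (d - 1) z @ [axis i 1]))"
    using polar_pderiv[OF F, of i z] d by simp
   ultimately show "fact d * ?g i (cvec z) = fsc (- of_nat d) (p i) (cvec z)"
    by (simp add: mpoly_eval_cvec)
  qed (use d in auto)
 qed
qed

section \<open>The number of zeros of the polar forms\<close>

text \<open>Lists of length \<open>k\<close> with entries in \<open>Y\<close>.\<close>
definition lists_in :: "nat => 'a set => 'a list set" where
 "lists_in k Y = {ws. set ws \<subseteq> Y \<and> length ws = k}"

lemma finite_lists_in [simp]: "finite Y ==> finite (lists_in k Y)"
 unfolding lists_in_def by (rule finite_lists_length_eq)

lemma card_lists_in: "finite Y ==> card (lists_in k Y) = card Y ^ k"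
 unfolding lists_in_def by (rule card_lists_length_eq)

text \<open>Grouping the tuples by the differences of their entries with the last one leaves \<open>d - 2\<close>
  free vectors, and each fibre is bounded by \<open>birch_fibre_bound\<close>.\<close>
lemma birch_count:
 fixes F :: "'n::finite int_mpoly"
 assumes F: "is_form d F" and sm: "smooth_form F" and d: "d \<ge> 2"
 shows "\<exists>E. \<forall>X. card {hs \<in> lists_in (d - 1) (sbox X). \<forall>i. polar (mpoly_eval F) (hs @ [axis i 1]) = 0}
   \<le> E * X ^ (CARD('n) * (d - 2))"
proof -
 let ?f = "mpoly_eval F :: int ^ 'n => int"
 obtain E where E: "\<And>us Z. length us = d - 2 ==> finite Z ==>
  (\<And>x i. x \<in> Z ==> polar ?f (map (\<lambda>u. u + x) us @ [x, axis i 1]) = 0) ==> card (Z :: (int ^ 'n) set) \<le> E"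
  using birch_fibre_bound[OF assms] by metis
 show ?thesis
 proof (intro exI allI)
  fix X
  define H where "H = {hs \<in> lists_in (d - 1) (sbox X). \<forall>i. polar ?f (hs @ [axis i 1]) = 0}"
  define Fb where "Fb us = {x \<in> sbox X. \<forall>i. polar ?f (map (\<lambda>u. u + x) us @ [x, axis i 1]) = 0}" for us
  let ?L = "lists_in (d - 2) (sbox (2 * X)) :: (int ^ 'n) list set"
  have finF: "finite (Fb us)" for us by (simp add: Fb_def)
  let ?m = "\<lambda>hs::(int ^ 'n) list. (map (\<lambda>h. h - last hs) (butlast hs), last hs)"
  have recon: "map (\<lambda>u. u + last hs) (map (\<lambda>h. h - last hs) (butlast hs)) @ [last hs] = hs" if "hs \<noteq> []" for hs :: "(int ^ 'n) list"
   using that by (simp add: o_def)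
  have ne: "hs \<noteq> []" if "hs \<in> H" for hs using that d by (auto simp: H_def lists_in_def)
  have "card H \<le> card (SIGMA us:?L. Fb us)"
  proof (rule card_inj_on_le[where f = ?m])
   show "finite (SIGMA us:?L. Fb us)" by (intro finite_SigmaI finF) simp
   show "inj_on ?m H"
   proof (rule inj_onI)
    fix hs ks assume "hs \<in> H" "ks \<in> H" and eq: "?m hs = ?m ks"
    thus "hs = ks" using recon[OF ne[of hs]] recon[OF ne[of ks]] by (metis prod.inject)
   qed
   show "?m ` H \<subseteq> (SIGMA us:?L. Fb us)"
   proof (rule image_subsetI)
    fix hs assume hs: "hs \<in> H"
    have S: "set hs \<subseteq> sbox X" and len: "length hs = d - 1" using hs by (auto simp: H_def lists_in_def)
    have l: "last hs \<in> sbox X" using S last_in_set[OF ne[OF hs]] by auto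
    have "h - last hs \<in> sbox (2 * X)" if "h \<in> set (butlast hs)" for h
    proof -
     have "h \<in> sbox X" using S in_set_butlastD[OF that] by auto
     hence "\<bar>h $ i\<bar> < int X \<and> \<bar>last hs $ i\<bar> < int X" for i using l by (simp add: sbox_def)
     hence "\<bar>h $ i - last hs $ i\<bar> < 2 * int X" for i
      using abs_triangle_ineq4[of "h $ i" "last hs $ i"] by (metis add_strict_mono le_less_trans mult_2)
     thus ?thesis by (simp add: sbox_def)
    qed
    moreover have "last hs \<in> Fb (map (\<lambda>h. h - last hs) (butlast hs))"
    proof -
     have "polar ?f (map (\<lambda>u. u + last hs) (map (\<lambda>h. h - last hs) (butlast hs)) @ [last hs, axis i 1]) = 0" for i
     proof -
      have e: "map (\<lambda>u. u + last hs) (map (\<lambda>h. h - last hs) (butlast hs)) @ [last hs, axis i 1] = hs @ [axis i 1]"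
       using recon[OF ne[OF hs]] by (metis append.assoc append_Cons append_Nil)
      show ?thesis unfolding e using hs by (simp add: H_def)
     qed
     thus ?thesis using l by (simp add: Fb_def)
    qed
    ultimately show "?m hs \<in> (SIGMA us:?L. Fb us)" using len by (auto simp: lists_in_def)
   qed
  qed
  also have "... = (\<Sum>us\<in>?L. card (Fb us))" by (simp add: finF)
  also have "... \<le> (\<Sum>us\<in>?L. E)"
  proof (rule sum_mono)
   fix us assume "us \<in> ?L"
   thus "card (Fb us) \<le> E" by (intro E finF) (auto simp: lists_in_def Fb_def)
  qed
  also have "... = card (sbox (2 * X) :: (int ^ 'n) set) ^ (d - 2) * E" by (simp add: card_lists_in)
  also have "... \<le> ((2 * (2 * X)) ^ CARD('n)) ^ (d - 2) * E"
   by (intro mult_right_mono power_mono card_sbox_le) auto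
  also have "... = (4 ^ (CARD('n) * (d - 2)) * E) * X ^ (CARD('n) * (d - 2))"
   by (simp add: power_mult[symmetric] power_mult_distrib)
  finally show "card H \<le> (4 ^ (CARD('n) * (d - 2)) * E) * X ^ (CARD('n) * (d - 2))" .
 qed
qed

lemma sum_lists_in_Suc:
 "(\<Sum>ws\<in>lists_in (Suc k) Y. f ws) = (\<Sum>y\<in>Y. \<Sum>ws\<in>lists_in k Y. f (y # ws))"
proof -
 have "lists_in (Suc k) Y = (\<lambda>(y, ws). y # ws) ` (Y \<times> lists_in k Y)"
  by (auto simp: lists_in_def length_Suc_conv image_iff)
 moreover have "inj_on (\<lambda>(y, ws). y # ws) (Y \<times> lists_in k Y)" by (auto simp: inj_on_def)
 ultimately show ?thesis by (simp add: sum.reindex sum.cartesian_product case_prod_unfold)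
qed

lemma lists_in_0 [simp]: "lists_in 0 Y = {[]}" by (auto simp: lists_in_def)

section \<open>Weyl differencing\<close>

text \<open>An exponential sum over \<open>k\<close>-tuples, the phase depending only on the sum of the entries; for
  a box \<open>Y\<close> it is a sum with a spline weight. \<open>difsum\<close> is the sum left after
  differencing.\<close>
definition expsum :: "nat => 'a::comm_monoid_add set => ('a => real) => complex" where
 "expsum k Y g = (\<Sum>ws\<in>lists_in k Y. cis (2 * pi * g (sum_list ws)))"

fun difsum :: "nat => 'a::comm_monoid_add set => ('a => real) => real" where
 "difsum 0 Y g = cmod (expsum 2 Y g)"
| "difsum (Suc k) Y g = (\<Sum>y\<in>Y. \<Sum>y'\<in>Y. difsum k Y (\<lambda>x. g (y + x) - g (y' + x)))"

lemma sum_square_le: "(\<Sum>i\<in>I. a i :: real)\<^sup>2 \<le> real (card I) * (\<Sum>i\<in>I. (a i)\<^sup>2)"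
 using sum_squared_le_sum_of_squares[of a I] by (simp add: mult.commute)

lemma sum_power_le:
 assumes "\<And>i. i \<in> I ==> (a i :: real) \<ge> 0"
 shows "real (card I) * (\<Sum>i\<in>I. a i) ^ (2 ^ k) \<le> real (card I) ^ (2 ^ k) * (\<Sum>i\<in>I. a i ^ (2 ^ k))"
proof (induction k)
 case (Suc k)
 let ?N = "real (card I)" and ?A = "(\<Sum>i\<in>I. a i) ^ (2 ^ k)" and ?B = "\<Sum>i\<in>I. a i ^ (2 ^ k)"
 have p: "(x::real) ^ (2 ^ Suc k) = (x ^ (2 ^ k))\<^sup>2" for x by (simp add: power_mult[symmetric] mult.commute)
 have A0: "?A \<ge> 0" using assms by (intro zero_le_power sum_nonneg)
 show ?case
 proof (cases "?N = 0")
  case False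
  hence N: "?N > 0" by simp
  have "?N * (?N * (\<Sum>i\<in>I. a i) ^ (2 ^ Suc k)) = (?N * ?A)\<^sup>2" unfolding p by (simp add: power2_eq_square)
  also have "... \<le> (?N ^ (2 ^ k) * ?B)\<^sup>2" using Suc A0 by (intro power_mono) auto
  also have "... = ?N ^ (2 ^ Suc k) * ?B\<^sup>2" unfolding p by (simp add: power_mult_distrib)
  also have "... \<le> ?N ^ (2 ^ Suc k) * (?N * (\<Sum>i\<in>I. (a i ^ (2 ^ k))\<^sup>2))"
   by (intro mult_left_mono sum_square_le) auto
  also have "... = ?N * (?N ^ (2 ^ Suc k) * (\<Sum>i\<in>I. a i ^ (2 ^ Suc k)))" unfolding p by simp
  finally show ?thesis using N by (simp only: mult_le_cancel_left_pos)
 qed (simp add: power_0_left)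
qed simp

lemma weyl_step:
 assumes Y: "finite Y"
 shows "(cmod (expsum (Suc k) Y g))\<^sup>2 \<le> real (card Y) ^ k * (\<Sum>y\<in>Y. \<Sum>y'\<in>Y. cmod (expsum k Y (\<lambda>x. g (y + x) - g (y' + x))))"
proof -
 let ?e = "\<lambda>y ws. cis (2 * pi * g (y + sum_list ws))"
 have "expsum (Suc k) Y g = (\<Sum>ws\<in>lists_in k Y. \<Sum>y\<in>Y. ?e y ws)"
  unfolding expsum_def sum_lists_in_Suc by (subst sum.swap) simp
 hence "cmod (expsum (Suc k) Y g) \<le> (\<Sum>ws\<in>lists_in k Y. cmod (\<Sum>y\<in>Y. ?e y ws))" by (simp add: norm_sum)
 hence "(cmod (expsum (Suc k) Y g))\<^sup>2 \<le> (\<Sum>ws\<in>lists_in k Y. cmod (\<Sum>y\<in>Y. ?e y ws))\<^sup>2" by (intro power_mono) auto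
 also have "... \<le> real (card (lists_in k Y)) * (\<Sum>ws\<in>lists_in k Y. (cmod (\<Sum>y\<in>Y. ?e y ws))\<^sup>2)" by (rule sum_square_le)
 also have "real (card (lists_in k Y)) = real (card Y) ^ k" by (simp add: card_lists_in Y)
 also have "(\<Sum>ws\<in>lists_in k Y. (cmod (\<Sum>y\<in>Y. ?e y ws))\<^sup>2) = Re (\<Sum>y\<in>Y. \<Sum>y'\<in>Y. expsum k Y (\<lambda>x. g (y + x) - g (y' + x)))"
 proof -
  have "complex_of_real ((cmod (\<Sum>y\<in>Y. ?e y ws))\<^sup>2) = (\<Sum>y\<in>Y. \<Sum>y'\<in>Y. cis (2 * pi * (g (y + sum_list ws) - g (y' + sum_list ws))))" for ws
   by (simp only: complex_norm_square) (simp add: sum_product cis_cnj cis_mult right_diff_distrib)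
  hence "complex_of_real (\<Sum>ws\<in>lists_in k Y. (cmod (\<Sum>y\<in>Y. ?e y ws))\<^sup>2) =
   (\<Sum>ws\<in>lists_in k Y. \<Sum>y\<in>Y. \<Sum>y'\<in>Y. cis (2 * pi * (g (y + sum_list ws) - g (y' + sum_list ws))))"
   by (simp only: of_real_sum)
  also have "... = (\<Sum>y\<in>Y. \<Sum>y'\<in>Y. expsum k Y (\<lambda>x. g (y + x) - g (y' + x)))"
   unfolding expsum_def by (subst sum.swap, rule sum.cong[OF refl], rule sum.swap)
  finally show ?thesis by (metis Re_complex_of_real)
 qed
 also have "... \<le> cmod (\<Sum>y\<in>Y. \<Sum>y'\<in>Y. expsum k Y (\<lambda>x. g (y + x) - g (y' + x)))" by (rule complex_Re_le_cmod)
 also have "... \<le> (\<Sum>y\<in>Y. \<Sum>y'\<in>Y. cmod (expsum k Y (\<lambda>x. g (y + x) - g (y' + x))))"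
  by (rule order_trans[OF norm_sum sum_mono[OF norm_sum]])
 finally show ?thesis by (simp add: mult_left_mono)
qed

text \<open>Two summands remain at the end, so that the innermost sums are squares of Dirichlet kernels, to which
  \<open>sum_dir_le\<close> applies without loss of a logarithm.\<close>
lemma weyl_differencing:
 assumes Y: "finite Y"
 shows "real (card Y) ^ (2 * k + 2) * cmod (expsum (k + 2) Y h) ^ (2 ^ k) \<le> real (card Y) ^ ((k + 2) * 2 ^ k) * difsum k Y h"
proof (induction k arbitrary: h)
 case 0 thus ?case by (simp add: numeral_2_eq_2)
next
 case (Suc k)
 let ?V = "real (card Y)"
 define c where "c p = cmod (expsum (k + 2) Y (\<lambda>x. h (fst p + x) - h (snd p + x)))" for p
 have pw: "(x::real) ^ (2 ^ Suc k) = (x\<^sup>2) ^ (2 ^ k)" for x by (simp add: power_mult[symmetric])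
 have cc: "(\<Sum>y\<in>Y. \<Sum>y'\<in>Y. g y y') = (\<Sum>p\<in>Y \<times> Y. g (fst p) (snd p))" for g :: "_ => _ => real"
  by (simp add: sum.cartesian_product case_prod_unfold)
 have card2: "real (card (Y \<times> Y)) = ?V\<^sup>2" by (simp add: card_cartesian_product power2_eq_square)
 have "(cmod (expsum (Suc k + 2) Y h))\<^sup>2 \<le> ?V ^ (k + 2) * (\<Sum>p\<in>Y \<times> Y. c p)"
  using weyl_step[OF Y, of "k + 2" h] by (simp add: cc c_def)
 hence "cmod (expsum (Suc k + 2) Y h) ^ (2 ^ Suc k) \<le> (?V ^ (k + 2) * (\<Sum>p\<in>Y \<times> Y. c p)) ^ (2 ^ k)"
  unfolding pw by (intro power_mono) auto
 also have "... = ?V ^ ((k + 2) * 2 ^ k) * (\<Sum>p\<in>Y \<times> Y. c p) ^ (2 ^ k)"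
  by (simp only: power_mult_distrib power_mult)
 finally have "?V ^ (2 * Suc k + 2) * cmod (expsum (Suc k + 2) Y h) ^ (2 ^ Suc k)
   \<le> ?V ^ (2 * Suc k + 2) * (?V ^ ((k + 2) * 2 ^ k) * (\<Sum>p\<in>Y \<times> Y. c p) ^ (2 ^ k))"
  by (intro mult_left_mono) auto
 also have "... = ?V ^ (2 * k + 2) * ?V ^ ((k + 2) * 2 ^ k) * (real (card (Y \<times> Y)) * (\<Sum>p\<in>Y \<times> Y. c p) ^ (2 ^ k))"
  unfolding card2 by (simp add: power_add power2_eq_square mult_ac)
 also have "... \<le> ?V ^ (2 * k + 2) * ?V ^ ((k + 2) * 2 ^ k) * (real (card (Y \<times> Y)) ^ (2 ^ k) * (\<Sum>p\<in>Y \<times> Y. c p ^ (2 ^ k)))"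
  by (intro mult_left_mono sum_power_le) (auto simp: c_def)
 also have "... = ?V ^ ((k + 2) * 2 ^ k + 2 * 2 ^ k) * (\<Sum>p\<in>Y \<times> Y. ?V ^ (2 * k + 2) * c p ^ (2 ^ k))"
  unfolding card2 by (simp only: power_add power_mult[symmetric] sum_distrib_left[symmetric] sum_distrib_right[symmetric] mult_ac)
 also have "... \<le> ?V ^ ((k + 2) * 2 ^ k + 2 * 2 ^ k) * (\<Sum>p\<in>Y \<times> Y. ?V ^ ((k + 2) * 2 ^ k) * difsum k Y (\<lambda>x. h (fst p + x) - h (snd p + x)))"
  unfolding c_def by (intro mult_left_mono sum_mono Suc.IH) auto
 also have "... = ?V ^ ((Suc k + 2) * 2 ^ Suc k) * difsum (Suc k) Y h"
 proof -
  have "(Suc k + 2) * 2 ^ Suc k = ((k + 2) * 2 ^ k + 2 * 2 ^ k) + (k + 2) * 2 ^ k" by (simp add: algebra_simps)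
  hence "?V ^ ((Suc k + 2) * 2 ^ Suc k) = ?V ^ ((k + 2) * 2 ^ k + 2 * 2 ^ k) * ?V ^ ((k + 2) * 2 ^ k)" by (simp only: power_add)
  thus ?thesis unfolding difsum.simps(2) cc by (simp only: sum_distrib_left[symmetric] mult.assoc)
 qed
 finally show ?case .
qed

lemma Difs_shift: "Difs hs (\<lambda>x. f (x + a)) = (\<lambda>x. Difs hs f (x + a))"
 by (induction hs arbitrary: f) (simp_all add: Dif_shift)

lemma Dif_two_point: "(\<lambda>x. f (y + x) - f (y' + x)) = (\<lambda>x. Dif (y - y') f (x + y'))" for f :: "'a::ab_group_add => 'b::ab_group_add"
 by (simp add: Dif_def fun_eq_iff algebra_simps)

lemma polar_two_point:
 assumes "dlt (Suc (Suc (length hs))) f"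
 shows "polar (\<lambda>x. f (y + x) - f (y' + x)) hs = polar f ((y - y') # hs)"
proof -
 have "dlt (Suc (length hs)) (Dif (y - y') f)" using assms by simp
 hence "Difs hs (Dif (y - y') f) y' = polar (Dif (y - y') f) hs" by (rule Difs_const) simp
 thus ?thesis unfolding Dif_two_point by (simp add: polar_def Difs_shift)
qed

lemma sum_two_point_le:
 fixes f :: "int ^ 'n::finite => real"
 assumes f: "\<And>u. f u \<ge> 0" and L: "\<And>i. L i \<le> P"
 shows "(\<Sum>y\<in>ibox L. \<Sum>y'\<in>ibox L. f (y - y')) \<le> real (card (ibox L)) * (\<Sum>h\<in>sbox P. f h)"
proof -
 have "(\<Sum>y\<in>ibox L. f (y - y')) \<le> (\<Sum>h\<in>sbox P. f h)" if y': "y' \<in> ibox L" for y'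
 proof -
  have "(\<Sum>y\<in>ibox L. f (y - y')) = (\<Sum>h\<in>(\<lambda>y. y - y') ` ibox L. f h)"
   by (subst sum.reindex) (auto simp: inj_on_def)
  also have "... \<le> (\<Sum>h\<in>sbox P. f h)"
  proof (rule sum_mono2)
   show "(\<lambda>y. y - y') ` ibox L \<subseteq> sbox P"
   proof (rule image_subsetI)
    fix y :: "int ^ 'n" assume y: "y \<in> ibox L"
    have "\<bar>y $ i - y' $ i\<bar> < int P" for i
    proof -
     have "0 \<le> y $ i" "y $ i < int (L i)" "0 \<le> y' $ i" "y' $ i < int (L i)" using y y' by (auto simp: ibox_def)
     thus ?thesis using L[of i] by linarith
    qed
    thus "y - y' \<in> sbox P" by (simp add: sbox_def)
   qed
  qed (use f in auto)
  finally show ?thesis .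
 qed
 hence "(\<Sum>y'\<in>ibox L. \<Sum>y\<in>ibox L. f (y - y')) \<le> (\<Sum>y'\<in>(ibox L :: (int ^ 'n) set). \<Sum>h\<in>sbox P. f h)" by (intro sum_mono)
 thus ?thesis by (subst sum.swap) simp
qed

lemma affine_expand:
 fixes g :: "int ^ 'n::finite => int"
 assumes "dlt (Suc (Suc 0)) g" shows "g x = g 0 + (\<Sum>i\<in>UNIV. x $ i * polar g [axis i 1])"
proof -
 have "polar g [x] = (\<Sum>i\<in>UNIV. x $ i * polar g [axis i 1])" using polar_expand[OF assms, of "[]" "[]" x] by simp
 thus ?thesis by (simp add: polar_def Dif_def)
qed

lemma cmod_expsum_2_affine:
 fixes L :: "'n::finite => nat"
 assumes g: "\<And>x. g x = a + (\<Sum>i\<in>UNIV. of_int (x $ i) * \<gamma> i)"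
 shows "cmod (expsum 2 (ibox L) g) = (\<Prod>i\<in>UNIV. (cmod (dir (L i) (\<gamma> i)))\<^sup>2)"
proof -
 let ?e = "\<lambda>w::int^'n. cis (2 * pi * (\<Sum>i\<in>UNIV. of_int (w $ i) * \<gamma> i))"
 have e: "cis (2 * pi * g (y + z)) = cis (2 * pi * a) * (?e y * ?e z)" for y z
  by (simp add: g cis_mult algebra_simps sum.distrib)
 have "expsum 2 (ibox L) g = (\<Sum>y\<in>ibox L. \<Sum>z\<in>ibox L. cis (2 * pi * g (y + z)))"
  unfolding expsum_def numeral_2_eq_2 sum_lists_in_Suc by simp
 also have "... = cis (2 * pi * a) * ((\<Sum>y\<in>ibox L. ?e y) * (\<Sum>z\<in>ibox L. ?e z))"
  unfolding e sum_product by (simp only: sum_distrib_left[symmetric])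
 finally show ?thesis unfolding sum_ibox_cis by (simp add: norm_mult prod_norm[symmetric] prod.distrib[symmetric] power2_eq_square)
qed

abbreviation polar_lin :: "real => (int ^ 'n::finite => int) => (int ^ 'n) list => 'n => int ^ 'n => real" where
 "polar_lin \<alpha> f hs \<equiv> \<lambda>i u. \<alpha> * of_int (polar f (hs @ [u, axis i 1]))"

lemma additive_forms_polar:
 assumes "dlt (Suc (length hs + 2)) f"
 shows "additive_forms (polar_lin \<alpha> f hs)"
 unfolding additive_forms_def
proof (intro allI)
 fix i :: 'a and u v :: "int ^ 'a"
 have "polar f (hs @ (u + v) # [axis i 1]) = polar f (hs @ u # [axis i 1]) + polar f (hs @ v # [axis i 1])"
  by (rule polar_add[OF assms]) simp
 thus "\<alpha> * of_int (polar f (hs @ [u + v, axis i 1])) = \<alpha> * of_int (polar f (hs @ [u, axis i 1])) + \<alpha> * of_int (polar f (hs @ [v, axis i 1]))"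
  by (simp add: ring_distribs)
qed

lemma difsum_le:
 fixes f :: "int ^ 'n::finite => int"
 assumes L: "\<And>i. 1 \<le> L i" "\<And>i. L i \<le> P" and P: "P \<ge> 1"
 shows "dlt (Suc (k + 2)) f ==> difsum (Suc k) (ibox L) (\<lambda>x. \<alpha> * of_int (f x)) \<le>
  real (card (ibox L :: (int ^ 'n) set)) ^ Suc k * (\<Prod>i\<in>UNIV. 12 * real P * real (L i)) *
  (\<Sum>hs\<in>lists_in k (sbox P). real (card (LP (polar_lin \<alpha> f hs) P P)))"
proof (induction k arbitrary: f)
 case 0
 let ?lam = "\<lambda>i u. \<alpha> * of_int (polar f [u, axis i 1])"
 have add: "additive_forms ?lam" using additive_forms_polar[of "[]" f \<alpha>] 0 by simp
 have d3: "dlt (Suc (Suc (length [axis i (1::int)]))) f" for i :: 'n using 0 by (simp del: dlt.simps add: numeral_2_eq_2)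
 have eq: "difsum 0 (ibox L) (\<lambda>x. \<alpha> * of_int (f (y + x)) - \<alpha> * of_int (f (y' + x))) = (\<Prod>i\<in>UNIV. (cmod (dir (L i) (?lam i (y - y'))))\<^sup>2)" for y y'
  unfolding difsum.simps
 proof (rule cmod_expsum_2_affine)
  fix x :: "int ^ 'n"
  let ?g = "\<lambda>x. f (y + x) - f (y' + x)"
  have "dlt (Suc (Suc 0)) ?g" unfolding Dif_two_point using 0 by (intro dlt_shift) simp
  from affine_expand[OF this, of x] have "?g x = ?g 0 + (\<Sum>i\<in>UNIV. x $ i * polar f [y - y', axis i 1])"
   unfolding polar_two_point[OF d3] .
  hence "real_of_int (?g x) = real_of_int (?g 0) + (\<Sum>i\<in>UNIV. of_int (x $ i) * of_int (polar f [y - y', axis i 1]))"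
   by (simp only: of_int_add of_int_sum of_int_mult)
  hence "\<alpha> * real_of_int (?g x) = \<alpha> * real_of_int (?g 0) + (\<Sum>i\<in>UNIV. of_int (x $ i) * ?lam i (y - y'))"
   by (simp add: ring_distribs sum_distrib_left mult_ac)
  thus "\<alpha> * of_int (f (y + x)) - \<alpha> * of_int (f (y' + x)) = \<alpha> * real_of_int (?g 0) + (\<Sum>i\<in>UNIV. of_int (x $ i) * ?lam i (y - y'))"
   by (simp add: right_diff_distrib)
 qed
 have "difsum (Suc 0) (ibox L) (\<lambda>x. \<alpha> * of_int (f x)) = (\<Sum>y\<in>ibox L. \<Sum>y'\<in>ibox L. \<Prod>i\<in>UNIV. (cmod (dir (L i) (?lam i (y - y'))))\<^sup>2)"
  by (simp only: difsum.simps(2) eq)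
 also have "... = (\<Sum>y'\<in>ibox L. \<Sum>y\<in>ibox L. \<Prod>i\<in>UNIV. (cmod (dir (L i) (?lam i y + - ?lam i y')))\<^sup>2)"
  by (subst sum.swap) (simp add: additive_forms_diff[OF add])
 also have "... \<le> (\<Sum>y'\<in>(ibox L :: (int ^ 'n) set). real (card (LP ?lam P P)) * (\<Prod>i\<in>UNIV. 12 * real P * real (L i)))"
 proof (intro sum_mono sum_dir_le add)
  fix w w' :: "int^'n" and i assume "w \<in> ibox L" "w' \<in> ibox L"
  hence "0 \<le> w $ i \<and> w $ i < int (L i)" "0 \<le> w' $ i \<and> w' $ i < int (L i)" by (auto simp: ibox_def)
  thus "\<bar>w $ i - w' $ i\<bar> < int P" using L(2)[of i] by linarith
 qed (use L P in auto)
 finally show ?case by (simp add: mult_ac)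
next
 case (Suc k)
 let ?V = "real (card (ibox L :: (int ^ 'n) set))" and ?K = "\<Prod>i\<in>(UNIV::'n set). 12 * real P * real (L i)"
 let ?S = "\<lambda>h. \<Sum>hs\<in>lists_in k (sbox P). real (card (LP (\<lambda>i u. \<alpha> * of_int (polar f (h # hs @ [u, axis i 1]))) P P))"
 have step: "difsum (Suc k) (ibox L) (\<lambda>x. \<alpha> * of_int (f (y + x)) - \<alpha> * of_int (f (y' + x))) \<le> ?V ^ Suc k * ?K * ?S (y - y')" for y y'
 proof -
  let ?g = "\<lambda>x. f (y + x) - f (y' + x)"
  have g: "dlt (Suc (k + 2)) ?g" unfolding Dif_two_point using Suc.prems by (intro dlt_shift) simp
  have "polar ?g (hs @ [u, axis i 1]) = polar f ((y - y') # hs @ [u, axis i 1])" if "hs \<in> lists_in k (sbox P)" for hs u and i :: 'n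
  proof (rule polar_two_point)
   show "dlt (Suc (Suc (length (hs @ [u, axis i 1])))) f" using Suc.prems that by (simp del: dlt.simps add: lists_in_def)
  qed
  thus ?thesis using Suc.IH[OF g] by (simp add: right_diff_distrib)
 qed
 have "difsum (Suc (Suc k)) (ibox L) (\<lambda>x. \<alpha> * of_int (f x)) \<le> (\<Sum>y\<in>ibox L. \<Sum>y'\<in>ibox L. ?V ^ Suc k * ?K * ?S (y - y'))"
  unfolding difsum.simps(2)[of "Suc k"] by (intro sum_mono step)
 also have "... \<le> ?V * (\<Sum>h\<in>sbox P. ?V ^ Suc k * ?K * ?S h)"
  by (rule sum_two_point_le) (auto intro!: mult_nonneg_nonneg prod_nonneg sum_nonneg L)
 also have "... = ?V ^ Suc (Suc k) * ?K * (\<Sum>h\<in>sbox P. ?S h)" by (simp add: sum_distrib_left mult_ac)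
 finally show ?case unfolding sum_lists_in_Suc by simp
qed

definition near_ints :: "('n::finite => real) => nat => (int ^ 'n) set" where
 "near_ints g c = {w. \<forall>i. \<bar>g i - of_int (w $ i)\<bar> < 1 / real c}"

lemma finite_near_ints:
 fixes g :: "'n::finite => real"
 assumes c: "c \<ge> 1" shows "finite (near_ints g c)"
proof (rule finite_subset)
 show "near_ints g c \<subseteq> {w. \<forall>i. w $ i \<in> {\<lfloor>g i\<rfloor> - 1..\<lceil>g i\<rceil> + 1}}"
 proof (rule subsetI, rule CollectI, rule allI)
  fix w i assume "w \<in> near_ints g c"
  hence "\<bar>g i - of_int (w $ i)\<bar> < 1 / real c" by (simp add: near_ints_def)
  moreover have "1 / real c \<le> 1" using c by simp
  ultimately have "\<bar>g i - of_int (w $ i)\<bar> < 1" by linarith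
  hence "\<lfloor>g i\<rfloor> - 1 \<le> w $ i \<and> w $ i \<le> \<lceil>g i\<rceil> + 1" by linarith
  thus "w $ i \<in> {\<lfloor>g i\<rfloor> - 1..\<lceil>g i\<rceil> + 1}" by simp
 qed
 show "finite {w :: int ^ 'n. \<forall>i. w $ i \<in> {\<lfloor>g i\<rfloor> - 1..\<lceil>g i\<rceil> + 1}}" by (rule finite_vec_box) simp
qed

lemma card_LP_eq:
 assumes c: "c \<ge> 1" shows "card (LP lam a c) = (\<Sum>u\<in>sbox a. card (near_ints (\<lambda>i. lam i u) c))"
proof -
 have "LP lam a c = (SIGMA u:sbox a. near_ints (\<lambda>i. lam i u) c)" by (auto simp: LP_def sbox_def near_ints_def)
 thus ?thesis by (simp add: finite_near_ints[OF c])
qed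

text \<open>\<open>LP_shrink\<close>, applied to one variable of the polar form after another.\<close>
lemma shrink_all:
 fixes f :: "int ^ 'n::finite => int"
 assumes f: "dlt (Suc (k + 2)) f" and x: "x \<ge> 1" and M: "M \<ge> 1" and X: "X = 16 * x" and P: "P = X * M"
 shows "a + b = k ==>
  (\<Sum>us\<in>lists_in a (sbox X). \<Sum>vs\<in>lists_in b (sbox P). card (LP (\<lambda>i u. \<alpha> * of_int (polar f (us @ vs @ [u, axis i 1]))) P (P * M ^ a)))
  \<le> ((13824 * M) ^ CARD('n)) ^ Suc b *
   (\<Sum>us\<in>lists_in k (sbox X). card (LP (polar_lin \<alpha> f us) X (P * M ^ Suc k)))"
proof (induction b arbitrary: a)
 have P1: "P \<ge> 1" using x M by (simp add: P X)
 have sh: "card (LP (polar_lin \<alpha> f hs) P (P * M ^ a)) \<le>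
   (13824 * M) ^ CARD('n) * card (LP (polar_lin \<alpha> f hs) X (P * M ^ Suc a))"
  if "length hs = k" for hs a
 proof -
  let ?lam = "\<lambda>i u. \<alpha> * of_int (polar f (hs @ [u, axis i 1]))"
  have add: "additive_forms ?lam" by (rule additive_forms_polar) (use f that in simp)
  have E: "(\<Sum>i\<in>UNIV. of_int (w $ i) * ?lam i u) = \<alpha> * of_int (polar f (hs @ [u, w]))" for u w
  proof -
   have "polar f ((hs @ [u]) @ w # []) = (\<Sum>i\<in>UNIV. w $ i * polar f ((hs @ [u]) @ axis i 1 # []))"
    by (rule polar_expand[OF f]) (simp add: that)
   thus ?thesis by (simp add: sum_distrib_left mult_ac)
  qed
  have sw: "polar f (hs @ [u, w]) = polar f (hs @ [w, u])" for u w by (rule polar_perm) simp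
  have "card (LP ?lam P (P * M ^ a)) \<le> (13824 * M) ^ CARD('n) * card (LP ?lam X (P * M ^ a * M))"
   by (rule LP_shrink[OF add _ x M _ X P]) (use M in \<open>simp_all add: E sw\<close>)
  thus ?thesis by (simp add: mult_ac)
 qed
 {
  case 0
  hence "a = k" by simp
  have "(\<Sum>us\<in>lists_in a (sbox X). card (LP (polar_lin \<alpha> f us) P (P * M ^ a)))
   \<le> (\<Sum>us\<in>lists_in k (sbox X). (13824 * M) ^ CARD('n) * card (LP (polar_lin \<alpha> f us) X (P * M ^ Suc k)))"
   unfolding \<open>a = k\<close> by (intro sum_mono sh) (simp add: lists_in_def)
  thus ?case by (simp add: sum_distrib_left)
 next
  case (Suc b)
  let ?C = "(13824 * M) ^ CARD('n)"
  let ?c = "P * M ^ Suc a"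
  have c1: "?c \<ge> 1" using P1 M by simp
  have "(\<Sum>us\<in>lists_in a (sbox X). \<Sum>vs\<in>lists_in (Suc b) (sbox P). card (LP (\<lambda>i u. \<alpha> * of_int (polar f (us @ vs @ [u, axis i 1]))) P (P * M ^ a)))
   \<le> (\<Sum>us\<in>lists_in a (sbox X). \<Sum>vs\<in>lists_in (Suc b) (sbox P). ?C * card (LP (\<lambda>i u. \<alpha> * of_int (polar f (us @ vs @ [u, axis i 1]))) X ?c))"
  proof (intro sum_mono)
   fix us vs :: "(int ^ 'n) list" assume "us \<in> lists_in a (sbox X)" "vs \<in> lists_in (Suc b) (sbox P)"
   hence "length (us @ vs) = k" using Suc.prems by (simp add: lists_in_def)
   from sh[OF this] show "card (LP (\<lambda>i u. \<alpha> * of_int (polar f (us @ vs @ [u, axis i 1]))) P (P * M ^ a))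
     \<le> ?C * card (LP (\<lambda>i u. \<alpha> * of_int (polar f (us @ vs @ [u, axis i 1]))) X ?c)" by simp
  qed
  also have "... = ?C * (\<Sum>us\<in>lists_in a (sbox X). \<Sum>v\<in>sbox P. \<Sum>vs\<in>lists_in b (sbox P). \<Sum>u\<in>sbox X.
    card (near_ints (\<lambda>i. \<alpha> * of_int (polar f (us @ (v # vs) @ [u, axis i 1]))) ?c))"
   unfolding sum_lists_in_Suc card_LP_eq[OF c1] by (simp only: sum_distrib_left)
  also have "(\<Sum>us\<in>lists_in a (sbox X). \<Sum>v\<in>sbox P. \<Sum>vs\<in>lists_in b (sbox P). \<Sum>u\<in>sbox X.
    card (near_ints (\<lambda>i. \<alpha> * of_int (polar f (us @ (v # vs) @ [u, axis i 1]))) ?c))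
   = (\<Sum>us\<in>lists_in a (sbox X). \<Sum>v\<in>sbox P. \<Sum>vs\<in>lists_in b (sbox P). \<Sum>u\<in>sbox X.
    card (near_ints (\<lambda>i. \<alpha> * of_int (polar f ((u # us) @ vs @ [v, axis i 1]))) ?c))"
  proof -
   have "polar f (us @ (v # vs) @ [u, axis i 1]) = polar f ((u # us) @ vs @ [v, axis i 1])" for us v vs u and i :: 'n
    by (rule polar_perm) simp
   thus ?thesis by (simp only:)
  qed
  also have "... = (\<Sum>u\<in>sbox X. \<Sum>us\<in>lists_in a (sbox X). \<Sum>vs\<in>lists_in b (sbox P). \<Sum>v\<in>sbox P.
    card (near_ints (\<lambda>i. \<alpha> * of_int (polar f ((u # us) @ vs @ [v, axis i 1]))) ?c))"
  proof -
   have sw: "(\<Sum>us\<in>A. \<Sum>v\<in>B. \<Sum>vs\<in>C. \<Sum>u\<in>D. g us v vs u) = (\<Sum>u\<in>D. \<Sum>us\<in>A. \<Sum>vs\<in>C. \<Sum>v\<in>B. g us v vs u)"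
    for A :: "(int^'n) list set" and B :: "(int^'n) set" and C :: "(int^'n) list set" and D :: "(int^'n) set" and g :: "_ => _ => _ => _ => nat"
   proof -
    have "(\<Sum>us\<in>A. \<Sum>v\<in>B. \<Sum>vs\<in>C. \<Sum>u\<in>D. g us v vs u) = (\<Sum>us\<in>A. \<Sum>vs\<in>C. \<Sum>v\<in>B. \<Sum>u\<in>D. g us v vs u)"
     by (intro sum.cong refl sum.swap)
    also have "... = (\<Sum>us\<in>A. \<Sum>vs\<in>C. \<Sum>u\<in>D. \<Sum>v\<in>B. g us v vs u)" by (intro sum.cong refl sum.swap)
    also have "... = (\<Sum>us\<in>A. \<Sum>u\<in>D. \<Sum>vs\<in>C. \<Sum>v\<in>B. g us v vs u)" by (intro sum.cong refl sum.swap)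
    also have "... = (\<Sum>u\<in>D. \<Sum>us\<in>A. \<Sum>vs\<in>C. \<Sum>v\<in>B. g us v vs u)" by (rule sum.swap)
    finally show ?thesis .
   qed
   show ?thesis by (rule sw)
  qed
  also have "... = (\<Sum>us\<in>lists_in (Suc a) (sbox X). \<Sum>vs\<in>lists_in b (sbox P). card (LP (\<lambda>i u. \<alpha> * of_int (polar f (us @ vs @ [u, axis i 1]))) P ?c))"
   unfolding sum_lists_in_Suc card_LP_eq[OF c1] ..
  also have "?C * ... \<le> ?C * (?C ^ Suc b * (\<Sum>us\<in>lists_in k (sbox X). card (LP (polar_lin \<alpha> f us) X (P * M ^ Suc k))))"
   using Suc.prems by (intro mult_left_mono Suc.IH) auto
  finally show ?case by (simp only: power_Suc mult_ac)
 }
qed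

lemma polar_bound:
 fixes f :: "int ^ 'n::finite => int"
 assumes f: "dlt (Suc d) f"
 shows "k + length ts = d ==> \<exists>C::nat. \<forall>X. \<forall>hs\<in>lists_in k (sbox X). \<bar>polar f (hs @ ts)\<bar> \<le> int (C * X ^ k)"
proof (induction k arbitrary: ts)
 case 0
 show ?case by (rule exI[of _ "nat \<bar>polar f ts\<bar>"]) simp
next
 case (Suc k)
 have "\<exists>C::nat. \<forall>X. \<forall>hs\<in>lists_in k (sbox X). \<bar>polar f (hs @ axis j 1 # ts)\<bar> \<le> int (C * X ^ k)" for j
  using Suc.IH[of "axis j 1 # ts"] Suc.prems by simp
 hence "\<exists>C::'n => nat. \<forall>j. \<forall>X. \<forall>hs\<in>lists_in k (sbox X). \<bar>polar f (hs @ axis j 1 # ts)\<bar> \<le> int (C j * X ^ k)"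
  by (intro choice allI)
 then obtain C :: "'n => nat" where C: "\<forall>j. \<forall>X. \<forall>hs\<in>lists_in k (sbox X). \<bar>polar f (hs @ axis j 1 # ts)\<bar> \<le> int (C j * X ^ k)"
  by (elim exE) (rule that)
 show ?case
 proof (intro exI allI ballI)
  fix X and ks :: "(int ^ 'n) list" assume "ks \<in> lists_in (Suc k) (sbox X)"
  then obtain h hs where ks: "ks = h # hs" "h \<in> sbox X" "hs \<in> lists_in k (sbox X)"
   by (cases ks) (auto simp: lists_in_def)
  have len: "Suc (length [] + length (hs @ ts)) = d" using ks Suc.prems by (simp add: lists_in_def)
  have mv: "polar f (axis j 1 # hs @ ts) = polar f (hs @ axis j 1 # ts)" for j by (rule polar_perm) simp
  have "polar f (ks @ ts) = (\<Sum>j\<in>UNIV. h $ j * polar f (hs @ axis j 1 # ts))"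
   using polar_expand[OF f len, of h] by (simp add: ks mv)
  hence "\<bar>polar f (ks @ ts)\<bar> \<le> (\<Sum>j\<in>UNIV. \<bar>h $ j * polar f (hs @ axis j 1 # ts)\<bar>)" by (simp add: sum_abs)
  also have "... \<le> (\<Sum>j\<in>UNIV. int X * int (C j * X ^ k))"
   unfolding abs_mult using ks C by (intro sum_mono mult_mono) (auto simp: sbox_def less_imp_le)
  also have "... = int (sum C UNIV * X ^ Suc k)" by (simp add: sum_distrib_left sum_distrib_right mult_ac)
  finally show "\<bar>polar f (ks @ ts)\<bar> \<le> int (sum C UNIV * X ^ Suc k)" .
 qed
qed

text \<open>\<open>\<alpha>\<close> has a rational approximation with denominator at most \<open>Q\<close>, up to an
  error \<open>\<delta>\<close> after multiplication by the denominator.\<close>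
definition major :: "nat => real => real => bool" where
 "major Q \<delta> \<alpha> \<longleftrightarrow> (\<exists>q b. 1 \<le> q \<and> q \<le> Q \<and> \<bar>real q * \<alpha> - of_int b\<bar> < \<delta>)"

text \<open>Off the major arcs a nonzero value of a polar form bounded by \<open>Q\<close> cannot have
  \<open>\<alpha>\<close>-multiple within \<open>1/c\<close> of an integer.\<close>
lemma count_near_le:
 fixes f :: "int ^ 'n::finite => int"
 assumes P: "c \<ge> 1"
  and C: "\<And>hs i. hs \<in> lists_in (Suc k) (sbox X) ==> \<bar>polar f (hs @ [axis i 1])\<bar> \<le> int Q"
  and minor: "\<not> major Q (1 / real c) \<alpha>"
 shows "(\<Sum>us\<in>lists_in k (sbox X). card (LP (polar_lin \<alpha> f us) X c))
  \<le> card {hs \<in> lists_in (Suc k) (sbox X). \<forall>i. polar f (hs @ [axis i 1]) = 0}"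
proof -
 let ?Z = "\<lambda>hs. \<forall>i. polar f (hs @ [axis i 1]) = 0"
 have mv: "polar f (us @ [u, axis i 1]) = polar f ((u # us) @ [axis i 1])" for us u and i :: 'n
  by (rule polar_perm) simp
 have one: "card (near_ints (\<lambda>i. \<alpha> * of_int (polar f (hs @ [axis i 1]))) c) \<le> (if ?Z hs then 1 else 0)"
  if hs: "hs \<in> lists_in (Suc k) (sbox X)" for hs
 proof (cases "?Z hs")
  case True
  have "near_ints (\<lambda>i. \<alpha> * of_int (polar f (hs @ [axis i 1]))) c \<subseteq> {0}"
  proof
   fix w assume "w \<in> near_ints (\<lambda>i. \<alpha> * of_int (polar f (hs @ [axis i 1]))) c"
   hence "\<bar>real_of_int (w $ i)\<bar> < 1 / real c" for i using True by (simp add: near_ints_def)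
   moreover have "1 / real c \<le> 1" using P by simp
   ultimately have "\<bar>real_of_int (w $ i)\<bar> < 1" for i by (meson less_le_trans)
   hence "w $ i = 0" for i by (metis abs_less_iff of_int_less_1_iff of_int_minus abs_zero int_one_le_iff_zero_less linorder_neqE_linordered_idom neg_0_less_iff_less not_le)
   thus "w \<in> {0}" by (simp add: vec_eq_iff)
  qed
  hence "card (near_ints (\<lambda>i. \<alpha> * of_int (polar f (hs @ [axis i 1]))) c) \<le> card {0 :: int ^ 'n}"
   by (intro card_mono) auto
  thus ?thesis using True by simp
 next
  case False
  then obtain i where i: "polar f (hs @ [axis i 1]) \<noteq> 0" by blast
  let ?D = "polar f (hs @ [axis i 1])"
  have "near_ints (\<lambda>i. \<alpha> * of_int (polar f (hs @ [axis i 1]))) c = {}"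
  proof (rule ccontr)
   assume "near_ints (\<lambda>i. \<alpha> * of_int (polar f (hs @ [axis i 1]))) c \<noteq> {}"
   then obtain w where w: "\<bar>\<alpha> * of_int ?D - of_int (w $ i)\<bar> < 1 / real c" unfolding near_ints_def by blast
   have "int (nat \<bar>?D\<bar>) = sgn ?D * ?D" by (simp add: sgn_if)
   hence "real (nat \<bar>?D\<bar>) = of_int (sgn ?D) * of_int ?D" by (metis of_int_mult of_int_of_nat_eq)
   hence "real (nat \<bar>?D\<bar>) * \<alpha> - of_int (sgn ?D * w $ i) = of_int (sgn ?D) * (\<alpha> * of_int ?D - of_int (w $ i))"
    by (simp add: algebra_simps)
   moreover have "\<bar>real_of_int (sgn ?D)\<bar> = 1" using i by (simp add: sgn_if)
   ultimately have "\<bar>real (nat \<bar>?D\<bar>) * \<alpha> - of_int (sgn ?D * w $ i)\<bar> < 1 / real c" using w by (simp only: abs_mult mult_1)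
   moreover have "1 \<le> nat \<bar>?D\<bar>" "nat \<bar>?D\<bar> \<le> Q" using i C[OF hs, of i] by auto
   ultimately show False using minor unfolding major_def by blast
  qed
  thus ?thesis by simp
 qed
 have "(\<Sum>us\<in>lists_in k (sbox X). card (LP (polar_lin \<alpha> f us) X c))
   = (\<Sum>us\<in>lists_in k (sbox X). \<Sum>u\<in>sbox X. card (near_ints (\<lambda>i. \<alpha> * of_int (polar f ((u # us) @ [axis i 1]))) c))"
  by (simp only: card_LP_eq[OF P] mv)
 also have "... = (\<Sum>hs\<in>lists_in (Suc k) (sbox X). card (near_ints (\<lambda>i. \<alpha> * of_int (polar f (hs @ [axis i 1]))) c))"
  unfolding sum_lists_in_Suc by (rule sum.swap)
 also have "... \<le> (\<Sum>hs\<in>lists_in (Suc k) (sbox X). if ?Z hs then 1 else 0)" by (intro sum_mono one)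
 also have "... = card {hs \<in> lists_in (Suc k) (sbox X). ?Z hs}" by (simp add: sum.If_cases Int_def conj_commute)
 finally show ?thesis .
qed

text \<open>Here \<open>16 x\<close> is the side of the shrunken box and \<open>16 x M\<close> a bound for the sides
  of the given one.\<close>
lemma weyl_inequality:
 fixes F :: "'n::finite int_mpoly"
 assumes F: "is_form d F" and sm: "smooth_form F" and d: "d \<ge> 2"
 shows "\<exists>C0 C1. C0 > 0 \<and> C1 \<ge> 1 \<and> (\<forall>x M \<alpha> c L. x \<ge> 1 --> M \<ge> 1 --> (\<forall>i. 1 \<le> L i \<and> L i \<le> 16 * x * M) -->
   \<not> major (C1 * (16 * x) ^ (d - 1)) ((16 * real x) ^ (d - 1) / (16 * real x * real M) ^ d) \<alpha> -->
   cmod (expsum (d + 1) (ibox L) (\<lambda>y. \<alpha> * of_int (mpoly_eval F (c + y)))) \<le>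
    C0 * real (card (ibox L :: (int ^ 'n) set)) ^ d * (16 * real x * real M) ^ CARD('n) * (16 * real x) powr (- (real CARD('n) / 2 ^ (d - 1))))"
proof -
 let ?n = "CARD('n)"
 let ?f = "mpoly_eval F :: int ^ 'n => int"
 obtain k where k: "d = k + 2" using d by (metis add.commute le_Suc_ex)
 have f: "dlt (Suc (k + 2)) ?f" using dlt_mpoly[OF F] unfolding k .
 have "\<exists>C::'n => nat. \<forall>i. \<forall>X. \<forall>hs\<in>lists_in (Suc k) (sbox X). \<bar>polar ?f (hs @ [axis i 1])\<bar> \<le> int (C i * X ^ Suc k)"
  by (intro choice allI polar_bound[OF f]) simp
 then obtain C :: "'n => nat" where C: "\<forall>i. \<forall>X. \<forall>hs\<in>lists_in (Suc k) (sbox X). \<bar>polar ?f (hs @ [axis i 1])\<bar> \<le> int (C i * X ^ Suc k)"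
  by (elim exE) (rule that)
 define C1 where "C1 = 1 + sum C UNIV"
 have C1: "\<bar>polar ?f (hs @ [axis i 1])\<bar> \<le> int (C1 * X ^ Suc k)" if "hs \<in> lists_in (Suc k) (sbox X)" for hs X i
 proof -
  have "C i \<le> C1" using member_le_sum[of i UNIV C] by (simp add: C1_def)
  hence "int (C i * X ^ Suc k) \<le> int (C1 * X ^ Suc k)" by (simp only: of_nat_le_iff mult_right_mono)
  moreover have "\<bar>polar ?f (hs @ [axis i 1])\<bar> \<le> int (C i * X ^ Suc k)" using C that by blast
  ultimately show ?thesis by (rule order_trans[rotated])
 qed
 obtain E where E: "\<And>X. card {hs \<in> lists_in (d - 1) (sbox X). \<forall>i. polar ?f (hs @ [axis i 1]) = 0} \<le> E * X ^ (?n * (d - 2))"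
  using birch_count[OF assms] by blast
 define K where "K = 12 ^ ?n * (13824 ^ ?n) ^ Suc k * real E + 1"
 have K1: "K \<ge> 1" by (simp add: K_def)
 have main: "cmod (expsum (d + 1) (ibox L) (\<lambda>y. \<alpha> * of_int (?f (c + y)))) \<le>
    K * real (card (ibox L :: (int ^ 'n) set)) ^ d * (16 * real x * real M) ^ ?n * (16 * real x) powr (- (real ?n / 2 ^ (d - 1)))"
  if x: "x \<ge> 1" and M: "M \<ge> 1" and L: "\<forall>i. 1 \<le> L i \<and> L i \<le> 16 * x * M"
   and mi: "\<not> major (C1 * (16 * x) ^ (d - 1)) ((16 * real x) ^ (d - 1) / (16 * real x * real M) ^ d) \<alpha>"
  for x M :: nat and \<alpha> and c :: "int ^ 'n" and L :: "'n => nat"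
 proof -
  define X where "X = 16 * x"
  define P where "P = X * M"
  define V where "V = real (card (ibox L :: (int ^ 'n) set))"
  define g where "g y = ?f (y + c)" for y
  define m where "m = (2::nat) ^ Suc k"
  let ?S = "cmod (expsum (Suc k + 2) (ibox L) (\<lambda>y. \<alpha> * of_int (g y)))"
  have X1: "X \<ge> 1" and P1: "P \<ge> 1" using x M by (auto simp: X_def P_def)
  have m1: "m \<ge> 1" "m \<ge> d"
  proof -
   show "m \<ge> 1" by (simp add: m_def)
   have "n + 1 \<le> 2 ^ n" for n :: nat by (induction n) auto
   from this[of "Suc k"] show "m \<ge> d" by (simp add: m_def k)
  qed
  have V1: "V \<ge> 1"
  proof -
   have "(\<Prod>i\<in>(UNIV::'n set). (1::nat)) \<le> (\<Prod>i\<in>UNIV. L i)" by (rule prod_mono) (use L in auto)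
   thus ?thesis by (simp add: V_def card_ibox del: of_nat_prod)
  qed
  have VL: "V = (\<Prod>i\<in>UNIV. real (L i))" by (simp add: V_def card_ibox)
  have VP: "V \<le> real P ^ ?n"
  proof -
   have "V \<le> (\<Prod>i\<in>(UNIV::'n set). real P)" unfolding VL by (rule prod_mono) (use L in \<open>auto simp: P_def X_def simp del: of_nat_mult\<close>)
   thus ?thesis by simp
  qed
  have pg: "polar g hs = polar ?f hs" if "length hs = k + 2" for hs
  proof -
   have "polar g hs = Difs hs ?f (0 + c)" unfolding polar_def g_def[abs_def] Difs_shift ..
   thus ?thesis using Difs_const[OF f that] by simp
  qed
  have dg: "dlt (Suc (k + 2)) g" unfolding g_def[abs_def] using f by (rule dlt_shift)
  let ?NT = "\<Sum>hs\<in>lists_in k (sbox P). card (LP (polar_lin \<alpha> g hs) P P)"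
  let ?NX = "\<Sum>us\<in>lists_in k (sbox X). card (LP (polar_lin \<alpha> g us) X (P * M ^ Suc k))"
  have cc: "1 / real (P * M ^ Suc k) = (16 * real x) ^ (d - 1) / (16 * real x * real M) ^ d"
   using x M by (simp add: P_def X_def k field_simps power_mult_distrib)
  have "?NX \<le> card {hs \<in> lists_in (Suc k) (sbox X). \<forall>i. polar g (hs @ [axis i 1]) = 0}"
  proof (rule count_near_le)
   show "1 \<le> P * M ^ Suc k" using P1 M by simp
   show "\<bar>polar g (hs @ [axis i 1])\<bar> \<le> int (C1 * X ^ Suc k)" if "hs \<in> lists_in (Suc k) (sbox X)" for hs i
    using C1[OF that, of i] that by (subst pg) (auto simp: lists_in_def)
   show "\<not> major (C1 * X ^ Suc k) (1 / real (P * M ^ Suc k)) \<alpha>" unfolding cc using mi by (simp add: X_def k)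
  qed
  also have "{hs \<in> lists_in (Suc k) (sbox X). \<forall>i. polar g (hs @ [axis i 1]) = 0} = {hs \<in> lists_in (d - 1) (sbox X). \<forall>i. polar ?f (hs @ [axis i 1]) = 0}"
   by (rule Collect_cong) (auto simp: k lists_in_def pg)
  also have "card ... \<le> E * X ^ (?n * (d - 2))" by (rule E)
  finally have NX: "?NX \<le> E * X ^ (?n * k)" by (simp add: k)
  have "?NT \<le> ((13824 * M) ^ ?n) ^ Suc k * ?NX"
   using shrink_all[OF dg x M X_def P_def, of 0 k \<alpha>] by simp
  also have "... \<le> ((13824 * M) ^ ?n) ^ Suc k * (E * X ^ (?n * k))" by (intro mult_left_mono NX) simp
  finally have NT: "real ?NT \<le> real (((13824 * M) ^ ?n) ^ Suc k * (E * X ^ (?n * k)))" by (simp only: of_nat_le_iff)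
  have "V ^ (2 * Suc k + 2) * ?S ^ m \<le> V ^ ((Suc k + 2) * m) * difsum (Suc k) (ibox L) (\<lambda>y. \<alpha> * of_int (g y))"
   unfolding V_def m_def by (rule weyl_differencing) simp
  also have "... \<le> V ^ ((Suc k + 2) * m) * (V ^ Suc k * (\<Prod>i\<in>UNIV. 12 * real P * real (L i)) * real ?NT)"
   unfolding V_def of_nat_sum using L by (intro mult_left_mono difsum_le dg P1) (auto simp: P_def X_def)
  also have "(\<Prod>i\<in>UNIV. 12 * real P * real (L i)) = (12 * real P) ^ ?n * V" by (simp add: VL prod.distrib)
  also have "V ^ ((Suc k + 2) * m) * (V ^ Suc k * ((12 * real P) ^ ?n * V) * real ?NT)
    \<le> V ^ ((Suc k + 2) * m) * (V ^ Suc k * ((12 * real P) ^ ?n * V) * real (((13824 * M) ^ ?n) ^ Suc k * (E * X ^ (?n * k))))"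
   using V1 by (intro mult_left_mono NT) auto
  also have "... = V ^ ((Suc k + 2) * m + d) * ((12 * real P) ^ ?n * (((13824 * real M) ^ ?n) ^ Suc k * (real E * real X ^ (?n * k))))"
   by (simp add: k power_add algebra_simps)
  also have "(12 * real P) ^ ?n * (((13824 * real M) ^ ?n) ^ Suc k * (real E * real X ^ (?n * k))) = (K - 1) * real P ^ (?n * d) / real X ^ ?n"
  proof -
  have "(12 * real P) ^ ?n * (((13824 * real M) ^ ?n) ^ Suc k * (real E * real X ^ (?n * k))) * real X ^ ?n = (K - 1) * real P ^ (?n * d)"
  proof -
   have 1: "real P ^ (?n * Suc k) = (real M ^ ?n) ^ Suc k * real X ^ (?n * k) * real X ^ ?n"
   proof -
    have "real X ^ (?n * Suc k) = real X ^ (?n * k) * real X ^ ?n" by (simp add: power_add)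
    thus ?thesis unfolding P_def of_nat_mult power_mult_distrib by (simp only: power_mult mult_ac)
   qed
   have 2: "real P ^ (?n * d) = real P ^ ?n * real P ^ (?n * Suc k)" by (simp add: k power_add[symmetric])
   show ?thesis unfolding 2 1 K_def by (simp only: power_mult_distrib) (simp add: mult_ac)
  qed
  thus ?thesis using X1 by (subst eq_divide_eq) simp
  qed
  also have "V ^ ((Suc k + 2) * m + d) * ((K - 1) * real P ^ (?n * d) / real X ^ ?n) \<le> V ^ ((Suc k + 2) * m + d) * (K * real P ^ (?n * d) / real X ^ ?n)"
   using V1 by (intro mult_left_mono divide_right_mono mult_right_mono) auto
  finally have "V ^ (2 * d) * ?S ^ m \<le> V ^ ((Suc k + 2) * m + d) * (K * real P ^ (?n * d) / real X ^ ?n)" by (simp add: k)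
  also have "V ^ ((Suc k + 2) * m + d) = V ^ (d * m) * V ^ (m - d) * V ^ (2 * d)"
  proof -
   have "(Suc k + 2) * m + d = d * m + (m - d) + 2 * d" using m1 by (simp add: k algebra_simps)
   thus ?thesis by (simp only: power_add)
  qed
  also have "V ^ (d * m) * V ^ (m - d) * V ^ (2 * d) * (K * real P ^ (?n * d) / real X ^ ?n)
    = V ^ (2 * d) * (V ^ (d * m) * V ^ (m - d) * (K * real P ^ (?n * d) / real X ^ ?n))" by simp
  finally have "?S ^ m \<le> V ^ (d * m) * V ^ (m - d) * (K * real P ^ (?n * d) / real X ^ ?n)"
   using V1 by (subst (asm) mult_le_cancel_left_pos) auto
  also have "... \<le> V ^ (d * m) * (real P ^ ?n) ^ (m - d) * (K * real P ^ (?n * d) / real X ^ ?n)"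
   using V1 VP K1 by (intro mult_right_mono mult_left_mono power_mono) auto
  also have "... = V ^ (d * m) * real P ^ (?n * m) * K / real X ^ ?n"
  proof -
   have "(real P ^ ?n) ^ (m - d) * real P ^ (?n * d) = real P ^ (?n * m)"
    using m1 by (simp add: power_mult[symmetric] power_add[symmetric] distrib_left[symmetric])
   thus ?thesis by (simp add: mult_ac)
  qed
  also have "... \<le> V ^ (d * m) * real P ^ (?n * m) * K ^ m / real X ^ ?n"
   using K1 m1 V1 self_le_power[of K m] by (intro divide_right_mono mult_left_mono) auto
  also have "... = (K * V ^ d * real P ^ ?n * real X powr (- (real ?n / real m))) ^ m"
  proof -
   have "(real X powr (- (real ?n / real m))) ^ m = real X powr (- real ?n)"
    using X1 m1 by (simp add: powr_powr[symmetric] powr_realpow[symmetric] powr_powr)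
   also have "... = 1 / real X ^ ?n" using X1 by (simp add: powr_minus powr_realpow divide_inverse)
   finally have e: "(real X powr (- (real ?n / real m))) ^ m = 1 / real X ^ ?n" .
   show ?thesis unfolding power_mult_distrib e power_mult by simp
  qed
  finally have "?S ^ m \<le> (K * V ^ d * real P ^ ?n * real X powr (- (real ?n / real m))) ^ m" .
  moreover have sm: "Suc (m - 1) = m" using m1 by simp
  ultimately have "?S ^ Suc (m - 1) \<le> (K * V ^ d * real P ^ ?n * real X powr (- (real ?n / real m))) ^ Suc (m - 1)"
   by (simp only: sm)
  hence "?S \<le> K * V ^ d * real P ^ ?n * real X powr (- (real ?n / real m))"
   by (rule power_le_imp_le_base) (use K1 V1 in auto)
  thus ?thesis unfolding V_def m_def P_def X_def g_def by (simp add: k add.commute mult_ac)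
 qed
 show ?thesis
  by (rule exI[of _ K], rule exI[of _ C1]) (use K1 main in \<open>auto simp: C1_def\<close>)
qed

section \<open>The circle method for spline counts\<close>

lemma card_int_interval_le:
 assumes "0 \<le> r" shows "real (card {a::int. \<bar>of_int a - y\<bar> < r}) \<le> 2 * r + 1"
proof -
 have sub: "{a::int. \<bar>of_int a - y\<bar> < r} \<subseteq> {\<lceil>y - r\<rceil>..\<lfloor>y + r\<rfloor>}"
 proof
  fix a :: int assume "a \<in> {a. \<bar>of_int a - y\<bar> < r}"
  hence "y - r \<le> of_int a" "of_int a \<le> y + r" by (auto simp: abs_less_iff)
  thus "a \<in> {\<lceil>y - r\<rceil>..\<lfloor>y + r\<rfloor>}" by (simp add: ceiling_le_iff le_floor_iff)
 qed
 have "card {a::int. \<bar>of_int a - y\<bar> < r} \<le> nat (\<lfloor>y + r\<rfloor> - \<lceil>y - r\<rceil> + 1)"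
  using card_mono[OF _ sub] by simp
 also have "real (nat (\<lfloor>y + r\<rfloor> - \<lceil>y - r\<rceil> + 1)) \<le> 2 * r + 1" using assms by linarith
 finally show ?thesis by simp
qed

lemma finite_int_interval: "finite {a::int. \<bar>of_int a - y\<bar> < (r::real)}"
proof (rule finite_subset)
 show "{a::int. \<bar>of_int a - y\<bar> < r} \<subseteq> {\<lfloor>y - r\<rfloor>..\<lceil>y + r\<rceil>}"
 proof
  fix a :: int assume "a \<in> {a. \<bar>of_int a - y\<bar> < r}"
  hence "y - r \<le> of_int a" "of_int a \<le> y + r" by (auto simp: abs_less_iff)
  thus "a \<in> {\<lfloor>y - r\<rfloor>..\<lceil>y + r\<rceil>}" by (auto; linarith)
 qed
qed simp

lemma card_major_le:
 assumes N: "real Q \<le> real N * \<delta>" and \<delta>: "0 < \<delta>" "\<delta> \<le> 1" and Q: "1 \<le> Q"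
 shows "real (card {a\<in>{0..<int N}. major Q \<delta> (of_int a / real N)}) \<le> 12 * real Q * \<delta> * real N"
proof -
 have N0: "real N > 0" using N Q \<delta> by (cases N) auto
 let ?I = "\<lambda>q b. {a::int. \<bar>of_int a - of_int b * real N / real q\<bar> < \<delta> * real N / real q}"
 have sub: "{a\<in>{0..<int N}. major Q \<delta> (of_int a / real N)} \<subseteq> (\<Union>q\<in>{1..Q}. \<Union>b\<in>{-1..int q + 1}. ?I q b)"
 proof
  fix a assume "a \<in> {a\<in>{0..<int N}. major Q \<delta> (of_int a / real N)}"
  then obtain q b where a: "0 \<le> a" "a < int N" and q: "1 \<le> q" "q \<le> Q" and b: "\<bar>real q * (of_int a / real N) - of_int b\<bar> < \<delta>"
   unfolding major_def by auto
  have q0: "real q > 0" using q by simp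
  have "0 \<le> real q * (of_int a / real N)" using a by simp
  moreover have "real q * (of_int a / real N) \<le> real q * 1" using a N0 by (intro mult_left_mono) auto
  ultimately have "-1 < real_of_int b" "real_of_int b < real q + 1" using b \<delta> by linarith+
  hence "-1 \<le> b \<and> b \<le> int q + 1" by linarith
  have eq: "\<bar>of_int a - of_int b * real N / real q\<bar> = \<bar>real q * (of_int a / real N) - of_int b\<bar> * (real N / real q)"
  proof -
   have "of_int a - of_int b * real N / real q = (real q * (of_int a / real N) - of_int b) * (real N / real q)"
    using q0 N0 by (simp add: field_simps)
   thus ?thesis using q0 N0 by (simp add: abs_mult)
  qed
  have "\<bar>of_int a - of_int b * real N / real q\<bar> < \<delta> * (real N / real q)"
   unfolding eq by (rule mult_strict_right_mono[OF b]) (use q0 N0 in simp)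
  hence "a \<in> ?I q b" by simp
  moreover have "b \<in> {-1..int q + 1}" using \<open>-1 \<le> b \<and> b \<le> int q + 1\<close> by simp
  moreover have "q \<in> {1..Q}" using q by simp
  ultimately show "a \<in> (\<Union>q\<in>{1..Q}. \<Union>b\<in>{-1..int q + 1}. ?I q b)" by blast
 qed
 have fin: "finite (\<Union>q\<in>{1..Q}. \<Union>b\<in>{-1..int q + 1}. ?I q b)"
  by (intro finite_UN_I finite_int_interval) auto
 have "card {a\<in>{0..<int N}. major Q \<delta> (of_int a / real N)} \<le> card (\<Union>q\<in>{1..Q}. \<Union>b\<in>{-1..int q + 1}. ?I q b)"
  by (rule card_mono[OF fin sub])
 also have "... \<le> (\<Sum>q\<in>{1..Q}. card (\<Union>b\<in>{-1..int q + 1}. ?I q b))" by (rule card_UN_le) simp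
 also have "... \<le> (\<Sum>q\<in>{1..Q}. \<Sum>b\<in>{-1..int q + 1}. card (?I q b))" by (intro sum_mono card_UN_le) simp
 finally have "real (card {a\<in>{0..<int N}. major Q \<delta> (of_int a / real N)}) \<le> (\<Sum>q\<in>{1..Q}. \<Sum>b\<in>{-1..int q + 1}. real (card (?I q b)))"
  by (simp only: of_nat_sum[symmetric] of_nat_le_iff)
 also have "... \<le> (\<Sum>q\<in>{1..Q}. 12 * \<delta> * real N)"
 proof (rule sum_mono)
  fix q assume q: "q \<in> {1..Q}"
  hence q0: "real q > 0" by simp
  have "real q \<le> \<delta> * real N" using q N by (simp add: mult.commute)
  hence one: "1 \<le> \<delta> * real N / real q" using q0 by simp
  have "(\<Sum>b\<in>{-1..int q + 1}. real (card (?I q b))) \<le> (\<Sum>b\<in>{-1..int q + 1}. 3 * (\<delta> * real N / real q))"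
  proof (rule sum_mono)
   fix b
   have "real (card (?I q b)) \<le> 2 * (\<delta> * real N / real q) + 1" by (rule card_int_interval_le) (use \<delta> in simp)
   thus "real (card (?I q b)) \<le> 3 * (\<delta> * real N / real q)" using one by linarith
  qed
  also have "... = (real q + 3) * (3 * (\<delta> * real N / real q))" by simp
  also have "... \<le> (4 * real q) * (3 * (\<delta> * real N / real q))"
   using q \<delta> by (intro mult_right_mono) auto
  also have "... = 12 * \<delta> * real N" using q0 by simp
  finally show "(\<Sum>b\<in>{-1..int q + 1}. real (card (?I q b))) \<le> 12 * \<delta> * real N" .
 qed
 also have "... = 12 * real Q * \<delta> * real N" by simp
 finally show ?thesis .
qed

lemma sum_cis_orthogonal:
 assumes N: "N \<ge> 1" and k: "\<bar>k\<bar> < int N"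
 shows "(\<Sum>a\<in>{0..<int N}. cis (2 * pi * (of_int a / real N * of_int k))) = (if k = 0 then of_nat N else 0)"
proof -
 have eq: "(\<Sum>a\<in>{0..<int N}. cis (2 * pi * (of_int a / real N * of_int k))) = dir N (of_int k / real N)"
  unfolding dir_def by (intro sum.cong refl) (simp add: mult_ac)
 show ?thesis
 proof (cases "k = 0")
  case True thus ?thesis by simp
 next
  case False
  have "2 * pi * real N * (of_int k / real N) = 2 * pi * of_int k" using N by simp
  hence "cis (2 * pi * real N * (of_int k / real N)) = 1" by (simp only: cis_multiple_2pi Ints_of_int)
  hence z: "dir N (of_int k / real N) * (cis (2 * pi * (of_int k / real N)) - 1) = 0"
   using dir_geom[of N "of_int k / real N"] by simp
  have "sin (pi * (of_int k / real N)) \<noteq> 0"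
  proof
   assume "sin (pi * (of_int k / real N)) = 0"
   then obtain i :: int where "pi * (of_int k / real N) = of_int i * pi" by (auto simp: sin_zero_iff_int2)
   hence "pi * (of_int k / real N) = pi * of_int i" by (simp only: mult.commute)
   hence "of_int k / real N = of_int i" by (simp only: mult_cancel_left pi_neq_zero simp_thms)
   hence "real_of_int k = of_int i * real N" using N by (simp add: field_simps)
   hence "k = i * int N" by (metis of_int_eq_iff of_int_mult of_int_of_nat_eq)
   hence "int N dvd k" by simp
   hence "int N \<le> \<bar>k\<bar>" using dvd_imp_le_int[OF False] by fastforce
   thus False using k by simp
  qed
  hence "cis (2 * (pi * (of_int k / real N))) - 1 \<noteq> 0"
   using cmod_cis_minus_1[of "pi * (of_int k / real N)"] by (metis abs_eq_0 mult_eq_0_iff norm_eq_zero zero_neq_numeral)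
  hence "dir N (of_int k / real N) = 0" using z by (simp add: mult.assoc)
  thus ?thesis using False eq by simp
 qed
qed

text \<open>Spline counts: the number of \<open>(w_1, ..., w_k)\<close> in a box with \<open>f (c + w_1 + ... + w_k)
  = m\<close>.\<close>
definition reps :: "nat => (int ^ 'n::finite => int) => ('n => nat) => int ^ 'n => int => nat" where
 "reps k f L c m = card {ws \<in> lists_in k (ibox L). f (c + sum_list ws) = m}"

lemma reps_fourier:
 fixes f :: "int ^ 'n::finite => int"
 assumes N: "N \<ge> 1" "\<And>ws. ws \<in> lists_in k (ibox L) ==> \<bar>f (c + sum_list ws) - m\<bar> < int N"
 shows "of_nat N * of_nat (reps k f L c m) = (\<Sum>a\<in>{0..<int N}. expsum k (ibox L) (\<lambda>y. of_int a / real N * of_int (f (c + y))) * cis (- (2 * pi * (of_int a / real N * of_int m))))"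
proof -
 have "(\<Sum>a\<in>{0..<int N}. expsum k (ibox L) (\<lambda>y. of_int a / real N * of_int (f (c + y))) * cis (- (2 * pi * (of_int a / real N * of_int m))))
   = (\<Sum>a\<in>{0..<int N}. \<Sum>ws\<in>lists_in k (ibox L). cis (2 * pi * (of_int a / real N * of_int (f (c + sum_list ws) - m))))"
  unfolding expsum_def sum_distrib_right by (intro sum.cong refl) (simp add: cis_mult algebra_simps)
 also have "... = (\<Sum>ws\<in>lists_in k (ibox L). \<Sum>a\<in>{0..<int N}. cis (2 * pi * (of_int a / real N * of_int (f (c + sum_list ws) - m))))"
  by (rule sum.swap)
 also have "... = (\<Sum>ws\<in>lists_in k (ibox L). if f (c + sum_list ws) - m = 0 then of_nat N else 0)"
  by (intro sum.cong refl sum_cis_orthogonal N)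
 also have "... = of_nat N * of_nat (reps k f L c m)"
  by (simp add: sum.If_cases reps_def Int_def conj_commute)
 finally show ?thesis by simp
qed

lemma norm_expsum_le: "finite Y ==> cmod (expsum k Y g) \<le> real (card Y) ^ k"
 unfolding expsum_def by (rule order_trans[OF norm_sum]) (simp add: card_lists_in)

lemma cmod_cis_minus_1_le: "cmod (cis t - 1) \<le> \<bar>t\<bar>"
proof -
 have "cmod (cis (2 * (t / 2)) - 1) = 2 * \<bar>sin (t / 2)\<bar>" by (rule cmod_cis_minus_1)
 also have "... \<le> 2 * \<bar>t / 2\<bar>" using abs_sin_x_le_abs_x[of "t / 2"] by simp
 finally show ?thesis by simp
qed

lemma major_phase_le:
 assumes maj: "major Q \<delta> \<alpha>" and dv: "int (fact Q) dvd t" and d0: "\<delta> \<ge> 0"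
 shows "cmod (cis (2 * pi * (\<alpha> * of_int t)) - 1) \<le> 2 * pi * (\<delta> * \<bar>of_int t\<bar>)"
proof -
 obtain q b where q: "1 \<le> q" "q \<le> Q" "\<bar>real q * \<alpha> - of_int b\<bar> < \<delta>" using maj unfolding major_def by blast
 have "q dvd fact Q" using q by (simp add: dvd_fact)
 hence "int q dvd t" using dv by (metis dvd_trans of_nat_dvd_iff of_nat_fact)
 then obtain s where s: "t = int q * s" by blast
 have "\<alpha> * of_int t = of_int (b * s) + (real q * \<alpha> - of_int b) * of_int s"
  by (simp add: s algebra_simps)
 hence "2 * pi * (\<alpha> * of_int t) = 2 * pi * of_int (b * s) + 2 * pi * ((real q * \<alpha> - of_int b) * of_int s)"
  by (simp add: ring_distribs)
 hence "cis (2 * pi * (\<alpha> * of_int t)) = cis (2 * pi * ((real q * \<alpha> - of_int b) * of_int s))"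
  by (simp only: cis_mult[symmetric]) (simp add: cis_multiple_2pi)
 hence "cmod (cis (2 * pi * (\<alpha> * of_int t)) - 1) \<le> 2 * pi * (\<bar>real q * \<alpha> - of_int b\<bar> * \<bar>of_int s\<bar>)"
  using cmod_cis_minus_1_le[of "2 * pi * ((real q * \<alpha> - of_int b) * of_int s)"] by (simp add: abs_mult)
 also have "... \<le> 2 * pi * (\<delta> * \<bar>of_int t\<bar>)"
 proof (intro mult_left_mono mult_mono)
  have "1 * \<bar>real_of_int s\<bar> \<le> real q * \<bar>real_of_int s\<bar>" using q by (intro mult_right_mono) auto
  thus "\<bar>real_of_int s\<bar> \<le> \<bar>real_of_int t\<bar>" by (simp add: s abs_mult)
 qed (use q d0 in auto)
 finally show ?thesis .
qed

lemma geometric_telescope: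
 fixes r :: real
 shows "k \<le> p ==> (\<Sum>j\<in>{k..<p}. r ^ j) * (1 - r) = r ^ k - r ^ p"
proof (induction p rule: dec_induct)
 case (step n)
 have "(\<Sum>j\<in>{k..<Suc n}. r ^ j) * (1 - r) = (\<Sum>j\<in>{k..<n}. r ^ j) * (1 - r) + r ^ n * (1 - r)"
  using step.hyps by (simp add: distrib_right)
 also have "... = r ^ k - r ^ n + r ^ n * (1 - r)" by (simp only: step.IH)
 finally show ?case by (simp add: algebra_simps)
qed simp

text \<open>The number \<open>reps\<close> is an average of exponential sums over \<open>a/N\<close> for
  \<open>N\<close> large. Level \<open>j\<close> consists of the points that are minor at level
  \<open>j\<close> but major at level \<open>j + 1\<close>; \<open>weyl_inequality\<close> bounds the sum
  there and \<open>card_major_le\<close> the number of points, so level \<open>j\<close> contributes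
  \<open>O(r^j)\<close> with \<open>r = 2 powr -(n / 2^(d-1) - 2 (d-1)) < 1\<close>. For the points that
  are major at level \<open>k\<close> the first bound is trivial, while the second uses that all
  denominators divide \<open>fact (Q k)\<close>.\<close>
theorem spline_bounds:
 fixes F :: "'n::finite int_mpoly"
 assumes F: "is_form d F" and sm: "smooth_form F" and d: "d \<ge> 2" and n: "CARD('n) > 2 ^ d * (d - 1)"
 shows "\<exists>C r Q. C > 0 \<and> 0 < r \<and> r < 1 \<and> (\<forall>k p c L. 4 \<le> k --> k \<le> p --> (\<forall>i. 1 \<le> L i \<and> L i \<le> 2 ^ p) -->
   (\<forall>m. real (reps (d + 1) (mpoly_eval F) L c m) \<le> C * real (card (ibox L :: (int ^ 'n) set)) ^ d * ((2 ^ p) ^ CARD('n) / (2 ^ p) ^ d)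
     * (r ^ k + 4 ^ (k * (d - 1)) * (real (card (ibox L :: (int ^ 'n) set)) / (2 ^ p) ^ CARD('n)))) \<and>
   (\<forall>m m'. int (fact (Q k)) dvd (m - m') --> \<bar>real (reps (d + 1) (mpoly_eval F) L c m) - real (reps (d + 1) (mpoly_eval F) L c m')\<bar>
     \<le> C * real (card (ibox L :: (int ^ 'n) set)) ^ d * ((2 ^ p) ^ CARD('n) / (2 ^ p) ^ d)
     * (r ^ k + 8 ^ (k * (d - 1)) * (\<bar>of_int (m - m')\<bar> / (2 ^ p) ^ d))))"
proof -
 let ?n = "CARD('n)"
 let ?f = "mpoly_eval F :: int ^ 'n => int"
 obtain C0 C1 where C0: "C0 > 0" and C1: "C1 \<ge> 1" and W: "\<And>x M \<alpha> c L. x \<ge> 1 ==> M \<ge> 1 ==> (\<forall>i. 1 \<le> L i \<and> L i \<le> 16 * x * M) ==>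
   \<not> major (C1 * (16 * x) ^ (d - 1)) ((16 * real x) ^ (d - 1) / (16 * real x * real M) ^ d) \<alpha> ==>
   cmod (expsum (d + 1) (ibox L) (\<lambda>y. \<alpha> * of_int (mpoly_eval F (c + y)))) \<le>
    C0 * real (card (ibox L :: (int ^ 'n) set)) ^ d * (16 * real x * real M) ^ ?n * (16 * real x) powr (- (real ?n / 2 ^ (d - 1)))"
  using weyl_inequality[OF F sm d] by metis
 define \<kappa> where "\<kappa> = real ?n / 2 ^ (d - 1)"
 define r where "r = 2 powr (- (\<kappa> - 2 * (real d - 1)))"
 have kap: "\<kappa> > 2 * (real d - 1)"
 proof -
  have "real (2 ^ d * (d - 1)) < real ?n" using n by (simp only: of_nat_less_iff)
  hence "2 ^ (d - 1) * (2 * (real d - 1)) < real ?n"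
   using d by (cases d) (auto simp: of_nat_diff)
  thus ?thesis by (simp add: \<kappa>_def pos_less_divide_eq mult.commute)
 qed
 have r: "0 < r" "r < 1" using kap by (auto simp: r_def intro: powr_less_one)
 have rk: "(2 ^ k) powr (- \<kappa>) = r ^ k / 4 ^ (k * (d - 1))" for k :: nat
 proof -
  have "(2 ^ k) powr (- \<kappa>) = 2 powr (- (real k * \<kappa>))" by (simp add: powr_realpow[symmetric] powr_powr)
  also have "... = 2 powr (real k * (- (\<kappa> - 2 * (real d - 1)))) / 2 powr (2 * real k * (real d - 1))"
   by (simp add: powr_diff[symmetric] algebra_simps)
  also have "2 powr (real k * (- (\<kappa> - 2 * (real d - 1)))) = r ^ k"
   by (simp add: r_def powr_realpow[symmetric] powr_powr mult.commute)
  also have "2 powr (2 * real k * (real d - 1)) = 4 ^ (k * (d - 1))"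
  proof -
   have "2 * real k * (real d - 1) = real (2 * (k * (d - 1)))" using d by (simp add: of_nat_diff)
   hence "2 powr (2 * real k * (real d - 1)) = 2 ^ (2 * (k * (d - 1)))" by (simp only: powr_realpow zero_less_numeral)
   thus ?thesis by (simp add: power_mult)
  qed
  finally show ?thesis .
 qed
 define Q where "Q k = C1 * (2 ^ k) ^ (d - 1)" for k :: nat
 define del where "del k p = (2 ^ k) ^ (d - 1) / (2 ^ p) ^ d" for k p :: nat
 define dl where "dl k p = ((2::real) ^ k) ^ (d - 1) / (2 ^ p) ^ d" for k p :: nat
 define D where "D = 12 * real C1"
 define A where "A = C0 * (1 + D * 4 ^ (d - 1) / (1 - r))"
 have D0: "D > 0" using C1 by (simp add: D_def)
 have A0: "A > 0" using C0 D0 r by (simp add: A_def add_pos_nonneg)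
 define CC where "CC = 2 * A + D * (2 * pi) + D"
 have "CC > 0" using A0 D0 by (simp add: CC_def add_pos_pos)
 {
  fix k p :: nat and c :: "int ^ 'n" and L :: "'n => nat"
  assume k: "4 \<le> k" "k \<le> p" and L: "\<forall>i. 1 \<le> L i \<and> L i \<le> 2 ^ p"
  define V where "V = real (card (ibox L :: (int ^ 'n) set))"
  define P where "P = ((2::real) ^ p) ^ ?n / (2 ^ p) ^ d"
  let ?S = "\<lambda>\<alpha>. expsum (d + 1) (ibox L) (\<lambda>y. \<alpha> * of_int (?f (c + y)))"
  have P0: "P > 0" by (simp add: P_def)
  have V0: "V \<ge> 1"
  proof -
   have "(\<Prod>i\<in>(UNIV::'n set). (1::nat)) \<le> (\<Prod>i\<in>UNIV. L i)" by (rule prod_mono) (use L in auto)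
   thus ?thesis by (simp add: V_def card_ibox del: of_nat_prod)
  qed
  have VP: "V \<le> (2 ^ p) ^ ?n"
  proof -
   have "V = (\<Prod>i\<in>UNIV. real (L i))" by (simp add: V_def card_ibox)
   also have "... \<le> (\<Prod>i\<in>(UNIV::'n set). 2 ^ p)"
   proof (rule prod_mono)
    fix i have "real (L i) \<le> real (2 ^ p)" using L by (simp only: of_nat_le_iff)
    thus "0 \<le> real (L i) \<and> real (L i) \<le> 2 ^ p" by simp
   qed
   finally show ?thesis by simp
  qed
  have weyl: "cmod (?S \<alpha>) \<le> C0 * V ^ d * (2 ^ p) ^ ?n * (r ^ j / 4 ^ (j * (d - 1)))"
   if j: "k \<le> j" "j \<le> p" and mi: "\<not> major (Q j) (dl j p) \<alpha>" for j \<alpha>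
  proof -
   have x: "16 * 2 ^ (j - 4) = (2::nat) ^ j"
   proof -
    have "(2::nat) ^ j = 2 ^ (4 + (j - 4))" using j k by simp
    thus ?thesis by (simp only: power_add) simp
   qed
   have xr: "16 * real (2 ^ (j - 4)) = 2 ^ j" using x by (metis of_nat_mult of_nat_numeral of_nat_power)
   have M: "(2::nat) ^ j * 2 ^ (p - j) = 2 ^ p" using j by (simp add: power_add[symmetric])
   have Mr: "(2::real) ^ j * real (2 ^ (p - j)) = 2 ^ p" using j by (simp add: power_add[symmetric])
   have "cmod (?S \<alpha>) \<le> C0 * V ^ d * (16 * real (2 ^ (j - 4)) * real (2 ^ (p - j))) ^ ?n * (16 * real (2 ^ (j - 4))) powr (- (real ?n / 2 ^ (d - 1)))"
    unfolding V_def
   proof (rule W)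
    show "\<forall>i. 1 \<le> L i \<and> L i \<le> 16 * 2 ^ (j - 4) * 2 ^ (p - j)" unfolding x M by (rule L)
    show "\<not> major (C1 * (16 * 2 ^ (j - 4)) ^ (d - 1)) ((16 * real (2 ^ (j - 4))) ^ (d - 1) / (16 * real (2 ^ (j - 4)) * real (2 ^ (p - j))) ^ d) \<alpha>"
     unfolding x xr Mr using mi by (simp add: Q_def dl_def)
   qed auto
   thus ?thesis unfolding xr Mr \<kappa>_def[symmetric] rk .
  qed
  have layer: "cmod (?S \<alpha>) \<le> C0 * V ^ d * (2 ^ p) ^ ?n * (r ^ p / 4 ^ (p * (d - 1)) +
    (\<Sum>j\<in>{k..<p}. r ^ j / 4 ^ (j * (d - 1)) * (if major (Q (Suc j)) (dl (Suc j) p) \<alpha> then 1 else 0)))"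
   if mi: "\<not> major (Q k) (dl k p) \<alpha>" for \<alpha>
  proof -
   let ?t = "\<lambda>j. r ^ j / 4 ^ (j * (d - 1)) * (if major (Q (Suc j)) (dl (Suc j) p) \<alpha> then 1 else 0)"
   let ?K = "C0 * V ^ d * (2 ^ p) ^ ?n"
   have K0: "?K \<ge> 0" using C0 V0 by simp
   have t0: "?t j \<ge> 0" for j using r by simp
   have "\<not> major (Q j) (dl j p) \<alpha> \<or> cmod (?S \<alpha>) \<le> ?K * (\<Sum>i\<in>{k..<j}. ?t i)" if "k \<le> j" "j \<le> p" for j
    using that
   proof (induction j rule: dec_induct)
    case base thus ?case using mi by simp
   next
    case (step j)
    have s: "(\<Sum>i\<in>{k..<Suc j}. ?t i) = (\<Sum>i\<in>{k..<j}. ?t i) + ?t j" using step.hyps by simp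
    have s0: "(\<Sum>i\<in>{k..<j}. ?t i) \<ge> 0" by (intro sum_nonneg t0)
    show ?case
    proof (cases "\<not> major (Q (Suc j)) (dl (Suc j) p) \<alpha>")
     case False
     hence tj: "?t j = r ^ j / 4 ^ (j * (d - 1))" by simp
     have "cmod (?S \<alpha>) \<le> ?K * (\<Sum>i\<in>{k..<Suc j}. ?t i)"
     proof (cases "\<not> major (Q j) (dl j p) \<alpha>")
      case True
      have "cmod (?S \<alpha>) \<le> ?K * ?t j" unfolding tj by (rule weyl) (use True step in auto)
      also have "... \<le> ?K * (\<Sum>i\<in>{k..<Suc j}. ?t i)" unfolding s using s0 by (intro mult_left_mono K0) simp
      finally show ?thesis .
     next
      case False
      hence "cmod (?S \<alpha>) \<le> ?K * (\<Sum>i\<in>{k..<j}. ?t i)" using step by auto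
      also have "... \<le> ?K * (\<Sum>i\<in>{k..<Suc j}. ?t i)" unfolding s using t0[of j] by (intro mult_left_mono K0) simp
      finally show ?thesis .
     qed
     thus ?thesis by blast
    qed simp
   qed
   from this[OF k(2) order_refl] show ?thesis
   proof
    assume "\<not> major (Q p) (dl p p) \<alpha>"
    hence "cmod (?S \<alpha>) \<le> ?K * (r ^ p / 4 ^ (p * (d - 1)))" using k by (intro weyl) auto
    also have "... \<le> ?K * (r ^ p / 4 ^ (p * (d - 1)) + (\<Sum>i\<in>{k..<p}. ?t i))"
     using sum_nonneg[of "{k..<p}" ?t, OF t0] by (intro mult_left_mono K0) simp
    finally show ?thesis .
   next
    assume "cmod (?S \<alpha>) \<le> ?K * (\<Sum>i\<in>{k..<p}. ?t i)"
    also have "... \<le> ?K * (r ^ p / 4 ^ (p * (d - 1)) + (\<Sum>i\<in>{k..<p}. ?t i))" using r by (intro mult_left_mono K0) simp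
    finally show ?thesis .
   qed
  qed
  have dl1: "0 < dl j p" "dl j p \<le> 1" if "j \<le> p" for j
  proof -
   have "((2::real) ^ j) ^ (d - 1) \<le> (2 ^ p) ^ (d - 1)" using that by (intro power_mono power_increasing) auto
   also have "... \<le> (2 ^ p) ^ d" by (intro power_increasing) auto
   finally show "dl j p \<le> 1" by (simp add: dl_def)
  qed (simp add: dl_def)
  have cm: "real (card {a\<in>{0..<int N}. major (Q j) (dl j p) (of_int a / real N)}) \<le> D * (4 ^ (j * (d - 1)) / (2 ^ p) ^ d) * real N"
   if N: "real C1 * (2 ^ p) ^ d \<le> real N" and j: "j \<le> p" for N j
  proof -
   have "real (card {a\<in>{0..<int N}. major (Q j) (dl j p) (of_int a / real N)}) \<le> 12 * real (Q j) * dl j p * real N"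
   proof (rule card_major_le)
    have "real (Q j) = (real C1 * (2 ^ p) ^ d) * dl j p" by (simp add: Q_def dl_def)
    also have "... \<le> real N * dl j p" using N dl1[OF j] by (intro mult_right_mono) auto
    finally show "real (Q j) \<le> real N * dl j p" .
   qed (use dl1[OF j] C1 in \<open>auto simp: Q_def\<close>)
   also have "12 * real (Q j) * dl j p = D * (4 ^ (j * (d - 1)) / (2 ^ p) ^ d)"
   proof -
    have "((2::real) ^ j) ^ (d - 1) * (2 ^ j) ^ (d - 1) = 4 ^ (j * (d - 1))"
     by (simp add: power_mult[symmetric] power_mult_distrib[symmetric])
    thus ?thesis by (simp add: Q_def dl_def D_def)
   qed
   finally show ?thesis .
  qed
  have minor: "(\<Sum>a\<in>{a\<in>{0..<int N}. \<not> major (Q k) (dl k p) (of_int a / real N)}. cmod (?S (of_int a / real N))) \<le> A * V ^ d * P * r ^ k * real N"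
   if N: "real C1 * (2 ^ p) ^ d \<le> real N" for N
  proof -
   let ?mi = "{a\<in>{0..<int N}. \<not> major (Q k) (dl k p) (of_int a / real N)}"
   let ?K = "C0 * V ^ d * (2 ^ p) ^ ?n"
   have K0: "?K \<ge> 0" using C0 V0 by simp
   let ?g = "\<lambda>a. r ^ p / 4 ^ (p * (d - 1)) + (\<Sum>j\<in>{k..<p}. r ^ j / 4 ^ (j * (d - 1)) * (if major (Q (Suc j)) (dl (Suc j) p) (of_int a / real N) then 1 else 0))"
   have g0: "?g a \<ge> 0" for a using r by (intro add_nonneg_nonneg sum_nonneg) auto
   have "(\<Sum>a\<in>?mi. cmod (?S (of_int a / real N))) \<le> (\<Sum>a\<in>?mi. ?K * ?g a)" by (intro sum_mono layer) auto
   also have "... \<le> (\<Sum>a\<in>{0..<int N}. ?K * ?g a)" by (rule sum_mono2) (use mult_nonneg_nonneg[OF K0 g0] in auto)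
   also have "... = ?K * (\<Sum>a\<in>{0..<int N}. ?g a)" by (simp only: sum_distrib_left)
   also have "(\<Sum>a\<in>{0..<int N}. ?g a) = real N * (r ^ p / 4 ^ (p * (d - 1))) +
     (\<Sum>j\<in>{k..<p}. r ^ j / 4 ^ (j * (d - 1)) * real (card {a\<in>{0..<int N}. major (Q (Suc j)) (dl (Suc j) p) (of_int a / real N)}))"
   proof -
    have cs: "real (card {a\<in>{0..<int N}. Pp a}) = (\<Sum>a\<in>{0..<int N}. if Pp a then 1 else 0)" for Pp
     by (simp add: sum.If_cases Int_def)
    show ?thesis unfolding sum.distrib cs sum_distrib_left by (subst sum.swap) simp
   qed
   also have "... \<le> real N * (r ^ k / (2 ^ p) ^ d) + (\<Sum>j\<in>{k..<p}. r ^ j / 4 ^ (j * (d - 1)) * (D * (4 ^ (Suc j * (d - 1)) / (2 ^ p) ^ d) * real N))"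
   proof (intro add_mono mult_left_mono sum_mono)
    have "((2::real) ^ p) ^ d \<le> 4 ^ (p * (d - 1))"
    proof -
     have "(2 ^ p) ^ d = (2::real) ^ (p * d)" by (simp add: power_mult)
     also have "... \<le> 2 ^ (2 * (p * (d - 1)))" 
     proof (rule power_increasing)
      have "d \<le> 2 * (d - 1)" using d by simp
      from mult_le_mono2[OF this, of p] show "p * d \<le> 2 * (p * (d - 1))" by (simp only: mult.left_commute)
     qed simp
     finally show ?thesis by (simp add: power_mult)
    qed
    moreover have "r ^ p \<le> r ^ k" using k r by (intro power_decreasing) auto
    ultimately show "r ^ p / 4 ^ (p * (d - 1)) \<le> r ^ k / (2 ^ p) ^ d" using r by (intro frac_le) auto
    show "real (card {a\<in>{0..<int N}. major (Q (Suc j)) (dl (Suc j) p) (of_int a / real N)}) \<le> D * (4 ^ (Suc j * (d - 1)) / (2 ^ p) ^ d) * real N"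
     if "j \<in> {k..<p}" for j using that by (intro cm N) auto
   qed (use r in auto)
   also have "(\<Sum>j\<in>{k..<p}. r ^ j / 4 ^ (j * (d - 1)) * (D * (4 ^ (Suc j * (d - 1)) / (2 ^ p) ^ d) * real N))
     = (\<Sum>j\<in>{k..<p}. r ^ j) * (D * 4 ^ (d - 1) * real N / (2 ^ p) ^ d)"
    unfolding sum_distrib_right by (intro sum.cong refl) (simp add: power_add)
   also have "... \<le> (r ^ k / (1 - r)) * (D * 4 ^ (d - 1) * real N / (2 ^ p) ^ d)"
   proof (intro mult_right_mono)
    have "(\<Sum>j\<in>{k..<p}. r ^ j) * (1 - r) = r ^ k - r ^ p" by (rule geometric_telescope[OF k(2)])
    hence "(\<Sum>j\<in>{k..<p}. r ^ j) * (1 - r) \<le> r ^ k" using r by simp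
    thus "(\<Sum>j\<in>{k..<p}. r ^ j) \<le> r ^ k / (1 - r)" using r by (simp add: pos_le_divide_eq)
   qed (use D0 in auto)
   finally have "(\<Sum>a\<in>?mi. cmod (?S (of_int a / real N))) \<le> ?K * (real N * (r ^ k / (2 ^ p) ^ d) + (r ^ k / (1 - r)) * (D * 4 ^ (d - 1) * real N / (2 ^ p) ^ d))"
    using K0 by (simp add: mult_left_mono)
   also have "... = A * V ^ d * P * r ^ k * real N" by (simp add: A_def P_def algebra_simps add_divide_distrib)
   finally show ?thesis .
  qed
  have finf: "finite {a\<in>{0..<int N}. Pp a}" for N Pp
   by (rule finite_subset[of _ "{0..<int N}"]) auto
  have "\<exists>N0. \<forall>ws\<in>lists_in (d + 1) (ibox L). \<bar>?f (c + sum_list ws)\<bar> \<le> N0"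
  proof -
   let ?T = "(\<lambda>ws. \<bar>?f (c + sum_list ws)\<bar>) ` lists_in (d + 1) (ibox L)"
   show ?thesis by (intro exI[of _ "Max (insert 0 ?T)"]) auto
  qed
  then obtain N0 where N0: "\<And>ws. ws \<in> lists_in (d + 1) (ibox L) ==> \<bar>?f (c + sum_list ws)\<bar> \<le> N0" by blast
  let ?R = "\<lambda>m. real (reps (d + 1) ?f L c m)"
  have triv: "cmod (?S \<alpha>) \<le> V ^ Suc d" for \<alpha> unfolding V_def using norm_expsum_le[of "ibox L" "d + 1"] by simp
  have B: "?R m \<le> CC * V ^ d * P * (r ^ k + 4 ^ (k * (d - 1)) * (V / (2 ^ p) ^ ?n))" for m
  proof -
   \<comment> \<open>\<open>N\<close> exceeds all differences of values, so that orthogonality modulo \<open>N\<close> detects equality\<close>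
   define N where "N = C1 * (2 ^ p) ^ d + nat (\<bar>N0\<bar> + \<bar>m\<bar> + 1)"
   have N1: "N \<ge> 1" "real C1 * (2 ^ p) ^ d \<le> real N" using C1 by (auto simp: N_def)
   have N2: "\<bar>?f (c + sum_list ws) - m\<bar> < int N" if "ws \<in> lists_in (d + 1) (ibox L)" for ws
   proof -
    have "\<bar>?f (c + sum_list ws) - m\<bar> \<le> \<bar>N0\<bar> + \<bar>m\<bar>" using N0[OF that] by linarith
    also have "... < int (nat (\<bar>N0\<bar> + \<bar>m\<bar> + 1))" by simp
    also have "... \<le> int N" unfolding N_def by (simp only: of_nat_le_iff)
    finally show ?thesis .
   qed
   let ?ma = "{a\<in>{0..<int N}. major (Q k) (dl k p) (of_int a / real N)}"
   let ?mi = "{a\<in>{0..<int N}. \<not> major (Q k) (dl k p) (of_int a / real N)}"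
   let ?g = "\<lambda>a. cmod (?S (of_int a / real N))"
   have "real N * ?R m = cmod (of_nat N * of_nat (reps (d + 1) ?f L c m))" by (simp add: norm_mult)
   also have "... \<le> (\<Sum>a\<in>{0..<int N}. ?g a)"
   proof -
    have fou: "of_nat N * of_nat (reps (d + 1) ?f L c m) = (\<Sum>a\<in>{0..<int N}. ?S (of_int a / real N) * cis (- (2 * pi * (of_int a / real N * of_int m))))"
     by (rule reps_fourier[OF N1(1)]) (rule N2)
    show ?thesis unfolding fou by (rule order_trans[OF norm_sum]) (simp add: norm_mult)
   qed
   also have "{0..<int N} = ?mi \<union> ?ma" by auto
   also have "(\<Sum>a\<in>?mi \<union> ?ma. ?g a) = (\<Sum>a\<in>?mi. ?g a) + (\<Sum>a\<in>?ma. ?g a)" by (rule sum.union_disjoint[OF finf finf]) auto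
   also have "... \<le> A * V ^ d * P * r ^ k * real N + (\<Sum>a\<in>?ma. V ^ Suc d)" by (intro add_mono minor N1 sum_mono triv)
   also have "... \<le> A * V ^ d * P * r ^ k * real N + (D * (4 ^ (k * (d - 1)) / (2 ^ p) ^ d) * real N) * V ^ Suc d"
   proof (rule add_left_mono)
    have "(\<Sum>a\<in>?ma. V ^ Suc d) = real (card ?ma) * V ^ Suc d" by simp
    also have "... \<le> (D * (4 ^ (k * (d - 1)) / (2 ^ p) ^ d) * real N) * V ^ Suc d"
     using V0 by (intro mult_right_mono cm N1 k) auto
    finally show "(\<Sum>a\<in>?ma. V ^ Suc d) \<le> (D * (4 ^ (k * (d - 1)) / (2 ^ p) ^ d) * real N) * V ^ Suc d" .
   qed
   also have "A * V ^ d * P * r ^ k * real N + (D * (4 ^ (k * (d - 1)) / (2 ^ p) ^ d) * real N) * V ^ Suc d =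
     real N * (A * V ^ d * P * r ^ k + D * V ^ d * P * (4 ^ (k * (d - 1)) * (V / (2 ^ p) ^ ?n)))"
    by (simp add: P_def algebra_simps)
   also have "... \<le> real N * (CC * V ^ d * P * r ^ k + CC * V ^ d * P * (4 ^ (k * (d - 1)) * (V / (2 ^ p) ^ ?n)))"
    using A0 D0 V0 P0 r by (intro mult_left_mono add_mono mult_right_mono) (auto simp: CC_def)
   finally have "?R m \<le> CC * V ^ d * P * r ^ k + CC * V ^ d * P * (4 ^ (k * (d - 1)) * (V / (2 ^ p) ^ ?n))"
    using N1 by (subst (asm) mult_le_cancel_left_pos) auto
   thus ?thesis by (simp add: algebra_simps)
  qed
  have Cb: "\<bar>?R m - ?R m'\<bar> \<le> CC * V ^ d * P * (r ^ k + 8 ^ (k * (d - 1)) * (\<bar>of_int (m - m')\<bar> / (2 ^ p) ^ d))"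
   if dv: "int (fact (Q k)) dvd (m - m')" for m m'
  proof -
   define N where "N = C1 * (2 ^ p) ^ d + nat (\<bar>N0\<bar> + \<bar>m\<bar> + \<bar>m'\<bar> + 1)"
   have N1: "N \<ge> 1" "real C1 * (2 ^ p) ^ d \<le> real N" using C1 by (auto simp: N_def)
   have N2: "\<bar>?f (c + sum_list ws) - u\<bar> < int N" if "ws \<in> lists_in (d + 1) (ibox L)" "u = m \<or> u = m'" for ws u
   proof -
    have "\<bar>?f (c + sum_list ws) - u\<bar> \<le> \<bar>N0\<bar> + \<bar>m\<bar> + \<bar>m'\<bar>" using N0[OF that(1)] that(2) by auto
    also have "... < int (nat (\<bar>N0\<bar> + \<bar>m\<bar> + \<bar>m'\<bar> + 1))" by simp
    also have "... \<le> int N" unfolding N_def by (simp only: of_nat_le_iff)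
    finally show ?thesis .
   qed
   let ?ma = "{a\<in>{0..<int N}. major (Q k) (dl k p) (of_int a / real N)}"
   let ?mi = "{a\<in>{0..<int N}. \<not> major (Q k) (dl k p) (of_int a / real N)}"
   let ?e = "\<lambda>a m. cis (- (2 * pi * (of_int a / real N * of_int m)))"
   let ?g = "\<lambda>a. cmod (?S (of_int a / real N)) * cmod (?e a m - ?e a m')"
   have ee: "cmod (?e a m - ?e a m') = cmod (cis (2 * pi * (of_int a / real N * of_int (m - m'))) - 1)" for a :: int
   proof -
    have "?e a m' - ?e a m = ?e a m * (cis (2 * pi * (of_int a / real N * of_int (m - m'))) - 1)"
     by (simp add: right_diff_distrib cis_mult)
    thus ?thesis by (metis norm_minus_commute norm_mult norm_cis mult_1)
   qed
   have ee2: "cmod (?e a m - ?e a m') \<le> 2" for a :: int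
    by (rule order_trans[OF norm_triangle_ineq4]) simp
   have "real N * \<bar>?R m - ?R m'\<bar> = cmod (of_nat N * of_nat (reps (d + 1) ?f L c m) - of_nat N * of_nat (reps (d + 1) ?f L c m'))"
   proof -
    have "of_nat N * of_nat (reps (d + 1) ?f L c m) - of_nat N * of_nat (reps (d + 1) ?f L c m') = complex_of_real (real N * (?R m - ?R m'))"
     by (simp add: algebra_simps)
    thus ?thesis by (simp only: norm_of_real abs_mult; simp)
   qed
   also have "... = cmod (\<Sum>a\<in>{0..<int N}. ?S (of_int a / real N) * (?e a m - ?e a m'))"
   proof -
    have fou: "of_nat N * of_nat (reps (d + 1) ?f L c u) = (\<Sum>a\<in>{0..<int N}. ?S (of_int a / real N) * ?e a u)" if "u = m \<or> u = m'" for u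
     by (rule reps_fourier[OF N1(1)]) (rule N2[OF _ that])
    show ?thesis using fou[of m] fou[of m'] by (simp only: right_diff_distrib sum_subtractf simp_thms)
   qed
   also have "... \<le> (\<Sum>a\<in>{0..<int N}. ?g a)" by (rule order_trans[OF norm_sum]) (simp add: norm_mult)
   also have "{0..<int N} = ?mi \<union> ?ma" by auto
   also have "(\<Sum>a\<in>?mi \<union> ?ma. ?g a) = (\<Sum>a\<in>?mi. ?g a) + (\<Sum>a\<in>?ma. ?g a)" by (rule sum.union_disjoint[OF finf finf]) auto
   also have "... \<le> (\<Sum>a\<in>?mi. cmod (?S (of_int a / real N)) * 2) + (\<Sum>a\<in>?ma. V ^ Suc d * (2 * pi * (dl k p * \<bar>of_int (m - m')\<bar>)))"
   proof (intro add_mono sum_mono mult_left_mono mult_mono triv ee2)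
    fix a assume "a \<in> ?ma"
    hence "major (Q k) (dl k p) (of_int a / real N)" by simp
    from major_phase_le[OF this dv] show "cmod (?e a m - ?e a m') \<le> 2 * pi * (dl k p * \<bar>of_int (m - m')\<bar>)"
     unfolding ee using dl1[OF k(2)] by simp
   qed (use V0 in auto)
   also have "... = 2 * (\<Sum>a\<in>?mi. cmod (?S (of_int a / real N))) + real (card ?ma) * (V ^ Suc d * (2 * pi * (dl k p * \<bar>of_int (m - m')\<bar>)))"
    by (simp add: sum_distrib_left mult.commute)
   also have "... \<le> 2 * (A * V ^ d * P * r ^ k * real N) + (D * (4 ^ (k * (d - 1)) / (2 ^ p) ^ d) * real N) * (V ^ d * (2 ^ p) ^ ?n * (2 * pi * (dl k p * \<bar>of_int (m - m')\<bar>)))"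
   proof (rule add_mono)
    show "2 * (\<Sum>a\<in>?mi. cmod (?S (of_int a / real N))) \<le> 2 * (A * V ^ d * P * r ^ k * real N)"
     using minor[OF N1(2)] by simp
    show "real (card ?ma) * (V ^ Suc d * (2 * pi * (dl k p * \<bar>of_int (m - m')\<bar>)))
     \<le> (D * (4 ^ (k * (d - 1)) / (2 ^ p) ^ d) * real N) * (V ^ d * (2 ^ p) ^ ?n * (2 * pi * (dl k p * \<bar>of_int (m - m')\<bar>)))"
    proof (rule mult_mono)
     show "real (card ?ma) \<le> D * (4 ^ (k * (d - 1)) / (2 ^ p) ^ d) * real N" by (rule cm[OF N1(2) k(2)])
     have "V ^ d * V \<le> V ^ d * (2 ^ p) ^ ?n" using VP V0 by (intro mult_left_mono) auto
     thus "V ^ Suc d * (2 * pi * (dl k p * \<bar>of_int (m - m')\<bar>)) \<le> V ^ d * (2 ^ p) ^ ?n * (2 * pi * (dl k p * \<bar>of_int (m - m')\<bar>))"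
      using dl1[OF k(2)] by (intro mult_right_mono) (auto simp: mult.commute)
    qed (use D0 V0 dl1[OF k(2)] in auto)
   qed
   also have "... = real N * (2 * A * V ^ d * P * r ^ k + D * (2 * pi) * V ^ d * P * (8 ^ (k * (d - 1)) * (\<bar>of_int (m - m')\<bar> / (2 ^ p) ^ d)))"
   proof -
    have "(8::real) ^ (k * (d - 1)) = 4 ^ (k * (d - 1)) * (2 ^ k) ^ (d - 1)"
     by (simp add: power_mult[symmetric] power_mult_distrib[symmetric])
    thus ?thesis by (simp add: P_def dl_def algebra_simps)
   qed
   also have "... \<le> real N * (CC * V ^ d * P * r ^ k + CC * V ^ d * P * (8 ^ (k * (d - 1)) * (\<bar>of_int (m - m')\<bar> / (2 ^ p) ^ d)))"
    using A0 D0 V0 P0 r by (intro mult_left_mono add_mono mult_right_mono) (auto simp: CC_def)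
   finally have "\<bar>?R m - ?R m'\<bar> \<le> CC * V ^ d * P * r ^ k + CC * V ^ d * P * (8 ^ (k * (d - 1)) * (\<bar>of_int (m - m')\<bar> / (2 ^ p) ^ d))"
    using N1 by (subst (asm) mult_le_cancel_left_pos) auto
   thus ?thesis by (simp add: algebra_simps)
  qed
  note B[unfolded V_def P_def] Cb[unfolded V_def P_def]
 }
 thus ?thesis
  by (intro exI[of _ CC] exI[of _ r] exI[of _ Q] conjI allI impI \<open>CC > 0\<close> r) blast+
qed

text \<open>Lattice points of the dilated box, and the number of those representing \<open>m\<close>.\<close>
definition lat_pts :: "(real ^ 'n::finite) set => real => (int ^ 'n) set" where
 "lat_pts B P = {x. (\<chi> j. real_of_int (x $ j)) \<in> (\<lambda>t. P *\<^sub>R t) ` B}"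

definition rep_count :: "'n::finite int_mpoly => (real ^ 'n) set => real => int => nat" where
 "rep_count F B P m = card {x \<in> lat_pts B P. mpoly_eval F x = m}"

section \<open>Regularity of representation numbers\<close>

text \<open>Abbreviations for the conditions on representation numbers. \<open>same_side D Q m m'\<close>: no point
  \<open>s Q\<close> with \<open>s \<in> D\<close> lies between \<open>m\<close> and \<open>m'\<close> or
  equals one of them.\<close>
abbreviation count_gap :: "'n::finite int_mpoly => (real ^ 'n) set => real => int => int => real" where
 "count_gap F B P m m' \<equiv> \<bar>real (rep_count F B P m) - real (rep_count F B P m')\<bar>"

abbreviation same_side :: "real set => real => int => int => bool" where
 "same_side D Q m m' \<equiv> \<forall>s\<in>D. of_int m \<noteq> s * Q \<and> of_int m' \<noteq> s * Q \<and> (of_int m < s * Q \<longleftrightarrow> of_int m' < s * Q)"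

abbreviation shift_stable :: "'n::finite int_mpoly => nat => (real ^ 'n) set => nat => real => real => real => bool" where
 "shift_stable F d B T \<delta> \<epsilon> P \<equiv> \<forall>m m'. [m = m'] (mod int T) --> \<bar>real_of_int (m - m')\<bar> \<le> \<delta> * P ^ d --> count_gap F B P m m' \<le> \<epsilon> * (P ^ CARD('n) / P ^ d)"

abbreviation cell_stable :: "'n::finite int_mpoly => nat => (real ^ 'n) set => nat => real set => real => real => bool" where
 "cell_stable F d B T D \<epsilon> P \<equiv> \<forall>m m'. [m = m'] (mod int T) --> same_side D (P ^ d) m m' --> count_gap F B P m m' \<le> \<epsilon> * (P ^ CARD('n) / P ^ d)"

abbreviation count_le :: "'n::finite int_mpoly => nat => (real ^ 'n) set => real => real => bool" where
 "count_le F d B C P \<equiv> \<forall>m. real (rep_count F B P m) \<le> C * (P ^ CARD('n) / P ^ d)"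

text \<open>Bounded and locally constant representation numbers, up to \<open>\<epsilon>\<close>, along residue
  classes. The constant \<open>C\<close> does not depend on \<open>\<epsilon>\<close>, whereas
  \<open>T\<close> and the set \<open>D\<close> of cut points do.\<close>
definition regular_at :: "'n::finite int_mpoly => nat => (real ^ 'n) set => real => real => nat => real set => bool" where
 "regular_at F d B C \<epsilon> T D \<longleftrightarrow> finite D \<and> (\<forall>\<^sub>F P in at_top. count_le F d B C P \<and> cell_stable F d B T D \<epsilon> P)"

definition regular_counts :: "'n::finite int_mpoly => nat => (real ^ 'n) set => bool" where
 "regular_counts F d B \<longleftrightarrow> (\<exists>C. \<forall>\<epsilon>>0. \<exists>T\<ge>1. \<exists>D. regular_at F d B C \<epsilon> T D)"

lemma lat_pts_iff:
 assumes "P > 0" shows "x \<in> lat_pts B P \<longleftrightarrow> (\<chi> j. real_of_int (x $ j) / P) \<in> B"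
proof
 assume "x \<in> lat_pts B P"
 then obtain t where t: "t \<in> B" "(\<chi> j. real_of_int (x $ j)) = P *\<^sub>R t" unfolding lat_pts_def by blast
 have "real_of_int (x $ j) = P * t $ j" for j using t(2) by (simp add: vec_eq_iff)
 thus "(\<chi> j. real_of_int (x $ j) / P) \<in> B" using assms t by simp
next
 assume "(\<chi> j. real_of_int (x $ j) / P) \<in> B"
 moreover have "(\<chi> j. real_of_int (x $ j)) = P *\<^sub>R (\<chi> j. real_of_int (x $ j) / P)" using assms by (simp add: vec_eq_iff)
 ultimately show "x \<in> lat_pts B P" unfolding lat_pts_def by blast
qed

lemma lat_pts_bound:
 assumes B: "B \<subseteq> {t. \<forall>j. t $ j \<in> {-1..1}}" and P: "P > 0" and x: "x \<in> lat_pts B P"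
 shows "\<bar>real_of_int (x $ j)\<bar> \<le> P"
proof -
 have "(\<chi> j. real_of_int (x $ j) / P) \<in> {t. \<forall>j. t $ j \<in> {-1..1}}" using x B by (auto simp: lat_pts_iff[OF P])
 hence "-1 \<le> real_of_int (x $ j) / P" "real_of_int (x $ j) / P \<le> 1" by auto
 thus ?thesis using P by (simp add: field_simps abs_le_iff)
qed

lemma finite_real_box: "finite {x :: int ^ 'n::finite. \<forall>j. \<bar>real_of_int (x $ j)\<bar> \<le> P}"
proof (rule finite_subset)
 show "{x :: int ^ 'n. \<forall>j. \<bar>real_of_int (x $ j)\<bar> \<le> P} \<subseteq> {x. \<forall>j. x $ j \<in> {-\<lceil>P\<rceil>..\<lceil>P\<rceil>}}"
 proof (rule subsetI, rule CollectI, rule allI)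
  fix x :: "int ^ 'n" and j assume "x \<in> {x. \<forall>j. \<bar>real_of_int (x $ j)\<bar> \<le> P}"
  hence "\<bar>real_of_int (x $ j)\<bar> \<le> P" by simp
  thus "x $ j \<in> {-\<lceil>P\<rceil>..\<lceil>P\<rceil>}" by auto linarith+
 qed
qed (rule finite_vec_box, simp)

lemma finite_lat_pts:
 fixes B :: "(real ^ 'n::finite) set"
 assumes B: "B \<subseteq> {t. \<forall>j. t $ j \<in> {-1..1}}" and P: "P > 0" shows "finite (lat_pts B P)"
  by (rule finite_subset[OF _ finite_real_box[of P]]) (use lat_pts_bound[OF B P] in auto)

lemma form_bound:
 assumes F: "is_form d F" and x: "\<And>j. \<bar>x $ j\<bar> \<le> (P::real)" and P: "P \<ge> 0"
 shows "\<bar>mpoly_eval F x\<bar> \<le> (\<Sum>m\<in>keys F. \<bar>of_int (lookup F m)\<bar>) * P ^ d"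
proof -
 have "\<bar>mpoly_eval F x\<bar> \<le> (\<Sum>m\<in>keys F. \<bar>of_int (lookup F m)\<bar> * (\<Prod>i\<in>UNIV. \<bar>x $ i\<bar> ^ lookup m i))"
  unfolding mpoly_eval_def by (rule order_trans[OF sum_abs]) (simp add: abs_mult abs_prod power_abs)
 also have "... \<le> (\<Sum>m\<in>keys F. \<bar>of_int (lookup F m)\<bar> * P ^ d)"
 proof (intro sum_mono mult_left_mono)
  fix m assume m: "m \<in> keys F"
  have "(\<Prod>i\<in>UNIV. \<bar>x $ i\<bar> ^ lookup m i) \<le> (\<Prod>i\<in>UNIV. P ^ lookup m i)"
   by (intro prod_mono conjI power_mono x) auto
  also have "... = P ^ d" using m F by (simp add: power_sum[symmetric] is_form_def)
  finally show "(\<Prod>i\<in>UNIV. \<bar>x $ i\<bar> ^ lookup m i) \<le> P ^ d" .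
 qed simp
 finally show ?thesis by (simp add: sum_distrib_right)
qed

lemma mpoly_eval_of_int: "mpoly_eval F (\<chi> j. real_of_int (x $ j)) = of_int (mpoly_eval F x)"
 by (simp add: mpoly_eval_def)

lemma sum_list_ibox_bounds:
 assumes "ws \<in> lists_in k (ibox L)"
 shows "0 \<le> sum_list ws $ i" "sum_list ws $ i \<le> int k * (int (L i) - 1)"
proof -
 have "0 \<le> sum_list ws $ i \<and> sum_list ws $ i \<le> int (length ws) * (int (L i) - 1)" if "set ws \<subseteq> ibox L" for ws
  using that
 proof (induction ws)
  case (Cons w ws)
  hence "0 \<le> w $ i" "w $ i \<le> int (L i) - 1" by (auto simp: ibox_def zle_diff1_eq)
  thus ?case using Cons by (auto simp: algebra_simps)
 qed simp
 thus "0 \<le> sum_list ws $ i" "sum_list ws $ i \<le> int k * (int (L i) - 1)" using assms by (auto simp: lists_in_def)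
qed

text \<open>A box is dominated by a spline: each of its points is hit by \<open>l^d\<close> choices in every
  coordinate.\<close>
lemma box_count_le_reps:
 fixes f :: "int ^ 'n::finite => int"
 assumes l: "\<And>i. 1 \<le> l i"
 shows "(\<Prod>i\<in>UNIV. l i) ^ d * card {x. (\<forall>i. c $ i \<le> x $ i \<and> x $ i < c $ i + int (l i)) \<and> f x = m}
   \<le> reps (d + 1) f (\<lambda>i. (d + 1) * l i) (c - (\<chi> i. int d * int (l i))) m"
proof -
 let ?Q = "{x. (\<forall>i. c $ i \<le> x $ i \<and> x $ i < c $ i + int (l i)) \<and> f x = m}"
 let ?c = "c - (\<chi> i. int d * int (l i))"
 let ?R = "{ws \<in> lists_in (d + 1) (ibox (\<lambda>i. (d + 1) * l i)). f (?c + sum_list ws) = m}"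
 let ?g = "\<lambda>(ws, x). (x - ?c - sum_list ws) # ws"
 have "card (lists_in d (ibox l) \<times> ?Q) \<le> card ?R"
 proof (rule card_inj_on_le[where f = ?g])
  show "inj_on ?g (lists_in d (ibox l) \<times> ?Q)"
  proof (rule inj_onI)
   fix a b assume e: "?g a = ?g b"
   obtain ws x ws' x' where ab: "a = (ws, x)" "b = (ws', x')" by (cases a; cases b)
   show "a = b" using e unfolding ab by auto
  qed
  show "finite ?R" by (rule finite_subset[OF _ finite_lists_in[OF finite_ibox, of "d + 1" "\<lambda>i. (d + 1) * l i"]]) blast
  show "?g ` (lists_in d (ibox l) \<times> ?Q) \<subseteq> ?R"
  proof (rule image_subsetI)
   fix a assume a: "a \<in> lists_in d (ibox l) \<times> ?Q"
   obtain ws x where wx: "a = (ws, x)" by (cases a)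
   have ws: "ws \<in> lists_in d (ibox l)" and x: "\<And>i. c $ i \<le> x $ i \<and> x $ i < c $ i + int (l i)" "f x = m"
    using a wx by auto
   have "x - ?c - sum_list ws \<in> ibox (\<lambda>i. (d + 1) * l i)"
   proof -
    have "0 \<le> (x - ?c - sum_list ws) $ i \<and> (x - ?c - sum_list ws) $ i < int ((d + 1) * l i)" for i
     using sum_list_ibox_bounds[OF ws, of i] x(1)[of i] by (auto simp: algebra_simps)
    thus ?thesis by (simp add: ibox_def)
   qed
   moreover have "set ws \<subseteq> ibox (\<lambda>i. (d + 1) * l i)"
   proof
    fix w assume "w \<in> set ws"
    hence w: "0 \<le> w $ i \<and> w $ i < int (l i)" for i using ws by (auto simp: lists_in_def ibox_def)
    have le: "int (l i) \<le> int ((d + 1) * l i)" for i by (simp only: of_nat_le_iff) simp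
    have "w $ i < int ((d + 1) * l i)" for i by (rule less_le_trans[OF conjunct2[OF w] le])
    thus "w \<in> ibox (\<lambda>i. (d + 1) * l i)" using w by (simp only: ibox_def mem_Collect_eq simp_thms)
   qed
   ultimately show "?g a \<in> ?R" using ws x by (simp add: wx lists_in_def)
  qed
 qed
 thus ?thesis by (simp add: card_cartesian_product card_lists_in card_ibox reps_def)
qed

text \<open>Splines centred at the points of a grid form a partition of unity, up to the factor \<open>l^(n
  d)\<close>.\<close>
lemma grid_cover_count:
 fixes x :: "int ^ 'n::finite"
 assumes l: "l \<ge> 1"
 shows "card {(ka, ws). ws \<in> lists_in (Suc d) (ibox (\<lambda>_. l)) \<and> smul (int l) ka + sum_list ws = x} = l ^ (CARD('n) * d)"
proof -
 let ?S = "{(ka, ws). ws \<in> lists_in (Suc d) (ibox (\<lambda>_. l)) \<and> smul (int l) ka + sum_list ws = x}"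
 let ?g = "\<lambda>ws. ((\<chi> i. (x - sum_list ws) $ i div int l), (\<chi> i. (x - sum_list ws) $ i mod int l) # ws) :: (int^'n) \<times> (int^'n) list"
 have bij: "bij_betw ?g (lists_in d (ibox (\<lambda>_. l))) ?S"
 proof (rule bij_betwI[where g = "\<lambda>p. tl (snd p)"])
  show "?g \<in> lists_in d (ibox (\<lambda>_. l)) \<rightarrow> ?S"
  proof
   fix ws :: "(int^'n) list" assume ws: "ws \<in> lists_in d (ibox (\<lambda>_. l))"
   have "(\<chi> i. (x - sum_list ws) $ i mod int l) \<in> ibox (\<lambda>_. l)" using l by (simp add: ibox_def)
   moreover have "smul (int l) (\<chi> i. (x - sum_list ws) $ i div int l) + ((\<chi> i. (x - sum_list ws) $ i mod int l) + sum_list ws) = x"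
   proof -
    have "int l * ((x - sum_list ws) $ i div int l) + (x - sum_list ws) $ i mod int l = (x - sum_list ws) $ i" for i by simp
    thus ?thesis by (simp add: vec_eq_iff algebra_simps; metis add.commute diff_eq_eq)
   qed
   ultimately show "?g ws \<in> ?S" using ws by (simp add: lists_in_def)
  qed
  show "(\<lambda>p. tl (snd p)) \<in> ?S \<rightarrow> lists_in d (ibox (\<lambda>_. l))"
  proof
   fix p assume "p \<in> ?S"
   thus "tl (snd p) \<in> lists_in d (ibox (\<lambda>_. l))" by (cases "snd p") (auto simp: lists_in_def)
  qed
  show "tl (snd (?g ws)) = ws" if "ws \<in> lists_in d (ibox (\<lambda>_. l))" for ws by simp
  show "?g (tl (snd p)) = p" if p: "p \<in> ?S" for p
  proof -
   obtain ka w ws where pe: "p = (ka, w # ws)" using p by (cases p; cases "snd p") (auto simp: lists_in_def)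
   have w: "w \<in> ibox (\<lambda>_. l)" and e: "smul (int l) ka + (w + sum_list ws) = x" using p by (auto simp: pe lists_in_def)
   have "(x - sum_list ws) $ i = int l * ka $ i + w $ i" for i using e by (auto simp: vec_eq_iff algebra_simps)
   moreover have "0 \<le> w $ i" "w $ i < int l" for i using w by (auto simp: ibox_def)
   ultimately have "(x - sum_list ws) $ i div int l = ka $ i" "(x - sum_list ws) $ i mod int l = w $ i" for i
    using l by (simp_all add: div_add1_eq)
   thus ?thesis by (simp add: pe vec_eq_iff del: vector_minus_component)
  qed
 qed
 have "card ?S = card (lists_in d (ibox (\<lambda>_. l)) :: (int^'n) list set)" by (rule bij_betw_same_card[OF bij, symmetric])
 also have "... = l ^ (CARD('n) * d)" by (simp add: card_lists_in card_ibox power_mult)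
 finally show ?thesis .
qed

lemma exists_dyadic_scale:
 assumes "y \<ge> (1::real)" shows "\<exists>p. y \<le> 2 ^ p \<and> 2 ^ p \<le> 2 * y"
proof -
 define p where "p = (LEAST p. y \<le> (2::real) ^ p)"
 have ex: "\<exists>p. y \<le> (2::real) ^ p" using real_arch_pow[of 2 y] by (meson less_imp_le one_less_numeral_iff semiring_norm(76))
 have 1: "y \<le> 2 ^ p" unfolding p_def by (rule LeastI_ex[OF ex])
 have "2 ^ p \<le> 2 * y"
 proof (cases p)
  case 0 thus ?thesis using assms by simp
 next
  case (Suc q)
  hence "\<not> y \<le> 2 ^ q" unfolding p_def by (metis lessI not_less_Least)
  thus ?thesis using Suc by simp
 qed
 thus ?thesis using 1 by blast
qed

lemma small_power:
 fixes r :: real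
 assumes "0 < r" "r < 1" "A \<ge> 0" "e > 0" shows "\<exists>k\<ge>4. A * r ^ k \<le> e"
proof -
 obtain k where k: "r ^ k < e / (A + 1)" using real_arch_pow_inv[of "e / (A + 1)" r] assms by auto
 have "A * r ^ (k + 4) \<le> (A + 1) * r ^ k"
  using assms power_decreasing[of k "k + 4" r] by (intro mult_mono) auto
 also have "... \<le> e" using k assms by (simp add: pos_less_divide_eq mult.commute)
 finally show ?thesis by (intro exI[of _ "k + 4"]) auto
qed

lemma box_count_bound:
 fixes F :: "'n::finite int_mpoly"
 assumes F: "is_form d F" and sm: "smooth_form F" and d: "d \<ge> 2" and n: "CARD('n) > 2 ^ d * (d - 1)"
 shows "\<exists>C r. C > 0 \<and> 0 < r \<and> r < 1 \<and> (\<forall>k p l c m. 4 \<le> k --> k \<le> p --> (\<forall>i. 1 \<le> l i \<and> (d + 1) * l i \<le> 2 ^ p) -->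
   real (card {x :: int ^ 'n. (\<forall>i. c $ i \<le> x $ i \<and> x $ i < c $ i + int (l i)) \<and> mpoly_eval F x = m})
    \<le> C * ((2 ^ p) ^ CARD('n) / (2 ^ p) ^ d) * (r ^ k + 4 ^ (k * (d - 1)) * (\<Prod>i\<in>UNIV. real (l i) / 2 ^ p)))"
proof -
 let ?n = "CARD('n)"
 let ?f = "mpoly_eval F :: int ^ 'n => int"
 from spline_bounds[OF assms] obtain C r Q where C: "C > 0" "0 < r" "r < 1" and all: "\<forall>k p c L. 4 \<le> k --> k \<le> p --> (\<forall>i. 1 \<le> L i \<and> L i \<le> 2 ^ p) -->
   (\<forall>m. real (reps (d + 1) ?f L c m) \<le> C * real (card (ibox L :: (int ^ 'n) set)) ^ d * ((2 ^ p) ^ ?n / (2 ^ p) ^ d)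
     * (r ^ k + 4 ^ (k * (d - 1)) * (real (card (ibox L :: (int ^ 'n) set)) / (2 ^ p) ^ ?n))) \<and>
   (\<forall>m m'. int (fact (Q k)) dvd (m - m') --> \<bar>real (reps (d + 1) ?f L c m) - real (reps (d + 1) ?f L c m')\<bar>
     \<le> C * real (card (ibox L :: (int ^ 'n) set)) ^ d * ((2 ^ p) ^ ?n / (2 ^ p) ^ d)
     * (r ^ k + 8 ^ (k * (d - 1)) * (\<bar>of_int (m - m')\<bar> / (2 ^ p) ^ d)))"
  by (elim exE conjE) (rule that)
 define c0 where "c0 = real (d + 1) ^ ?n"
 have c01: "c0 \<ge> 1" by (simp add: c0_def)
 have "real (card {x. (\<forall>i. c $ i \<le> x $ i \<and> x $ i < c $ i + int (l i)) \<and> ?f x = m})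
    \<le> C * c0 ^ Suc d * ((2 ^ p) ^ ?n / (2 ^ p) ^ d) * (r ^ k + 4 ^ (k * (d - 1)) * (\<Prod>i\<in>UNIV. real (l i) / 2 ^ p))"
  if k: "4 \<le> k" "k \<le> p" and l: "\<forall>i. 1 \<le> l i \<and> (d + 1) * l i \<le> 2 ^ p" for k p l c m
 proof -
  define La where "La = (\<Prod>i\<in>UNIV. real (l i))"
  let ?P = "(2 ^ p) ^ ?n / (2 ^ p) ^ d :: real"
  have La: "La \<ge> 1" unfolding La_def by (rule prod_ge_1) (use l in auto)
  have V: "real (card (ibox (\<lambda>i. (d + 1) * l i) :: (int ^ 'n) set)) = c0 * La"
   unfolding card_ibox c0_def La_def of_nat_prod of_nat_mult prod.distrib by simp
  have pr: "(\<Prod>i\<in>UNIV. real (l i) / 2 ^ p) = La / (2 ^ p) ^ ?n" by (simp add: La_def prod_dividef)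
  have L: "\<forall>i. 1 \<le> (d + 1) * l i \<and> (d + 1) * l i \<le> 2 ^ p"
  proof
   fix i have "1 * 1 \<le> (d + 1) * l i" using l by (intro mult_le_mono) auto
   thus "1 \<le> (d + 1) * l i \<and> (d + 1) * l i \<le> 2 ^ p" using l by simp
  qed
  let ?K = "card {x. (\<forall>i. c $ i \<le> x $ i \<and> x $ i < c $ i + int (l i)) \<and> ?f x = m}"
  have "(\<Prod>i\<in>UNIV. l i) ^ d * ?K \<le> reps (d + 1) ?f (\<lambda>i. (d + 1) * l i) (c - (\<chi> i. int d * int (l i))) m"
   using l by (intro box_count_le_reps) auto
  hence "real ((\<Prod>i\<in>UNIV. l i) ^ d * ?K) \<le> real (reps (d + 1) ?f (\<lambda>i. (d + 1) * l i) (c - (\<chi> i. int d * int (l i))) m)"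
   by (simp only: of_nat_le_iff)
  also have "... \<le> C * (c0 * La) ^ d * ?P * (r ^ k + 4 ^ (k * (d - 1)) * (c0 * La / (2 ^ p) ^ ?n))"
   using all[rule_format, OF k, of "\<lambda>i. (d + 1) * l i" "c - (\<chi> i. int d * int (l i))", THEN conjunct1, rule_format, of m] L
   unfolding V by blast
  also have "... \<le> C * (c0 * La) ^ d * ?P * (c0 * (r ^ k + 4 ^ (k * (d - 1)) * (La / (2 ^ p) ^ ?n)))"
  proof (rule mult_left_mono)
   have "r ^ k \<le> c0 * r ^ k" using c01 C by simp
   thus "r ^ k + 4 ^ (k * (d - 1)) * (c0 * La / (2 ^ p) ^ ?n) \<le> c0 * (r ^ k + 4 ^ (k * (d - 1)) * (La / (2 ^ p) ^ ?n))"
    by (simp add: algebra_simps)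
  qed (use C c01 La in auto)
  also have "... = La ^ d * (C * c0 ^ Suc d * ?P * (r ^ k + 4 ^ (k * (d - 1)) * (La / (2 ^ p) ^ ?n)))"
   by (simp only: power_mult_distrib power_Suc mult_ac)
  finally have "La ^ d * real ?K \<le> La ^ d * (C * c0 ^ Suc d * ?P * (r ^ k + 4 ^ (k * (d - 1)) * (La / (2 ^ p) ^ ?n)))"
   by (simp add: La_def)
  thus ?thesis unfolding pr using La by (subst (asm) mult_le_cancel_left_pos) auto
 qed
 thus ?thesis using C c01 by (intro exI[of _ "C * c0 ^ Suc d"] exI[of _ r]) auto
qed

text \<open>The count over \<open>LB\<close> is sandwiched between spline counts; the error comes from grid splines
  that are not contained in \<open>LB\<close>.\<close>
lemma grid_decomposition:
 fixes f :: "int ^ 'n::finite => int" and m :: int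
 assumes l: "l \<ge> 1" and fin: "finite LB"
  and I: "I = {ka. \<forall>ws\<in>lists_in (Suc d) (ibox (\<lambda>_. l)). smul (int l) ka + sum_list ws \<in> LB}" and finI: "finite I"
 defines "bad \<equiv> {x \<in> LB. f x = m \<and> (\<exists>ka ws. ka \<notin> I \<and> ws \<in> lists_in (Suc d) (ibox (\<lambda>_. l)) \<and> smul (int l) ka + sum_list ws = x)}"
 shows "(\<Sum>ka\<in>I. reps (Suc d) f (\<lambda>_. l) (smul (int l) ka) m) \<le> l ^ (CARD('n) * d) * card {x \<in> LB. f x = m}"
  "l ^ (CARD('n) * d) * card {x \<in> LB. f x = m} \<le> (\<Sum>ka\<in>I. reps (Suc d) f (\<lambda>_. l) (smul (int l) ka) m) + l ^ (CARD('n) * d) * card bad"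
proof -
 let ?L = "lists_in (Suc d) (ibox (\<lambda>_. l)) :: (int ^ 'n) list set"
 let ?X = "{x \<in> LB. f x = m}"
 define S where "S x = {(ka, ws). ws \<in> ?L \<and> smul (int l) ka + sum_list ws = x}" for x
 have cS: "card (S x) = l ^ (CARD('n) * d)" for x unfolding S_def by (rule grid_cover_count[OF l])
 have finS: "finite (S x)" for x using cS[of x] l by (intro card_ge_0_finite) simp
 have split: "card (S x) = card {q \<in> S x. fst q \<in> I} + card {q \<in> S x. fst q \<notin> I}" for x
 proof -
  have "S x = {q \<in> S x. fst q \<in> I} \<union> {q \<in> S x. fst q \<notin> I}" by blast
  thus ?thesis using card_Un_disjoint[of "{q \<in> S x. fst q \<in> I}" "{q \<in> S x. fst q \<notin> I}"] finS[of x] by auto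
 qed
 have "(\<Sum>ka\<in>I. reps (Suc d) f (\<lambda>_. l) (smul (int l) ka) m) = card (SIGMA ka:I. {ws \<in> ?L. f (smul (int l) ka + sum_list ws) = m})"
  by (subst card_SigmaI) (auto simp: finI reps_def)
 also have "... = card (SIGMA x:?X. {q \<in> S x. fst q \<in> I})"
 proof (rule bij_betw_same_card[where f = "\<lambda>q. (smul (int l) (fst q) + sum_list (snd q), q)"], rule bij_betwI[where g = snd])
  show "(\<lambda>q. (smul (int l) (fst q) + sum_list (snd q), q)) \<in> (SIGMA ka:I. {ws \<in> ?L. f (smul (int l) ka + sum_list ws) = m}) \<rightarrow> (SIGMA x:?X. {q \<in> S x. fst q \<in> I})"
  proof
   fix q assume q: "q \<in> (SIGMA ka:I. {ws \<in> ?L. f (smul (int l) ka + sum_list ws) = m})"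
   obtain ka ws where e: "q = (ka, ws)" by (cases q)
   have "ka \<in> I" "ws \<in> ?L" "f (smul (int l) ka + sum_list ws) = m" using q e by auto
   moreover from this have "smul (int l) ka + sum_list ws \<in> LB" by (simp add: I)
   ultimately show "(smul (int l) (fst q) + sum_list (snd q), q) \<in> (SIGMA x:?X. {q \<in> S x. fst q \<in> I})"
    by (simp add: e S_def)
  qed
  show "snd \<in> (SIGMA x:?X. {q \<in> S x. fst q \<in> I}) \<rightarrow> (SIGMA ka:I. {ws \<in> ?L. f (smul (int l) ka + sum_list ws) = m})"
   by (auto simp: S_def)
 qed (auto simp: S_def)
 also have "... = (\<Sum>x\<in>?X. card {q \<in> S x. fst q \<in> I})"
  using fin finS by (subst card_SigmaI) auto
 finally have inn: "(\<Sum>ka\<in>I. reps (Suc d) f (\<lambda>_. l) (smul (int l) ka) m) = (\<Sum>x\<in>?X. card {q \<in> S x. fst q \<in> I})" .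
 have tot: "l ^ (CARD('n) * d) * card ?X = (\<Sum>x\<in>?X. card {q \<in> S x. fst q \<in> I}) + (\<Sum>x\<in>?X. card {q \<in> S x. fst q \<notin> I})"
  unfolding sum.distrib[symmetric] split[symmetric] by (simp add: cS)
 thus "(\<Sum>ka\<in>I. reps (Suc d) f (\<lambda>_. l) (smul (int l) ka) m) \<le> l ^ (CARD('n) * d) * card ?X" by (simp add: inn)
 have "(\<Sum>x\<in>?X. card {q \<in> S x. fst q \<notin> I}) \<le> (\<Sum>x\<in>?X. if x \<in> bad then l ^ (CARD('n) * d) else 0)"
 proof (rule sum_mono)
  fix x assume x: "x \<in> ?X"
  show "card {q \<in> S x. fst q \<notin> I} \<le> (if x \<in> bad then l ^ (CARD('n) * d) else 0)"
  proof (cases "x \<in> bad")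
   case True
   thus ?thesis using split[of x] cS[of x] by simp
  next
   case False
   hence e: "{q \<in> S x. fst q \<notin> I} = {}" using x by (auto simp: bad_def S_def)
   show ?thesis unfolding e by simp
  qed
 qed
 also have "... = l ^ (CARD('n) * d) * card bad"
 proof -
  have "?X \<inter> {x. x \<in> bad} = bad" by (auto simp: bad_def)
  thus ?thesis using fin by (simp add: sum.If_cases)
 qed
 finally show "l ^ (CARD('n) * d) * card ?X \<le> (\<Sum>ka\<in>I. reps (Suc d) f (\<lambda>_. l) (smul (int l) ka) m) + l ^ (CARD('n) * d) * card bad"
  using tot by (simp add: inn)
qed

section \<open>Regularity for degree at least two\<close>

lemma is_boxE:
 assumes "is_box B"
 obtains a a' where "B = {t. \<forall>j. t $ j \<in> {a $ j..a' $ j}}" "B \<subseteq> {t. \<forall>j. t $ j \<in> {-1..1}}"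
 using assms unfolding is_box_def by auto

text \<open>A form of regularity without cut points is enough: the multiples of \<open>\<delta>\<close> then serve as
  cut points, and \<open>r(m) = 0\<close> for \<open>m\<close> outside \<open>[-H \<delta> P^d, H \<delta>
  P^d]\<close>.\<close>
lemma regular_countsI:
 fixes F :: "'n::finite int_mpoly"
 assumes F: "is_form d F" and Bs: "B \<subseteq> {t. \<forall>j. t $ j \<in> {-1..1}}"
  and sup: "\<forall>\<^sub>F P in at_top. count_le F d B C P"
  and sh: "\<And>\<epsilon>. \<epsilon> > 0 ==> \<exists>T\<ge>1. \<exists>\<delta>>0. \<forall>\<^sub>F P in at_top. shift_stable F d B T \<delta> \<epsilon> P"
 shows "regular_counts F d B"
proof -
 let ?n = "CARD('n)"
 let ?f = "mpoly_eval F :: int ^ 'n => int"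
 define cF where "cF = (\<Sum>m\<in>keys F. \<bar>real_of_int (lookup F m)\<bar>) + 1"
 have cF1: "cF \<ge> 1" by (simp add: cF_def sum_nonneg)
 have fin: "finite (lat_pts B P)" if "P \<ge> 1" for P using finite_lat_pts[OF Bs, of P] that by simp
 have bd: "\<bar>real_of_int (x $ j)\<bar> \<le> P" if "P \<ge> 1" "x \<in> lat_pts B P" for x P j using lat_pts_bound[OF Bs, of P] that by simp
 have "\<exists>T\<ge>1. \<exists>D. finite D \<and> (\<forall>\<^sub>F P in at_top.
   (count_le F d B C P) \<and>
   cell_stable F d B T D \<epsilon> P)"
  if eps: "\<epsilon> > 0" for \<epsilon> :: real
 proof -
  from sh[OF eps] obtain T \<delta> where T: "T \<ge> 1" and del: "\<delta> > 0"
   and sh': "\<forall>\<^sub>F P in at_top. shift_stable F d B T \<delta> \<epsilon> P" by blast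
  \<comment> \<open>beyond \<open>H \<delta> P^d\<close> there are no values of \<open>F\<close> on the dilated box\<close>
  define H where "H = \<lceil>cF / \<delta>\<rceil> + 1"
  define D where "D = (\<lambda>i::int. of_int i * \<delta>) ` {-H..H}"
  have HD: "real_of_int H * \<delta> > cF"
  proof -
   have "cF / \<delta> < real_of_int H" by (simp add: H_def) linarith
   thus ?thesis using del by (simp add: pos_divide_less_eq)
  qed
  have ev: "count_gap F B P m m' \<le> \<epsilon> * (P ^ ?n / P ^ d)"
   if P1: "P \<ge> 1" and mm: "[m = m'] (mod int T)"
    and cl: "same_side D (P ^ d) m m'"
    and sh2: "shift_stable F d B T \<delta> \<epsilon> P" for P m m'
  proof -
   have Pd: "P ^ d > 0" using P1 by auto
   let ?Z = "P ^ ?n / P ^ d"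
   have Z0: "?Z > 0" using P1 by simp
   have zero: "rep_count F B P u = 0" if u: "\<bar>real_of_int u\<bar> \<ge> of_int H * \<delta> * P ^ d" for u
   proof -
    have "?f x \<noteq> u" if x: "x \<in> lat_pts B P" for x
    proof
     assume fx: "?f x = u"
     have "\<bar>mpoly_eval F (\<chi> j. real_of_int (x $ j))\<bar> \<le> (\<Sum>m\<in>keys F. \<bar>of_int (lookup F m)\<bar>) * P ^ d"
      by (rule form_bound[OF F]) (use bd[OF P1 x] P1 in auto)
     hence "\<bar>real_of_int u\<bar> \<le> (cF - 1) * P ^ d" by (simp add: mpoly_eval_of_int fx cF_def)
     also have "... < cF * P ^ d" using Pd by simp
     also have "... \<le> of_int H * \<delta> * P ^ d" using HD Pd by (intro mult_right_mono) auto
     finally show False using u by simp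
    qed
    hence e: "{x \<in> lat_pts B P. ?f x = u} = {}" by blast
    show ?thesis unfolding rep_count_def e by simp
   qed
   have memD: "of_int i * \<delta> \<in> D" if "-H \<le> i" "i \<le> H" for i using that by (auto simp: D_def)
   consider "\<bar>real_of_int m\<bar> \<ge> of_int H * \<delta> * P ^ d \<and> \<bar>real_of_int m'\<bar> \<ge> of_int H * \<delta> * P ^ d" | "\<bar>real_of_int (m - m')\<bar> \<le> \<delta> * P ^ d"
   proof -
    define i where "i = \<lfloor>real_of_int m / (\<delta> * P ^ d)\<rfloor>"
    have dP: "\<delta> * P ^ d > 0" using del Pd by simp
    have i: "of_int i * \<delta> * P ^ d \<le> of_int m" "of_int m < (of_int i + 1) * \<delta> * P ^ d"
    proof -
     have "of_int i \<le> real_of_int m / (\<delta> * P ^ d)" "real_of_int m / (\<delta> * P ^ d) < of_int i + 1" unfolding i_def by linarith+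
     hence "of_int i * (\<delta> * P ^ d) \<le> of_int m" "of_int m < (of_int i + 1) * (\<delta> * P ^ d)" using dP by (simp_all add: pos_le_divide_eq pos_divide_less_eq)
     thus "of_int i * \<delta> * P ^ d \<le> of_int m" "of_int m < (of_int i + 1) * \<delta> * P ^ d" by (simp_all add: mult.assoc)
    qed
    have "0 \<le> cF / \<delta>" using cF1 del by simp
    hence H0: "H \<ge> 1" unfolding H_def by linarith
    consider (hi) "i \<ge> H" | (lo) "i < -H" | (mid) "-H \<le> i" "i < H" by linarith
    thus ?thesis
    proof cases
     case hi
     have "of_int H * \<delta> * P ^ d \<le> of_int i * \<delta> * P ^ d" using hi del Pd by (intro mult_right_mono) auto
     hence m: "of_int H * \<delta> * P ^ d \<le> of_int m" using i by linarith
     moreover have "\<not> of_int m' < of_int H * \<delta> * P ^ d" using cl[rule_format, OF memD[of H]] H0 m by auto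
     ultimately show ?thesis using that(1) by linarith
    next
     case lo
     have "(of_int i + 1) * \<delta> * P ^ d \<le> - of_int H * \<delta> * P ^ d" using lo del Pd by (intro mult_right_mono) auto
     hence m: "of_int m < - of_int H * \<delta> * P ^ d" using i by linarith
     moreover have "of_int m' < of_int (- H) * \<delta> * P ^ d" using cl[rule_format, OF memD[of "- H"]] H0 m by auto
     ultimately have "of_int H * \<delta> * P ^ d \<le> - real_of_int m" "of_int H * \<delta> * P ^ d \<le> - real_of_int m'" by auto
     thus ?thesis using that(1) by linarith
    next
     case mid
     have "\<not> of_int m' < of_int i * \<delta> * P ^ d" using cl[rule_format, OF memD[of i]] mid i by auto
     moreover have "of_int m' < of_int (i + 1) * \<delta> * P ^ d" using cl[rule_format, OF memD[of "i + 1"]] mid i by auto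
     moreover have "(of_int i + 1) * \<delta> * P ^ d = of_int i * \<delta> * P ^ d + \<delta> * P ^ d" by (simp add: algebra_simps)
     ultimately have "\<bar>real_of_int (m - m')\<bar> \<le> \<delta> * P ^ d" using i by (simp add: abs_le_iff)
     thus ?thesis using that(2) by blast
    qed
   qed
   thus ?thesis
   proof cases
    case 1
    hence "rep_count F B P m = 0" "rep_count F B P m' = 0" using zero by blast+
    moreover have "0 \<le> \<epsilon> * ?Z" using Z0 eps by (intro mult_nonneg_nonneg) auto
    ultimately show ?thesis by simp
   next
    case 2
    thus ?thesis using sh2 mm by blast
   qed
  qed
  have "\<forall>\<^sub>F P in at_top.
   (count_le F d B C P) \<and>
   cell_stable F d B T D \<epsilon> P"
   using sup sh' eventually_ge_at_top[of 1]
  proof eventually_elim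
   case (elim P)
   show ?case
   proof (intro conjI allI impI)
    show "real (rep_count F B P m) \<le> C * (P ^ ?n / P ^ d)" for m using elim(1) by blast
   qed (rule ev[OF elim(3) _ _ elim(2)])
  qed
  moreover have "finite D" by (simp add: D_def)
  ultimately show ?thesis using T by blast
 qed
 thus ?thesis unfolding regular_counts_def regular_at_def by blast
qed

text \<open>The box is covered by splines of side \<open>\<eta> P\<close>, up to a fixed factor. Those meeting the
  boundary lie in slabs around the faces, whose contribution \<open>box_count_bound\<close> makes small;
  the others are compared by \<open>spline_bounds\<close>.\<close>
lemma regular_counts_ge_2:
 fixes F :: "'n::finite int_mpoly"
 assumes F: "is_form d F" and sm: "smooth_form F" and d: "d \<ge> 2" and n: "CARD('n) > 2 ^ d * (d - 1)" and B: "is_box B"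
 shows "regular_counts F d B"
proof -
 let ?n = "CARD('n)"
 let ?f = "mpoly_eval F :: int ^ 'n => int"
 obtain a a' where Ba: "B = {t. \<forall>j. t $ j \<in> {a $ j..a' $ j}}" and Bs: "B \<subseteq> {t. \<forall>j. t $ j \<in> {-1..1}}"
  using is_boxE[OF B] by blast
 have LB: "x \<in> lat_pts B P \<longleftrightarrow> (\<forall>j. P * a $ j \<le> of_int (x $ j) \<and> of_int (x $ j) \<le> P * a' $ j)" if "P > 0" for x P
  unfolding lat_pts_iff[OF that] Ba using that by (simp add: field_simps)
 from box_count_bound[OF F sm d n] obtain C1 r1 where C1: "C1 > 0" "0 < r1" "r1 < 1"
  and ub: "\<forall>k p l c m. 4 \<le> k --> k \<le> p --> (\<forall>i. 1 \<le> l i \<and> (d + 1) * l i \<le> 2 ^ p) -->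
   real (card {x :: int ^ 'n. (\<forall>i. c $ i \<le> x $ i \<and> x $ i < c $ i + int (l i)) \<and> mpoly_eval F x = m})
    \<le> C1 * ((2 ^ p) ^ ?n / (2 ^ p) ^ d) * (r1 ^ k + 4 ^ (k * (d - 1)) * (\<Prod>i\<in>UNIV. real (l i) / 2 ^ p))"
  by (elim exE conjE) (rule that)
 from spline_bounds[OF F sm d n] obtain C2 r2 Q where C2: "C2 > 0" "0 < r2" "r2 < 1" and sp: "\<forall>k p c L. 4 \<le> k --> k \<le> p --> (\<forall>i. 1 \<le> L i \<and> L i \<le> 2 ^ p) -->
   (\<forall>m. real (reps (d + 1) ?f L c m) \<le> C2 * real (card (ibox L :: (int ^ 'n) set)) ^ d * ((2 ^ p) ^ ?n / (2 ^ p) ^ d)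
     * (r2 ^ k + 4 ^ (k * (d - 1)) * (real (card (ibox L :: (int ^ 'n) set)) / (2 ^ p) ^ ?n))) \<and>
   (\<forall>m m'. int (fact (Q k)) dvd (m - m') --> \<bar>real (reps (d + 1) ?f L c m) - real (reps (d + 1) ?f L c m')\<bar>
     \<le> C2 * real (card (ibox L :: (int ^ 'n) set)) ^ d * ((2 ^ p) ^ ?n / (2 ^ p) ^ d)
     * (r2 ^ k + 8 ^ (k * (d - 1)) * (\<bar>of_int (m - m')\<bar> / (2 ^ p) ^ d)))"
  by (elim exE conjE) (rule that)
 define K where "K = (8 * (real d + 1)) ^ ?n"
 have K0: "K > 0" by (simp add: K_def)
 have scale: "\<exists>p. 4 * (real d + 1) * P \<le> 2 ^ p \<and> P \<le> 2 ^ p \<and> ((2 ^ p) ^ ?n / (2 ^ p) ^ d) \<le> K * (P ^ ?n / P ^ d) \<and> (\<forall>k. 2 ^ k \<le> P --> k \<le> p)"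
  if P: "P \<ge> 1" for P :: real
 proof -
  have "1 * 1 \<le> 4 * (real d + 1) * P" using P by (intro mult_mono) auto
  then obtain p where p: "4 * (real d + 1) * P \<le> 2 ^ p" "2 ^ p \<le> 2 * (4 * (real d + 1) * P)"
   using exists_dyadic_scale[of "4 * (real d + 1) * P"] by auto
  have "1 * P \<le> 4 * (real d + 1) * P" using P by (intro mult_right_mono) auto
  hence pP: "P \<le> 2 ^ p" using p by linarith
  have "2 * (4 * (real d + 1) * P) = 8 * (real d + 1) * P" by (simp add: algebra_simps)
  hence p2: "2 ^ p \<le> 8 * (real d + 1) * P" using p(2) by (simp only:)
  have "(2 ^ p) ^ ?n / (2 ^ p) ^ d \<le> (8 * (real d + 1) * P) ^ ?n / P ^ d"
   by (intro frac_le power_mono p2 pP) (use P in auto)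
  also have "... = K * (P ^ ?n / P ^ d)" by (simp add: K_def power_mult_distrib)
  finally have 3: "(2 ^ p) ^ ?n / (2 ^ p) ^ d \<le> K * (P ^ ?n / P ^ d)" .
  have "k \<le> p" if "2 ^ k \<le> P" for k
  proof -
   have "(2::real) ^ k \<le> 2 ^ p" using that pP by linarith
   thus ?thesis by simp
  qed
  thus ?thesis using p(1) pP 3 by blast
 qed
 have fin: "finite (lat_pts B P)" if "P \<ge> 1" for P using finite_lat_pts[OF Bs, of P] that by simp
 have bd: "\<bar>real_of_int (x $ j)\<bar> \<le> P" if "P \<ge> 1" "x \<in> lat_pts B P" for x P j using lat_pts_bound[OF Bs, of P] that by simp
 have iP: "real (2 * nat \<lfloor>P\<rfloor> + 1) \<le> 4 * P" if "P \<ge> 1" for P :: real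
 proof -
  have "real (nat \<lfloor>P\<rfloor>) = of_int \<lfloor>P\<rfloor>" using that by simp
  hence "2 * real (nat \<lfloor>P\<rfloor>) + 1 \<le> 4 * P" using that of_int_floor_le[of P] by linarith
  thus ?thesis by simp
 qed
 have il: "(d + 1) * l \<le> 2 ^ p" if "real l \<le> 4 * P" "4 * (real d + 1) * P \<le> 2 ^ p" for l p P
 proof -
  have "real ((d + 1) * l) \<le> (real d + 1) * (4 * P)" using that(1) by (simp only: of_nat_mult of_nat_add of_nat_1) (intro mult_left_mono; simp)
  also have "... \<le> real (2 ^ p)" using that(2) by (simp add: mult_ac)
  finally show ?thesis by (simp only: of_nat_le_iff)
 qed
 have ic: "- \<lfloor>P\<rfloor> \<le> x $ i \<and> x $ i < - \<lfloor>P\<rfloor> + int (2 * nat \<lfloor>P\<rfloor> + 1)" if P: "P \<ge> 1" and x: "x \<in> lat_pts B P" for P x i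
 proof -
  have "real_of_int (x $ i) \<le> P" "real_of_int (- x $ i) \<le> P" using bd[OF P x, of i] by (auto simp: abs_le_iff)
  hence "x $ i \<le> \<lfloor>P\<rfloor>" "- x $ i \<le> \<lfloor>P\<rfloor>" by (simp_all only: le_floor_iff)
  moreover have "int (nat \<lfloor>P\<rfloor>) = \<lfloor>P\<rfloor>" using P by simp
  ultimately show ?thesis by simp
 qed
 define Cs where "Cs = C1 * K * (r1 ^ 4 + 4 ^ (4 * (d - 1)))"
 have sup: "real (rep_count F B P m) \<le> Cs * (P ^ ?n / P ^ d)" if P: "P \<ge> 16" for P m
 proof -
  have P1: "P \<ge> 1" using P by simp
  obtain p where p: "4 * (real d + 1) * P \<le> 2 ^ p" "P \<le> 2 ^ p" "(2 ^ p) ^ ?n / (2 ^ p) ^ d \<le> K * (P ^ ?n / P ^ d)" "\<forall>k. 2 ^ k \<le> P --> k \<le> p"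
   using scale[OF P1] by blast
  have p4: "4 \<le> p" using p(4) P by simp
  define l where "l = 2 * nat \<lfloor>P\<rfloor> + 1"
  have l: "\<forall>i::'n. 1 \<le> l \<and> (d + 1) * l \<le> 2 ^ p" using il[OF iP[OF P1] p(1)] by (simp add: l_def)
  have "rep_count F B P m \<le> card {x :: int ^ 'n. (\<forall>i. (\<chi> i. - \<lfloor>P\<rfloor>) $ i \<le> x $ i \<and> x $ i < (\<chi> i. - \<lfloor>P\<rfloor>) $ i + int l) \<and> ?f x = m}"
   unfolding rep_count_def
  proof (rule card_mono)
   show "finite {x :: int ^ 'n. (\<forall>i. (\<chi> i. - \<lfloor>P\<rfloor>) $ i \<le> x $ i \<and> x $ i < (\<chi> i. - \<lfloor>P\<rfloor>) $ i + int l) \<and> ?f x = m}"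
    by (rule finite_subset[OF _ finite_vec_box[of "\<lambda>_. {- \<lfloor>P\<rfloor>..<- \<lfloor>P\<rfloor> + int l}"]]) auto
   show "{x \<in> lat_pts B P. ?f x = m} \<subseteq> {x :: int ^ 'n. (\<forall>i. (\<chi> i. - \<lfloor>P\<rfloor>) $ i \<le> x $ i \<and> x $ i < (\<chi> i. - \<lfloor>P\<rfloor>) $ i + int l) \<and> ?f x = m}"
    using ic[OF P1] by (auto simp: l_def)
  qed
  hence "real (rep_count F B P m) \<le> C1 * ((2 ^ p) ^ ?n / (2 ^ p) ^ d) * (r1 ^ 4 + 4 ^ (4 * (d - 1)) * (\<Prod>i\<in>(UNIV::'n set). real l / 2 ^ p))"
   using ub[rule_format, OF order_refl p4, of "\<lambda>_. l" "\<chi> i. - \<lfloor>P\<rfloor>" m] l by (meson of_nat_le_iff order_trans)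
  also have "... \<le> C1 * (K * (P ^ ?n / P ^ d)) * (r1 ^ 4 + 4 ^ (4 * (d - 1)) * 1)"
  proof (intro mult_mono add_mono order_refl p(3))
   have "real l \<le> 2 ^ p"
   proof -
    have "l \<le> (d + 1) * l" by simp
    hence "l \<le> 2 ^ p" using l by (meson order_trans)
    thus ?thesis by (metis of_nat_le_iff of_nat_numeral of_nat_power)
   qed
   thus "(\<Prod>i\<in>(UNIV::'n set). real l / 2 ^ p) \<le> 1" by (intro prod_le_1) auto
  qed (use C1 K0 P in \<open>auto intro!: add_nonneg_nonneg mult_nonneg_nonneg prod_nonneg\<close>)
  finally show ?thesis by (simp add: Cs_def mult_ac)
 qed
 have slab: "real (card {x \<in> lat_pts B P. ?f x = m \<and> \<bar>of_int (x $ j) - e\<bar> \<le> real w}) \<le> C1 * (K * (P ^ ?n / P ^ d)) * (r1 ^ k + 4 ^ (k * (d - 1)) * (real (2 * w + 1) / P))"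
  if P: "P \<ge> 1" "2 ^ k \<le> P" and k: "4 \<le> k" and w: "real (2 * w + 1) \<le> 4 * P" for P m j e w k
 proof -
  obtain p where p: "4 * (real d + 1) * P \<le> 2 ^ p" "P \<le> 2 ^ p" "(2 ^ p) ^ ?n / (2 ^ p) ^ d \<le> K * (P ^ ?n / P ^ d)" "\<forall>k. 2 ^ k \<le> P --> k \<le> p"
   using scale[OF P(1)] by blast
  have kp: "k \<le> p" using p(4) P by simp
  define l where "l i = (if i = j then 2 * w + 1 else 2 * nat \<lfloor>P\<rfloor> + 1)" for i
  define c where "c = (\<chi> i. if i = j then \<lceil>e - real w\<rceil> else - \<lfloor>P\<rfloor>)"
  have l4: "real (l i) \<le> 4 * P" for i using w iP[OF P(1)] by (simp add: l_def)
  have l: "\<forall>i. 1 \<le> l i \<and> (d + 1) * l i \<le> 2 ^ p" using il[OF l4 p(1)] by (simp add: l_def)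
  have l2: "real (l i) \<le> 2 ^ p" for i
  proof -
   have "l i \<le> (d + 1) * l i" by simp
   hence "l i \<le> 2 ^ p" using l by (meson order_trans)
   thus ?thesis by (metis of_nat_le_iff of_nat_numeral of_nat_power)
  qed
  have "card {x \<in> lat_pts B P. ?f x = m \<and> \<bar>of_int (x $ j) - e\<bar> \<le> real w} \<le> card {x :: int ^ 'n. (\<forall>i. c $ i \<le> x $ i \<and> x $ i < c $ i + int (l i)) \<and> ?f x = m}"
  proof (rule card_mono)
   show "finite {x :: int ^ 'n. (\<forall>i. c $ i \<le> x $ i \<and> x $ i < c $ i + int (l i)) \<and> ?f x = m}"
    by (rule finite_subset[OF _ finite_vec_box[of "\<lambda>i. {c $ i..<c $ i + int (l i)}"]]) auto
   show "{x \<in> lat_pts B P. ?f x = m \<and> \<bar>of_int (x $ j) - e\<bar> \<le> real w} \<subseteq> {x :: int ^ 'n. (\<forall>i. c $ i \<le> x $ i \<and> x $ i < c $ i + int (l i)) \<and> ?f x = m}"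
   proof
    fix x assume "x \<in> {x \<in> lat_pts B P. ?f x = m \<and> \<bar>of_int (x $ j) - e\<bar> \<le> real w}"
    hence x: "x \<in> lat_pts B P" "?f x = m" "\<bar>of_int (x $ j) - e\<bar> \<le> real w" by auto
    have "c $ i \<le> x $ i \<and> x $ i < c $ i + int (l i)" for i
    proof (cases "i = j")
     case True
     have "\<lceil>e - real w\<rceil> \<le> x $ j" using x(3) by (simp add: ceiling_le_iff abs_le_iff)
     moreover have "real_of_int (x $ j) < of_int \<lceil>e - real w\<rceil> + real (2 * w + 1)" using x(3) by (simp add: abs_le_iff) linarith
     hence "real_of_int (x $ j) < of_int (\<lceil>e - real w\<rceil> + int (2 * w + 1))" by (simp only: of_int_add of_int_of_nat_eq)
     hence "x $ j < \<lceil>e - real w\<rceil> + int (2 * w + 1)" by (simp only: of_int_less_iff)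
     ultimately show ?thesis using True by (simp add: c_def l_def)
    next
     case False
     thus ?thesis using ic[OF P(1) x(1), of i] by (simp add: c_def l_def)
    qed
    thus "x \<in> {x :: int ^ 'n. (\<forall>i. c $ i \<le> x $ i \<and> x $ i < c $ i + int (l i)) \<and> ?f x = m}" using x(2) by simp
   qed
  qed
  hence "real (card {x \<in> lat_pts B P. ?f x = m \<and> \<bar>of_int (x $ j) - e\<bar> \<le> real w}) \<le> C1 * ((2 ^ p) ^ ?n / (2 ^ p) ^ d) * (r1 ^ k + 4 ^ (k * (d - 1)) * (\<Prod>i\<in>UNIV. real (l i) / 2 ^ p))"
   using ub[rule_format, OF k kp, of l c m] l by (meson of_nat_le_iff order_trans)
  also have "... \<le> C1 * (K * (P ^ ?n / P ^ d)) * (r1 ^ k + 4 ^ (k * (d - 1)) * (real (2 * w + 1) / P))"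
  proof (intro mult_mono add_mono order_refl p(3))
   have "(\<Prod>i\<in>UNIV. real (l i) / 2 ^ p) = (real (l j) / 2 ^ p) * (\<Prod>i\<in>UNIV - {j}. real (l i) / 2 ^ p)" by (rule prod.remove) auto
   also have "... \<le> (real (l j) / 2 ^ p) * 1" using l2 by (intro mult_left_mono prod_le_1) auto
   also have "... \<le> real (2 * w + 1) / P" using p(2) P by (simp add: l_def frac_le)
   finally show "(\<Prod>i\<in>UNIV. real (l i) / 2 ^ p) \<le> real (2 * w + 1) / P" .
  qed (use C1 K0 P in \<open>auto intro!: add_nonneg_nonneg mult_nonneg_nonneg prod_nonneg\<close>)
  finally show ?thesis .
 qed
 show ?thesis
 proof (rule regular_countsI[OF F Bs])
  show "\<forall>\<^sub>F P in at_top. count_le F d B Cs P"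
   using eventually_ge_at_top[of 16] by eventually_elim (use sup in blast)
 next
  fix h :: real assume eps: "h > 0"
  define e1 where "e1 = h / (16 * real ?n)"
  have e1: "e1 > 0" using eps by (simp add: e1_def)
  obtain k1 where k1: "4 \<le> k1" "(C1 * K) * r1 ^ k1 \<le> e1"
   using small_power[OF C1(2,3) _ e1, of "C1 * K"] C1 K0 by auto
  define A1 where "A1 = C1 * K * 4 ^ (k1 * (d - 1)) * (6 * (real d + 1))"
  have A10: "A1 > 0" using C1 K0 by (simp add: A1_def add_pos_nonneg)
  define z where "z = min (e1 / A1) (1 / (6 * (real d + 1)))"
  have eta: "z > 0" "A1 * z \<le> e1" "6 * (real d + 1) * z \<le> 1"
  proof -
   show "z > 0" using e1 A10 by (simp add: z_def)
   have "A1 * z \<le> A1 * (e1 / A1)" using A10 by (intro mult_left_mono) (auto simp: z_def)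
   thus "A1 * z \<le> e1" using A10 by simp
   have "6 * (real d + 1) * z \<le> 6 * (real d + 1) * (1 / (6 * (real d + 1)))" by (intro mult_left_mono) (auto simp: z_def)
   thus "6 * (real d + 1) * z \<le> 1" by simp
  qed
  define G where "G = (2 / z + 1) ^ ?n"
  have G0: "G > 0" using eta by (simp add: G_def add_pos_pos)
  have e4: "h / 4 > 0" using eps by simp
  obtain k2 where k2: "4 \<le> k2" "(G * C2 * K) * r2 ^ k2 \<le> h / 4"
   using small_power[OF C2(2,3) _ e4, of "G * C2 * K"] G0 C2 K0 by auto
  define A2 where "A2 = G * C2 * K * 8 ^ (k2 * (d - 1))"
  have A20: "A2 > 0" using G0 C2 K0 by (simp add: A2_def)
  define \<delta> where "\<delta> = h / 4 / A2"
  have del: "\<delta> > 0" "A2 * \<delta> = h / 4" using eps A20 by (auto simp: \<delta>_def)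
  \<comment> \<open>all denominators of the major arcs at level \<open>k2\<close> divide \<open>T\<close>\<close>
  define T where "T = (fact (Q k2) :: nat)"
  have ev: "count_gap F B P m m' \<le> h * (P ^ ?n / P ^ d)"
   if P: "P \<ge> 16" "P \<ge> 1 / z" "P \<ge> 2 ^ k1" "P \<ge> 2 ^ k2" and mm: "[m = m'] (mod int T)"
    and 2: "\<bar>real_of_int (m - m')\<bar> \<le> \<delta> * P ^ d" for P m m'
  proof -
    have P1: "P \<ge> 1" and Pd: "P ^ d > 0" using P by auto
    let ?Z = "P ^ ?n / P ^ d"
    have Z0: "?Z > 0" using P1 by simp
    obtain p where p: "4 * (real d + 1) * P \<le> 2 ^ p" "P \<le> 2 ^ p" "(2 ^ p) ^ ?n / (2 ^ p) ^ d \<le> K * ?Z" "\<forall>k. 2 ^ k \<le> P --> k \<le> p"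
     using scale[OF P1] by blast
    have k2p: "k2 \<le> p" using p(4) P by simp
    define l where "l = nat \<lceil>z * P\<rceil>"
    have etaP: "z * P \<ge> 1" using P(2) eta by (simp add: pos_divide_le_eq mult.commute)
    have l: "l \<ge> 1" "z * P \<le> real l" "real l \<le> 2 * z * P"
    proof -
     have c1: "\<lceil>z * P\<rceil> \<ge> 1" using etaP by linarith
     thus "l \<ge> 1" unfolding l_def by linarith
     have rl: "real l = of_int \<lceil>z * P\<rceil>" using c1 by (simp add: l_def)
     show "z * P \<le> real l" unfolding rl by linarith
     have "real l \<le> z * P + 1" unfolding rl by linarith
     thus "real l \<le> 2 * z * P" using etaP by simp
    qed
    define w where "w = (d + 1) * l"
    have w1: "real (2 * w + 1) \<le> 6 * (real d + 1) * z * P"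
    proof -
     have "1 \<le> w" using l by (simp add: w_def)
     hence "real (2 * w + 1) \<le> 3 * real w" by simp
     also have "... = 3 * (real d + 1) * real l" by (simp add: w_def algebra_simps)
     also have "... \<le> 3 * (real d + 1) * (2 * z * P)" by (intro mult_left_mono l) auto
     also have "... = 6 * (real d + 1) * z * P" by (simp add: algebra_simps)
     finally show ?thesis .
    qed
    have w2: "real (2 * w + 1) \<le> 4 * P"
    proof -
     have "6 * (real d + 1) * z * P \<le> 1 * P" using eta P1 by (intro mult_right_mono) auto
     thus ?thesis using w1 P1 by linarith
    qed
    define I where "I = {ka. \<forall>ws\<in>lists_in (Suc d) (ibox (\<lambda>_. l)). smul (int l) ka + sum_list ws \<in> lat_pts B P}"
    have Isub: "I \<subseteq> {ka. \<forall>j. ka $ j \<in> {-\<lfloor>P / real l\<rfloor>..\<lfloor>P / real l\<rfloor>}}"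
    proof (rule subsetI, rule CollectI, rule allI)
     fix ka j assume ka: "ka \<in> I"
     have "replicate (Suc d) 0 \<in> lists_in (Suc d) (ibox (\<lambda>_. l) :: (int ^ 'n) set)" using l by (auto simp: lists_in_def ibox_def)
     hence "smul (int l) ka + sum_list (replicate (Suc d) 0) \<in> lat_pts B P" using ka by (simp only: I_def mem_Collect_eq; blast)
     moreover have "sum_list (replicate (Suc d) (0 :: int ^ 'n)) = 0" by (simp add: sum_list_replicate)
     ultimately have "smul (int l) ka \<in> lat_pts B P" by simp
     from bd[OF P1 this, of j] have "real l * \<bar>real_of_int (ka $ j)\<bar> \<le> P" by (simp add: abs_mult)
     hence "\<bar>real_of_int (ka $ j)\<bar> \<le> P / real l" using l by (simp add: pos_le_divide_eq mult.commute)
     hence "ka $ j \<le> \<lfloor>P / real l\<rfloor>" "- ka $ j \<le> \<lfloor>P / real l\<rfloor>" by (auto simp: le_floor_iff abs_le_iff)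
     thus "ka $ j \<in> {-\<lfloor>P / real l\<rfloor>..\<lfloor>P / real l\<rfloor>}" by auto
    qed
    have finI: "finite I" by (rule finite_subset[OF Isub finite_vec_box]) simp
    have cI: "real (card I) \<le> G"
    proof -
     have "card I \<le> (\<Prod>j\<in>(UNIV::'n set). card {-\<lfloor>P / real l\<rfloor>..\<lfloor>P / real l\<rfloor>})"
     proof -
      have f: "finite {-\<lfloor>P / real l\<rfloor>..\<lfloor>P / real l\<rfloor>}" by simp
      show ?thesis using card_mono[OF finite_vec_box Isub] f unfolding card_vec_box[OF f] by blast
     qed
     hence "real (card I) \<le> real (nat (2 * \<lfloor>P / real l\<rfloor> + 1)) ^ ?n" by (simp flip: of_nat_power)
     also have "... \<le> G" unfolding G_def
     proof (rule power_mono)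
      have "P / real l \<le> P / (z * P)" using l eta P1 by (intro divide_left_mono) auto
      hence "P / real l \<le> 1 / z" using P1 by simp
      moreover have "0 \<le> P / real l" using P1 by simp
      moreover have "2 / z = 2 * (1 / z)" by simp
      ultimately show "real (nat (2 * \<lfloor>P / real l\<rfloor> + 1)) \<le> 2 / z + 1" by linarith
     qed simp
     finally show ?thesis .
    qed
    let ?In = "\<lambda>u. \<Sum>ka\<in>I. reps (Suc d) ?f (\<lambda>_. l) (smul (int l) ka) u"
    let ?N = "l ^ (?n * d)"
    have Nn: "real ?N > 0" using l by simp
    let ?bad = "\<lambda>u. {x \<in> lat_pts B P. ?f x = u \<and> (\<exists>ka ws. ka \<notin> I \<and> ws \<in> lists_in (Suc d) (ibox (\<lambda>_. l)) \<and> smul (int l) ka + sum_list ws = x)}"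
    have gd: "real (?In u) \<le> real ?N * real (rep_count F B P u)" "real ?N * real (rep_count F B P u) \<le> real (?In u) + real ?N * real (card (?bad u))" for u
    proof -
     note g = grid_decomposition[OF l(1) fin[OF P1] I_def finI, of ?f u, folded rep_count_def]
     have "real (?In u) \<le> real (?N * rep_count F B P u)" using g(1) by (simp only: of_nat_le_iff)
     thus "real (?In u) \<le> real ?N * real (rep_count F B P u)" by (simp only: of_nat_mult)
     have "real (?N * rep_count F B P u) \<le> real (?In u + ?N * card (?bad u))" using g(2) by (simp only: of_nat_le_iff)
     thus "real ?N * real (rep_count F B P u) \<le> real (?In u) + real ?N * real (card (?bad u))"
      by (simp only: of_nat_add of_nat_mult)
    qed
    have bad: "real (card (?bad u)) \<le> h / 4 * ?Z" for u
    proof -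
     let ?s1 = "\<lambda>j. {x \<in> lat_pts B P. ?f x = u \<and> \<bar>of_int (x $ j) - P * a $ j\<bar> \<le> real w}"
     let ?s2 = "\<lambda>j. {x \<in> lat_pts B P. ?f x = u \<and> \<bar>of_int (x $ j) - P * a' $ j\<bar> \<le> real w}"
     have sub: "?bad u \<subseteq> (\<Union>j. ?s1 j \<union> ?s2 j)"
     proof
      fix x assume "x \<in> ?bad u"
      then obtain ka ws where x: "x \<in> lat_pts B P" "?f x = u" "ka \<notin> I" "ws \<in> lists_in (Suc d) (ibox (\<lambda>_. l))" "smul (int l) ka + sum_list ws = x" by blast
      then obtain ws' where ws': "ws' \<in> lists_in (Suc d) (ibox (\<lambda>_. l))" "smul (int l) ka + sum_list ws' \<notin> lat_pts B P" by (auto simp: I_def)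
      let ?y = "smul (int l) ka + sum_list ws'"
      have xb: "P * a $ j \<le> of_int (x $ j) \<and> of_int (x $ j) \<le> P * a' $ j" for j using x(1) LB[of P x] P1 by auto
      obtain j where j: "\<not> (P * a $ j \<le> of_int (?y $ j) \<and> of_int (?y $ j) \<le> P * a' $ j)" using ws'(2) LB[of P ?y] P1 by auto
      have "\<bar>x $ j - ?y $ j\<bar> \<le> int w"
      proof -
       have le: "int (Suc d) * (int l - 1) \<le> int w" by (simp add: w_def algebra_simps)
       have "x $ j = int l * ka $ j + sum_list ws $ j" using x(5) by auto
       moreover have "?y $ j = int l * ka $ j + sum_list ws' $ j" by simp
       ultimately show ?thesis using sum_list_ibox_bounds[OF x(4), of j] sum_list_ibox_bounds[OF ws'(1), of j] le by linarith
      qed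
      hence dist: "\<bar>real_of_int (x $ j) - of_int (?y $ j)\<bar> \<le> real w" by (metis of_int_abs of_int_diff of_int_le_iff of_int_of_nat_eq)
      have "\<bar>of_int (x $ j) - P * a $ j\<bar> \<le> real w \<or> \<bar>of_int (x $ j) - P * a' $ j\<bar> \<le> real w"
       using j xb[of j] dist by linarith
      thus "x \<in> (\<Union>j. ?s1 j \<union> ?s2 j)" using x by auto
     qed
     have "card (?bad u) \<le> card (\<Union>j. ?s1 j \<union> ?s2 j)"
      by (rule card_mono[OF finite_subset[OF _ fin[OF P1]] sub]) auto
     also have "... \<le> (\<Sum>j\<in>UNIV. card (?s1 j \<union> ?s2 j))" by (rule card_UN_le) simp
     also have "... \<le> (\<Sum>j\<in>UNIV. card (?s1 j) + card (?s2 j))" by (intro sum_mono card_Un_le)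
     finally have "real (card (?bad u)) \<le> (\<Sum>j\<in>UNIV. real (card (?s1 j)) + real (card (?s2 j)))"
      by (simp only: of_nat_sum[symmetric] of_nat_add[symmetric] of_nat_le_iff)
     also have "... \<le> (\<Sum>j\<in>(UNIV::'n set). 2 * e1 * ?Z + 2 * e1 * ?Z)"
     proof -
      have "C1 * (K * ?Z) * (r1 ^ k1 + 4 ^ (k1 * (d - 1)) * (real (2 * w + 1) / P)) \<le> 2 * e1 * ?Z"
      proof -
       have "real (2 * w + 1) / P \<le> 6 * (real d + 1) * z" using w1 P1 by (simp add: pos_divide_le_eq)
       hence "C1 * K * 4 ^ (k1 * (d - 1)) * (real (2 * w + 1) / P) \<le> C1 * K * 4 ^ (k1 * (d - 1)) * (6 * (real d + 1) * z)"
        using C1 K0 by (intro mult_left_mono) auto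
       also have "... = A1 * z" by (simp add: A1_def)
       also have "... \<le> e1" by (rule eta)
       finally have "C1 * K * r1 ^ k1 + C1 * K * 4 ^ (k1 * (d - 1)) * (real (2 * w + 1) / P) \<le> 2 * e1" using k1(2) by linarith
       hence "(C1 * K * r1 ^ k1 + C1 * K * 4 ^ (k1 * (d - 1)) * (real (2 * w + 1) / P)) * ?Z \<le> 2 * e1 * ?Z" using Z0 by (intro mult_right_mono) auto
       thus ?thesis by (simp add: algebra_simps)
      qed
      thus ?thesis
       using slab[OF P1 P(3) k1(1) w2] by (intro sum_mono add_mono) (meson order_trans)+
     qed
     also have "... = h / 4 * ?Z" by (simp add: e1_def)
     finally show ?thesis .
    qed
    have inn: "\<bar>real (?In m) - real (?In m')\<bar> \<le> real ?N * (h / 2 * ?Z)"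
    proof -
     have dv: "int (fact (Q k2)) dvd (m - m')" using mm by (simp add: T_def cong_iff_dvd_diff)
     have V: "real (card (ibox (\<lambda>_. l) :: (int ^ 'n) set)) ^ d = real ?N" by (simp add: card_ibox power_mult)
     have l2p: "l \<le> 2 ^ p"
     proof -
      have "l \<le> w" by (simp add: w_def)
      hence "real l \<le> real (2 * w + 1)" by simp
      hence "real l \<le> 4 * P" using w2 by linarith
      from il[OF this p(1)] have "(d + 1) * l \<le> 2 ^ p" .
      moreover have "l \<le> (d + 1) * l" by simp
      ultimately show ?thesis by (meson order_trans)
     qed
     have one: "\<bar>real (reps (Suc d) ?f (\<lambda>_. l) c m) - real (reps (Suc d) ?f (\<lambda>_. l) c m')\<bar>
       \<le> real ?N * (C2 * K * (r2 ^ k2 + 8 ^ (k2 * (d - 1)) * \<delta>) * ?Z)" for c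
     proof -
      have "\<bar>real (reps (d + 1) ?f (\<lambda>_. l) c m) - real (reps (d + 1) ?f (\<lambda>_. l) c m')\<bar>
       \<le> C2 * real ?N * ((2 ^ p) ^ ?n / (2 ^ p) ^ d) * (r2 ^ k2 + 8 ^ (k2 * (d - 1)) * (\<bar>of_int (m - m')\<bar> / (2 ^ p) ^ d))"
       using sp[rule_format, OF k2(1) k2p, of "\<lambda>_. l" c, THEN conjunct2, rule_format, of m m'] l l2p dv unfolding V by blast
      also have "... \<le> C2 * real ?N * (K * ?Z) * (r2 ^ k2 + 8 ^ (k2 * (d - 1)) * \<delta>)"
      proof (intro mult_mono add_mono order_refl p(3))
       have "\<bar>of_int (m - m')\<bar> / (2 ^ p) ^ d \<le> \<delta> * P ^ d / P ^ d"
        using 2 p(2) P1 del by (intro frac_le power_mono) auto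
       thus "\<bar>real_of_int (m - m')\<bar> / (2 ^ p) ^ d \<le> \<delta>" using P1 by simp
      qed (use C2 K0 P1 del Z0 Nn in \<open>auto intro!: add_nonneg_nonneg mult_nonneg_nonneg\<close>)
      finally show ?thesis by (simp add: mult_ac)
     qed
     have "\<bar>real (?In m) - real (?In m')\<bar> \<le> (\<Sum>ka\<in>I. \<bar>real (reps (Suc d) ?f (\<lambda>_. l) (smul (int l) ka) m) - real (reps (Suc d) ?f (\<lambda>_. l) (smul (int l) ka) m')\<bar>)"
      unfolding of_nat_sum sum_subtractf[symmetric] by (rule sum_abs)
     also have "... \<le> (\<Sum>ka\<in>I. real ?N * (C2 * K * (r2 ^ k2 + 8 ^ (k2 * (d - 1)) * \<delta>) * ?Z))" by (intro sum_mono one)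
     also have "... = real (card I) * (real ?N * (C2 * K * (r2 ^ k2 + 8 ^ (k2 * (d - 1)) * \<delta>) * ?Z))" by simp
     also have "... \<le> G * (real ?N * (C2 * K * (r2 ^ k2 + 8 ^ (k2 * (d - 1)) * \<delta>) * ?Z))"
      using C2 K0 del Z0 Nn by (intro mult_right_mono cI mult_nonneg_nonneg add_nonneg_nonneg) auto
     also have "... = real ?N * (((G * C2 * K) * r2 ^ k2 + A2 * \<delta>) * ?Z)" by (simp add: A2_def algebra_simps)
     also have "... \<le> real ?N * ((h / 4 + h / 4) * ?Z)"
      using Z0 Nn k2(2) del by (intro mult_left_mono mult_right_mono add_mono) auto
     finally show ?thesis by simp
    qed
    have "real ?N * count_gap F B P m m' = \<bar>real ?N * real (rep_count F B P m) - real ?N * real (rep_count F B P m')\<bar>"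
     by (simp add: right_diff_distrib[symmetric] abs_mult)
    also have "... \<le> \<bar>real (?In m) - real (?In m')\<bar> + (real ?N * real (card (?bad m)) + real ?N * real (card (?bad m')))"
    proof -
     have nn: "0 \<le> real ?N * real (card (?bad m))" "0 \<le> real ?N * real (card (?bad m'))" by simp_all
     show ?thesis using gd[of m] gd[of m'] nn unfolding abs_le_iff by linarith
    qed
    also have "... \<le> real ?N * (h / 2 * ?Z) + (real ?N * (h / 4 * ?Z) + real ?N * (h / 4 * ?Z))"
     using Nn by (intro add_mono inn mult_left_mono bad) auto
    also have "... = real ?N * (h * ?Z)" by (simp add: algebra_simps)
    finally show ?thesis using Nn by (simp only: mult_le_cancel_left_pos)
  qed
  have "\<forall>\<^sub>F P in at_top. P \<ge> 16 \<and> P \<ge> 1 / z \<and> P \<ge> 2 ^ k1 \<and> P \<ge> 2 ^ k2"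
   by (intro eventually_conj eventually_ge_at_top)
  hence "\<forall>\<^sub>F P in at_top. shift_stable F d B T \<delta> h P"
   by eventually_elim (use ev in blast)
  moreover have "T \<ge> 1" by (simp add: T_def)
  ultimately show "\<exists>T\<ge>1. \<exists>\<delta>>0. \<forall>\<^sub>F P in at_top. shift_stable F d B T \<delta> h P"
   using del(1) by blast
 qed
qed

section \<open>Regularity for linear forms\<close>

lemma card_le_proj:
 fixes S :: "('a ^ 'n::finite) set"
 assumes S: "\<And>x k. x \<in> S ==> k \<in> K ==> x $ k \<in> A k" and A: "\<And>k. k \<in> K ==> finite (A k)"
  and inj: "\<And>x y. x \<in> S ==> y \<in> S ==> (\<And>k. k \<in> K ==> x $ k = y $ k) ==> x = y"
 shows "card S \<le> (\<Prod>k\<in>K. card (A k))"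
proof -
 have "card S \<le> card (PiE K A)"
 proof (rule card_inj_on_le[where f = "\<lambda>x. restrict (\<lambda>k. x $ k) K"])
  show "inj_on (\<lambda>x. restrict (\<lambda>k. x $ k) K) S"
  proof (rule inj_onI)
   fix x y assume xy: "x \<in> S" "y \<in> S" "restrict (\<lambda>k. x $ k) K = restrict (\<lambda>k. y $ k) K"
   show "x = y"
   proof (rule inj[OF xy(1,2)])
    fix k assume "k \<in> K" thus "x $ k = y $ k" using fun_cong[OF xy(3), of k] by simp
   qed
  qed
  show "(\<lambda>x. restrict (\<lambda>k. x $ k) K) ` S \<subseteq> PiE K A" using S by auto
  show "finite (PiE K A)" using A by (intro finite_PiE) auto
 qed
 also have "... = (\<Prod>k\<in>K. card (A k))" by (rule card_PiE) simp
 finally show ?thesis .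
qed

lemma linear_form:
 fixes F :: "'n::finite int_mpoly"
 assumes F: "is_form 1 F" and sm: "smooth_form F"
 obtains c :: "'n => int" and i where "\<And>x. mpoly_eval F x = (\<Sum>k\<in>UNIV. c k * x $ k)" "c i \<noteq> 0"
proof -
 let ?f = "mpoly_eval F :: int ^ 'n => int"
 define c where "c k = polar ?f [axis k 1]" for k
 have d2: "dlt (Suc (Suc 0)) ?f" using dlt_mpoly[OF F] by simp
 have "smul 0 (0 :: int ^ 'n) = 0" by (simp add: vec_eq_iff)
 hence f0: "?f 0 = 0" using form_smul[OF F, of 0 "0 :: int ^ 'n"] by simp
 have 1: "?f x = (\<Sum>k\<in>UNIV. c k * x $ k)" for x
  using affine_expand[OF d2, of x] by (simp add: f0 c_def mult.commute)
 have "\<exists>i. c i \<noteq> 0"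
 proof (rule ccontr)
  assume "\<not> ?thesis"
  hence z: "c k = 0" for k by blast
  define u where "u = cvec (axis undefined 1 :: int ^ 'n)"
  have "mpoly_eval (mpoly_pderiv k F) u = 0" for k
  proof -
   have "mpoly_eval (mpoly_pderiv k F) (axis undefined 1 :: int ^ 'n) = 0"
    using polar_pderiv[OF F, of k "axis undefined 1"] z[of k] by (simp add: c_def)
   thus ?thesis by (simp add: u_def mpoly_eval_cvec)
  qed
  moreover have "u $ undefined \<noteq> 0" by (simp add: u_def)
  hence "u \<noteq> 0" by (metis zero_index)
  ultimately show False using sm unfolding smooth_form_def by blast
 qed
 thus ?thesis using 1 that by blast
qed

text \<open>Shifting \<open>x\<close> along a coordinate \<open>i\<close> with nonzero coefficient maps solutions for
  \<open>m\<close> to solutions for \<open>m'\<close>, except near two faces of the box. If only one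
  coefficient is nonzero, the images of these faces are the cut points; otherwise the exceptional solutions
  are few.\<close>
lemma regular_counts_1:
 fixes F :: "'n::finite int_mpoly"
 assumes F: "is_form 1 F" and sm: "smooth_form F" and B: "is_box B"
 shows "regular_counts F 1 B"
proof -
 let ?n = "CARD('n)"
 let ?f = "mpoly_eval F :: int ^ 'n => int"
 obtain a a' where Ba: "B = {t. \<forall>j. t $ j \<in> {a $ j..a' $ j}}" and Bs: "B \<subseteq> {t. \<forall>j. t $ j \<in> {-1..1}}"
  using is_boxE[OF B] by blast
 have LB: "x \<in> lat_pts B P \<longleftrightarrow> (\<forall>j. P * a $ j \<le> of_int (x $ j) \<and> of_int (x $ j) \<le> P * a' $ j)" if "P > 0" for x P
  unfolding lat_pts_iff[OF that] Ba using that by (simp add: field_simps)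
 obtain c i where fx: "\<And>x. ?f x = (\<Sum>k\<in>UNIV. c k * x $ k)" and ci: "c i \<noteq> 0"
  using linear_form[OF F sm] by blast
 have fin: "finite (lat_pts B P)" if "P \<ge> 1" for P using finite_lat_pts[OF Bs, of P] that by simp
 have det: "x = y" if "?f x = ?f y" "c j \<noteq> 0" "\<And>k. k \<noteq> j ==> x $ k = y $ k" for x y j
 proof -
  have "(\<Sum>k\<in>UNIV - {j}. c k * x $ k) = (\<Sum>k\<in>UNIV - {j}. c k * y $ k)" using that(3) by (intro sum.cong) auto
  hence "c j * x $ j = c j * y $ j" using that(1) unfolding fx by (simp add: sum.remove[of UNIV j])
  hence "x $ j = y $ j" using that(2) by simp
  thus ?thesis using that(3) by (metis vec_eq_iff)
 qed
 define Jv where "Jv P = {- \<lfloor>P\<rfloor>..\<lfloor>P\<rfloor>}" for P :: real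
 have cJ: "real (card (Jv P)) \<le> 3 * P" if "P \<ge> 1" for P
 proof -
  have "real (card (Jv P)) = 2 * of_int \<lfloor>P\<rfloor> + 1" using that by (simp add: Jv_def)
  thus ?thesis using of_int_floor_le[of P] that by linarith
 qed
 have Jm: "x $ k \<in> Jv P" if "P \<ge> 1" "x \<in> lat_pts B P" for x P k
 proof -
  have "real_of_int (x $ k) \<le> P" "real_of_int (- x $ k) \<le> P" using lat_pts_bound[OF Bs, of P x k] that by (auto simp: abs_le_iff)
  hence "x $ k \<le> \<lfloor>P\<rfloor>" "- x $ k \<le> \<lfloor>P\<rfloor>" by (simp_all only: le_floor_iff)
  thus ?thesis by (simp add: Jv_def)
 qed
 have n1: "real ?n \<ge> 1" "?n \<ge> 1" by (simp_all add: Suc_le_eq)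
 have sup: "real (rep_count F B P m) \<le> 3 ^ ?n * (P ^ ?n / P ^ 1)" if P: "P \<ge> 1" for P m
 proof -
  have "rep_count F B P m \<le> (\<Prod>k\<in>UNIV - {i}. card (Jv P))"
   unfolding rep_count_def
  proof (rule card_le_proj)
   show "x = y" if "x \<in> {x \<in> lat_pts B P. ?f x = m}" "y \<in> {x \<in> lat_pts B P. ?f x = m}" "\<And>k. k \<in> UNIV - {i} ==> x $ k = y $ k" for x y
    by (rule det[of _ _ i]) (use that ci in auto)
  qed (use Jm[OF P] in \<open>auto simp: Jv_def\<close>)
  hence "real (rep_count F B P m) \<le> real (card (Jv P)) ^ (?n - 1)" by (simp add: of_nat_power[symmetric] del: of_nat_power)
  also have "... \<le> (3 * P) ^ (?n - 1)" by (intro power_mono cJ P) simp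
  also have "... = 3 ^ (?n - 1) * (P ^ ?n / P)" using P n1 by (simp add: power_mult_distrib power_diff)
  also have "... \<le> 3 ^ ?n * (P ^ ?n / P)" using P by (intro mult_right_mono power_increasing) auto
  finally show ?thesis by simp
 qed
 define R where "R P m = {x \<in> lat_pts B P. ?f x = m}" for P m
 have RC: "rep_count F B P m = card (R P m)" for P m by (simp add: rep_count_def R_def)
 have finR: "finite (R P m)" if "P \<ge> 1" for P m by (rule finite_subset[OF _ fin[OF that]]) (auto simp: R_def)
 have shift: "card (R P m) \<le> card (R P m') + card {x \<in> R P m. x + axis i s \<notin> lat_pts B P}" if P: "P \<ge> 1" and s: "m' = m + c i * s" for P m m' s
 proof -
  let ?b = "{x \<in> R P m. x + axis i s \<notin> lat_pts B P}" and ?g = "{x \<in> R P m. x + axis i s \<in> lat_pts B P}"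
  have "card (R P m) = card (?g \<union> ?b)" by (rule arg_cong[of _ _ card]) blast
  also have "... \<le> card ?g + card ?b" by (rule card_Un_le)
  also have "card ?g \<le> card (R P m')"
  proof (rule card_inj_on_le[where f = "\<lambda>x. x + axis i s"])
   show "(\<lambda>x. x + axis i s) ` ?g \<subseteq> R P m'"
   proof (rule image_subsetI)
    fix x assume x: "x \<in> ?g"
    have "?f (x + axis i s) = ?f x + (\<Sum>k\<in>UNIV. c k * axis i s $ k)" unfolding fx by (simp add: distrib_left sum.distrib)
    also have "(\<Sum>k\<in>UNIV. c k * axis i s $ k) = (\<Sum>k\<in>UNIV. if k = i then c k * s else 0)"
     by (rule sum.cong) (auto simp: axis_def)
    also have "... = c i * s" by simp
    finally show "x + axis i s \<in> R P m'" using x s by (simp add: R_def)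
   qed
  qed (auto simp: finR[OF P])
  finally show ?thesis by simp
 qed
 define T where "T = nat \<bar>c i\<bar>"
 have T1: "T \<ge> 1" using ci by (simp add: T_def)
 have sex: "\<exists>s. m' = m + c i * s" if "[m = m'] (mod int T)" for m m'
 proof -
  have "c i dvd m' - m" using that by (simp add: T_def cong_iff_dvd_diff dvd_diff_commute)
  then obtain s where "m' - m = c i * s" by blast
  thus ?thesis by (intro exI[of _ s]) simp
 qed
 show ?thesis
 proof (cases "\<exists>j. j \<noteq> i \<and> c j \<noteq> 0")
  case False
  hence c0: "c j = 0" if "j \<noteq> i" for j using that by blast
  have fi: "?f x = c i * x $ i" for x
  proof -
   have "?f x = c i * x $ i + (\<Sum>k\<in>UNIV - {i}. c k * x $ k)" unfolding fx by (rule sum.remove) auto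
   also have "(\<Sum>k\<in>UNIV - {i}. c k * x $ k) = 0" by (rule sum.neutral) (use c0 in auto)
   finally show ?thesis by simp
  qed
  define D where "D = {of_int (c i) * a $ i, of_int (c i) * a' $ i}"
  have main: "rep_count F B P m \<le> rep_count F B P m'" if P: "P \<ge> 1" and mm: "[m = m'] (mod int T)"
   and cl: "same_side D (P ^ 1) m m'" for P m m'
  proof -
   obtain s where s: "m' = m + c i * s" using sex[OF mm] by blast
   have e: "{x \<in> R P m. x + axis i s \<notin> lat_pts B P} = {}"
   proof (rule ccontr)
    assume "{x \<in> R P m. x + axis i s \<notin> lat_pts B P} \<noteq> {}"
    then obtain x where x: "x \<in> lat_pts B P" "?f x = m" "x + axis i s \<notin> lat_pts B P" by (auto simp: R_def)
    let ?y = "x + axis i s"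
    have xb: "P * a $ j \<le> of_int (x $ j) \<and> of_int (x $ j) \<le> P * a' $ j" for j using x(1) LB[of P x] P by auto
    have "m = c i * x $ i" using x(2) by (simp add: fi)
    hence m: "of_int m = of_int (c i) * real_of_int (x $ i)" by simp
    have m': "of_int m' = of_int (c i) * real_of_int (?y $ i)" by (simp add: s m distrib_left axis_def)
    have c1: "of_int m \<noteq> of_int (c i) * (P * a $ i)" "of_int m' \<noteq> of_int (c i) * (P * a $ i)"
     "(of_int m < of_int (c i) * (P * a $ i)) = (of_int m' < of_int (c i) * (P * a $ i))"
     "of_int m \<noteq> of_int (c i) * (P * a' $ i)" "of_int m' \<noteq> of_int (c i) * (P * a' $ i)"
     "(of_int m < of_int (c i) * (P * a' $ i)) = (of_int m' < of_int (c i) * (P * a' $ i))"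
     using cl by (simp_all add: D_def mult_ac)
    have "P * a $ i \<le> of_int (?y $ i) \<and> of_int (?y $ i) \<le> P * a' $ i"
    proof (cases "c i > 0")
     case True
     hence "real_of_int (c i) > 0" by simp
     thus ?thesis using c1 xb[of i] unfolding m m' by (auto simp: mult_less_cancel_left_pos)
    next
     case False
     hence "real_of_int (c i) < 0" using ci by simp
     thus ?thesis using c1 xb[of i] unfolding m m' by (auto simp: mult_less_cancel_left_neg)
    qed
    moreover have "?y $ j = x $ j" if "j \<noteq> i" for j using that by (simp add: axis_def)
    ultimately have "P * a $ j \<le> of_int (?y $ j) \<and> of_int (?y $ j) \<le> P * a' $ j" for j using xb[of j] by (cases "j = i") auto
    hence "?y \<in> lat_pts B P" using LB[of P ?y] P by auto
    thus False using x(3) by simp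
   qed
   show ?thesis using shift[OF P s] unfolding RC e by simp
  qed
  show ?thesis unfolding regular_counts_def regular_at_def
  proof (intro exI[of _ "3 ^ ?n :: real"] allI impI exI[of _ T] exI[of _ D] conjI T1)
   show "finite D" by (simp add: D_def)
   fix h :: real assume eps: "h > 0"
   show "\<forall>\<^sub>F P in at_top.
   (count_le F 1 B (3 ^ ?n) P) \<and>
   cell_stable F 1 B T D h P"
    using eventually_ge_at_top[of 1]
   proof eventually_elim
    case (elim P)
    have Z: "0 \<le> h * (P ^ ?n / P ^ 1)" using elim eps by simp
    have "rep_count F B P m = rep_count F B P m'" if mm: "[m = m'] (mod int T)"
     and cl: "same_side D (P ^ 1) m m'" for m m'
    proof (rule antisym)
     show "rep_count F B P m \<le> rep_count F B P m'" by (rule main[OF elim mm cl])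
     show "rep_count F B P m' \<le> rep_count F B P m" by (rule main[OF elim]) (use mm cl in \<open>auto simp: cong_sym\<close>)
    qed
    thus ?case using Z sup[OF elim] by auto
   qed
  qed
 next
  case True
  then obtain j where j: "j \<noteq> i" "c j \<noteq> 0" by blast
  show ?thesis
  proof (rule regular_countsI[OF F Bs])
   show "\<forall>\<^sub>F P in at_top. count_le F 1 B (3 ^ ?n) P"
    using eventually_ge_at_top[of 1] by eventually_elim (use sup in blast)
   fix h :: real assume eps: "h > 0"
   define \<delta> where "\<delta> = h / (10 * 3 ^ ?n)"
   have del: "\<delta> > 0" using eps by (simp add: \<delta>_def)
   have main: "real (rep_count F B P m) \<le> real (rep_count F B P m') + h * (P ^ ?n / P ^ 1)"
    if P: "P \<ge> 1" "P \<ge> 1 / \<delta>" and mm: "[m = m'] (mod int T)" and dd: "\<bar>real_of_int (m - m')\<bar> \<le> \<delta> * P ^ 1" for P m m'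
   proof -
    obtain s where s: "m' = m + c i * s" using sex[OF mm] by blast
    let ?b = "{x \<in> R P m. x + axis i s \<notin> lat_pts B P}"
    define A where "A k = (if k = i then {v. \<bar>of_int v - P * a $ i\<bar> < \<bar>of_int s\<bar> + 1} \<union> {v. \<bar>of_int v - P * a' $ i\<bar> < \<bar>of_int s\<bar> + 1} else Jv P)" for k
    have "card ?b \<le> (\<Prod>k\<in>UNIV - {j}. card (A k))"
    proof (rule card_le_proj)
     fix x k assume "x \<in> ?b"
     hence x: "x \<in> lat_pts B P" "x + axis i s \<notin> lat_pts B P" by (auto simp: R_def)
     let ?y = "x + axis i s"
     have xb: "P * a $ j \<le> of_int (x $ j) \<and> of_int (x $ j) \<le> P * a' $ j" for j using x(1) LB[of P x] P by auto
     obtain k' where k': "\<not> (P * a $ k' \<le> of_int (?y $ k') \<and> of_int (?y $ k') \<le> P * a' $ k')" using x(2) LB[of P ?y] P by auto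
     have "k' = i" using k' xb[of k'] by (auto simp: axis_def split: if_splits)
     hence "\<not> (P * a $ i \<le> of_int (x $ i) + of_int s \<and> of_int (x $ i) + of_int s \<le> P * a' $ i)" using k' by (simp add: axis_def)
     hence "\<bar>of_int (x $ i) - P * a $ i\<bar> < \<bar>of_int s\<bar> + 1 \<or> \<bar>of_int (x $ i) - P * a' $ i\<bar> < \<bar>of_int s\<bar> + 1"
      using xb[of i] by linarith
     thus "x $ k \<in> A k" using Jm[OF P(1) x(1), of k] by (auto simp: A_def)
    next
     show "finite (A k)" for k by (simp add: A_def Jv_def finite_int_interval)
     show "x = y" if "x \<in> ?b" "y \<in> ?b" "\<And>k. k \<in> UNIV - {j} ==> x $ k = y $ k" for x y
      by (rule det[of _ _ j]) (use that j in \<open>auto simp: R_def\<close>)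
    qed
    also have "... = card (A i) * (\<Prod>k\<in>UNIV - {j} - {i}. card (A k))" using j by (intro prod.remove) auto
    also have "(\<Prod>k\<in>UNIV - {j} - {i}. card (A k)) = card (Jv P) ^ (?n - 2)"
    proof -
     have "(\<Prod>k\<in>UNIV - {j} - {i}. card (A k)) = (\<Prod>k\<in>(UNIV::'n set) - {j} - {i}. card (Jv P))" by (rule prod.cong) (auto simp: A_def)
     also have "... = card (Jv P) ^ card ((UNIV::'n set) - {j} - {i})" by simp
     also have "card ((UNIV::'n set) - {j} - {i}) = ?n - 2" using j by simp
     finally show ?thesis .
    qed
    finally have b1: "real (card ?b) \<le> real (card (A i)) * real (card (Jv P)) ^ (?n - 2)"
     by (simp only: of_nat_power[symmetric] of_nat_mult[symmetric] of_nat_le_iff)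
    have sd: "\<bar>real_of_int s\<bar> \<le> \<delta> * P"
    proof -
     have "1 * \<bar>real_of_int s\<bar> \<le> \<bar>real_of_int (c i)\<bar> * \<bar>real_of_int s\<bar>" using ci by (intro mult_right_mono) auto
     also have "... = \<bar>real_of_int (m - m')\<bar>" by (simp add: s abs_mult)
     finally show ?thesis using dd by simp
    qed
    have dP: "1 \<le> \<delta> * P" using P(2) del by (simp add: pos_divide_le_eq mult.commute)
    have "real (card (A i)) \<le> 10 * \<delta> * P"
    proof -
     have "card (A i) \<le> card {v::int. \<bar>of_int v - P * a $ i\<bar> < \<bar>of_int s\<bar> + 1} + card {v::int. \<bar>of_int v - P * a' $ i\<bar> < \<bar>of_int s\<bar> + 1}"
      unfolding A_def by (simp add: card_Un_le)
     hence "real (card (A i)) \<le> real (card {v::int. \<bar>of_int v - P * a $ i\<bar> < \<bar>of_int s\<bar> + 1}) + real (card {v::int. \<bar>of_int v - P * a' $ i\<bar> < \<bar>of_int s\<bar> + 1})"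
      by (simp only: of_nat_add[symmetric] of_nat_le_iff)
     also have "... \<le> (2 * (\<bar>of_int s\<bar> + 1) + 1) + (2 * (\<bar>of_int s\<bar> + 1) + 1)" by (intro add_mono card_int_interval_le) auto
     finally have "real (card (A i)) \<le> 4 * \<bar>real_of_int s\<bar> + 6" by simp
     also have "... \<le> 4 * (\<delta> * P) + 6 * (\<delta> * P)" using sd dP by (intro add_mono mult_left_mono) auto
     finally show ?thesis by (simp add: algebra_simps)
    qed
    hence "real (card ?b) \<le> (10 * \<delta> * P) * (3 * P) ^ (?n - 2)"
     using b1 cJ[OF P(1)] del P by (elim order_trans) (intro mult_mono power_mono; simp)
    also have "... = 10 * \<delta> * 3 ^ (?n - 2) * (P * P ^ (?n - 2))" by (simp add: power_mult_distrib)
    also have "P * P ^ (?n - 2) = P ^ ?n / P ^ 1"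
    proof -
     have "?n \<ge> 2"
     proof -
      have "card {i, j} \<le> ?n" by (rule card_mono) auto
      thus ?thesis using j by simp
     qed
     hence "P ^ ?n = P * (P * P ^ (?n - 2))" by (metis add_2_eq_Suc le_add_diff_inverse power_Suc)
     thus ?thesis using P by simp
    qed
    also have "10 * \<delta> * 3 ^ (?n - 2) * (P ^ ?n / P ^ 1) \<le> 10 * \<delta> * 3 ^ ?n * (P ^ ?n / P ^ 1)"
     using del P by (intro mult_right_mono mult_left_mono power_increasing) auto
    also have "10 * \<delta> * 3 ^ ?n = h" by (simp add: \<delta>_def)
    finally show ?thesis using shift[OF P(1) s] unfolding RC by linarith
   qed
   have "\<forall>\<^sub>F P in at_top. P \<ge> 1 \<and> P \<ge> 1 / \<delta>" by (intro eventually_conj eventually_ge_at_top)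
   hence "\<forall>\<^sub>F P in at_top. shift_stable F 1 B T \<delta> h P"
   proof eventually_elim
    case (elim P)
    show ?case
    proof (intro allI impI)
     fix m m' assume mm: "[m = m'] (mod int T)" and dd: "\<bar>real_of_int (m - m')\<bar> \<le> \<delta> * P ^ 1"
     have dd': "\<bar>real_of_int (m' - m)\<bar> \<le> \<delta> * P ^ 1" using dd by (simp add: abs_minus_commute)
     show "count_gap F B P m m' \<le> h * (P ^ ?n / P ^ 1)"
      using main[of P m m'] main[of P m' m] elim mm dd dd' by (auto simp: cong_sym abs_le_iff)
    qed
   qed
   thus "\<exists>T\<ge>1. \<exists>\<delta>>0. \<forall>\<^sub>F P in at_top. shift_stable F 1 B T \<delta> h P" using T1 del by blast
  qed
 qed
qed

section \<open>Riemann sums over lattice points\<close>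

text \<open>The sum is the integral of a step function that converges to \<open>g\<close> at every point of
  continuity, so dominated convergence applies.\<close>
lemma lattice_riemann_sum:
 fixes g :: "real ^ 'n::finite => real" and t0 :: "int ^ 'n" and T :: nat
 assumes T: "T \<ge> 1" and gm [measurable]: "g \<in> borel_measurable borel" and bd: "\<And>y. \<bar>g y\<bar> \<le> M"
  and supp: "\<And>y j. g y \<noteq> 0 ==> \<bar>y $ j\<bar> \<le> 1" and cont: "AE y in lborel. isCont g y"
 shows "((\<lambda>P. (\<Sum>x | (\<forall>j. \<bar>real_of_int (x $ j)\<bar> \<le> P) \<and> (\<forall>j. [x $ j = t0 $ j] (mod int T)). g (\<chi> j. real_of_int (x $ j) / P)) / P ^ CARD('n))
  \<longlongrightarrow> (\<integral>y. g y \<partial>lborel) / real T ^ CARD('n)) at_top"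
proof -
 let ?n = "CARD('n)"
 define S where "S P = {x :: int ^ 'n. (\<forall>j. \<bar>real_of_int (x $ j)\<bar> \<le> P) \<and> (\<forall>j. [x $ j = t0 $ j] (mod int T))}" for P
 define cell where "cell P x = {y :: real ^ 'n. \<forall>j. real_of_int (x $ j) \<le> P * y $ j \<and> P * y $ j < real_of_int (x $ j) + real T}" for P and x :: "int ^ 'n"
 define R where "R P y = (\<chi> j. t0 $ j + int T * \<lfloor>(P * y $ j - of_int (t0 $ j)) / real T\<rfloor>)" for P and y :: "real ^ 'n"
 define pt where "pt P x = (\<chi> j. real_of_int (x $ j) / P)" for P and x :: "int ^ 'n"
 define G where "G P y = (\<Sum>x\<in>S P. g (pt P x) * indicator (cell P x) y)" for P y
 have Tp: "real T > 0" using T by simp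
 have M0: "M \<ge> 0" using bd[of 0] by linarith
 have finS: "finite (S P)" for P
  by (rule finite_subset[OF _ finite_real_box[of P]]) (auto simp: S_def)
 have cellb: "box (pt P x) (pt P x + (\<chi> j. real T / P)) \<subseteq> cell P x" "cell P x \<subseteq> cbox (pt P x) (pt P x + (\<chi> j. real T / P))" if "P > 0" for P x
  using that unfolding cell_def pt_def box_def cbox_def
  by (auto simp: Basis_vec_def inner_axis field_simps less_imp_le)
 have cellm [measurable]: "cell P x \<in> sets borel" for P x
  unfolding cell_def by measurable
 have em: "emeasure lborel (cell P x) = ennreal ((real T / P) ^ ?n)" if P: "P > 0" for P x
 proof (rule antisym)
  let ?w = "\<chi> j. real T / P :: real ^ 'n"
  have pr: "(\<Prod>b\<in>Basis. (pt P x + ?w - pt P x) \<bullet> b) = (real T / P) ^ ?n"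
   by (simp add: Basis_vec_def inner_axis prod.UNION_disjoint axis_eq_axis)
  have le: "pt P x \<bullet> b \<le> (pt P x + ?w) \<bullet> b" if "b \<in> Basis" for b
   using that P T by (auto simp: Basis_vec_def inner_axis)
  have cb: "emeasure lborel (cbox (pt P x) (pt P x + ?w)) = ennreal ((real T / P) ^ ?n)"
   by (subst emeasure_lborel_cbox[OF le]) (simp_all only: pr)
  have bx: "emeasure lborel (box (pt P x) (pt P x + ?w)) = ennreal ((real T / P) ^ ?n)"
   by (subst emeasure_lborel_box[OF le]) (simp_all only: pr)
  show "emeasure lborel (cell P x) \<le> ennreal ((real T / P) ^ ?n)"
   unfolding cb[symmetric] by (rule emeasure_mono[OF cellb(2)[OF P]]) simp
  show "ennreal ((real T / P) ^ ?n) \<le> emeasure lborel (cell P x)"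
   unfolding bx[symmetric] by (rule emeasure_mono[OF cellb(1)[OF P]]) simp
 qed
 have cell_iff: "y \<in> cell P x \<longleftrightarrow> x = R P y" if x: "x \<in> S P" for x P y
 proof -
  have "real_of_int (x $ j) \<le> P * y $ j \<and> P * y $ j < real_of_int (x $ j) + real T \<longleftrightarrow> x $ j = R P y $ j" for j
  proof -
   obtain k where k: "x $ j = t0 $ j + int T * k"
   proof -
    have "int T dvd x $ j - t0 $ j" using x by (simp add: S_def cong_iff_dvd_diff)
    then obtain k where "x $ j - t0 $ j = int T * k" by blast
    thus ?thesis by (intro that[of k]) simp
   qed
   have "real_of_int (x $ j) \<le> P * y $ j \<and> P * y $ j < real_of_int (x $ j) + real T \<longleftrightarrow>
    of_int k \<le> (P * y $ j - of_int (t0 $ j)) / real T \<and> (P * y $ j - of_int (t0 $ j)) / real T < of_int k + 1"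
    unfolding k using Tp by (simp add: pos_le_divide_eq pos_divide_less_eq algebra_simps)
   also have "... \<longleftrightarrow> \<lfloor>(P * y $ j - of_int (t0 $ j)) / real T\<rfloor> = k" by (simp add: floor_eq_iff)
   also have "... \<longleftrightarrow> x $ j = R P y $ j" unfolding k R_def using T by auto
   finally show ?thesis .
  qed
  thus ?thesis unfolding cell_def vec_eq_iff by simp
 qed
 have GR: "G P y = g (pt P (R P y))" if P: "P > 0" for P y
 proof (cases "R P y \<in> S P")
  case True
  have "G P y = (\<Sum>x\<in>S P. if x = R P y then g (pt P (R P y)) else 0)"
   unfolding G_def by (rule sum.cong) (auto simp: cell_iff)
  also have "... = g (pt P (R P y))" using True finS by simp
  finally show ?thesis .
 next
  case False
  have "G P y = 0" unfolding G_def by (rule sum.neutral) (use False cell_iff in \<open>auto simp: indicator_def\<close>)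
  moreover have "g (pt P (R P y)) = 0"
  proof (rule ccontr)
   assume nz: "g (pt P (R P y)) \<noteq> 0"
   have "\<bar>real_of_int (R P y $ j)\<bar> \<le> P" for j using supp[OF nz, of j] P by (simp add: pt_def field_simps)
   moreover have "[R P y $ j = t0 $ j] (mod int T)" for j by (simp add: R_def cong_iff_dvd_diff)
   ultimately show False using False by (simp add: S_def)
  qed
  ultimately show ?thesis by simp
 qed
 have Rb: "\<bar>pt P (R P y) $ j - y $ j\<bar> \<le> real T / P" if P: "P > 0" for P y j
 proof -
  let ?z = "(P * y $ j - of_int (t0 $ j)) / real T"
  have z: "real T * ?z = P * y $ j - of_int (t0 $ j)" using Tp by simp
  have "of_int \<lfloor>?z\<rfloor> \<le> ?z" "?z \<le> of_int \<lfloor>?z\<rfloor> + 1" by linarith+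
  hence "real T * of_int \<lfloor>?z\<rfloor> \<le> real T * ?z" "real T * ?z \<le> real T * (of_int \<lfloor>?z\<rfloor> + 1)"
   by (intro mult_left_mono; simp)+
  hence "real T * of_int \<lfloor>?z\<rfloor> \<le> P * y $ j - of_int (t0 $ j)" "P * y $ j - of_int (t0 $ j) \<le> real T * (of_int \<lfloor>?z\<rfloor> + 1)"
   by (simp_all only: z)
  hence "\<bar>real_of_int (R P y $ j) - P * y $ j\<bar> \<le> real T" by (simp add: R_def algebra_simps abs_le_iff)
  moreover have "pt P (R P y) $ j - y $ j = (real_of_int (R P y $ j) - P * y $ j) / P" using P by (simp add: pt_def field_simps)
  ultimately show ?thesis using P by (simp add: divide_right_mono)
 qed
 have Rlim: "((\<lambda>P. pt P (R P y)) \<longlongrightarrow> y) at_top" for y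
 proof (rule vec_tendstoI)
  fix j
  have "((\<lambda>P. pt P (R P y) $ j - y $ j) \<longlongrightarrow> 0) at_top"
  proof (rule Lim_null_comparison)
   show "\<forall>\<^sub>F P in at_top. norm (pt P (R P y) $ j - y $ j) \<le> real T / P"
    using eventually_gt_at_top[of 0] by eventually_elim (simp add: Rb)
   show "((\<lambda>P. real T / P) \<longlongrightarrow> 0) at_top" by real_asymp
  qed
  thus "((\<lambda>P. pt P (R P y) $ j) \<longlongrightarrow> y $ j) at_top" by (rule LIM_zero_cancel)
 qed
 define Q where "Q = (cbox (\<chi> j. -2) (\<chi> j. 2) :: (real ^ 'n) set)"
 have "((\<lambda>P. integral\<^sup>L lborel (G P)) \<longlongrightarrow> integral\<^sup>L lborel g) at_top"
 proof (rule integral_dominated_convergence_at_top[where s = G and f = g and M = lborel and w = "\<lambda>y. M * indicator Q y"])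
  show "g \<in> borel_measurable lborel" by simp
  show "G P \<in> borel_measurable lborel" for P unfolding G_def
   by (intro borel_measurable_sum borel_measurable_times borel_measurable_const borel_measurable_indicator) simp
  show "integrable lborel (\<lambda>y. M * indicator Q y :: real)"
   by (intro integrable_mult_right integrable_real_indicator) (auto simp: Q_def emeasure_lborel_cbox_eq)
  show "AE y in lborel. ((\<lambda>P. G P y) \<longlongrightarrow> g y) at_top"
   using cont
  proof eventually_elim
   case (elim y)
   have "((\<lambda>P. g (pt P (R P y))) \<longlongrightarrow> g y) at_top" by (rule isCont_tendsto_compose[OF elim Rlim])
   moreover have "\<forall>\<^sub>F P in at_top. g (pt P (R P y)) = G P y"
    using eventually_gt_at_top[of 0] by eventually_elim (simp add: GR)
   ultimately show ?case by (rule Lim_transform_eventually)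
  qed
  show "\<forall>\<^sub>F P in at_top. AE y in lborel. norm (G P y) \<le> M * indicator Q y"
   using eventually_ge_at_top[of "real T"]
  proof eventually_elim
   case (elim P)
   have P: "P > 0" using elim Tp by linarith
   have "norm (G P y) \<le> M * indicator Q y" for y
   proof (cases "G P y = 0")
    case True thus ?thesis using M0 by simp
   next
    case False
    hence nz: "g (pt P (R P y)) \<noteq> 0" by (simp add: GR[OF P])
    have tp: "real T / P \<le> 1" using elim P by simp
    have "\<bar>y $ j\<bar> \<le> 2" for j using supp[OF nz, of j] Rb[OF P, of y j] tp by linarith
    hence "-2 \<le> y $ j \<and> y $ j \<le> 2" for j by (metis abs_le_iff minus_le_iff)
    hence "y \<in> Q" by (simp add: Q_def mem_box_cart)
    thus ?thesis using bd by (simp add: GR[OF P])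
   qed
   thus ?case by simp
  qed
 qed
 hence "((\<lambda>P. integral\<^sup>L lborel (G P) / real T ^ ?n) \<longlongrightarrow> integral\<^sup>L lborel g / real T ^ ?n) at_top"
  by (intro tendsto_divide tendsto_const) (use Tp in auto)
 moreover have "\<forall>\<^sub>F P in at_top. integral\<^sup>L lborel (G P) / real T ^ ?n = (\<Sum>x\<in>S P. g (pt P x)) / P ^ ?n"
  using eventually_gt_at_top[of 0]
 proof eventually_elim
  case (elim P)
  have i: "integrable lborel (indicator (cell P x) :: _ => real)" for x by (intro integrable_real_indicator) (auto simp: em[OF elim])
  have mc: "measure lborel (cell P x) = (real T / P) ^ ?n" for x unfolding measure_def em[OF elim] using elim by simp
  have "integral\<^sup>L lborel (G P) = (\<Sum>x\<in>S P. integral\<^sup>L lborel (\<lambda>y. g (pt P x) * indicator (cell P x) y))"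
   unfolding G_def by (rule Bochner_Integration.integral_sum) (intro integrable_mult_right i)
  also have "... = (\<Sum>x\<in>S P. g (pt P x) * (real T / P) ^ ?n)" by (simp add: mc)
  also have "... = (\<Sum>x\<in>S P. g (pt P x)) * (real T / P) ^ ?n" by (simp add: sum_distrib_right)
  finally show ?case using Tp elim by (simp add: power_divide)
 qed
 ultimately have "((\<lambda>P. (\<Sum>x\<in>S P. g (pt P x)) / P ^ ?n) \<longlongrightarrow> integral\<^sup>L lborel g / real T ^ ?n) at_top"
  by (rule Lim_transform_eventually)
 thus ?thesis unfolding S_def pt_def .
qed

lemma continuous_mpoly: "continuous_on X (mpoly_eval F :: real ^ 'n::finite => real)"
 unfolding mpoly_eval_def by (intro continuous_intros)

lemma mpoly_measurable [measurable]: "(mpoly_eval F :: real ^ 'n::finite => real) \<in> borel_measurable borel"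
 by (rule borel_measurable_continuous_onI) (rule continuous_mpoly)

lemma mpoly_eval_cong_mod:
 assumes "\<And>j. [x $ j = y $ j] (mod m)" shows "[mpoly_eval F x = mpoly_eval F y] (mod (m::int))"
 unfolding mpoly_eval_def by (intro cong_sum cong_mult cong_prod cong_pow cong_refl assms)

lemma is_box_cbox:
 assumes "is_box B" obtains a a' where "B = cbox a a'"
proof -
 obtain a a' where "B = {t. \<forall>j. t $ j \<in> {a $ j..a' $ j}}" by (rule is_boxE[OF assms])
 moreover have "{t. \<forall>j. t $ j \<in> {a $ j..a' $ j}} = cbox a a'" unfolding set_eq_iff mem_box_cart by simp
 ultimately show ?thesis using that[of a a'] by simp
qed

lemma box_measurable: "is_box B ==> B \<in> sets borel"
 by (elim is_box_cbox) simp

lemma box_subset: "is_box B ==> B \<subseteq> {t. \<forall>j. t $ j \<in> {-1..1}}" by (elim is_boxE)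

lemma box_finite: "is_box B ==> emeasure lborel B < \<infinity>"
 by (elim is_box_cbox) (simp add: emeasure_lborel_cbox_eq)

lemma isCont_eventually_eq:
 assumes "\<forall>\<^sub>F z in nhds y. f z = g z" "isCont g y" shows "isCont f y"
 using isCont_cong[OF assms(1)] assms(2) by simp

lemma AE_isCont_box:
 fixes B :: "(real ^ 'n::finite) set"
 assumes B: "is_box B" and phi: "AE y in lborel. y \<in> B --> isCont g (mpoly_eval F y)"
 shows "AE y in lborel. isCont (\<lambda>y. indicator B y * g (mpoly_eval F y) :: real) y"
proof -
 obtain a a' where Ba: "B = cbox a a'" using is_box_cbox[OF B] by blast
 have "negligible (cbox a a' - box a a')" by (rule negligible_frontier_interval)
 hence "cbox a a' - box a a' \<in> null_sets lborel" by (simp add: negligible_iff_null_sets null_sets_completion_iff)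
 hence "AE y in lborel. y \<notin> cbox a a' - box a a'" by (rule AE_not_in)
 thus ?thesis using phi
 proof eventually_elim
  case (elim y)
  consider "y \<in> box a a'" | "y \<notin> cbox a a'" using elim(1) by blast
  thus ?case
  proof cases
   case 1
   hence yB: "y \<in> B" using box_subset_cbox Ba by blast
   have "\<forall>\<^sub>F z in nhds y. z \<in> box a a'" using 1 by (intro eventually_nhds_in_open) auto
   hence "\<forall>\<^sub>F z in nhds y. indicator B z * g (mpoly_eval F z) = g (mpoly_eval F z)"
    by eventually_elim (use box_subset_cbox[of a a'] Ba in \<open>auto simp: indicator_def\<close>)
   moreover have "isCont (\<lambda>z. g (mpoly_eval F z)) y"
   proof -
    have c1: "isCont (mpoly_eval F) y" using continuous_mpoly[of UNIV F] by (simp add: continuous_on_eq_continuous_at)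
    have c2: "isCont g (mpoly_eval F y)" using elim(2) yB by blast
    show ?thesis by (rule isCont_o2[OF c1 c2])
   qed
   ultimately show ?thesis by (rule isCont_eventually_eq)
  next
   case 2
   hence "\<forall>\<^sub>F z in nhds y. z \<in> - cbox a a'" by (intro eventually_nhds_in_open) auto
   hence "\<forall>\<^sub>F z in nhds y. indicator B z * g (mpoly_eval F z) = 0" by eventually_elim (use Ba in auto)
   thus ?thesis by (rule isCont_eventually_eq) simp
  qed
 qed
qed

lemma lattice_box_sum:
 fixes F :: "'n::finite int_mpoly" and T :: nat
 assumes F: "is_form d F" and B: "is_box B" and T: "T \<ge> 1"
  and pm [measurable]: "h \<in> borel_measurable borel" and bd: "\<And>s. \<bar>h s\<bar> \<le> M"
  and cont: "AE y in lborel. y \<in> B --> isCont h (mpoly_eval F y)"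
 shows "((\<lambda>P. (\<Sum>x | x \<in> lat_pts B P \<and> (\<forall>j. [x $ j = t0 $ j] (mod int T)). h (real_of_int (mpoly_eval F x) / P ^ d)) / P ^ CARD('n))
  \<longlongrightarrow> (\<integral>y. indicator B y * h (mpoly_eval F y) \<partial>lborel) / real T ^ CARD('n)) at_top"
proof -
 let ?g = "\<lambda>y. indicator B y * h (mpoly_eval F y) :: real"
 have Bm [measurable]: "B \<in> sets borel" by (rule box_measurable[OF B])
 have M0: "M \<ge> 0" using bd[of 0] by linarith
 have "((\<lambda>P. (\<Sum>x | (\<forall>j. \<bar>real_of_int (x $ j)\<bar> \<le> P) \<and> (\<forall>j. [x $ j = t0 $ j] (mod int T)). ?g (\<chi> j. real_of_int (x $ j) / P)) / P ^ CARD('n))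
  \<longlongrightarrow> (\<integral>y. ?g y \<partial>lborel) / real T ^ CARD('n)) at_top"
 proof (rule lattice_riemann_sum[OF T])
  show "?g \<in> borel_measurable borel" by measurable
  show "\<bar>?g y\<bar> \<le> M" for y using bd[of "mpoly_eval F y"] M0 by (simp add: indicator_def)
  show "\<bar>y $ j\<bar> \<le> 1" if "?g y \<noteq> 0" for y j
  proof -
   have "y \<in> {t. \<forall>j. t $ j \<in> {-1..1}}" using that box_subset[OF B] by (auto simp: indicator_def split: if_splits)
   thus ?thesis by (auto simp: abs_le_iff minus_le_iff)
  qed
  show "AE y in lborel. isCont ?g y" by (rule AE_isCont_box[OF B cont])
 qed
 moreover have "\<forall>\<^sub>F P in at_top. (\<Sum>x | (\<forall>j. \<bar>real_of_int (x $ j)\<bar> \<le> P) \<and> (\<forall>j. [x $ j = t0 $ j] (mod int T)). ?g (\<chi> j. real_of_int (x $ j) / P)) / P ^ CARD('n)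
   = (\<Sum>x | x \<in> lat_pts B P \<and> (\<forall>j. [x $ j = t0 $ j] (mod int T)). h (real_of_int (mpoly_eval F x) / P ^ d)) / P ^ CARD('n)"
  using eventually_gt_at_top[of 0]
 proof eventually_elim
  case (elim P)
  let ?S = "{x :: int ^ 'n. (\<forall>j. \<bar>real_of_int (x $ j)\<bar> \<le> P) \<and> (\<forall>j. [x $ j = t0 $ j] (mod int T))}"
  have fin: "finite ?S"
   by (rule finite_subset[OF _ finite_real_box[of P]]) auto
  have ev: "mpoly_eval F (\<chi> j. real_of_int (x $ j) / P) = real_of_int (mpoly_eval F x) / P ^ d" for x
  proof -
   show ?thesis using form_scale[OF F, of "1 / P" "\<chi> j. real_of_int (x $ j)"] by (simp add: mpoly_eval_of_int power_divide)
  qed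
  have "(\<Sum>x\<in>?S. ?g (\<chi> j. real_of_int (x $ j) / P)) = (\<Sum>x | x \<in> lat_pts B P \<and> (\<forall>j. [x $ j = t0 $ j] (mod int T)). h (real_of_int (mpoly_eval F x) / P ^ d))"
  proof (rule sum.mono_neutral_cong_right[OF fin])
   show "{x. x \<in> lat_pts B P \<and> (\<forall>j. [x $ j = t0 $ j] (mod int T))} \<subseteq> ?S" using lat_pts_bound[OF box_subset[OF B] elim] by auto
   show "\<forall>x\<in>?S - {x. x \<in> lat_pts B P \<and> (\<forall>j. [x $ j = t0 $ j] (mod int T))}. ?g (\<chi> j. real_of_int (x $ j) / P) = 0"
    by (auto simp: lat_pts_iff[OF elim] indicator_def)
   show "?g (\<chi> j. real_of_int (x $ j) / P) = h (real_of_int (mpoly_eval F x) / P ^ d)" if "x \<in> {x. x \<in> lat_pts B P \<and> (\<forall>j. [x $ j = t0 $ j] (mod int T))}" for x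
    using that by (simp add: lat_pts_iff[OF elim] ev)
  qed
  thus ?case by simp
 qed
 ultimately show ?thesis by (rule Lim_transform_eventually)
qed

lemma sum_rep_count:
 assumes fin: "finite M" and B: "is_box B" and P: "P > 0"
 shows "(\<Sum>m\<in>M. rep_count F B P m) = card {x \<in> lat_pts B P. mpoly_eval F x \<in> M}"
proof -
 let ?S = "{x \<in> lat_pts B P. mpoly_eval F x \<in> M}"
 have fS: "finite ?S" using finite_lat_pts[OF box_subset[OF B] P] by simp
 have "card ?S = (\<Sum>x\<in>?S. 1)" by simp
 also have "... = (\<Sum>m\<in>M. sum (\<lambda>x. 1) {x \<in> ?S. mpoly_eval F x = m})"
  by (rule sum.group[symmetric, OF fS fin]) auto
 also have "... = (\<Sum>m\<in>M. rep_count F B P m)"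
  unfolding rep_count_def by (rule sum.cong) (auto intro!: arg_cong[of _ _ card])
 finally show ?thesis by simp
qed

section \<open>Level sets and residue classes\<close>

locale form_on_box =
 fixes F :: "'n::finite int_mpoly" and d :: nat and B :: "(real ^ 'n) set"
 assumes F: "is_form d F" and d: "d \<ge> 1" and B: "is_box B"

text \<open>The bound on the representation numbers shows that the values in an interval of length \<open>2h\<close>
  around \<open>u\<close> are taken on a set of measure \<open>O(h)\<close>.\<close>
lemma (in form_on_box) level_set_null:
 assumes sup: "\<forall>\<^sub>F P in at_top. count_le F d B C P"
 shows "AE t in lborel. t \<in> B --> mpoly_eval F t \<noteq> (u::real)"
proof -
 let ?L = "{t \<in> B. mpoly_eval F t = u}"
 have Bm [measurable]: "B \<in> sets borel" by (rule box_measurable[OF B])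
 have Lm [measurable]: "?L \<in> sets borel" by measurable
 have Lf: "emeasure lborel ?L < \<infinity>" by (rule le_less_trans[OF emeasure_mono box_finite[OF B]]) auto
 have key: "measure lborel ?L \<le> 3 * h * C" if h: "h > 0" for h
 proof -
  define g where "g s = max 0 (1 - \<bar>s - u\<bar> / h)" for s
  have pc: "isCont g s" for s unfolding g_def by (intro continuous_intros) (use h in auto)
  have pm [measurable]: "g \<in> borel_measurable borel" unfolding g_def by measurable
  have pb: "0 \<le> g s" "g s \<le> 1" "\<bar>g s\<bar> \<le> 1" for s using h by (auto simp: g_def)
  have "((\<lambda>P. (\<Sum>x | x \<in> lat_pts B P \<and> (\<forall>j. [x $ j = (0 :: int ^ 'n) $ j] (mod int 1)). g (real_of_int (mpoly_eval F x) / P ^ d)) / P ^ CARD('n))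
   \<longlongrightarrow> (\<integral>y. indicator B y * g (mpoly_eval F y) \<partial>lborel) / real 1 ^ CARD('n)) at_top"
   by (rule lattice_box_sum[OF F B _ pm pb(3)]) (auto simp: pc)
  hence lim: "((\<lambda>P. (\<Sum>x\<in>lat_pts B P. g (real_of_int (mpoly_eval F x) / P ^ d)) / P ^ CARD('n))
   \<longlongrightarrow> (\<integral>y. indicator B y * g (mpoly_eval F y) \<partial>lborel)) at_top" by simp
  have hd: "\<forall>\<^sub>F P in at_top. 1 / P ^ d \<le> h"
  proof -
   have lim0: "((\<lambda>P::real. 1 / P ^ d) \<longlongrightarrow> 0) at_top"
    by (rule tendsto_divide_0[OF tendsto_const]) (use d in \<open>auto intro!: filterlim_at_top_imp_at_infinity filterlim_pow_at_top filterlim_ident\<close>)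
   show ?thesis using order_tendstoD(2)[OF lim0 h] by eventually_elim simp
  qed
  have "(\<integral>y. indicator B y * g (mpoly_eval F y) \<partial>lborel) \<le> 3 * h * C"
  proof (rule tendsto_upperbound[OF lim])
   show "\<forall>\<^sub>F P in at_top. (\<Sum>x\<in>lat_pts B P. g (real_of_int (mpoly_eval F x) / P ^ d)) / P ^ CARD('n) \<le> 3 * h * C"
    using sup hd eventually_gt_at_top[of 0]
   proof eventually_elim
    case (elim P)
    let ?M = "{m::int. \<bar>of_int m - u * P ^ d\<bar> < h * P ^ d}"
    have Pd: "P ^ d > 0" using elim(3) by simp
    have fL: "finite (lat_pts B P)" by (rule finite_lat_pts[OF box_subset[OF B] elim(3)])
    have C0: "0 \<le> C * (P ^ CARD('n) / P ^ d)" using elim(1)[rule_format, of 0] by (meson of_nat_0_le_iff order_trans)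
    have "(\<Sum>x\<in>lat_pts B P. g (real_of_int (mpoly_eval F x) / P ^ d)) \<le> (\<Sum>x\<in>lat_pts B P. if mpoly_eval F x \<in> ?M then 1 else 0)"
    proof (rule sum_mono)
     fix x
     have "g (real_of_int (mpoly_eval F x) / P ^ d) = 0" if "mpoly_eval F x \<notin> ?M"
     proof -
      have "h * P ^ d \<le> \<bar>of_int (mpoly_eval F x) - u * P ^ d\<bar>" using that by simp
      also have "... = \<bar>of_int (mpoly_eval F x) / P ^ d - u\<bar> * P ^ d" using elim(3) Pd by (simp add: abs_if field_simps)
      finally have "h \<le> \<bar>of_int (mpoly_eval F x) / P ^ d - u\<bar>" using Pd by simp
      thus ?thesis using h by (simp add: g_def)
     qed
     thus "g (real_of_int (mpoly_eval F x) / P ^ d) \<le> (if mpoly_eval F x \<in> ?M then 1 else 0)" using pb(2) by auto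
    qed
    also have "... = real (card {x \<in> lat_pts B P. mpoly_eval F x \<in> ?M})"
     using fL by (simp add: sum.If_cases Int_def)
    also have "... = (\<Sum>m\<in>?M. real (rep_count F B P m))"
     unfolding sum_rep_count[OF finite_int_interval B elim(3), symmetric] by (rule of_nat_sum)
    also have "... \<le> (\<Sum>m\<in>?M. C * (P ^ CARD('n) / P ^ d))" by (intro sum_mono) (use elim in blast)
    also have "... = real (card ?M) * (C * (P ^ CARD('n) / P ^ d))" by simp
    also have "... \<le> (3 * h * P ^ d) * (C * (P ^ CARD('n) / P ^ d))"
    proof (rule mult_right_mono[OF _ C0])
     have "real (card ?M) \<le> 2 * (h * P ^ d) + 1" by (rule card_int_interval_le) (use h Pd in simp)
     also have "1 \<le> h * P ^ d" using elim(2) Pd by (simp add: pos_divide_le_eq)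
     finally show "real (card ?M) \<le> 3 * h * P ^ d" by simp
    qed
    also have "... = (3 * h * C) * P ^ CARD('n)" using Pd by simp
    finally show ?case using elim(3) by (simp add: pos_divide_le_eq)
   qed
  qed simp
  moreover have "measure lborel ?L \<le> (\<integral>y. indicator B y * g (mpoly_eval F y) \<partial>lborel)"
  proof -
   have "measure lborel ?L = (\<integral>y. indicator ?L y \<partial>lborel)" by simp
   also have "... \<le> (\<integral>y. indicator B y * g (mpoly_eval F y) \<partial>lborel)"
   proof (rule integral_mono)
    show "integrable lborel (indicator ?L :: _ => real)" by (intro integrable_real_indicator) (use Lf in auto)
    show "integrable lborel (\<lambda>y. indicator B y * g (mpoly_eval F y) :: real)"
    proof (rule Bochner_Integration.integrable_bound)
     show "integrable lborel (indicator B :: _ => real)" by (intro integrable_real_indicator) (use box_finite[OF B] in auto)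
     show "(\<lambda>y. indicator B y * g (mpoly_eval F y) :: real) \<in> borel_measurable lborel" by measurable
     show "AE y in lborel. norm (indicator B y * g (mpoly_eval F y) :: real) \<le> norm (indicator B y :: real)"
      using pb by (auto simp: indicator_def)
    qed
    show "indicator ?L y \<le> indicator B y * g (mpoly_eval F y)" for y
     using pb by (auto simp: indicator_def g_def)
   qed
   finally show ?thesis .
  qed
  ultimately show ?thesis by linarith
 qed
 have "measure lborel ?L \<le> 0"
 proof (rule field_le_epsilon)
  fix e :: real assume e: "e > 0"
  show "measure lborel ?L \<le> 0 + e"
  proof (cases "C \<le> 0")
   case True
   thus ?thesis using key[of 1] e by simp
  next
   case False
   thus ?thesis using key[of "e / (3 * C)"] e by simp
  qed
 qed
 hence "measure lborel ?L = 0" using measure_nonneg[of lborel ?L] by (rule antisym)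
 moreover have "emeasure lborel ?L = ennreal (measure lborel ?L)" by (rule emeasure_eq_ennreal_measure) (use Lf in auto)
 ultimately have "emeasure lborel ?L = 0" by simp
 hence "?L \<in> null_sets lborel" by (intro null_setsI) auto
 hence "AE t in lborel. t \<notin> ?L" by (rule AE_not_in)
 thus ?thesis by eventually_elim auto
qed

abbreviation residue_sols :: "'n::finite int_mpoly => nat => int => (int ^ 'n) set" where
 "residue_sols F T r \<equiv> {t :: int ^ 'n. (\<forall>i. t $ i \<in> {0..<int T}) \<and> [mpoly_eval F t = r] (mod int T)}"

text \<open>The density \<open>T^(1-n) #{t mod T. F(t) = r mod T}\<close> of solutions of a congruence.\<close>
definition res_density :: "'n::finite int_mpoly => nat => int => real" where
 "res_density F T r = real T * real (card (residue_sols F T r)) / real T ^ CARD('n)"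

lemma res_density_mod:
 assumes "[r = r'] (mod int T)" shows "res_density F T r = res_density F T r'"
proof -
 have "[x = r] (mod int T) \<longleftrightarrow> [x = r'] (mod int T)" for x using assms by (metis cong_sym cong_trans)
 thus ?thesis unfolding res_density_def by simp
qed

lemma res_density_nonneg: "res_density F T r \<ge> 0" by (simp add: res_density_def)

lemma sum_res_density:
 fixes F :: "'n::finite int_mpoly"
 assumes T: "T \<ge> 1" shows "(\<Sum>r\<in>{0..<int T}. res_density F T r) = real T"
proof -
 let ?Z = "{t :: int ^ 'n. \<forall>i. t $ i \<in> {0..<int T}}"
 have fin: "finite ?Z" by (rule finite_vec_box) simp
 have "(\<Sum>r\<in>{0..<int T}. card (residue_sols F T r)) =
  (\<Sum>r\<in>{0..<int T}. sum (\<lambda>_. 1) {t \<in> ?Z. mpoly_eval F t mod int T = r})"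
 proof (rule sum.cong[OF refl])
  fix r assume "r \<in> {0..<int T}"
  hence "(residue_sols F T r) = {t \<in> ?Z. mpoly_eval F t mod int T = r}"
   by (auto simp: cong_def)
  thus "card (residue_sols F T r) = sum (\<lambda>_. 1) {t \<in> ?Z. mpoly_eval F t mod int T = r}" by simp
 qed
 also have "... = sum (\<lambda>_. 1) ?Z" by (rule sum.group[OF fin]) (use T in auto)
 also have "... = T ^ CARD('n)" using card_vec_box[of "\<lambda>_::'n. {0..<int T}"] by simp
 finally have *: "(\<Sum>r\<in>{0..<int T}. card (residue_sols F T r)) = T ^ CARD('n)" .
 have "(\<Sum>r\<in>{0..<int T}. res_density F T r) = real T * real (T ^ CARD('n)) / real T ^ CARD('n)"
  unfolding res_density_def *[symmetric] by (simp add: sum_distrib_left sum_divide_distrib)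
 thus ?thesis using T by simp
qed

text \<open>The volume of the part of the box on which \<open>F\<close> takes values in \<open>(u, v]\<close>.\<close>
definition level_vol :: "'n::finite int_mpoly => (real ^ 'n) set => real => real => real" where
 "level_vol F B u v = measure lborel {t \<in> B. u < mpoly_eval F t \<and> mpoly_eval F t \<le> v}"

text \<open>The members of a residue class in \<open>(x, y]\<close>.\<close>
definition ap_interval :: "nat => int => real => real => int set" where
 "ap_interval T r x y = {m. [m = r] (mod int T) \<and> x < of_int m \<and> of_int m \<le> y}"

lemma ap_interval:
 assumes T: "T \<ge> 1" and xy: "x \<le> y"
 shows "finite (ap_interval T r x y)" "\<bar>real (card (ap_interval T r x y)) - (y - x) / real T\<bar> \<le> 1"
proof -
 let ?K = "{\<lfloor>(x - r) / T\<rfloor> <.. \<lfloor>(y - r) / T\<rfloor>}"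
 have Tp: "real T > 0" using T by simp
 have eq: "ap_interval T r x y = (\<lambda>k. r + int T * k) ` ?K"
 proof (intro equalityI subsetI)
  fix m assume m: "m \<in> ap_interval T r x y"
  hence "int T dvd m - r" by (simp add: ap_interval_def cong_iff_dvd_diff)
  then obtain k where "m - r = int T * k" by blast
  hence k: "m = r + int T * k" by simp
  have "(x - r) / T < of_int k" "of_int k \<le> (y - r) / T"
   using m Tp unfolding k ap_interval_def by (simp_all add: field_simps)
  hence "k \<in> ?K" by (simp add: floor_less_iff le_floor_iff)
  thus "m \<in> (\<lambda>k. r + int T * k) ` ?K" using k by blast
 next
  fix m assume "m \<in> (\<lambda>k. r + int T * k) ` ?K"
  then obtain k where k: "m = r + int T * k" "k \<in> ?K" by blast
  have "(x - r) / T < of_int k" "of_int k \<le> (y - r) / T" using k(2) by (simp_all add: floor_less_iff le_floor_iff)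
  hence "x < r + int T * k" "r + int T * k \<le> y" using Tp by (simp_all add: field_simps)
  thus "m \<in> ap_interval T r x y" unfolding ap_interval_def k by (simp add: cong_iff_dvd_diff)
 qed
 show "finite (ap_interval T r x y)" unfolding eq by simp
 have mono: "(x - r) / T \<le> (y - r) / T" using xy Tp by (simp add: divide_right_mono)
 hence fm: "\<lfloor>(x - r) / T\<rfloor> \<le> \<lfloor>(y - r) / T\<rfloor>" by (rule floor_mono)
 have "card (ap_interval T r x y) = card ?K" unfolding eq by (rule card_image) (use T in \<open>auto simp: inj_on_def\<close>)
 hence "real (card (ap_interval T r x y)) = of_int \<lfloor>(y - r) / T\<rfloor> - of_int \<lfloor>(x - r) / T\<rfloor>" using fm by simp
 moreover have "(y - x) / real T = (y - r) / T - (x - r) / T" by (simp add: diff_divide_distrib)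
 ultimately show "\<bar>real (card (ap_interval T r x y)) - (y - x) / real T\<bar> \<le> 1" by linarith
qed

lemma power_at_top: "d \<ge> 1 ==> filterlim (\<lambda>P::real. P ^ d) at_top at_top"
 by (rule filterlim_pow_at_top[OF _ filterlim_ident]) simp

lemma ap_card_ratio:
 assumes T: "T \<ge> 1" and uv: "u < v" and d: "d \<ge> 1"
 shows "((\<lambda>P. real (card (ap_interval T r (u * P ^ d) (v * P ^ d))) / P ^ d) \<longlongrightarrow> (v - u) / real T) at_top"
proof (rule LIM_zero_cancel, rule Lim_null_comparison)
 show "((\<lambda>P::real. 1 / P ^ d) \<longlongrightarrow> 0) at_top"
  by (rule tendsto_divide_0[OF tendsto_const filterlim_at_top_imp_at_infinity[OF power_at_top[OF d]]])
 show "\<forall>\<^sub>F P in at_top. norm (real (card (ap_interval T r (u * P ^ d) (v * P ^ d))) / P ^ d - (v - u) / real T) \<le> 1 / P ^ d"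
  using eventually_gt_at_top[of 0]
 proof eventually_elim
  case (elim P)
  hence Pd: "P ^ d > 0" by simp
  let ?k = "real (card (ap_interval T r (u * P ^ d) (v * P ^ d)))"
  have "\<bar>?k - (v * P ^ d - u * P ^ d) / real T\<bar> \<le> 1" by (rule ap_interval(2)[OF T]) (use uv Pd in simp)
  hence "\<bar>?k - (v * P ^ d - u * P ^ d) / real T\<bar> / P ^ d \<le> 1 / P ^ d" using Pd by (intro divide_right_mono) auto
  moreover have "?k / P ^ d - (v - u) / real T = (?k - (v * P ^ d - u * P ^ d) / real T) / P ^ d"
   using Pd elim by (simp add: diff_divide_distrib left_diff_distrib[symmetric])
  ultimately show ?case using Pd by simp
 qed
qed

lemma ap_card_large:
 assumes T: "T \<ge> 1" and uv: "u < v" and d: "d \<ge> 1"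
 shows "\<forall>\<^sub>F P in at_top. N < card (ap_interval T r (u * P ^ d) (v * P ^ d))"
proof -
 have "filterlim (\<lambda>P. (real (card (ap_interval T r (u * P ^ d) (v * P ^ d))) / P ^ d) * P ^ d) at_top at_top"
  by (rule filterlim_tendsto_pos_mult_at_top[OF ap_card_ratio[OF T uv d] _ power_at_top[OF d]]) (use T uv in simp)
 hence "\<forall>\<^sub>F P in at_top. real N < (real (card (ap_interval T r (u * P ^ d) (v * P ^ d))) / P ^ d) * P ^ d"
  by (simp only: filterlim_at_top_dense)
 thus ?thesis using eventually_gt_at_top[of 0] by eventually_elim simp
qed

lemma (in form_on_box) ap_rep_count_limit:
 assumes T: "T \<ge> 1" and uv: "u < v"
  and sup: "\<forall>\<^sub>F P in at_top. count_le F d B C P"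
 shows "((\<lambda>P. real (\<Sum>m\<in>ap_interval T r (u * P ^ d) (v * P ^ d). rep_count F B P m) / P ^ CARD('n))
  \<longlongrightarrow> res_density F T r / real T * level_vol F B u v) at_top"
proof -
 let ?n = "CARD('n)"
 have Bm [measurable]: "B \<in> sets borel" by (rule box_measurable[OF B])
 define g where "g = (indicator {u<..v} :: real => real)"
 have pm [measurable]: "g \<in> borel_measurable borel" unfolding g_def by measurable
 have pb: "\<bar>g s\<bar> \<le> 1" for s by (auto simp: g_def indicator_def)
 have "AE y in lborel. y \<in> B --> isCont g (mpoly_eval F y)"
  using level_set_null[OF sup, of u] level_set_null[OF sup, of v]
 proof eventually_elim
  case (elim y)
  show ?case
  proof
   assume "y \<in> B"
   hence ne: "mpoly_eval F y \<noteq> u" "mpoly_eval F y \<noteq> v" using elim by auto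
   then consider "mpoly_eval F y \<in> {u<..<v}" | "mpoly_eval F y \<in> {..<u} \<union> {v<..}" by force
   thus "isCont g (mpoly_eval F y)"
   proof cases
    case 1
    hence "\<forall>\<^sub>F z in nhds (mpoly_eval F y). z \<in> {u<..<v}" by (intro eventually_nhds_in_open) auto
    hence "\<forall>\<^sub>F z in nhds (mpoly_eval F y). g z = 1" by eventually_elim (auto simp: g_def)
    thus ?thesis by (rule isCont_eventually_eq) simp
   next
    case 2
    hence "\<forall>\<^sub>F z in nhds (mpoly_eval F y). z \<in> {..<u} \<union> {v<..}" by (intro eventually_nhds_in_open) auto
    hence "\<forall>\<^sub>F z in nhds (mpoly_eval F y). g z = 0" by eventually_elim (use uv in \<open>auto simp: g_def indicator_def\<close>)
    thus ?thesis by (rule isCont_eventually_eq) simp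
   qed
  qed
 qed
 note L = lattice_box_sum[OF F B T pm pb this]
 define Z where "Z = (residue_sols F T r)"
 have finZ: "finite Z" unfolding Z_def by (rule finite_subset[OF _ finite_vec_box[of "\<lambda>_. {0..<int T}"]]) auto
 have int: "(\<integral>y. indicator B y * g (mpoly_eval F y) \<partial>lborel) = level_vol F B u v"
 proof -
  have "(\<lambda>y. indicator B y * g (mpoly_eval F y)) = indicator {t \<in> B. u < mpoly_eval F t \<and> mpoly_eval F t \<le> v}"
   by (auto simp: g_def indicator_def fun_eq_iff)
  thus ?thesis by (simp add: level_vol_def)
 qed
 have A: "((\<lambda>P. \<Sum>t0\<in>Z. (\<Sum>x | x \<in> lat_pts B P \<and> (\<forall>j. [x $ j = t0 $ j] (mod int T)). g (real_of_int (mpoly_eval F x) / P ^ d)) / P ^ ?n)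
  \<longlongrightarrow> (\<Sum>t0\<in>Z. level_vol F B u v / real T ^ ?n)) at_top"
  unfolding int[symmetric] by (intro tendsto_sum L)
 have E: "(\<Sum>t0\<in>Z. level_vol F B u v / real T ^ ?n) = res_density F T r / real T * level_vol F B u v"
  using T by (simp add: res_density_def Z_def)
 have V: "\<forall>\<^sub>F P in at_top. (\<Sum>t0\<in>Z. (\<Sum>x | x \<in> lat_pts B P \<and> (\<forall>j. [x $ j = t0 $ j] (mod int T)). g (real_of_int (mpoly_eval F x) / P ^ d)) / P ^ ?n) =
  real (\<Sum>m\<in>ap_interval T r (u * P ^ d) (v * P ^ d). rep_count F B P m) / P ^ ?n"
  using eventually_gt_at_top[of 0]
 proof eventually_elim
  case (elim P)
  have Pd: "P ^ d > 0" using elim by simp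
  have fL: "finite (lat_pts B P)" by (rule finite_lat_pts[OF box_subset[OF B] elim])
  have uvP: "u * P ^ d \<le> v * P ^ d" using uv Pd by simp
  let ?S = "{x \<in> lat_pts B P. [mpoly_eval F x = r] (mod int T)}"
  let ?h = "\<lambda>x. g (real_of_int (mpoly_eval F x) / P ^ d)"
  let ?q = "\<lambda>x :: int ^ 'n. \<chi> i. x $ i mod int T"
  have qc: "[?q x $ j = x $ j] (mod int T)" for x j by simp
  have "(\<Sum>t0\<in>Z. \<Sum>x | x \<in> lat_pts B P \<and> (\<forall>j. [x $ j = t0 $ j] (mod int T)). ?h x) = (\<Sum>t0\<in>Z. sum ?h {x \<in> ?S. ?q x = t0})"
  proof (rule sum.cong[OF refl])
   fix t0 assume t0: "t0 \<in> Z"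
   have "(\<forall>j. [x $ j = t0 $ j] (mod int T)) \<longleftrightarrow> [mpoly_eval F x = r] (mod int T) \<and> ?q x = t0" for x
   proof
    assume c: "\<forall>j. [x $ j = t0 $ j] (mod int T)"
    have "[mpoly_eval F x = mpoly_eval F t0] (mod int T)" by (rule mpoly_eval_cong_mod) (use c in blast)
    moreover have "[mpoly_eval F t0 = r] (mod int T)" using t0 by (simp add: Z_def)
    moreover have "x $ j mod int T = t0 $ j" for j using c t0 by (simp add: Z_def cong_def)
    ultimately show "[mpoly_eval F x = r] (mod int T) \<and> ?q x = t0" by (auto simp: vec_eq_iff intro: cong_trans)
   next
    assume "[mpoly_eval F x = r] (mod int T) \<and> ?q x = t0"
    thus "\<forall>j. [x $ j = t0 $ j] (mod int T)" using qc[of x] cong_sym by blast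
   qed
   thus "(\<Sum>x | x \<in> lat_pts B P \<and> (\<forall>j. [x $ j = t0 $ j] (mod int T)). ?h x) = sum ?h {x \<in> ?S. ?q x = t0}" by simp
  qed
  also have "... = sum ?h ?S"
  proof (rule sum.group)
   show "finite ?S" using fL by simp
   show "?q ` ?S \<subseteq> Z"
   proof (rule image_subsetI)
    fix x assume x: "x \<in> ?S"
    have "[mpoly_eval F (?q x) = mpoly_eval F x] (mod int T)" by (rule mpoly_eval_cong_mod) (rule qc)
    hence "[mpoly_eval F (?q x) = r] (mod int T)" using x by (blast intro: cong_trans)
    thus "?q x \<in> Z" using T by (simp add: Z_def)
   qed
  qed (rule finZ)
  also have "... = (\<Sum>x\<in>?S. if u * P ^ d < of_int (mpoly_eval F x) \<and> of_int (mpoly_eval F x) \<le> v * P ^ d then 1 else 0)"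
   by (rule sum.cong) (use Pd in \<open>auto simp: g_def indicator_def pos_less_divide_eq pos_divide_le_eq\<close>)
  also have "... = real (card {x \<in> ?S. u * P ^ d < of_int (mpoly_eval F x) \<and> of_int (mpoly_eval F x) \<le> v * P ^ d})"
   using fL by (simp add: sum.If_cases Int_def)
  also have "{x \<in> ?S. u * P ^ d < of_int (mpoly_eval F x) \<and> of_int (mpoly_eval F x) \<le> v * P ^ d} = {x \<in> lat_pts B P. mpoly_eval F x \<in> ap_interval T r (u * P ^ d) (v * P ^ d)}"
   by (auto simp: ap_interval_def)
  also have "card ... = (\<Sum>m\<in>ap_interval T r (u * P ^ d) (v * P ^ d). rep_count F B P m)"
   by (rule sum_rep_count[symmetric, OF ap_interval(1)[OF T uvP] B elim])
  finally show ?case by (simp only: sum_divide_distrib[symmetric])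
 qed
 show ?thesis using Lim_transform_eventually[OF A V] unfolding E .
qed

section \<open>Local densities\<close>

lemma regular_at_sup:
 fixes F :: "'n::finite int_mpoly"
 assumes "regular_at F d B C e T D"
 shows "\<forall>\<^sub>F P in at_top. count_le F d B C P"
 using assms unfolding regular_at_def by (auto elim!: eventually_mono)

lemma card_exceptional:
 assumes "finite D" shows "finite {m::int. \<exists>s\<in>D. of_int m = s * (Q::real)}" "card {m::int. \<exists>s\<in>D. of_int m = s * (Q::real)} \<le> card D"
proof -
 have sub: "{m::int. \<exists>s\<in>D. of_int m = s * (Q::real)} \<subseteq> (\<lambda>s. \<lfloor>s * Q\<rfloor>) ` D"
 proof
  fix m :: int assume "m \<in> {m. \<exists>s\<in>D. of_int m = s * Q}"
  then obtain s where s: "s \<in> D" "of_int m = s * Q" by blast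
  hence "m = \<lfloor>s * Q\<rfloor>" by (metis floor_of_int)
  thus "m \<in> (\<lambda>s. \<lfloor>s * Q\<rfloor>) ` D" using s(1) by blast
 qed
 show "finite {m::int. \<exists>s\<in>D. of_int m = s * Q}" by (rule finite_subset[OF sub]) (use assms in simp)
 have "card {m::int. \<exists>s\<in>D. of_int m = s * Q} \<le> card ((\<lambda>s. \<lfloor>s * Q\<rfloor>) ` D)" by (rule card_mono[OF _ sub]) (use assms in simp)
 also have "... \<le> card D" by (rule card_image_le[OF assms])
 finally show "card {m::int. \<exists>s\<in>D. of_int m = s * Q} \<le> card D" .
qed

text \<open>By regularity \<open>r(m)\<close> differs little from its average over the residue class of
  \<open>m\<close> in the interval, and \<open>ap_rep_count_limit\<close> evaluates this average.\<close>
lemma (in form_on_box) rep_count_local: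
 assumes R: "regular_at F d B C e T0 D" and eps: "e > 0"
  and T: "T \<ge> 1" "T0 dvd T" and uv: "u < v" "D \<inter> {u<..<v} = {}"
 shows "\<forall>\<^sub>F P in at_top. \<forall>m. u * P ^ d < of_int m --> of_int m \<le> v * P ^ d --> (\<forall>s\<in>D. of_int m \<noteq> s * P ^ d) -->
  \<bar>real (rep_count F B P m) - res_density F T m * (level_vol F B u v / (v - u)) * (P ^ CARD('n) / P ^ d)\<bar> \<le> 2 * e * (P ^ CARD('n) / P ^ d)"
proof -
 let ?n = "CARD('n)"
 define lam where "lam = level_vol F B u v / (v - u)"
 have finD: "finite D" using R by (simp add: regular_at_def)
 note sup = regular_at_sup[OF R]
 have main: "\<forall>\<^sub>F P in at_top. \<forall>m\<in>ap_interval T r (u * P ^ d) (v * P ^ d). (\<forall>s\<in>D. of_int m \<noteq> s * P ^ d) -->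
  \<bar>real (rep_count F B P m) - res_density F T r * lam * (P ^ ?n / P ^ d)\<bar> \<le> 2 * e * (P ^ ?n / P ^ d)" for r
 proof -
  define M where "M P = ap_interval T r (u * P ^ d) (v * P ^ d)" for P
  define K where "K P = real (card (M P))" for P
  define S where "S P = real (\<Sum>m\<in>M P. rep_count F B P m)" for P
  have Klim: "((\<lambda>P. K P / P ^ d) \<longlongrightarrow> (v - u) / real T) at_top"
   unfolding K_def M_def by (rule ap_card_ratio[OF T(1) uv(1) d])
  have Slim: "((\<lambda>P. S P / P ^ ?n) \<longlongrightarrow> res_density F T r / real T * level_vol F B u v) at_top"
   unfolding S_def M_def by (rule ap_rep_count_limit[OF T(1) uv(1) sup])
  have nz: "(v - u) / real T \<noteq> 0" using uv T by simp
  have "((\<lambda>P. (S P / P ^ ?n) / (K P / P ^ d)) \<longlongrightarrow> (res_density F T r / real T * level_vol F B u v) / ((v - u) / real T)) at_top"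
   by (rule tendsto_divide[OF Slim Klim nz])
  moreover have "(res_density F T r / real T * level_vol F B u v) / ((v - u) / real T) = res_density F T r * lam"
   using T uv by (simp add: lam_def)
  ultimately have rl: "((\<lambda>P. (S P / P ^ ?n) / (K P / P ^ d)) \<longlongrightarrow> res_density F T r * lam) at_top" by simp
  have e1: "\<forall>\<^sub>F P in at_top. \<bar>(S P / P ^ ?n) / (K P / P ^ d) - res_density F T r * lam\<bar> < e / 2"
   using tendstoD[OF rl, of "e / 2"] eps by (simp add: dist_real_def)
  have e2: "\<forall>\<^sub>F P in at_top. nat \<lceil>2 * real (card D) * \<bar>C\<bar> / e\<rceil> < card (M P)"
   unfolding M_def by (rule ap_card_large[OF T(1) uv(1) d])
  have R': "\<forall>\<^sub>F P in at_top.
   (count_le F d B C P) \<and>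
   cell_stable F d B T0 D e P"
   using R by (simp add: regular_at_def)
  show ?thesis using R' e1 e2 eventually_gt_at_top[of 0]
  proof eventually_elim
   case (elim P)
   define X where "X = P ^ ?n / P ^ d"
   have Pd: "P ^ d > 0" and X0: "X > 0" using elim(4) by (auto simp: X_def)
   have uvP: "u * P ^ d \<le> v * P ^ d" using uv Pd by simp
   have finM: "finite (M P)" unfolding M_def by (rule ap_interval(1)[OF T(1) uvP])
   have Kp: "K P > 0" using elim(3) by (simp add: K_def)
   have DC: "2 * real (card D) * \<bar>C\<bar> / e \<le> K P" using elim(3) unfolding K_def by linarith
   have Cb: "real (rep_count F B P m) \<le> \<bar>C\<bar> * X" for m
   proof -
    have "real (rep_count F B P m) \<le> C * X" using elim(1) by (simp add: X_def)
    also have "... \<le> \<bar>C\<bar> * X" using X0 by (intro mult_right_mono) auto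
    finally show ?thesis .
   qed
   show ?case
   proof (intro ballI impI)
    fix m assume m: "m \<in> ap_interval T r (u * P ^ d) (v * P ^ d)" and mD: "\<forall>s\<in>D. of_int m \<noteq> s * P ^ d"
    have dif: "count_gap F B P m m' \<le> e * X + (if \<exists>s\<in>D. of_int m' = s * P ^ d then \<bar>C\<bar> * X else 0)" if m': "m' \<in> M P" for m'
    proof (cases "\<exists>s\<in>D. of_int m' = s * P ^ d")
     case True
     have "count_gap F B P m m' \<le> \<bar>C\<bar> * X"
      using Cb[of m] Cb[of m'] by (simp add: abs_le_iff add_increasing2 add_increasing)
     moreover have "e * X \<ge> 0" using eps X0 by simp
     ultimately show ?thesis using True by simp
    next
     case False
     have "[m = m'] (mod int T)" using m m' unfolding ap_interval_def M_def by (metis (no_types, lifting) cong_sym cong_trans mem_Collect_eq)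
     hence "[m = m'] (mod int T0)" using T(2) by (metis cong_dvd_modulus int_dvd_int_iff)
     moreover have "of_int m \<noteq> s * P ^ d \<and> of_int m' \<noteq> s * P ^ d \<and> (of_int m < s * P ^ d \<longleftrightarrow> of_int m' < s * P ^ d)" if s: "s \<in> D" for s
     proof -
      have ne: "of_int m \<noteq> s * P ^ d" "of_int m' \<noteq> s * P ^ d" using False mD s by auto
      have b: "u * P ^ d < of_int m" "of_int m \<le> v * P ^ d" "u * P ^ d < of_int m'" "of_int m' \<le> v * P ^ d"
       using m m' by (auto simp: ap_interval_def M_def)
      have "s * P ^ d \<le> u * P ^ d \<or> v * P ^ d \<le> s * P ^ d" using uv(2) s Pd by auto
      thus ?thesis using ne b by linarith
     qed
     ultimately have "count_gap F B P m m' \<le> e * X" using elim(1) unfolding X_def by blast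
     thus ?thesis using False by simp
    qed
    have "\<bar>K P * real (rep_count F B P m) - S P\<bar> = \<bar>\<Sum>m'\<in>M P. real (rep_count F B P m) - real (rep_count F B P m')\<bar>"
     by (simp add: K_def S_def sum_subtractf)
    also have "... \<le> (\<Sum>m'\<in>M P. e * X + (if \<exists>s\<in>D. of_int m' = s * P ^ d then \<bar>C\<bar> * X else 0))"
     by (rule order_trans[OF sum_abs sum_mono[OF dif]])
    also have "... = K P * (e * X) + real (card (M P \<inter> {m'. \<exists>s\<in>D. of_int m' = s * P ^ d})) * (\<bar>C\<bar> * X)"
     using finM by (simp add: sum.distrib sum.If_cases K_def)
    also have "... \<le> K P * (e * X) + real (card D) * (\<bar>C\<bar> * X)"
    proof -
     have "card (M P \<inter> {m'. \<exists>s\<in>D. of_int m' = s * P ^ d}) \<le> card {m'::int. \<exists>s\<in>D. of_int m' = s * P ^ d}"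
      by (rule card_mono[OF card_exceptional(1)[OF finD]]) blast
     also have "... \<le> card D" by (rule card_exceptional(2)[OF finD])
     finally show ?thesis using X0 by (intro add_left_mono mult_right_mono) auto
    qed
    also have "... \<le> K P * (e * X) + K P * (e / 2 * X)"
    proof -
     have "real (card D) * \<bar>C\<bar> \<le> K P * (e / 2)" using DC eps by (simp add: field_simps)
     hence "real (card D) * \<bar>C\<bar> * X \<le> K P * (e / 2) * X" using X0 by (intro mult_right_mono) auto
     thus ?thesis by (simp add: mult_ac)
    qed
    finally have "\<bar>K P * real (rep_count F B P m) - S P\<bar> \<le> K P * (3 / 2 * e * X)" by (simp add: algebra_simps)
    moreover have "K P * real (rep_count F B P m) - S P = K P * (real (rep_count F B P m) - S P / K P)" using Kp by (simp add: right_diff_distrib)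
    ultimately have a: "\<bar>real (rep_count F B P m) - S P / K P\<bar> \<le> 3 / 2 * e * X" using Kp by (simp add: abs_mult)
    have "S P / K P - res_density F T r * lam * X = ((S P / P ^ ?n) / (K P / P ^ d) - res_density F T r * lam) * X"
     using Pd Kp elim(4) by (simp add: X_def field_simps)
    hence "\<bar>S P / K P - res_density F T r * lam * X\<bar> = \<bar>(S P / P ^ ?n) / (K P / P ^ d) - res_density F T r * lam\<bar> * X"
     using X0 by (simp add: abs_mult)
    also have "... \<le> e / 2 * X" using elim(2) X0 by (intro mult_right_mono) auto
    finally have b: "\<bar>S P / K P - res_density F T r * lam * X\<bar> \<le> e / 2 * X" .
    have "3 / 2 * e * X + e / 2 * X = 2 * e * X" by simp
    thus "\<bar>real (rep_count F B P m) - res_density F T r * lam * (P ^ ?n / P ^ d)\<bar> \<le> 2 * e * (P ^ ?n / P ^ d)"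
     using a b unfolding X_def[symmetric] by linarith
   qed
  qed
 qed
 have "\<forall>\<^sub>F P in at_top. \<forall>r\<in>{0..<int T}. \<forall>m\<in>ap_interval T r (u * P ^ d) (v * P ^ d). (\<forall>s\<in>D. of_int m \<noteq> s * P ^ d) -->
  \<bar>real (rep_count F B P m) - res_density F T r * lam * (P ^ ?n / P ^ d)\<bar> \<le> 2 * e * (P ^ ?n / P ^ d)"
  by (rule eventually_ball_finite) (use main in auto)
 thus ?thesis
 proof eventually_elim
  case (elim P)
  show ?case
  proof (intro allI impI)
   fix m assume m: "u * P ^ d < of_int m" "of_int m \<le> v * P ^ d" "\<forall>s\<in>D. of_int m \<noteq> s * P ^ d"
   have r: "m mod int T \<in> {0..<int T}" using T by simp
   have mm: "m \<in> ap_interval T (m mod int T) (u * P ^ d) (v * P ^ d)" using m by (simp add: ap_interval_def cong_def)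
   have rd: "res_density F T (m mod int T) = res_density F T m" by (rule res_density_mod) (simp add: cong_def)
   show "\<bar>real (rep_count F B P m) - res_density F T m * (level_vol F B u v / (v - u)) * (P ^ CARD('n) / P ^ d)\<bar> \<le> 2 * e * (P ^ CARD('n) / P ^ d)"
    using elim[rule_format, OF r mm] m(3) unfolding rd lam_def by blast
  qed
 qed
qed

text \<open>Both the interval and its subinterval predict \<open>r(m)\<close> for a residue class of density at least
  1, so their average densities agree up to \<open>4 \<epsilon>\<close>.\<close>
lemma (in form_on_box) level_vol_local:
 assumes R: "regular_at F d B C \<epsilon> T D" and eps: "\<epsilon> > 0"
  and T: "T \<ge> 1" and uv: "u < v" "D \<inter> {u<..<v} = {}" and xy: "u \<le> x" "x < y" "y \<le> v"
 shows "\<bar>level_vol F B x y - level_vol F B u v / (v - u) * (y - x)\<bar> \<le> 4 * \<epsilon> * (y - x)"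
proof -
 let ?n = "CARD('n)"
 have xyD: "D \<inter> {x<..<y} = {}"
 proof -
  have "{x<..<y} \<subseteq> {u<..<v}" using xy by auto
  thus ?thesis using uv(2) by blast
 qed
 have finD: "finite D" using R by (simp add: regular_at_def)
 have "\<exists>r\<in>{0..<int T}. res_density F T r \<ge> 1"
 proof (rule ccontr)
  assume "\<not> ?thesis"
  hence "(\<Sum>r\<in>{0..<int T}. res_density F T r) < (\<Sum>r\<in>{0..<int T}. 1)" by (intro sum_strict_mono) (use T in \<open>auto simp: not_le\<close>)
  thus False using sum_res_density[OF T, of F] by simp
 qed
 \<comment> \<open>the densities have average 1 over the residue classes\<close>
 then obtain r where r: "res_density F T r \<ge> 1" by blast
 define l1 where "l1 = level_vol F B u v / (v - u)"
 define l2 where "l2 = level_vol F B x y / (y - x)"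
 have "\<forall>\<^sub>F P :: real in at_top. P = P \<and> \<bar>l2 - l1\<bar> \<le> 4 * \<epsilon>"
  using rep_count_local[OF R eps T dvd_refl uv] rep_count_local[OF R eps T dvd_refl xy(2) xyD]
   ap_card_large[OF T xy(2) d, of "card D" r] eventually_gt_at_top[of 0]
 proof eventually_elim
  case (elim P)
  have Pd: "P ^ d > 0" and X0: "P ^ ?n / P ^ d > 0" using elim(4) by auto
  let ?E = "{m::int. \<exists>s\<in>D. of_int m = s * P ^ d}"
  have "\<not> ap_interval T r (x * P ^ d) (y * P ^ d) \<subseteq> ?E"
  proof
   assume "ap_interval T r (x * P ^ d) (y * P ^ d) \<subseteq> ?E"
   from card_mono[OF card_exceptional(1)[OF finD] this] card_exceptional(2)[OF finD, of "P ^ d"] elim(3) show False by linarith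
  qed
  then obtain m where m: "m \<in> ap_interval T r (x * P ^ d) (y * P ^ d)" "\<forall>s\<in>D. of_int m \<noteq> s * P ^ d" by blast
  have mb: "x * P ^ d < of_int m" "of_int m \<le> y * P ^ d" "[m = r] (mod int T)" using m(1) by (auto simp: ap_interval_def)
  have "u * P ^ d \<le> x * P ^ d" "y * P ^ d \<le> v * P ^ d" using xy Pd by auto
  hence mb': "u * P ^ d < of_int m" "of_int m \<le> v * P ^ d" using mb by linarith+
  let ?X = "P ^ ?n / P ^ d" and ?a = "real (rep_count F B P m)"
  have rd: "res_density F T m = res_density F T r" by (rule res_density_mod[OF mb(3)])
  have a: "\<bar>?a - res_density F T r * l1 * ?X\<bar> \<le> 2 * \<epsilon> * ?X" using elim(1) mb' m(2) unfolding rd[symmetric] l1_def by blast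
  have b: "\<bar>?a - res_density F T r * l2 * ?X\<bar> \<le> 2 * \<epsilon> * ?X" using elim(2) mb m(2) unfolding rd[symmetric] l2_def by blast
  have "\<bar>(res_density F T r * (l2 - l1)) * ?X\<bar> = \<bar>res_density F T r * l2 * ?X - res_density F T r * l1 * ?X\<bar>" by (simp only: left_diff_distrib right_diff_distrib)
  also have "... \<le> 2 * \<epsilon> * ?X + 2 * \<epsilon> * ?X"
  proof -
   have "\<bar>p - q\<bar> \<le> e ==> \<bar>p - s\<bar> \<le> e ==> \<bar>s - q\<bar> \<le> e + e" for p q s e :: real by linarith
   from this[OF a b] show ?thesis .
  qed
  also have "... = (4 * \<epsilon>) * ?X" by simp
  finally have "\<bar>res_density F T r * (l2 - l1)\<bar> * ?X \<le> (4 * \<epsilon>) * ?X" using X0 by (simp only: abs_mult abs_of_pos)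
  hence "\<bar>res_density F T r * (l2 - l1)\<bar> \<le> 4 * \<epsilon>" using X0 by (simp only: mult_le_cancel_right_pos)
  moreover have "1 * \<bar>l2 - l1\<bar> \<le> res_density F T r * \<bar>l2 - l1\<bar>" using r by (intro mult_right_mono) auto
  ultimately show ?case using r by (simp add: abs_mult)
 qed
 hence le: "\<bar>l2 - l1\<bar> \<le> 4 * \<epsilon>" by simp
 have "level_vol F B x y - l1 * (y - x) = (l2 - l1) * (y - x)" using xy by (simp add: l2_def left_diff_distrib)
 hence "\<bar>level_vol F B x y - l1 * (y - x)\<bar> = \<bar>l2 - l1\<bar> * (y - x)" using xy by (simp add: abs_mult)
 also have "... \<le> 4 * \<epsilon> * (y - x)" using le xy by (intro mult_right_mono) auto
 finally show ?thesis by (simp add: l1_def)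
qed

section \<open>Integrals over level sets\<close>

text \<open>The integral of \<open>g(F(t))\<close> over the same part of the box.\<close>
definition level_int :: "'n::finite int_mpoly => (real ^ 'n) set => (real => real) => real => real => real" where
 "level_int F B g x y = (\<integral>t. indicator {t \<in> B. x < mpoly_eval F t \<and> mpoly_eval F t \<le> y} t * g (mpoly_eval F t) \<partial>lborel)"

lemma level_int_integrable:
 fixes F :: "'n::finite int_mpoly"
 assumes B: "is_box B" and g: "continuous_on UNIV g"
 shows "integrable lborel (\<lambda>t. indicator {t \<in> B. x < mpoly_eval F t \<and> mpoly_eval F t \<le> y} t * g (mpoly_eval F t) :: real)"
proof -
 obtain a a' where Ba: "B = cbox a a'" by (rule is_box_cbox[OF B])
 have "continuous_on B (\<lambda>t. g (mpoly_eval F t))"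
  by (rule continuous_on_compose2[OF g continuous_mpoly]) simp
 hence "integrable lborel (\<lambda>t. indicator B t *\<^sub>R g (mpoly_eval F t))"
  unfolding Ba by (intro borel_integrable_compact) auto
 hence "integrable lborel (\<lambda>t. indicator {t. x < mpoly_eval F t \<and> mpoly_eval F t \<le> y} t *\<^sub>R (indicator B t *\<^sub>R g (mpoly_eval F t)))"
  by (rule integrable_mult_indicator[rotated]) measurable
 moreover have "(\<lambda>t. indicator {t. x < mpoly_eval F t \<and> mpoly_eval F t \<le> y} t *\<^sub>R (indicator B t *\<^sub>R g (mpoly_eval F t))) =
  (\<lambda>t. indicator {t \<in> B. x < mpoly_eval F t \<and> mpoly_eval F t \<le> y} t * g (mpoly_eval F t))"
  by (auto simp: fun_eq_iff indicator_def)
 ultimately show ?thesis by simp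
qed

lemma level_int_add:
 assumes B: "is_box B" and g: "continuous_on UNIV g" and xyz: "x \<le> y" "y \<le> z"
 shows "level_int F B g x z = level_int F B g x y + level_int F B g y z"
 unfolding level_int_def
 by (subst Bochner_Integration.integral_add[OF level_int_integrable[OF B g] level_int_integrable[OF B g], symmetric])
  (rule Bochner_Integration.integral_cong, use xyz in \<open>auto simp: indicator_def\<close>)

lemma level_int_approx:
 assumes B: "is_box B" and g: "continuous_on UNIV g" and c: "\<And>s. x < s ==> s \<le> y ==> \<bar>g s - c\<bar> \<le> k"
 shows "\<bar>level_int F B g x y - c * level_vol F B x y\<bar> \<le> k * level_vol F B x y"
proof -
 let ?i = "\<lambda>t. indicator {t \<in> B. x < mpoly_eval F t \<and> mpoly_eval F t \<le> y} t :: real"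
 have i1: "integrable lborel ?i" using level_int_integrable[OF B, of "\<lambda>_. 1" x F y] by simp
 have v: "level_vol F B x y = (\<integral>t. ?i t \<partial>lborel)" by (simp add: level_vol_def)
 note i2 = level_int_integrable[OF B g, of x F y]
 have "level_int F B g x y \<le> (\<integral>t. (c + k) * ?i t \<partial>lborel)" unfolding level_int_def
  by (rule integral_mono[OF i2]) (use i1 c in \<open>auto simp: indicator_def abs_le_iff algebra_simps\<close>)
 moreover have "(\<integral>t. (c - k) * ?i t \<partial>lborel) \<le> level_int F B g x y" unfolding level_int_def
  by (rule integral_mono[OF _ i2]) (use i1 c in \<open>auto simp: indicator_def abs_le_iff algebra_simps\<close>)
 ultimately have "level_int F B g x y \<le> (c + k) * level_vol F B x y" "(c - k) * level_vol F B x y \<le> level_int F B g x y"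
  unfolding v by (simp_all only: integral_mult_right_zero)
 thus ?thesis by (simp add: abs_le_iff algebra_simps)
qed

lemma telescope_bound:
 fixes \<Phi> \<Psi> :: "real => real"
 assumes ab: "a \<le> b" and loc: "\<And>z. z > 0 ==> \<exists>\<delta>>0. \<forall>x y. a \<le> x --> x < y --> y \<le> b --> y - x < \<delta> --> \<bar>\<Phi> y - \<Phi> x\<bar> \<le> \<Psi> y - \<Psi> x + z * (y - x)"
 shows "\<bar>\<Phi> b - \<Phi> a\<bar> \<le> \<Psi> b - \<Psi> a"
proof (cases "a = b")
 case False
 hence ab': "a < b" using ab by simp
 show ?thesis
 proof (rule field_le_epsilon)
  fix e :: real assume e: "e > 0"
  define z where "z = e / (b - a)"
  have eta: "z > 0" using e ab' by (simp add: z_def)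
  obtain \<delta> where \<delta>: "\<delta> > 0" "\<And>x y. a \<le> x ==> x < y ==> y \<le> b ==> y - x < \<delta> ==> \<bar>\<Phi> y - \<Phi> x\<bar> \<le> \<Psi> y - \<Psi> x + z * (y - x)"
   using loc[OF eta] by blast
  obtain N :: nat where N: "(b - a) / \<delta> < real N" using reals_Archimedean2 by blast
  have Np: "real N > 0" using N \<delta>(1) ab' by (smt (verit) divide_pos_pos)
  define h where "h = (b - a) / real N"
  have h: "h > 0" "h < \<delta>" "real N * h = b - a" using N Np \<delta>(1) ab' by (auto simp: h_def field_simps)
  define p where "p k = a + real k * h" for k
  have pb: "a \<le> p k" "p k < p (Suc k)" "p (Suc k) - p k = h" for k using h by (auto simp: p_def algebra_simps)
  have pe: "p (Suc k) \<le> b" if "k < N" for k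
  proof -
   have "real (Suc k) * h \<le> real N * h" using that h by (intro mult_right_mono) auto
   thus ?thesis using h(3) by (simp add: p_def)
  qed
  have pN: "p N = b" "p 0 = a" using h(3) by (simp_all add: p_def)
  have "\<bar>\<Phi> b - \<Phi> a\<bar> = \<bar>\<Sum>k<N. \<Phi> (p (Suc k)) - \<Phi> (p k)\<bar>" by (simp only: sum_lessThan_telescope[of "\<lambda>k. \<Phi> (p k)"] pN)
  also have "... \<le> (\<Sum>k<N. \<bar>\<Phi> (p (Suc k)) - \<Phi> (p k)\<bar>)" by (rule sum_abs)
  also have "... \<le> (\<Sum>k<N. (\<Psi> (p (Suc k)) - \<Psi> (p k)) + z * h)"
  proof (rule sum_mono)
   fix k assume "k \<in> {..<N}"
   thus "\<bar>\<Phi> (p (Suc k)) - \<Phi> (p k)\<bar> \<le> \<Psi> (p (Suc k)) - \<Psi> (p k) + z * h"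
    using \<delta>(2)[of "p k" "p (Suc k)"] pb[of k] pe[of k] h(2) by simp
  qed
  also have "... = \<Psi> b - \<Psi> a + z * (real N * h)"
   by (simp only: sum.distrib sum_lessThan_telescope[of "\<lambda>k. \<Psi> (p k)"] pN sum_constant card_lessThan) simp
  also have "z * (real N * h) = e" using ab' by (simp add: h(3) z_def)
  finally show "\<bar>\<Phi> b - \<Phi> a\<bar> \<le> \<Psi> b - \<Psi> a + e" .
 qed
qed simp

lemma level_int_compare:
 fixes F :: "'n::finite int_mpoly" and g G :: "real => real"
 assumes B: "is_box B" and gc: "continuous_on UNIV g" and g0: "\<And>s. g s \<ge> 0" and ab: "a \<le> b"
  and mv: "\<And>x y. a \<le> x ==> x < y ==> y \<le> b ==> \<exists>z\<in>{x..y}. G y - G x = g z * (y - x)"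
  and V: "\<And>x y. a \<le> x ==> x < y ==> y \<le> b ==> \<bar>level_vol F B x y - lam * (y - x)\<bar> \<le> \<eta> * (y - x)"
  and eta: "\<eta> \<ge> 0"
 shows "\<bar>level_int F B g a b - lam * (G b - G a)\<bar> \<le> \<eta> * (G b - G a)"
proof -
 define \<Phi> where "\<Phi> y = level_int F B g a y - lam * G y" for y
 define \<Psi> where "\<Psi> y = \<eta> * G y" for y
 have "\<bar>\<Phi> b - \<Phi> a\<bar> \<le> \<Psi> b - \<Psi> a"
 proof (rule telescope_bound[OF ab])
  fix e :: real assume e: "e > 0"
  define \<kappa> where "\<kappa> = e / (2 * \<bar>lam\<bar> + 2 * \<eta> + 1)"
  have den: "2 * \<bar>lam\<bar> + 2 * \<eta> + 1 > 0" using eta by (simp add: add_nonneg_pos)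
  have k: "\<kappa> > 0" using e den by (simp add: \<kappa>_def)
  have ke: "\<kappa> * (2 * \<bar>lam\<bar> + 2 * \<eta>) \<le> e"
  proof -
   have "\<kappa> * (2 * \<bar>lam\<bar> + 2 * \<eta>) \<le> \<kappa> * (2 * \<bar>lam\<bar> + 2 * \<eta> + 1)" using k by (intro mult_left_mono) auto
   also have "... = e" using den by (simp add: \<kappa>_def)
   finally show ?thesis .
  qed
  have "uniformly_continuous_on {a..b} g"
   by (rule compact_uniformly_continuous[OF continuous_on_subset[OF gc]]) auto
  then obtain \<delta> where \<delta>: "\<delta> > 0" "\<And>s s'. s \<in> {a..b} ==> s' \<in> {a..b} ==> dist s' s < \<delta> ==> dist (g s') (g s) < \<kappa>"
   unfolding uniformly_continuous_on_def using k by blast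
  show "\<exists>\<delta>>0. \<forall>x y. a \<le> x --> x < y --> y \<le> b --> y - x < \<delta> --> \<bar>\<Phi> y - \<Phi> x\<bar> \<le> \<Psi> y - \<Psi> x + e * (y - x)"
  proof (intro exI[of _ \<delta>] conjI allI impI \<delta>(1))
   fix x y assume xy: "a \<le> x" "x < y" "y \<le> b" "y - x < \<delta>"
   have gx: "\<bar>g s - g x\<bar> \<le> \<kappa>" if "x \<le> s" "s \<le> y" for s
    using \<delta>(2)[of x s] that xy by (simp add: dist_real_def)
   let ?V = "level_vol F B x y" and ?h = "y - x"
   obtain z where z: "z \<in> {x..y}" "G y - G x = g z * ?h" using mv[OF xy(1-3)] by blast
   have "level_int F B g a y - level_int F B g a x = level_int F B g x y"
    using level_int_add[OF B gc, of a x y F] xy by simp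
   hence d1: "\<Phi> y - \<Phi> x = (level_int F B g x y - g x * ?V) + g x * (?V - lam * ?h) + lam * (g x * ?h - (G y - G x))"
    by (simp add: \<Phi>_def algebra_simps)
   have V': "\<bar>?V - lam * ?h\<bar> \<le> \<eta> * ?h" by (rule V[OF xy(1-3)])
   have "lam * ?h \<le> \<bar>lam\<bar> * ?h" using xy by (intro mult_right_mono) auto
   hence Vb: "?V \<le> (\<bar>lam\<bar> + \<eta>) * ?h" using V' by (simp add: abs_le_iff distrib_right)
   have e1: "\<bar>level_int F B g x y - g x * ?V\<bar> \<le> \<kappa> * ?V"
    by (rule level_int_approx[OF B gc]) (use gx in auto)
   also have "... \<le> \<kappa> * ((\<bar>lam\<bar> + \<eta>) * ?h)" using Vb k by (intro mult_left_mono) auto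
   finally have e1: "\<bar>level_int F B g x y - g x * ?V\<bar> \<le> \<kappa> * ((\<bar>lam\<bar> + \<eta>) * ?h)" .
   have gz: "\<bar>g x - g z\<bar> \<le> \<kappa>" using gx[of z] z(1) by (simp add: abs_minus_commute)
   have gd: "g x * ?h - (G y - G x) = (g x - g z) * ?h" by (simp add: z(2) left_diff_distrib)
   have gd2: "\<bar>g x * ?h - (G y - G x)\<bar> \<le> \<kappa> * ?h" unfolding gd abs_mult using gz xy by (simp add: mult_right_mono)
   have "\<bar>g x * (?V - lam * ?h)\<bar> = g x * \<bar>?V - lam * ?h\<bar>" using g0 by (simp add: abs_mult)
   also have "... \<le> g x * (\<eta> * ?h)" using V' g0 by (intro mult_left_mono) auto
   also have "... = \<eta> * (g x * ?h)" by simp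
   also have "... \<le> \<eta> * ((G y - G x) + \<kappa> * ?h)" using gd2 eta by (intro mult_left_mono) (auto simp: abs_le_iff)
   finally have e2: "\<bar>g x * (?V - lam * ?h)\<bar> \<le> \<eta> * ((G y - G x) + \<kappa> * ?h)" .
   have e3: "\<bar>lam * (g x * ?h - (G y - G x))\<bar> \<le> \<bar>lam\<bar> * (\<kappa> * ?h)" unfolding abs_mult using gd2 by (intro mult_left_mono) auto
   have "\<bar>\<Phi> y - \<Phi> x\<bar> \<le> \<kappa> * ((\<bar>lam\<bar> + \<eta>) * ?h) + \<eta> * ((G y - G x) + \<kappa> * ?h) + \<bar>lam\<bar> * (\<kappa> * ?h)"
    unfolding d1 using e1 e2 e3 by linarith
   also have "... = \<Psi> y - \<Psi> x + (\<kappa> * (2 * \<bar>lam\<bar> + 2 * \<eta>)) * ?h" by (simp add: \<Psi>_def algebra_simps)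
   also have "... \<le> \<Psi> y - \<Psi> x + e * ?h" using ke xy by (intro add_left_mono mult_right_mono) auto
   finally show "\<bar>\<Phi> y - \<Phi> x\<bar> \<le> \<Psi> y - \<Psi> x + e * (y - x)" .
  qed
 qed
 moreover have "level_int F B g a a = 0"
 proof -
  show ?thesis by (simp only: level_int_def) simp
 qed
 ultimately show ?thesis by (simp add: \<Phi>_def \<Psi>_def algebra_simps)
qed

section \<open>Equidistributed sets\<close>

text \<open>The integral of \<open>\<omega>\<close> from 1 to \<open>y\<close>; it is 0 for \<open>y \<le> 1\<close>.\<close>
definition cum_weight :: "(real => real) => real => real" where
 "cum_weight \<omega> y = (LINT t:{1..y}|lborel. \<omega> t)"

locale weight =
 fixes \<omega> :: "real => real"
 assumes w: "continuous_on {1..} \<omega>" and p: "\<And>t. t \<ge> 1 ==> \<omega> t > 0"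

lemma (in weight) cum_weight_integral:
 shows "cum_weight \<omega> y = integral {1..y} \<omega>"
proof -
 have "continuous_on {1..y} \<omega>" by (rule continuous_on_subset[OF w]) auto
 hence "set_integrable lborel {1..y} \<omega>" by (rule borel_integrable_atLeastAtMost')
 thus ?thesis unfolding cum_weight_def by (rule set_borel_integral_eq_integral(2))
qed

lemma (in weight) cum_weight_eq_0:
 assumes "y \<le> 1" shows "cum_weight \<omega> y = 0"
proof (cases "y = 1")
 case False
 hence "{1..y} = {}" using assms by simp
 thus ?thesis unfolding cum_weight_integral by simp
qed (simp add: cum_weight_integral)

lemma (in weight) cum_weight_max: "cum_weight \<omega> (max y 1) = cum_weight \<omega> y"
 by (cases "y \<le> 1") (simp_all add: cum_weight_eq_0 max_def)

lemma (in weight) cum_weight_mvt: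
 assumes xy: "1 \<le> x" "x \<le> y"
 shows "\<exists>z\<in>{x..y}. cum_weight \<omega> y - cum_weight \<omega> x = \<omega> z * (y - x)"
proof -
 have c: "continuous_on {1..y} \<omega>" by (rule continuous_on_subset[OF w]) auto
 have "((\<lambda>x. integral {1..x} \<omega>) has_real_derivative \<omega> t) (at t within {x..y})" if "t \<in> {x..y}" for t
 proof (rule DERIV_subset)
  show "((\<lambda>x. integral {1..x} \<omega>) has_real_derivative \<omega> t) (at t within {1..y})"
   by (rule integral_has_real_derivative[OF c]) (use that xy in auto)
 qed (use xy in auto)
 hence "\<forall>t. x \<le> t --> t \<le> y --> ((\<lambda>x. integral {1..x} \<omega>) has_derivative (\<lambda>h. \<omega> t * h)) (at t within {x..y})"
  by (simp add: has_field_derivative_def mult_commute_abs)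
 then obtain z where "z \<in> {x..y}" "integral {1..y} \<omega> - integral {1..x} \<omega> = \<omega> z * (y - x)"
  using mvt_very_simple[OF xy(2), of "\<lambda>x. integral {1..x} \<omega>" "\<lambda>t h. \<omega> t * h"] by auto
 thus ?thesis unfolding cum_weight_integral by blast
qed

lemma (in weight) cum_weight_mono:
 assumes xy: "x \<le> y"
 shows "cum_weight \<omega> x \<le> cum_weight \<omega> y"
proof -
 have "max x 1 \<le> max y 1" using xy by auto
 then obtain z where z: "z \<in> {max x 1..max y 1}" "cum_weight \<omega> (max y 1) - cum_weight \<omega> (max x 1) = \<omega> z * (max y 1 - max x 1)"
  using cum_weight_mvt[of "max x 1" "max y 1"] by auto
 have "\<omega> z * (max y 1 - max x 1) \<ge> 0" using p[of z] z(1) \<open>max x 1 \<le> max y 1\<close> by (intro mult_nonneg_nonneg) auto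
 thus ?thesis using z(2) by (simp add: cum_weight_max)
qed

lemma (in weight) cum_weight_strict:
 assumes xy: "1 \<le> x" "x < y"
 shows "cum_weight \<omega> x < cum_weight \<omega> y"
proof -
 obtain z where z: "z \<in> {x..y}" "cum_weight \<omega> y - cum_weight \<omega> x = \<omega> z * (y - x)"
  using cum_weight_mvt[of x y] xy by auto
 have "\<omega> z * (y - x) > 0" using p[of z] z(1) xy by (intro mult_pos_pos) auto
 thus ?thesis using z(2) by simp
qed

lemma (in weight) cum_weight_nonneg:
 shows "0 \<le> cum_weight \<omega> y"
 using cum_weight_mono[of "min y 1" y] cum_weight_eq_0[of "min y 1"] by simp

locale equidistributed = weight +
 fixes A :: "int set" and \<rho> :: "int => nat => real"
 assumes eq: "equidistributed_in_aps A \<omega> \<rho>" and A: "A \<subseteq> {0..}" "A \<noteq> {}"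
  and rho: "\<forall>q\<ge>1. \<forall>r\<in>{0..<int q}. \<rho> r q \<ge> 0"

lemma finite_ap_count: "A \<subseteq> {0..} ==> finite {a \<in> A. real_of_int a \<le> y \<and> [a = r] (mod q)}"
 by (rule finite_subset[of _ "{0..\<lfloor>y\<rfloor>}"]) (auto simp: le_floor_iff)

lemma (in equidistributed) equidistributed_pointwise1:
 assumes q: "q \<ge> 1" and k: "e > 0"
 shows "\<forall>\<^sub>F x in at_top. \<forall>y r. 1 \<le> y --> y \<le> x --> r \<in> {0..<int q} -->
  \<bar>real (ap_count A r q y) - \<rho> r q * cum_weight \<omega> y\<bar> \<le> e * cum_weight \<omega> x"
proof -
 let ?J = "cum_weight \<omega>"
 define f where "f x y = (MAX r\<in>{0..<int q}. \<bar>real (ap_count A r q y) - \<rho> r q * ?J y\<bar> / ?J x)" for x y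
 have "((\<lambda>x. SUP y\<in>{1..x}. f x y) \<longlongrightarrow> 0) at_top"
  using eq q unfolding equidistributed_in_aps_def f_def cum_weight_def by blast
 from order_tendstoD(2)[OF this k] have "\<forall>\<^sub>F x in at_top. (SUP y\<in>{1..x}. f x y) < e" .
 thus ?thesis using eventually_gt_at_top[of 1]
 proof eventually_elim
  case (elim x)
  have Jx: "?J x > 0" using cum_weight_strict[of 1 x] cum_weight_eq_0[of 1] elim by simp
  define S where "S = (\<Sum>r\<in>{0..<int q}. \<rho> r q)"
  define M where "M = (real (card {0..\<lfloor>x\<rfloor>}) + S * ?J x) / ?J x"
  have ne: "{0..<int q} \<noteq> {}" using q by simp
  have bd: "\<bar>real (ap_count A r q y) - \<rho> r q * ?J y\<bar> / ?J x \<le> M" if y: "1 \<le> y" "y \<le> x" and r: "r \<in> {0..<int q}" for y r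
  proof -
   have "ap_count A r q y \<le> card {0..\<lfloor>x\<rfloor>}" unfolding ap_count_def
    by (rule card_mono) (use A y in \<open>auto simp: le_floor_iff\<close>)
   moreover have "\<rho> r q \<le> S" unfolding S_def by (rule member_le_sum) (use r rho q in auto)
   hence "\<rho> r q * ?J y \<le> S * ?J x"
    using cum_weight_mono[OF y(2)] cum_weight_nonneg[of y] rho[rule_format, OF q r] by (intro mult_mono) auto
   moreover have "0 \<le> \<rho> r q * ?J y" using cum_weight_nonneg[of y] rho[rule_format, OF q r] by simp
   ultimately have "\<bar>real (ap_count A r q y) - \<rho> r q * ?J y\<bar> \<le> real (card {0..\<lfloor>x\<rfloor>}) + S * ?J x"
    unfolding abs_le_iff by linarith
   thus ?thesis unfolding M_def using Jx by (intro divide_right_mono) auto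
  qed
  have fb: "f x y \<le> M" if "y \<in> {1..x}" for y
   unfolding f_def by (rule Max.boundedI) (use bd that ne in auto)
  have bdd: "bdd_above (f x ` {1..x})" by (rule bdd_aboveI2[of _ _ M]) (rule fb)
  show ?case
  proof (intro allI impI)
   fix y r assume y: "1 \<le> y" "y \<le> x" and r: "r \<in> {0..<int q}"
   have "\<bar>real (ap_count A r q y) - \<rho> r q * ?J y\<bar> / ?J x \<le> f x y" unfolding f_def by (rule Max_ge) (use r in auto)
   also have "... \<le> (SUP y\<in>{1..x}. f x y)" by (rule cSUP_upper[OF _ bdd]) (use y in simp)
   also have "... \<le> e" using elim by simp
   finally show "\<bar>real (ap_count A r q y) - \<rho> r q * ?J y\<bar> \<le> e * ?J x" using Jx by (simp add: pos_divide_le_eq)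
  qed
 qed
qed

text \<open>If the integral were bounded, letting \<open>x\<close> tend to infinity would give \<open>#{a \<in> A. a
  \<le> y} = \<rho>(0,1) \<integral>\<omega>\<close> exactly; as the left side is a step function and the
  integral strictly increasing, both would vanish.\<close>
lemma (in equidistributed) cum_weight_at_top:
 shows "filterlim (cum_weight \<omega>) at_top at_top"
proof (rule ccontr)
 let ?J = "cum_weight \<omega>"
 assume "\<not> ?thesis"
 then obtain Z where Z: "\<not> (\<forall>\<^sub>F x in at_top. Z \<le> ?J x)" unfolding filterlim_at_top by blast
 have JZ: "?J x \<le> Z" for x
 proof (rule ccontr)
  assume nJ: "\<not> ?J x \<le> Z"
  have "\<forall>\<^sub>F y in at_top. Z \<le> ?J y"
   using eventually_ge_at_top[of x]
  proof eventually_elim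
   case (elim y)
   show ?case using cum_weight_mono[OF elim] nJ by linarith
  qed
  thus False using Z by blast
 qed
 define N where "N y = ap_count A 0 1 y" for y
 have N: "real (N y) = \<rho> 0 1 * ?J y" if y: "y \<ge> 1" for y
 proof -
  have "\<bar>real (N y) - \<rho> 0 1 * ?J y\<bar> \<le> 0"
  proof (rule field_le_epsilon)
   fix e :: real assume e: "e > 0"
   define h where "h = e / (\<bar>Z\<bar> + 1)"
   have k: "h > 0" using e by (simp add: h_def add_nonneg_pos)
   have "\<forall>\<^sub>F x in at_top. \<bar>real (N y) - \<rho> 0 1 * ?J y\<bar> \<le> h * ?J x"
    using equidistributed_pointwise1[OF order_refl k] eventually_ge_at_top[of y]
    by eventually_elim (use y in \<open>auto simp: N_def\<close>)
   then obtain x where "\<bar>real (N y) - \<rho> 0 1 * ?J y\<bar> \<le> h * ?J x" using eventually_happens by fastforce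
   also have "... \<le> h * (\<bar>Z\<bar> + 1)" using JZ[of x] k by (intro mult_left_mono) auto
   also have "... = e" by (simp add: h_def add_nonneg_eq_0_iff)
   finally show "\<bar>real (N y) - \<rho> 0 1 * ?J y\<bar> \<le> 0 + e" by simp
  qed
  thus ?thesis by simp
 qed
 have "real_of_int a \<le> 5/2 \<longleftrightarrow> real_of_int a \<le> 2" for a by (cases "a \<le> 2") auto
 \<comment> \<open>there is no integer in \<open>(2, 5/2]\<close>\<close>
 hence "N (5/2) = N 2" by (simp add: N_def ap_count_def)
 hence "\<rho> 0 1 * ?J 2 = \<rho> 0 1 * ?J (5/2)" using N[of 2] N[of "5/2"] by simp
 hence r0: "\<rho> 0 1 = 0" using cum_weight_strict[of 2 "5/2"] by auto
 obtain a where a: "a \<in> A" using A by blast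
 define y where "y = real_of_int (a + 1)"
 have y: "y \<ge> 1" using a A by (auto simp: y_def)
 have "N y = 0" using N[OF y] r0 by simp
 hence "{b \<in> A. real_of_int b \<le> y \<and> [b = 0] (mod int 1)} = {}"
  using finite_ap_count[OF A(1), of y 0 "int 1"] by (simp add: N_def ap_count_def)
 thus False using a by (auto simp: y_def)
qed

lemma (in equidistributed) equidistributed_pointwise:
 assumes q: "q \<ge> 1" and k: "e > 0"
 shows "\<forall>\<^sub>F x in at_top. \<forall>y r. y \<le> x --> r \<in> {0..<int q} -->
  \<bar>real (ap_count A r q y) - \<rho> r q * cum_weight \<omega> y\<bar> \<le> e * cum_weight \<omega> x"
proof -
 have "\<forall>\<^sub>F x in at_top. 1 / e \<le> cum_weight \<omega> x"
  using cum_weight_at_top by (simp add: filterlim_at_top)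
 thus ?thesis using equidistributed_pointwise1[OF q k]
 proof eventually_elim
  case (elim x)
  show ?case
  proof (intro allI impI)
   fix y r assume y: "y \<le> x" and r: "r \<in> {0..<int q}"
   show "\<bar>real (ap_count A r q y) - \<rho> r q * cum_weight \<omega> y\<bar> \<le> e * cum_weight \<omega> x"
   proof (cases "1 \<le> y")
    case True thus ?thesis using elim(2) y r by blast
   next
    case False
    have "ap_count A r q y \<le> card {0::int}" unfolding ap_count_def
     by (rule card_mono) (use A False in \<open>auto, linarith?\<close>)
    hence "real (ap_count A r q y) \<le> 1" by simp
    moreover have "cum_weight \<omega> y = 0" by (rule cum_weight_eq_0) (use False in simp)
    moreover have "1 \<le> e * cum_weight \<omega> x" using elim(1) k by (simp add: pos_divide_le_eq mult.commute)
    ultimately show ?thesis by simp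
   qed
  qed
 qed
qed

section \<open>Counting the values that lie in the set\<close>

definition window :: "int set => real => real => int set" where
 "window A x y = {a \<in> A. x < of_int a \<and> of_int a \<le> y}"

lemma finite_window: "A \<subseteq> {0..} ==> finite (window A x y)"
 by (rule finite_subset[of _ "{0..\<lfloor>y\<rfloor>}"]) (auto simp: window_def le_floor_iff)

lemma window_residue_card:
 assumes A: "A \<subseteq> {0..}" and xy: "x \<le> y"
 shows "real (card {a \<in> window A x y. [a = r] (mod int q)}) = real (ap_count A r q y) - real (ap_count A r q x)"
proof -
 let ?S = "\<lambda>y. {a \<in> A. real_of_int a \<le> y \<and> [a = r] (mod int q)}"
 have "{a \<in> window A x y. [a = r] (mod int q)} = ?S y - ?S x" by (auto simp: window_def)
 moreover have "?S x \<subseteq> ?S y" using xy by auto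
 hence "card (?S y - ?S x) = card (?S y) - card (?S x)" "card (?S x) \<le> card (?S y)"
  using finite_ap_count[OF A] by (auto intro: card_Diff_subset card_mono)
 ultimately show ?thesis by (simp add: ap_count_def of_nat_diff)
qed

text \<open>The part of the weighted volume with values of \<open>F\<close> in \<open>(x, y]\<close>. The inner
  maximum extends \<open>\<omega>\<close> continuously to the whole line; the outer ones implement the
  cutoff \<open>F(t) > P^-d\<close>.\<close>
definition weight_window :: "'n::finite int_mpoly => nat => (real ^ 'n) set => (real => real) => real => real => real => real" where
 "weight_window F d B \<omega> P x y = level_int F B (\<lambda>s. \<omega> (max 1 (P ^ d * s))) (max x (1 / P ^ d)) (max y (1 / P ^ d))"

lemma continuous_weight:
 fixes \<omega> :: "real => real"
 assumes w: "continuous_on {1..} \<omega>" shows "continuous_on UNIV (\<lambda>s. \<omega> (max 1 (c * s)))"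
 by (rule continuous_on_compose2[OF w]) (auto intro!: continuous_on_max continuous_intros)

lemma weighted_volume_window:
 fixes F :: "'n::finite int_mpoly"
 assumes P: "P > 0" and Fb: "\<And>t. t \<in> B ==> mpoly_eval F t \<le> b"
 shows "weighted_volume F d B \<omega> P = weight_window F d B \<omega> P (-1) b"
proof -
 define c where "c = 1 / P ^ d"
 have c: "P powi (- int d) = c" "c > 0" using P by (simp_all add: c_def power_int_minus inverse_eq_divide)
 have e: "indicator {t \<in> B. c < mpoly_eval F t} t * \<omega> (P ^ d * mpoly_eval F t) =
   indicator {t \<in> B. max (-1) c < mpoly_eval F t \<and> mpoly_eval F t \<le> max b c} t * \<omega> (max 1 (P ^ d * mpoly_eval F t))" for t
 proof (cases "t \<in> B \<and> c < mpoly_eval F t")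
  case True
  hence "1 < P ^ d * mpoly_eval F t" using P by (simp add: c_def pos_divide_less_eq mult.commute)
  hence "max 1 (P ^ d * mpoly_eval F t) = P ^ d * mpoly_eval F t" by simp
  moreover have "max (-1) c < mpoly_eval F t" "mpoly_eval F t \<le> max b c" using True c(2) Fb[of t] by auto
  ultimately show ?thesis using True by simp
 next
  case False
  hence "t \<notin> {t \<in> B. c < mpoly_eval F t}" "t \<notin> {t \<in> B. max (-1) c < mpoly_eval F t \<and> mpoly_eval F t \<le> max b c}" by auto
  thus ?thesis by (simp only: indicator_def of_bool_eq mult_zero_left)
 qed
 show ?thesis unfolding weighted_volume_def set_lebesgue_integral_def weight_window_def level_int_def c(1) c_def[symmetric] real_scaleR_def
  by (rule Bochner_Integration.integral_cong[OF refl e])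
qed

text \<open>The normalized average of \<open>\<rho>\<close> over the values of \<open>F\<close> modulo
  \<open>T\<close>, sorted by residue class.\<close>
definition sigma_sum :: "'n::finite int_mpoly => (int => nat => real) => nat => real" where
 "sigma_sum F \<rho> T = (\<Sum>r\<in>{0..<int T}. res_density F T r * \<rho> r T)"

lemma sigma_mod_eq:
 fixes F :: "'n::finite int_mpoly"
 assumes T: "T \<ge> 1" shows "sigma_mod F \<rho> T = sigma_sum F \<rho> T"
proof -
 let ?Z = "{t :: int ^ 'n. \<forall>i. t $ i \<in> {0..<int T}}"
 have fin: "finite ?Z" by (rule finite_vec_box) simp
 have "(\<Sum>t\<in>?Z. \<rho> (mpoly_eval F t mod int T) T) = (\<Sum>r\<in>{0..<int T}. \<Sum>t | t \<in> ?Z \<and> mpoly_eval F t mod int T = r. \<rho> (mpoly_eval F t mod int T) T)"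
  by (rule sum.group[symmetric, OF fin]) (use T in auto)
 also have "... = (\<Sum>r\<in>{0..<int T}. real (card (residue_sols F T r)) * \<rho> r T)"
 proof (rule sum.cong[OF refl])
  fix r assume "r \<in> {0..<int T}"
  hence "{t. t \<in> ?Z \<and> mpoly_eval F t mod int T = r} = {t. (\<forall>i. t $ i \<in> {0..<int T}) \<and> [mpoly_eval F t = r] (mod int T)}"
   by (auto simp: cong_def)
  moreover have "(\<Sum>t | t \<in> ?Z \<and> mpoly_eval F t mod int T = r. \<rho> (mpoly_eval F t mod int T) T) = (\<Sum>t | t \<in> ?Z \<and> mpoly_eval F t mod int T = r. \<rho> r T)"
   by (rule sum.cong) auto
  ultimately show "(\<Sum>t | t \<in> ?Z \<and> mpoly_eval F t mod int T = r. \<rho> (mpoly_eval F t mod int T) T) =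
   real (card (residue_sols F T r)) * \<rho> r T" by simp
 qed
 finally have *: "(\<Sum>t\<in>?Z. \<rho> (mpoly_eval F t mod int T) T) = (\<Sum>r\<in>{0..<int T}. real (card (residue_sols F T r)) * \<rho> r T)" .
 have pw: "real T powi (1 - int CARD('n)) = real T / real T ^ CARD('n)"
  using T by (simp add: power_int_diff)
 show ?thesis unfolding sigma_mod_def sigma_sum_def * pw res_density_def sum_distrib_left
  by (rule sum.cong) simp_all
qed

text \<open>The weight and the set \<open>A\<close> are combined with the form; \<open>b\<close> is an upper bound
  for the values considered.\<close>
locale form_count = form_on_box F d B + equidistributed \<omega> A \<rho>
 for F :: "'n::finite int_mpoly" and d B \<omega> A \<rho> +
 fixes b :: real
 assumes b: "b > 0"

lemma (in form_count) weight_window_local: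
 assumes R: "regular_at F d B C e T D" and eps: "e > 0"
  and T: "T \<ge> 1" and uv: "u < v" "D \<inter> {u<..<v} = {}" and P: "P > 0"
 shows "\<bar>weight_window F d B \<omega> P u v - level_vol F B u v / (v - u) * ((cum_weight \<omega> (v * P ^ d) - cum_weight \<omega> (u * P ^ d)) / P ^ d)\<bar>
  \<le> 4 * e * ((cum_weight \<omega> (v * P ^ d) - cum_weight \<omega> (u * P ^ d)) / P ^ d)"
proof -
 define c where "c = 1 / P ^ d"
 define G where "G y = cum_weight \<omega> (P ^ d * y) / P ^ d" for y
 have Pd: "P ^ d > 0" using P by simp
 have Gm: "G (max y c) = cum_weight \<omega> (y * P ^ d) / P ^ d" for y
 proof -
  have "P ^ d * max y c = max (y * P ^ d) 1" using Pd P by (simp add: max_def c_def field_simps)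
  thus ?thesis by (simp add: G_def cum_weight_max)
 qed
 have "\<bar>level_int F B (\<lambda>s. \<omega> (max 1 (P ^ d * s))) (max u c) (max v c) - level_vol F B u v / (v - u) * (G (max v c) - G (max u c))\<bar> \<le> 4 * e * (G (max v c) - G (max u c))"
 proof (rule level_int_compare[OF B continuous_weight[OF w]])
  show "0 \<le> \<omega> (max 1 (P ^ d * s))" for s using p[of "max 1 (P ^ d * s)"] by simp
  show "max u c \<le> max v c" using uv by auto
  show "0 \<le> 4 * e" using eps by simp
  fix x y assume xy: "max u c \<le> x" "x < y" "y \<le> max v c"
  have x1: "1 \<le> P ^ d * x" using xy(1) Pd by (simp add: c_def pos_divide_le_eq mult.commute)
  have "P ^ d * x \<le> P ^ d * y" using xy Pd by simp
  then obtain z where z: "z \<in> {P ^ d * x..P ^ d * y}" "cum_weight \<omega> (P ^ d * y) - cum_weight \<omega> (P ^ d * x) = \<omega> z * (P ^ d * y - P ^ d * x)"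
   using cum_weight_mvt[OF x1] by blast
  show "\<exists>z\<in>{x..y}. G y - G x = \<omega> (max 1 (P ^ d * z)) * (y - x)"
  proof (rule bexI[of _ "z / P ^ d"])
   have "max 1 (P ^ d * (z / P ^ d)) = z" using z(1) x1 Pd P by simp
   thus "G y - G x = \<omega> (max 1 (P ^ d * (z / P ^ d))) * (y - x)"
    using z(2) Pd P unfolding G_def diff_divide_distrib[symmetric] by (simp add: right_diff_distrib[symmetric])
   show "z / P ^ d \<in> {x..y}" using z(1) Pd by (simp add: pos_le_divide_eq pos_divide_le_eq mult.commute)
  qed
  have "u \<le> x" "y \<le> v" using xy xy by auto
  thus "\<bar>level_vol F B x y - level_vol F B u v / (v - u) * (y - x)\<bar> \<le> 4 * e * (y - x)"
   by (intro level_vol_local[OF R eps T uv _ xy(2)])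
 qed
 from this[unfolded Gm] show ?thesis unfolding weight_window_def c_def[symmetric] diff_divide_distrib .
qed

text \<open>On an interval without cut points the count is \<open>\<lambda> X\<close> times the sum of
  \<open>res_density\<close> over the window, which equidistribution evaluates; the weighted volume is
  \<open>\<lambda> P^-d\<close> times the increment of the integral of \<open>\<omega>\<close>.\<close>
lemma (in form_count) count_local:
 assumes R: "regular_at F d B C e T0 D" and eps: "e > 0"
  and T0: "T0 \<ge> 1" and T: "T \<ge> 1" "T0 dvd T" and uv: "u < v" "D \<inter> {u<..<v} = {}" and vb: "v \<le> b" and k: "h > 0"
 shows "\<forall>\<^sub>F P in at_top. \<bar>real (\<Sum>a\<in>window A (u * P ^ d) (v * P ^ d). rep_count F B P a) - sigma_sum F \<rho> T * (P ^ CARD('n) * weight_window F d B \<omega> P u v)\<bar>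
  \<le> P ^ CARD('n) / P ^ d * (2 * e * real (card (window A (u * P ^ d) (v * P ^ d)))
    + 4 * e * sigma_sum F \<rho> T * (cum_weight \<omega> (v * P ^ d) - cum_weight \<omega> (u * P ^ d)) + h * cum_weight \<omega> (b * P ^ d))"
proof -
 let ?n = "CARD('n)" and ?J = "cum_weight \<omega>"
 define lam where "lam = level_vol F B u v / (v - u)"
 define sig where "sig = sigma_sum F \<rho> T"
 \<comment> \<open>the error of equidistribution gets multiplied by \<open>2 T \<lambda>\<close>\<close>
 define h' where "h' = h / (4 * real T * lam + 1)"
 have lam0: "lam \<ge> 0" using uv by (simp add: lam_def level_vol_def)
 have den: "4 * real T * lam + 1 > 0" using lam0 by (simp add: add_nonneg_pos)
 have k': "h' > 0" using k den by (simp add: h'_def)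
 have kk: "2 * real T * lam * h' \<le> h / 2"
 proof -
  have "(4 * real T * lam) * h' \<le> (4 * real T * lam + 1) * h'" using k' by (intro mult_right_mono) auto
  also have "... = h" using den by (simp add: h'_def)
  finally show ?thesis by simp
 qed
 have sig0: "sig \<ge> 0" unfolding sig_def sigma_sum_def by (intro sum_nonneg mult_nonneg_nonneg res_density_nonneg) (use rho T in auto)
 have finD: "finite D" using R by (simp add: regular_at_def)
 have bP: "filterlim (\<lambda>P. b * P ^ d) at_top at_top"
  by (rule filterlim_tendsto_pos_mult_at_top[OF tendsto_const b power_at_top[OF d]])
 define c0 where "c0 = real (card D) * (\<bar>C\<bar> + real T * lam)"
 have e1: "\<forall>\<^sub>F P in at_top. 2 * c0 / h \<le> ?J (b * P ^ d)"
  using filterlim_compose[OF cum_weight_at_top bP] by (simp add: filterlim_at_top)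
 have e2: "\<forall>\<^sub>F P in at_top. \<forall>y r. y \<le> b * P ^ d --> r \<in> {0..<int T} --> \<bar>real (ap_count A r T y) - \<rho> r T * ?J y\<bar> \<le> h' * ?J (b * P ^ d)"
  using bP equidistributed_pointwise[OF T(1) k'] by (rule filterlim_iff[THEN iffD1, rule_format])
 have nuT: "res_density F T r \<le> real T" for r
 proof -
  have "res_density F T r = res_density F T (r mod int T)" by (rule res_density_mod) (simp add: cong_def)
  also have "... \<le> (\<Sum>r\<in>{0..<int T}. res_density F T r)"
   by (rule member_le_sum) (use T res_density_nonneg in auto)
  finally show ?thesis using sum_res_density[OF T(1), of F] by simp
 qed
 show ?thesis using rep_count_local[OF R eps T uv] regular_at_sup[OF R] e1 e2 eventually_gt_at_top[of 0]
 proof eventually_elim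
  case (elim P)
  define X where "X = P ^ ?n / P ^ d"
  have Pd: "P ^ d > 0" and X0: "X > 0" using elim(5) by (auto simp: X_def)
  define W where "W = window A (u * P ^ d) (v * P ^ d)"
  have finW: "finite W" unfolding W_def by (rule finite_window[OF A(1)])
  define dJ where "dJ = ?J (v * P ^ d) - ?J (u * P ^ d)"
  define Jb where "Jb = ?J (b * P ^ d)"
  have uvP: "u * P ^ d \<le> v * P ^ d" using uv Pd by simp
  have vbP: "v * P ^ d \<le> b * P ^ d" using vb Pd by simp
  have dJ0: "dJ \<ge> 0" unfolding dJ_def using cum_weight_mono[OF uvP] by simp
  have Jb0: "Jb \<ge> 0" unfolding Jb_def by (rule cum_weight_nonneg)
  let ?nu = "res_density F T"
  \<comment> \<open>at most \<open>card D\<close> elements of the window are multiples of cut points\<close>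
  let ?E = "{m::int. \<exists>s\<in>D. of_int m = s * P ^ d}"
  have dif: "\<bar>real (rep_count F B P a) - ?nu a * lam * X\<bar> \<le> 2 * e * X + (if a \<in> ?E then (\<bar>C\<bar> + real T * lam) * X else 0)" if a: "a \<in> W" for a
  proof (cases "a \<in> ?E")
   case True
   have r0: "real (rep_count F B P a) \<le> \<bar>C\<bar> * X"
   proof -
    have "real (rep_count F B P a) \<le> C * X" using elim(2) by (simp add: X_def)
    also have "... \<le> \<bar>C\<bar> * X" using X0 by (intro mult_right_mono) auto
    finally show ?thesis .
   qed
   have n0: "0 \<le> ?nu a * lam * X" using res_density_nonneg[of F T a] lam0 X0 by simp
   have n1: "?nu a * lam * X \<le> real T * lam * X" using nuT lam0 X0 by (intro mult_right_mono) auto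
   have "\<bar>real (rep_count F B P a) - ?nu a * lam * X\<bar> \<le> \<bar>C\<bar> * X + real T * lam * X"
    using r0 n0 n1 X0 unfolding abs_le_iff by (simp add: add_increasing add_increasing2)
   moreover have "0 \<le> 2 * e * X" using eps X0 by simp
   ultimately have "\<bar>real (rep_count F B P a) - ?nu a * lam * X\<bar> \<le> 2 * e * X + (\<bar>C\<bar> * X + real T * lam * X)" by linarith
   thus ?thesis using True by (simp add: distrib_right)
  next
   case False
   have "u * P ^ d < of_int a" "of_int a \<le> v * P ^ d" using a by (auto simp: W_def window_def)
   thus ?thesis using False elim(1) by (auto simp: X_def lam_def)
  qed
  have "\<bar>real (\<Sum>a\<in>W. rep_count F B P a) - lam * X * (\<Sum>a\<in>W. ?nu a)\<bar> = \<bar>\<Sum>a\<in>W. real (rep_count F B P a) - ?nu a * lam * X\<bar>"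
   by (simp add: sum_subtractf sum_distrib_left mult_ac)
  also have "... \<le> (\<Sum>a\<in>W. 2 * e * X + (if a \<in> ?E then (\<bar>C\<bar> + real T * lam) * X else 0))"
   by (rule order_trans[OF sum_abs sum_mono[OF dif]])
  also have "... = real (card W) * (2 * e * X) + real (card (W \<inter> ?E)) * ((\<bar>C\<bar> + real T * lam) * X)"
   using finW by (simp add: sum.distrib sum.If_cases)
  also have "... \<le> real (card W) * (2 * e * X) + real (card D) * ((\<bar>C\<bar> + real T * lam) * X)"
  proof -
   have "card (W \<inter> ?E) \<le> card ?E" by (rule card_mono[OF card_exceptional(1)[OF finD]]) blast
   also have "... \<le> card D" by (rule card_exceptional(2)[OF finD])
   finally show ?thesis using X0 lam0 by (intro add_left_mono mult_right_mono) auto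
  qed
  also have "... = X * (2 * e * real (card W) + c0)" by (simp add: c0_def algebra_simps)
  finally have s1: "\<bar>real (\<Sum>a\<in>W. rep_count F B P a) - lam * X * (\<Sum>a\<in>W. ?nu a)\<bar> \<le> X * (2 * e * real (card W) + c0)" .
  have "(\<Sum>a\<in>W. ?nu a) = (\<Sum>r\<in>{0..<int T}. \<Sum>a | a \<in> W \<and> a mod int T = r. ?nu a)"
   by (rule sum.group[symmetric, OF finW]) (use T in auto)
  also have "... = (\<Sum>r\<in>{0..<int T}. ?nu r * (real (ap_count A r T (v * P ^ d)) - real (ap_count A r T (u * P ^ d))))"
  proof (rule sum.cong[OF refl])
   fix r assume r: "r \<in> {0..<int T}"
   have "(\<Sum>a | a \<in> W \<and> a mod int T = r. ?nu a) = (\<Sum>a | a \<in> W \<and> a mod int T = r. ?nu r)"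
    by (rule sum.cong[OF refl], rule res_density_mod) (auto simp: cong_def)
   also have "... = ?nu r * real (card {a \<in> W. [a = r] (mod int T)})" using r by (simp add: cong_def)
   finally show "(\<Sum>a | a \<in> W \<and> a mod int T = r. ?nu a) = ?nu r * (real (ap_count A r T (v * P ^ d)) - real (ap_count A r T (u * P ^ d)))"
    unfolding W_def window_residue_card[OF A(1) uvP] .
  qed
  finally have nuW: "(\<Sum>a\<in>W. ?nu a) = (\<Sum>r\<in>{0..<int T}. ?nu r * (real (ap_count A r T (v * P ^ d)) - real (ap_count A r T (u * P ^ d))))" .
  have "\<bar>(\<Sum>a\<in>W. ?nu a) - sig * dJ\<bar> = \<bar>\<Sum>r\<in>{0..<int T}. ?nu r * ((real (ap_count A r T (v * P ^ d)) - \<rho> r T * ?J (v * P ^ d)) - (real (ap_count A r T (u * P ^ d)) - \<rho> r T * ?J (u * P ^ d)))\<bar>"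
   unfolding nuW sig_def sigma_sum_def dJ_def sum_distrib_right sum_subtractf[symmetric]
   by (rule arg_cong[of _ _ abs], rule sum.cong) (simp_all add: algebra_simps)
  also have "... \<le> (\<Sum>r\<in>{0..<int T}. ?nu r * (2 * h' * Jb))"
  proof (rule order_trans[OF sum_abs sum_mono])
   fix r assume r: "r \<in> {0..<int T}"
   have "\<bar>real (ap_count A r T (v * P ^ d)) - \<rho> r T * ?J (v * P ^ d)\<bar> \<le> h' * Jb" using elim(4) vbP r unfolding Jb_def by blast
   moreover have "\<bar>real (ap_count A r T (u * P ^ d)) - \<rho> r T * ?J (u * P ^ d)\<bar> \<le> h' * Jb"
    using elim(4)[rule_format, of "u * P ^ d" r] uvP vbP r unfolding Jb_def by linarith
   ultimately have "\<bar>(real (ap_count A r T (v * P ^ d)) - \<rho> r T * ?J (v * P ^ d)) - (real (ap_count A r T (u * P ^ d)) - \<rho> r T * ?J (u * P ^ d))\<bar> \<le> 2 * h' * Jb" by linarith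
   thus "\<bar>?nu r * ((real (ap_count A r T (v * P ^ d)) - \<rho> r T * ?J (v * P ^ d)) - (real (ap_count A r T (u * P ^ d)) - \<rho> r T * ?J (u * P ^ d)))\<bar> \<le> ?nu r * (2 * h' * Jb)"
    unfolding abs_mult using res_density_nonneg[of F T r] by (simp add: mult_left_mono)
  qed
  also have "... = real T * (2 * h' * Jb)" by (simp only: sum_distrib_right[symmetric] sum_res_density[OF T(1)])
  finally have s2: "\<bar>(\<Sum>a\<in>W. ?nu a) - sig * dJ\<bar> \<le> real T * (2 * h' * Jb)" .
  have "\<bar>lam * X * (\<Sum>a\<in>W. ?nu a) - lam * X * (sig * dJ)\<bar> = lam * X * \<bar>(\<Sum>a\<in>W. ?nu a) - sig * dJ\<bar>"
   using lam0 X0 by (simp add: right_diff_distrib[symmetric] abs_mult)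
  also have "... \<le> lam * X * (real T * (2 * h' * Jb))" using s2 lam0 X0 by (intro mult_left_mono) auto
  also have "... = X * ((2 * real T * lam * h') * Jb)" by simp
  also have "... \<le> X * (h / 2 * Jb)" using kk X0 Jb0 by (intro mult_left_mono mult_right_mono) auto
  finally have s2': "\<bar>lam * X * (\<Sum>a\<in>W. ?nu a) - lam * X * (sig * dJ)\<bar> \<le> X * (h / 2 * Jb)" .
  have "\<bar>weight_window F d B \<omega> P u v - lam * (dJ / P ^ d)\<bar> \<le> 4 * e * (dJ / P ^ d)"
   unfolding lam_def dJ_def by (rule weight_window_local[OF R eps T0 uv elim(5)])
  hence "sig * P ^ ?n * \<bar>weight_window F d B \<omega> P u v - lam * (dJ / P ^ d)\<bar> \<le> sig * P ^ ?n * (4 * e * (dJ / P ^ d))"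
   using sig0 elim(5) by (intro mult_left_mono) auto
  also have "... = X * (4 * e * sig * dJ)" by (simp add: X_def)
  finally have "\<bar>sig * P ^ ?n * (weight_window F d B \<omega> P u v - lam * (dJ / P ^ d))\<bar> \<le> X * (4 * e * sig * dJ)"
   using sig0 elim(5) by (simp add: abs_mult)
  moreover have "sig * P ^ ?n * (weight_window F d B \<omega> P u v - lam * (dJ / P ^ d)) = sig * (P ^ ?n * weight_window F d B \<omega> P u v) - lam * X * (sig * dJ)"
   by (simp add: X_def algebra_simps)
  ultimately have s3: "\<bar>sig * (P ^ ?n * weight_window F d B \<omega> P u v) - lam * X * (sig * dJ)\<bar> \<le> X * (4 * e * sig * dJ)" by simp
  have c0: "X * c0 \<le> X * (h / 2 * Jb)" using elim(3) k X0 unfolding Jb_def by (intro mult_left_mono) (auto simp: field_simps)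
  have comb: "\<bar>p1 - q1\<bar> \<le> z1 ==> \<bar>q1 - r1\<bar> \<le> z2 ==> \<bar>s1 - r1\<bar> \<le> z3 ==> \<bar>p1 - s1\<bar> \<le> z1 + z2 + z3" for p1 q1 r1 s1 z1 z2 z3 :: real
   by linarith
  have "\<bar>real (\<Sum>a\<in>W. rep_count F B P a) - sig * (P ^ ?n * weight_window F d B \<omega> P u v)\<bar> \<le> X * (2 * e * real (card W) + c0) + X * (h / 2 * Jb) + X * (4 * e * sig * dJ)"
   by (rule comb[OF s1 s2' s3])
  also have "... = X * (2 * e * real (card W) + 4 * e * sig * dJ) + X * c0 + X * (h / 2 * Jb)" by (simp add: algebra_simps)
  also have "... \<le> X * (2 * e * real (card W) + 4 * e * sig * dJ) + X * (h / 2 * Jb) + X * (h / 2 * Jb)" by (intro add_mono order_refl c0)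
  also have "... = X * (2 * e * real (card W) + 4 * e * sig * dJ + h * Jb)" by (simp add: algebra_simps)
  finally show ?case unfolding W_def sig_def dJ_def Jb_def X_def .
 qed
qed

lemma split_interval:
 fixes Q :: "real => real => bool"
 assumes D: "finite D" and base: "\<And>u v. u < v ==> v \<le> h ==> D \<inter> {u<..<v} = {} ==> Q u v"
  and add: "\<And>u w v. u < w ==> w < v ==> v \<le> h ==> Q u w ==> Q w v ==> Q u v"
 shows "u < v ==> v \<le> h ==> Q u v"
proof (induction "card (D \<inter> {u<..<v})" arbitrary: u v rule: less_induct)
 case less
 show ?case
 proof (cases "D \<inter> {u<..<v} = {}")
  case True thus ?thesis using base less.prems by blast
 next
  case False
  then obtain w where w: "w \<in> D" "u < w" "w < v" by auto
  have fin: "finite (D \<inter> {u<..<v})" using D by simp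
  have "card (D \<inter> {u<..<w}) < card (D \<inter> {u<..<v})" by (rule psubset_card_mono[OF fin]) (use w in force)
  moreover have "card (D \<inter> {w<..<v}) < card (D \<inter> {u<..<v})" by (rule psubset_card_mono[OF fin]) (use w in force)
  ultimately show ?thesis using add[of u w v] less.hyps[of u w] less.hyps[of w v] w less.prems by simp
 qed
qed

lemma (in form_count) count_window:
 assumes R: "regular_at F d B C e T0 D" and eps: "e > 0"
  and T0: "T0 \<ge> 1" and T: "T \<ge> 1" "T0 dvd T"
  and uv: "u < v" "v \<le> b" and k: "h > 0"
 shows "\<forall>\<^sub>F P in at_top. \<bar>real (\<Sum>a\<in>window A (u * P ^ d) (v * P ^ d). rep_count F B P a) - sigma_sum F \<rho> T * (P ^ CARD('n) * weight_window F d B \<omega> P u v)\<bar>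
  \<le> P ^ CARD('n) / P ^ d * (2 * e * real (card (window A (u * P ^ d) (v * P ^ d)))
    + 4 * e * sigma_sum F \<rho> T * (cum_weight \<omega> (v * P ^ d) - cum_weight \<omega> (u * P ^ d)) + h * cum_weight \<omega> (b * P ^ d))"
proof -
 define E where "E u v P = real (\<Sum>a\<in>window A (u * P ^ d) (v * P ^ d). rep_count F B P a) - sigma_sum F \<rho> T * (P ^ CARD('n) * weight_window F d B \<omega> P u v)" for u v P
 define H where "H u v P = 2 * e * real (card (window A (u * P ^ d) (v * P ^ d))) + 4 * e * sigma_sum F \<rho> T * (cum_weight \<omega> (v * P ^ d) - cum_weight \<omega> (u * P ^ d))" for u v P
 define Q where "Q u v = (\<forall>h>0. \<forall>\<^sub>F P in at_top. \<bar>E u v P\<bar> \<le> P ^ CARD('n) / P ^ d * (H u v P + h * cum_weight \<omega> (b * P ^ d)))" for u v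
 have finD: "finite D" using R by (simp add: regular_at_def)
 have "Q u v"
 proof (rule split_interval[OF finD _ _ uv])
  fix u v assume "u < v" "v \<le> b" "D \<inter> {u<..<v} = {}"
  thus "Q u v" unfolding Q_def E_def H_def
   using count_local[OF R eps T0 T _ _ _, of u v] by blast
 next
  fix u z v assume uzv: "u < z" "z < v" and Q: "Q u z" "Q z v"
  show "Q u v" unfolding Q_def
  proof (intro allI impI)
   fix h :: real assume "h > 0"
   hence k2: "h / 2 > 0" by simp
   note e1 = Q(1)[unfolded Q_def, rule_format, OF k2] and e2 = Q(2)[unfolded Q_def, rule_format, OF k2]
   from e1 e2 eventually_gt_at_top[of 0]
   show "\<forall>\<^sub>F P in at_top. \<bar>E u v P\<bar> \<le> P ^ CARD('n) / P ^ d * (H u v P + h * cum_weight \<omega> (b * P ^ d))"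
   proof eventually_elim
    case (elim P)
    have Pd: "P ^ d > 0" using elim(3) by simp
    have le: "u * P ^ d \<le> z * P ^ d" "z * P ^ d \<le> v * P ^ d" using uzv Pd by auto
    have un: "window A (u * P ^ d) (v * P ^ d) = window A (u * P ^ d) (z * P ^ d) \<union> window A (z * P ^ d) (v * P ^ d)"
     using le unfolding window_def by fastforce
    have dj: "window A (u * P ^ d) (z * P ^ d) \<inter> window A (z * P ^ d) (v * P ^ d) = {}" by (auto simp: window_def)
    have ww: "weight_window F d B \<omega> P u v = weight_window F d B \<omega> P u z + weight_window F d B \<omega> P z v"
     unfolding weight_window_def by (rule level_int_add[OF B continuous_weight[OF w]]) (use uzv in auto)
    have Ea: "E u v P = E u z P + E z v P"
     unfolding E_def un ww sum.union_disjoint[OF finite_window[OF A(1)] finite_window[OF A(1)] dj] by (simp add: algebra_simps)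
    have Ha: "H u v P = H u z P + H z v P"
     unfolding H_def un card_Un_disjoint[OF finite_window[OF A(1)] finite_window[OF A(1)] dj] by (simp add: algebra_simps)
    have "\<bar>E u v P\<bar> \<le> \<bar>E u z P\<bar> + \<bar>E z v P\<bar>" unfolding Ea by (rule abs_triangle_ineq)
    also have "... \<le> P ^ CARD('n) / P ^ d * (H u z P + h / 2 * cum_weight \<omega> (b * P ^ d)) + P ^ CARD('n) / P ^ d * (H z v P + h / 2 * cum_weight \<omega> (b * P ^ d))"
     by (rule add_mono[OF elim(1,2)])
    also have "... = P ^ CARD('n) / P ^ d * (H u v P + h * cum_weight \<omega> (b * P ^ d))" unfolding Ha by (simp add: algebra_simps add_divide_distrib)
    finally show ?case .
   qed
  qed
 qed
 thus ?thesis using k unfolding Q_def E_def H_def by blast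
qed

text \<open>The hypothesis \<open>low\<close> makes the error, of order \<open>\<epsilon> X
  \<integral>\<omega>\<close>, small compared with the main term.\<close>
lemma (in form_count) ratio_approximation:
 assumes reg: "regular_counts F d B"
  and Fb: "\<And>t. t \<in> B ==> \<bar>mpoly_eval F t\<bar> \<le> b / 2"
  and c: "c > 0" and low: "\<forall>\<^sub>F P in at_top. c < P ^ d * \<bar>weighted_volume F d B \<omega> P\<bar> * inverse \<bar>cum_weight \<omega> (b * P ^ d)\<bar>"
 shows "\<exists>K\<ge>0. \<forall>\<epsilon>>0. \<exists>T0\<ge>1. \<forall>T\<ge>1. T0 dvd T --> (\<forall>\<^sub>F P in at_top.
  \<bar>real (lattice_count F B A P) / (P ^ CARD('n) * weighted_volume F d B \<omega> P) - sigma_sum F \<rho> T\<bar> \<le> K * \<epsilon> * (1 + sigma_sum F \<rho> T))"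
proof -
 let ?n = "CARD('n)" and ?J = "cum_weight \<omega>"
 define r1 where "r1 = \<rho> 0 1"
 have r10: "r1 \<ge> 0" using rho by (simp add: r1_def)
 define L where "L = 2 * (r1 + 1) + 5"
 have L0: "L \<ge> 0" using r10 by (simp add: L_def)
 have bP: "filterlim (\<lambda>P. b * P ^ d) at_top at_top"
  by (rule filterlim_tendsto_pos_mult_at_top[OF tendsto_const b power_at_top[OF d]])
 obtain C where C: "\<forall>\<epsilon>>0. \<exists>T\<ge>1. \<exists>D. regular_at F d B C \<epsilon> T D" using reg unfolding regular_counts_def by blast
 show ?thesis
 proof (intro exI[of _ "L / c"] conjI allI impI)
  show "0 \<le> L / c" using L0 c by simp
  fix \<epsilon> :: real assume eps: "\<epsilon> > 0"
  obtain T0 D where T0: "T0 \<ge> 1" and R: "regular_at F d B C \<epsilon> T0 D" using C eps by blast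
  show "\<exists>T0\<ge>1. \<forall>T\<ge>1. T0 dvd T --> (\<forall>\<^sub>F P in at_top.
   \<bar>real (lattice_count F B A P) / (P ^ ?n * weighted_volume F d B \<omega> P) - sigma_sum F \<rho> T\<bar> \<le> L / c * \<epsilon> * (1 + sigma_sum F \<rho> T))"
  proof (intro exI[of _ T0] conjI allI impI T0)
   fix T assume T: "T \<ge> 1" "T0 dvd T"
   define sig where "sig = sigma_sum F \<rho> T"
   have sig0: "sig \<ge> 0" unfolding sig_def sigma_sum_def
    by (intro sum_nonneg mult_nonneg_nonneg res_density_nonneg) (use rho T in auto)
   \<comment> \<open>the interval \<open>(-1, b]\<close> contains 0 and all values of \<open>F\<close> on \<open>B\<close>\<close>
   have b1: "-1 < b" using b by simp
   have e2: "\<forall>\<^sub>F P in at_top. \<forall>y r. y \<le> b * P ^ d --> r \<in> {0..<int 1} --> \<bar>real (ap_count A r 1 y) - \<rho> r 1 * ?J y\<bar> \<le> 1 * ?J (b * P ^ d)"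
    using bP equidistributed_pointwise[OF order_refl zero_less_one] by (rule filterlim_iff[THEN iffD1, rule_format])
   show "\<forall>\<^sub>F P in at_top. \<bar>real (lattice_count F B A P) / (P ^ ?n * weighted_volume F d B \<omega> P) - sigma_sum F \<rho> T\<bar> \<le> L / c * \<epsilon> * (1 + sigma_sum F \<rho> T)"
    using count_window[OF R eps T0 T b1 order_refl eps] e2 low eventually_ge_at_top[of 1]
   proof eventually_elim
    case (elim P)
    have P: "P > 0" using elim(4) by simp
    have Pd: "P ^ d > 0" "P ^ ?n > 0" using P by simp_all
    define X where "X = P ^ ?n / P ^ d"
    have X0: "X > 0" using Pd by (simp add: X_def)
    define J where "J = ?J (b * P ^ d)"
    define W where "W = weighted_volume F d B \<omega> P"
    let ?M = "window A (- 1 * P ^ d) (b * P ^ d)"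
    have FbP: "\<bar>real_of_int (mpoly_eval F x)\<bar> \<le> b / 2 * P ^ d" if x: "x \<in> lat_pts B P" for x :: "int ^ 'n"
    proof -
     have xB: "(\<chi> j. real_of_int (x $ j) / P) \<in> B" using x by (simp add: lat_pts_iff[OF P])
     have "(\<chi> j. real_of_int (x $ j)) = (\<chi> j. P * (\<chi> j. real_of_int (x $ j) / P) $ j)" using P by (simp add: vec_eq_iff)
     hence "real_of_int (mpoly_eval F x) = P ^ d * mpoly_eval F (\<chi> j. real_of_int (x $ j) / P)"
      using form_scale[OF F, of P "\<chi> j. real_of_int (x $ j) / P"] mpoly_eval_of_int[of F x] by simp
     hence "\<bar>real_of_int (mpoly_eval F x)\<bar> = P ^ d * \<bar>mpoly_eval F (\<chi> j. real_of_int (x $ j) / P)\<bar>" using Pd by (simp add: abs_mult)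
     also have "... \<le> P ^ d * (b / 2)" using Fb[OF xB] Pd by (intro mult_left_mono) auto
     finally show ?thesis by (simp add: mult.commute)
    qed
    have LC: "lattice_count F B A P = (\<Sum>a\<in>?M. rep_count F B P a)"
    proof -
     have "x \<in> lat_pts B P \<and> mpoly_eval F x \<in> A \<longleftrightarrow> x \<in> lat_pts B P \<and> mpoly_eval F x \<in> ?M" for x
     proof -
      have "mpoly_eval F x \<in> ?M" if x: "x \<in> lat_pts B P" and a: "mpoly_eval F x \<in> A"
      proof -
       have "0 \<le> real_of_int (mpoly_eval F x)" using a A(1) by auto
       moreover have "b / 2 * P ^ d \<le> b * P ^ d" using b Pd by simp
       ultimately show ?thesis using a FbP[OF x] Pd unfolding window_def by auto
      qed
      thus ?thesis by (auto simp: window_def)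
     qed
     hence "lattice_count F B A P = card {x \<in> lat_pts B P. mpoly_eval F x \<in> ?M}"
      unfolding lattice_count_def lat_pts_def by simp
     also have "... = (\<Sum>a\<in>?M. rep_count F B P a)" by (rule sum_rep_count[symmetric, OF finite_window[OF A(1)] B P])
     finally show ?thesis .
    qed
    have Weq: "W = weight_window F d B \<omega> P (-1) b" unfolding W_def
     by (rule weighted_volume_window[OF P]) (use Fb b in force)
    have W0: "W \<ge> 0" unfolding Weq weight_window_def level_int_def
     by (rule integral_nonneg_AE) (use p in \<open>auto simp: less_imp_le\<close>)
    have J0: "J \<ge> 0" unfolding J_def by (rule cum_weight_nonneg)
    have lowP: "c < P ^ d * W * inverse J" using elim(3) W0 J0 by (simp add: W_def[symmetric] J_def[symmetric])
    have J1: "J > 0" using lowP c J0 by (cases "J = 0") auto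
    have WJ: "c * J < P ^ d * W" using lowP J1 by (simp add: field_simps)
    have W1: "W > 0" 
    proof -
     have "0 < c * J" using c J1 by simp
     hence "0 < P ^ d * W" using WJ by linarith
     thus ?thesis using Pd(1) by (rule zero_less_mult_pos)
    qed
    have m: "real (card ?M) \<le> (r1 + 1) * J"
    proof -
     have "card ?M \<le> ap_count A 0 1 (b * P ^ d)" unfolding ap_count_def
      by (rule card_mono[OF finite_ap_count[OF A(1)]]) (auto simp: window_def)
     moreover have "\<bar>real (ap_count A 0 1 (b * P ^ d)) - r1 * J\<bar> \<le> J"
      using elim(2)[rule_format, of "b * P ^ d" 0] by (simp add: r1_def J_def)
     ultimately have "real (card ?M) \<le> r1 * J + J" by linarith
     thus ?thesis by (simp add: distrib_right)
    qed
    have Jm: "?J (- 1 * P ^ d) = 0" by (rule cum_weight_eq_0) (use Pd in simp)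
    have "\<bar>real (lattice_count F B A P) - sig * (P ^ ?n * W)\<bar> \<le> X * (2 * \<epsilon> * real (card ?M) + 4 * \<epsilon> * sig * J + \<epsilon> * J)"
     using elim(1) unfolding LC[symmetric] Weq[symmetric] sig_def[symmetric] X_def[symmetric] J_def[symmetric] Jm by simp
    also have "... \<le> X * (2 * \<epsilon> * ((r1 + 1) * J) + 4 * \<epsilon> * sig * J + \<epsilon> * J)"
     using m eps X0 by (intro mult_left_mono add_right_mono) auto
    also have "... = X * (\<epsilon> * J) * (2 * (r1 + 1) + 4 * sig + 1)" by (simp add: algebra_simps)
    also have "... \<le> X * (\<epsilon> * J) * (L * (1 + sig))"
    proof (rule mult_left_mono)
     have "L * (1 + sig) = (2 * (r1 + 1) + 4 * sig + 1) + (4 + (2 * (r1 + 1) + 1) * sig)" by (simp add: L_def algebra_simps)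
     moreover have "0 \<le> 4 + (2 * (r1 + 1) + 1) * sig" using r10 sig0 by simp
     ultimately show "2 * (r1 + 1) + 4 * sig + 1 \<le> L * (1 + sig)" by linarith
     show "0 \<le> X * (\<epsilon> * J)" using X0 eps J0 by simp
    qed
    also have "... = (P ^ ?n / P ^ d) * (c * J) * (L / c * \<epsilon> * (1 + sig))" using c by (simp add: X_def)
    also have "... \<le> (P ^ ?n / P ^ d) * (P ^ d * W) * (L / c * \<epsilon> * (1 + sig))"
     using WJ Pd L0 c eps sig0 by (intro mult_right_mono mult_left_mono) auto
    also have "... = (P ^ ?n * W) * (L / c * \<epsilon> * (1 + sig))" using P by simp
    finally have fin: "\<bar>real (lattice_count F B A P) - sig * (P ^ ?n * W)\<bar> \<le> (P ^ ?n * W) * (L / c * \<epsilon> * (1 + sig))" .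
    have PW: "P ^ ?n * W > 0" using Pd W1 by simp
    have "\<bar>real (lattice_count F B A P) / (P ^ ?n * W) - sig\<bar> = \<bar>real (lattice_count F B A P) - sig * (P ^ ?n * W)\<bar> / (P ^ ?n * W)"
    proof -
     have "x / q - y = (x - y * q) / q" if "q > 0" for x y q :: real using that by (simp add: field_simps)
     from this[OF PW] have "real (lattice_count F B A P) / (P ^ ?n * W) - sig = (real (lattice_count F B A P) - sig * (P ^ ?n * W)) / (P ^ ?n * W)" .
     thus ?thesis using PW by (simp only: abs_divide abs_of_pos)
    qed
    also have "... \<le> L / c * \<epsilon> * (1 + sig)" using fin PW by (simp add: pos_divide_le_eq mult.commute)
    finally show ?case unfolding W_def sig_def .
   qed
  qed
 qed
qed

section \<open>Existence of the limits\<close>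

text \<open>First with a fixed \<open>\<epsilon>\<close>, \<open>R\<close> is eventually bounded; then so are the
  \<open>s T\<close>, and any two of them are close since both are close to \<open>R P\<close> for a common
  large \<open>P\<close>.\<close>
lemma limit_of_approximations:
 fixes R :: "real => real" and s :: "nat => real"
 assumes K: "K \<ge> 0" and s0: "\<And>T. T \<ge> 1 ==> s T \<ge> 0"
  and ap: "\<And>\<epsilon>. \<epsilon> > 0 ==> \<exists>T0\<ge>1. \<forall>T\<ge>1. T0 dvd T --> (\<forall>\<^sub>F P in at_top. \<bar>R P - s T\<bar> \<le> K * \<epsilon> * (1 + s T))"
 shows "\<exists>\<sigma>. (R \<longlongrightarrow> \<sigma>) at_top \<and> (\<forall>e>0. \<exists>T0\<ge>1. \<forall>T\<ge>1. T0 dvd T --> \<bar>s T - \<sigma>\<bar> \<le> e)"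
proof -
 have ap': "\<exists>T0\<ge>1. \<forall>T\<ge>1. T0 dvd T --> (\<forall>\<^sub>F P in at_top. \<bar>R P - s T\<bar> \<le> h * (1 + s T))" if eta: "h > 0" for h
 proof -
  define \<epsilon> where "\<epsilon> = h / (K + 1)"
  have e: "\<epsilon> > 0" "K * \<epsilon> \<le> h" using eta K by (auto simp: \<epsilon>_def field_simps)
  obtain T0 where T0: "T0 \<ge> 1" "\<And>T. T \<ge> 1 ==> T0 dvd T ==> \<forall>\<^sub>F P in at_top. \<bar>R P - s T\<bar> \<le> K * \<epsilon> * (1 + s T)"
   using ap[OF e(1)] by blast
  show ?thesis
  proof (intro exI[of _ T0] conjI allI impI T0(1))
   fix T assume T: "T \<ge> 1" "T0 dvd T"
   have "K * \<epsilon> * (1 + s T) \<le> h * (1 + s T)" using e(2) s0[OF T(1)] by (intro mult_right_mono) auto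
   thus "\<forall>\<^sub>F P in at_top. \<bar>R P - s T\<bar> \<le> h * (1 + s T)"
    using T0(2)[OF T] by (auto elim!: eventually_mono)
  qed
 qed
 obtain T1 where T1: "T1 \<ge> 1" "\<forall>\<^sub>F P in at_top. \<bar>R P - s T1\<bar> \<le> 1 / 2 * (1 + s T1)"
  using ap'[of "1/2"] by auto
 define M where "M = s T1 + 1 / 2 * (1 + s T1)"
 have M0: "M \<ge> 0" using s0[OF T1(1)] by (simp add: M_def)
 have RM: "\<forall>\<^sub>F P in at_top. R P \<le> M" using T1(2)
 proof eventually_elim
  case (elim P)
  thus ?case unfolding M_def by linarith
 qed
 have ap2: "\<exists>T0\<ge>1. \<forall>T\<ge>1. T0 dvd T --> (\<forall>\<^sub>F P in at_top. \<bar>R P - s T\<bar> \<le> e)" if e: "e > 0" for e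
 proof -
  define h where "h = min (1 / 2) (e / (2 * M + 2))"
  have eta: "h > 0" "h \<le> 1 / 2" "h * (2 * M + 2) \<le> e"
  proof -
   show "h > 0" using e M0 by (simp add: h_def)
   show "h \<le> 1 / 2" unfolding h_def by (rule min.cobounded1)
   have "h * (2 * M + 2) \<le> e / (2 * M + 2) * (2 * M + 2)" 
    unfolding h_def by (rule mult_right_mono[OF min.cobounded2]) (use M0 in simp)
   thus "h * (2 * M + 2) \<le> e" using M0 by simp
  qed
  obtain T0 where T0: "T0 \<ge> 1" "\<And>T. T \<ge> 1 ==> T0 dvd T ==> \<forall>\<^sub>F P in at_top. \<bar>R P - s T\<bar> \<le> h * (1 + s T)"
   using ap'[OF eta(1)] by blast
  show ?thesis
  proof (intro exI[of _ T0] conjI allI impI T0(1))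
   fix T assume T: "T \<ge> 1" "T0 dvd T"
   have sT: "s T \<ge> 0" by (rule s0[OF T(1)])
   have "\<forall>\<^sub>F P in at_top. \<bar>R P - s T\<bar> \<le> h * (1 + s T) \<and> R P \<le> M" by (intro eventually_conj T0(2)[OF T] RM)
   then obtain P where P: "\<bar>R P - s T\<bar> \<le> h * (1 + s T)" "R P \<le> M" using eventually_happens by fastforce
   have "h * (1 + s T) \<le> 1 / 2 * (1 + s T)" using eta(2) sT by (intro mult_right_mono) auto
   hence "s T \<le> 2 * M + 1" using P by (simp add: abs_le_iff)
   hence "h * (1 + s T) \<le> h * (2 * M + 2)" using eta(1) by (intro mult_left_mono) auto
   hence "h * (1 + s T) \<le> e" using eta(3) by linarith
   thus "\<forall>\<^sub>F P in at_top. \<bar>R P - s T\<bar> \<le> e" using T0(2)[OF T] by (auto elim!: eventually_mono)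
  qed
 qed
 have "\<forall>k::nat. \<exists>T0\<ge>1. \<forall>T\<ge>1. T0 dvd T --> (\<forall>\<^sub>F P in at_top. \<bar>R P - s T\<bar> \<le> 1 / real (Suc k))"
  by (intro allI ap2) simp
 then obtain T where T: "\<And>k. T k \<ge> 1" "\<And>k S. S \<ge> 1 ==> T k dvd S ==> \<forall>\<^sub>F P in at_top. \<bar>R P - s S\<bar> \<le> 1 / real (Suc k)"
  by (auto dest!: choice)
 have cl: "\<bar>s S - s S'\<bar> \<le> 1 / real (Suc j) + 1 / real (Suc k)" if "S \<ge> 1" "T j dvd S" "S' \<ge> 1" "T k dvd S'" for S S' j k
 proof -
  have "\<forall>\<^sub>F P in at_top. \<bar>R P - s S\<bar> \<le> 1 / real (Suc j) \<and> \<bar>R P - s S'\<bar> \<le> 1 / real (Suc k)"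
   by (intro eventually_conj T(2) that)
  then obtain P where "\<bar>R P - s S\<bar> \<le> 1 / real (Suc j)" "\<bar>R P - s S'\<bar> \<le> 1 / real (Suc k)" using eventually_happens by fastforce
  thus ?thesis by linarith
 qed
 have inv: "((\<lambda>k. 1 / real (Suc k)) \<longlonglongrightarrow> 0)" using LIMSEQ_inverse_real_of_nat by (simp add: inverse_eq_divide)
 have "Cauchy (\<lambda>k. s (T k))"
 proof (rule CauchyI)
  fix e :: real assume e: "e > 0"
  have "\<forall>\<^sub>F k in sequentially. 1 / real (Suc k) < e / 2" using order_tendstoD(2)[OF inv, of "e / 2"] e by simp
  then obtain N where N: "\<And>k. k \<ge> N ==> 1 / real (Suc k) < e / 2" unfolding eventually_sequentially by blast
  show "\<exists>N. \<forall>j\<ge>N. \<forall>k\<ge>N. norm (s (T j) - s (T k)) < e"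
  proof (intro exI[of _ N] allI impI)
   fix j k assume jk: "j \<ge> N" "k \<ge> N"
   show "norm (s (T j) - s (T k)) < e"
    using cl[OF T(1)[of j] dvd_refl T(1)[of k] dvd_refl] N[OF jk(1)] N[OF jk(2)] by simp
  qed
 qed
 then obtain \<sigma> where \<sigma>: "(\<lambda>k. s (T k)) \<longlonglongrightarrow> \<sigma>" using real_Cauchy_convergent convergent_def by blast
 have near: "\<bar>s S - \<sigma>\<bar> \<le> 1 / real (Suc j)" if S: "S \<ge> 1" "T j dvd S" for S j
 proof (rule tendsto_le[OF sequentially_bot])
  show "(\<lambda>k. \<bar>s S - s (T k)\<bar>) \<longlonglongrightarrow> \<bar>s S - \<sigma>\<bar>" by (intro tendsto_intros \<sigma>)
  show "(\<lambda>k. 1 / real (Suc j) + 1 / real (Suc k)) \<longlonglongrightarrow> 1 / real (Suc j)" using tendsto_add[OF tendsto_const inv] by simp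
  show "\<forall>\<^sub>F k in sequentially. \<bar>s S - s (T k)\<bar> \<le> 1 / real (Suc j) + 1 / real (Suc k)"
   using cl[OF S T(1) dvd_refl] by simp
 qed
 have small: "\<exists>k. 1 / real (Suc k) < e" if "e > 0" for e :: real using nat_approx_posE[OF that] by blast
 show ?thesis
 proof (intro exI[of _ \<sigma>] conjI allI impI)
  show "(R \<longlongrightarrow> \<sigma>) at_top"
  proof (rule tendstoI)
   fix e :: real assume e: "e > 0"
   obtain k where k: "1 / real (Suc k) < e / 2" using small[of "e / 2"] e by auto
   show "\<forall>\<^sub>F P in at_top. dist (R P) \<sigma> < e" using T(2)[OF T(1) dvd_refl, of k]
   proof eventually_elim
    case (elim P)
    thus ?case using near[OF T(1) dvd_refl, of k] k unfolding dist_real_def by linarith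
   qed
  qed
  fix e :: real assume e: "e > 0"
  obtain k where k: "1 / real (Suc k) < e" using small[OF e] by auto
  show "\<exists>T0\<ge>1. \<forall>S\<ge>1. T0 dvd S --> \<bar>s S - \<sigma>\<bar> \<le> e"
   by (intro exI[of _ "T k"] conjI allI impI T(1)) (use near[of _ k] k in force)
 qed
qed

lemma T_mod_ge_1: "T_mod t z \<ge> 1"
proof -
 have "T_mod t z > 0" unfolding T_mod_def by (rule prod_pos) (auto intro: prime_gt_0_nat)
 thus ?thesis by simp
qed

lemma dvd_T_mod:
 assumes t: "admissible_exponents t" and T: "T \<ge> 1"
 shows "\<forall>\<^sub>F z in at_top. T dvd T_mod t z"
proof -
 have ev: "\<forall>\<^sub>F z in at_top. real p \<le> z \<and> multiplicity p T \<le> t p z" if "p \<in> prime_factors T" for p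
 proof (rule eventually_conj[OF eventually_ge_at_top])
  have "filterlim (t p) at_top at_top" using t that by (auto simp: admissible_exponents_def)
  thus "\<forall>\<^sub>F z in at_top. multiplicity p T \<le> t p z" by (simp add: filterlim_at_top)
 qed
 have "\<forall>\<^sub>F z in at_top. \<forall>p\<in>prime_factors T. real p \<le> z \<and> multiplicity p T \<le> t p z"
  by (rule eventually_ball_finite) (use ev in auto)
 thus ?thesis
 proof eventually_elim
  case (elim z)
  have fin: "finite {p. prime p \<and> real p \<le> z}"
   by (rule finite_subset[of _ "{..nat \<lfloor>z\<rfloor>}"]) (auto simp: le_nat_floor)
  have "T = (\<Prod>p\<in>prime_factors T. p ^ multiplicity p T)" using T by (intro prime_factorization_nat) simp
  also have "... dvd (\<Prod>p\<in>prime_factors T. p ^ t p z)" by (rule prod_dvd_prod) (use elim in \<open>auto intro: le_imp_power_dvd\<close>)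
  also have "... dvd T_mod t z" unfolding T_mod_def by (rule prod_dvd_prod_subset[OF fin]) (use elim in auto)
  finally show ?case .
 qed
qed

theorem theorem1p4:
  fixes d :: nat
    and F :: "'n::finite int_mpoly"
    and B :: "(real ^ 'n) set"
    and b :: real
    and A :: "int set"
    and \<omega> :: "real \<Rightarrow> real"
    and \<rho> :: "int \<Rightarrow> nat \<Rightarrow> real"
  assumes "d \<ge> 1"
    and "CARD('n) > 2 ^ d * (d - 1)"
    and "is_form d F" and "smooth_form F"
    and "is_box B"
    and "b = 2 * (SUP t\<in>B. \<bar>mpoly_eval F t\<bar>)"
    and "A \<subseteq> {0..}" and "A \<noteq> {}"
    and "C1_on {1..} \<omega>" and "\<And>t. t \<ge> 1 \<Longrightarrow> \<omega> t > 0"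
    and "\<And>q r. q \<ge> 1 \<Longrightarrow> r \<in> {0..<int q} \<Longrightarrow> \<rho> r q \<ge> 0"
    and "equidistributed_in_aps A \<omega> \<rho>"
    and "Liminf at_top (\<lambda>P::real.
           ereal (P ^ d * \<bar>weighted_volume F d B \<omega> P\<bar> *
                  inverse \<bar>LINT u:{1..b * P ^ d}|lborel. \<omega> u\<bar>)) \<noteq> 0"
  shows "\<exists>\<sigma>::real.
           (\<forall>t. admissible_exponents t \<longrightarrow>
              ((\<lambda>z. sigma_mod F \<rho> (T_mod t z)) \<longlongrightarrow> \<sigma>) at_top) \<and>
           ((\<lambda>P::real. real (lattice_count F B A P) /
              (P ^ CARD('n) * weighted_volume F d B \<omega> P)) \<longlongrightarrow> \<sigma>) at_top"
proof -
 note d = assms(1) and F = assms(3) and B = assms(5) and b_def = assms(6) and A = assms(7,8) and eq = assms(12)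
 have w: "continuous_on {1..} \<omega>"
 proof -
  obtain f' where f': "\<And>t. t \<in> {1..} ==> (\<omega> has_real_derivative f' t) (at t within {1..})"
   using assms(9) unfolding C1_on_def by blast
  show ?thesis by (rule DERIV_continuous_on[OF f'])
 qed
 have W: "weight \<omega>" by unfold_locales (use w assms(10) in auto)
 have rho: "\<forall>q\<ge>1. \<forall>r\<in>{0..<int q}. \<rho> r q \<ge> 0" using assms(11) by blast
 define f where "f P = P ^ d * \<bar>weighted_volume F d B \<omega> P\<bar> * inverse \<bar>cum_weight \<omega> (b * P ^ d)\<bar>" for P
 have L: "Liminf at_top (\<lambda>P. ereal (f P)) \<noteq> 0" using assms(13) unfolding f_def cum_weight_def .
 have "\<forall>\<^sub>F P in at_top. 0 \<le> ereal (f P)" using eventually_ge_at_top[of 0] by eventually_elim (simp add: f_def)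
 hence "0 \<le> Liminf at_top (\<lambda>P. ereal (f P))" by (rule Liminf_bounded)
 hence "0 < Liminf at_top (\<lambda>P. ereal (f P))" using L by simp
 then obtain c where c: "0 < ereal c" "ereal c < Liminf at_top (\<lambda>P. ereal (f P))" using ereal_dense2 by blast
 have c0: "c > 0" using c(1) by simp
 have low: "\<forall>\<^sub>F P in at_top. c < f P" using less_LiminfD[OF c(2)] by simp
 obtain P1 where P1: "c < f P1" "P1 \<ge> 1"
  using eventually_happens[OF eventually_conj[OF low eventually_ge_at_top[of 1]]] by auto
 have "cum_weight \<omega> (b * P1 ^ d) \<noteq> 0" using P1(1) c0 by (auto simp: f_def)
 hence "\<not> b * P1 ^ d \<le> 1" using weight.cum_weight_eq_0[OF W, of "b * P1 ^ d"] by blast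
 hence "0 < b * P1 ^ d" by linarith
 moreover have "P1 ^ d > 0" using P1(2) by simp
 ultimately have b: "b > 0" by (rule zero_less_mult_pos2)
 have Fb: "\<bar>mpoly_eval F t\<bar> \<le> b / 2" if t: "t \<in> B" for t
 proof -
  have "bdd_above ((\<lambda>t. \<bar>mpoly_eval F t\<bar>) ` B)"
  proof (rule bdd_aboveI2)
   fix s assume "s \<in> B"
   hence s: "s \<in> {t. \<forall>j. t $ j \<in> {-1..1}}" using box_subset[OF B] by blast
   have "\<bar>s $ j\<bar> \<le> 1" for j using s by (auto simp: abs_le_iff minus_le_iff)
   thus "\<bar>mpoly_eval F s\<bar> \<le> (\<Sum>m\<in>keys F. \<bar>of_int (lookup F m)\<bar>) * 1 ^ d" by (intro form_bound[OF F]) auto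
  qed
  hence "\<bar>mpoly_eval F t\<bar> \<le> (SUP t\<in>B. \<bar>mpoly_eval F t\<bar>)" by (rule cSUP_upper[OF t])
  thus ?thesis by (simp add: b_def)
 qed
 have reg: "regular_counts F d B"
 proof (cases "d = 1")
  case True
  thus ?thesis using regular_counts_1[OF _ assms(4) B] F by simp
 next
  case False
  thus ?thesis using d by (intro regular_counts_ge_2[OF F assms(4) _ assms(2) B]) simp
 qed
 interpret C: form_count F d B \<omega> A \<rho> b
  by unfold_locales (use F d B w assms(10) eq A rho b in auto)
 obtain K where K: "K \<ge> 0" "\<And>\<epsilon>. \<epsilon> > 0 ==> \<exists>T0\<ge>1. \<forall>T\<ge>1. T0 dvd T --> (\<forall>\<^sub>F P in at_top.
  \<bar>real (lattice_count F B A P) / (P ^ CARD('n) * weighted_volume F d B \<omega> P) - sigma_sum F \<rho> T\<bar> \<le> K * \<epsilon> * (1 + sigma_sum F \<rho> T))"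
  using C.ratio_approximation[OF reg Fb c0 low[unfolded f_def]] by blast
 have s0: "sigma_sum F \<rho> T \<ge> 0" if "T \<ge> 1" for T
  unfolding sigma_sum_def by (intro sum_nonneg mult_nonneg_nonneg res_density_nonneg) (use rho that in auto)
 obtain \<sigma> where \<sigma>: "((\<lambda>P. real (lattice_count F B A P) / (P ^ CARD('n) * weighted_volume F d B \<omega> P)) \<longlongrightarrow> \<sigma>) at_top"
  "\<And>e. e > 0 ==> \<exists>T0\<ge>1. \<forall>T\<ge>1. T0 dvd T --> \<bar>sigma_sum F \<rho> T - \<sigma>\<bar> \<le> e"
  using limit_of_approximations[OF K(1) s0 K(2)] by blast
 have "((\<lambda>z. sigma_mod F \<rho> (T_mod t z)) \<longlongrightarrow> \<sigma>) at_top" if t: "admissible_exponents t" for t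
 proof (rule tendstoI)
  fix e :: real assume e: "e > 0"
  hence "e / 2 > 0" by simp
  then obtain T0 where T0: "T0 \<ge> 1" "\<And>T. T \<ge> 1 ==> T0 dvd T ==> \<bar>sigma_sum F \<rho> T - \<sigma>\<bar> \<le> e / 2" using \<sigma>(2) by blast
  show "\<forall>\<^sub>F z in at_top. dist (sigma_mod F \<rho> (T_mod t z)) \<sigma> < e"
   using dvd_T_mod[OF t T0(1)]
  proof eventually_elim
   case (elim z)
   show ?case using T0(2)[OF T_mod_ge_1 elim] e unfolding sigma_mod_eq[OF T_mod_ge_1] dist_real_def by linarith
  qed
 qed
 thus ?thesis using \<sigma>(1) by blast
qed

end
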